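(* Let $d<p\le\infty$, $p\ge2$, $1/p+1/q=1$, $h>0$, $N\in\mathbb Z_+$, let $M$ be a $d\times d$ isotropic dilation matrix and $\lambda$ an eigenvalue of $M$. Let $$a_\beta=\frac1{\beta!\,V_h}\int_{B_h}t^\beta\,dt\quad(\beta\in\Delta_{N+1}),\qquad \widetilde\varphi=\sum_{\beta\in\Delta_{N+1}}\overline{a_\beta}(-1)^{[\beta]}D^\beta\delta_0,$$ where $\delta_0$ is the Dirac delta at the origin. Suppose: (i) $\varphi\in\mathcal L_p$ and there exists $B_\varphi>0$ such that $\sum_{k\in\mathbb Z^d}|\widehat\varphi(\xi+k)|^q<B_\varphi$ for all $\xi\in\mathbb R^d$; there exist $n\in\mathbb N$ and $\delta\in(0,1/2)$ such that $\widehat\varphi\,\widehat{\widetilde\varphi}$ is boundedly differentiable up to order $n$ on $\{|\xi|<\delta\}$, $\widehat\varphi$ is boundedly differentiable up to order $n$ on $\{|\xi+l|<\delta\}$ for all $l\in\mathbb Z^d\setminus\{\mathbf 0\}$; the function $\sum_{l\in\mathbb Z^d,\,l\neq\mathbf 0}|D^\beta\widehat\varphi(\xi+l)|$ is bounded on $\{|\xi|<\delta\}$ for every $\beta$ with $[\beta]=n$; $D^\beta(1-\widehat\varphi\,\widehat{\widetilde\varphi})(\mathbf 0)=0$ for all $\beta\in\Delta_n$; and the Strang-Fix condition of order $n$ holds for $\varphi$; (ii) $f(x)=\widehat g(-x)$, where $g\in L_q(\mathbb R^d)$ and $g(\xi)=O(|\xi|^{-N-d-\varepsilon})$ as $|\xi|\to\infty$,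 $\varepsilon>1$. Then there is a constant $C$ not depending on $j$ such that for all $j\in\mathbb Z_+$ $$\Big\|f-m^{-j/2}\sum_{k\in\mathbb Z^d}\mathrm{Av}_h(f,-M^{-j}k)\,\varphi_{jk}\Big\|_p\le\begin{cases}C|\lambda|^{-j(N+1)}&\text{if }n>N+1,\\ C|\lambda|^{-jn}&\text{if }n\le N+1.\end{cases}$$
   Context: A dilation matrix is an integer $d\times d$ matrix $M$ all of whose eigenvalues are greater than $1$ in modulus; $m=|\det M|$. $M$ is isotropic if it is similar (over $\mathbb C$) to a diagonal matrix with diagonal entries $\lambda_1,\dots,\lambda_d$, $|\lambda_1|=\dots=|\lambda_d|$. $\mathbb Z_+=\{0,1,2,\dots\}$, $\mathbb T^d=[-\frac12,\frac12]^d$, $B_h=\{x\in\mathbb R^d:|x|\le h\}$, $V_h$ is the volume of $B_h$. For $\beta\in\mathbb Z_+^d$, $[\beta]=\beta_1+\dots+\beta_d$, $\beta!=\prod_i\beta_i!$, $t^\beta=\prod_it_i^{\beta_i}$, $D^\beta$ is the corresponding partial derivative; $\Delta_n=\{\beta\in\mathbb Z_+^d:[\beta]<n\}$. The average near a point $y$ of the form $M^{-j}k$, $k\in\mathbb Z^d$ (the dependence on $j$ being implicit), is $$\mathrm{Av}_h(f,y)=\frac{m^j}{V_h}\int_{M^{-j}B_h}f(y+t)\,dt .$$ Fourier transform: $\widehat f(\xi)=\int_{\mathbb R^d}f(x)e^{-2\pi i(x,\xi)}dx$, extended to tempered distributions as usual; thus $\widehat{\widetilde\varphi}(\xi)=\sum_{\beta\in\Delta_{N+1}}\overline{a_\beta}(-1)^{[\beta]}(2\pi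 i\xi)^\beta$. $\mathcal L_p$ is the space of $f\in L_p(\mathbb R^d)$ with $\big\|\sum_{k\in\mathbb Z^d}|f(\cdot+k)|\big\|_{L_p(\mathbb T^d)}<\infty$. $\varphi_{jk}(x)=m^{j/2}\varphi(M^jx+k)$. A function $\varphi\in L_1(\mathbb R^d)$ satisfies the Strang-Fix condition of order $n$ if $D^\beta\widehat\varphi(k)=0$ for all $k\in\mathbb Z^d\setminus\{\mathbf 0\}$ and all $\beta\in\Delta_n$. "Boundedly differentiable up to order $n$ on a set" means $n$ times differentiable there with all partial derivatives of order at most $n$ bounded there. *)

theory Defs
  imports
    "HOL-Analysis.Analysis"
    "HOL-Library.Landau_Symbols"
    "HOL-Probability.Essential_Supremum"
begin

section \<open>Dilation matrices\<close>

definition int_lattice :: "(real^'d) set" where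
  "int_lattice = {k. \<forall>i. k $ i \<in> \<int>}"

definition is_eigenvalue :: "complex^'d^'d \<Rightarrow> complex \<Rightarrow> bool" where
  "is_eigenvalue A \<mu> \<longleftrightarrow> (\<exists>v. v \<noteq> 0 \<and> A *v v = \<mu> *s v)"

definition dilation_matrix :: "real^'d^'d \<Rightarrow> bool" where
  "dilation_matrix M \<longleftrightarrow>
     (\<forall>i j. M $ i $ j \<in> \<int>) \<and>
     (\<forall>\<mu>. is_eigenvalue (map_matrix complex_of_real M) \<mu> \<longrightarrow> 1 < cmod \<mu>)"

definition isotropic :: "real^'d^'d \<Rightarrow> bool" where
  "isotropic M \<longleftrightarrow>
     (\<exists>(P :: complex^'d^'d) (\<Lambda> :: complex^'d).
        invertible P \<and>
        matrix_inv P ** map_matrix complex_of_real M ** P = (\<chi> i j. if i = j then \<Lambda> $ i else 0) \<and>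
        (\<forall>i j. cmod (\<Lambda> $ i) = cmod (\<Lambda> $ j)))"

text \<open>The operation \<open>^\<close> on vectors of vectors is taken componentwise, so matrix powers
  need their own definition.\<close>

definition mat_pow :: "real^'d^'d \<Rightarrow> nat \<Rightarrow> real^'d^'d" where
  "mat_pow A j = (((**) A) ^^ j) (mat 1)"

definition dil :: "real^'d^'d \<Rightarrow> (real^'d \<Rightarrow> complex) \<Rightarrow> nat \<Rightarrow> real^'d \<Rightarrow> real^'d \<Rightarrow> complex" where
  "dil M \<phi> j k x = complex_of_real (\<bar>det M\<bar> powr (real j / 2)) * \<phi> (mat_pow M j *v x + k)"

definition Av :: "real^'d^'d \<Rightarrow> real \<Rightarrow> nat \<Rightarrow> (real^'d \<Rightarrow> complex) \<Rightarrow> real^'d \<Rightarrow> complex" where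
  "Av M h j f y =
     complex_of_real (\<bar>det M\<bar> ^ j / measure lebesgue (cball (0 :: real^'d) h)) *
     (LINT t:((*v) (mat_pow (matrix_inv M) j) ` cball 0 h)|lebesgue. f (y + t))"


section \<open>Lebesgue spaces\<close>

definition ennreal_powr :: "ennreal \<Rightarrow> real \<Rightarrow> ennreal" where
  "ennreal_powr x a = (if x = \<infinity> then \<infinity> else ennreal (enn2real x powr a))"

text \<open>The norm is defined for functions with values in \<open>[0, \<infinity>]\<close>, so that it also applies to the
  periodization in the definition of \<open>script_L\<close>; a complex function enters through its modulus.\<close>

definition Lp_norm :: "'a measure \<Rightarrow> ennreal \<Rightarrow> ('a \<Rightarrow> ennreal) \<Rightarrow> ennreal" where
  "Lp_norm M p u =
     (if u \<notin> borel_measurable M then \<infinity>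
      else if p = \<infinity> then esssup M u
      else ennreal_powr (\<integral>\<^sup>+x. ennreal_powr (u x) (enn2real p) \<partial>M) (1 / enn2real p))"

definition in_Lp :: "ennreal \<Rightarrow> (real^'d \<Rightarrow> complex) \<Rightarrow> bool" where
  "in_Lp p f \<longleftrightarrow>
     f \<in> borel_measurable lebesgue \<and> Lp_norm lebesgue p (\<lambda>x. ennreal (cmod (f x))) < \<infinity>"

definition unit_torus :: "(real^'d) set" where
  "unit_torus = cbox (\<chi> i. - (1/2)) (\<chi> i. 1/2)"

definition script_L :: "ennreal \<Rightarrow> (real^'d \<Rightarrow> complex) \<Rightarrow> bool" where
  "script_L p f \<longleftrightarrow>
     in_Lp p f \<and>
     Lp_norm (lebesgue_on unit_torus) p
       (\<lambda>x. \<Sum>\<^sub>\<infinity>k\<in>int_lattice. ennreal (cmod (f (x + k)))) < \<infinity>"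


section \<open>Multi-indices and partial derivatives\<close>

definition mi_abs :: "('d::finite \<Rightarrow> nat) \<Rightarrow> nat" where
  "mi_abs \<beta> = (\<Sum>i\<in>UNIV. \<beta> i)"

definition mi_fact :: "('d::finite \<Rightarrow> nat) \<Rightarrow> real" where
  "mi_fact \<beta> = (\<Prod>i\<in>UNIV. fact (\<beta> i))"

definition mi_power :: "'a::comm_semiring_1 ^ 'd \<Rightarrow> ('d \<Rightarrow> nat) \<Rightarrow> 'a" where
  "mi_power t \<beta> = (\<Prod>i\<in>UNIV. (t $ i) ^ \<beta> i)"

definition Delta :: "nat \<Rightarrow> ('d::finite \<Rightarrow> nat) set" where
  "Delta n = {\<beta>. mi_abs \<beta> < n}"

definition partial_deriv :: "'d \<Rightarrow> (real^'d \<Rightarrow> complex) \<Rightarrow> real^'d \<Rightarrow> complex" where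
  "partial_deriv i f x = vector_derivative (\<lambda>t. f (x + t *\<^sub>R axis i 1)) (at 0)"

text \<open>There is no canonical order on the index type, so \<open>D\<^sup>\<beta>\<close> takes the partial derivatives in some
  unspecified order. It is only applied at points near which the function is (at least) \<open>[\<beta>]\<close> times
  Frechet differentiable, where the order does not matter.\<close>

definition mi_deriv :: "('d::finite \<Rightarrow> nat) \<Rightarrow> (real^'d \<Rightarrow> complex) \<Rightarrow> real^'d \<Rightarrow> complex" where
  "mi_deriv \<beta> f = foldr partial_deriv (SOME is. \<forall>i. count_list is i = \<beta> i) f"

fun n_times_differentiable_on :: "nat \<Rightarrow> (real^'d \<Rightarrow> complex) \<Rightarrow> (real^'d) set \<Rightarrow> bool" where
  "n_times_differentiable_on 0 f S \<longleftrightarrow> True"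
| "n_times_differentiable_on (Suc n) f S \<longleftrightarrow>
     (\<forall>x\<in>S. f differentiable (at x)) \<and>
     (\<forall>i. n_times_differentiable_on n (partial_deriv i f) S)"

definition boundedly_differentiable_on ::
    "nat \<Rightarrow> (real^'d \<Rightarrow> complex) \<Rightarrow> (real^'d) set \<Rightarrow> bool" where
  "boundedly_differentiable_on n f S \<longleftrightarrow>
     n_times_differentiable_on n f S \<and> (\<forall>\<beta>. mi_abs \<beta> \<le> n \<longrightarrow> bounded (mi_deriv \<beta> f ` S))"


section \<open>Fourier transform\<close>

definition fourier :: "(real^'d \<Rightarrow> complex) \<Rightarrow> real^'d \<Rightarrow> complex" where
  "fourier f \<xi> = (LINT x|lebesgue. f x * exp (- (2 * pi * \<i> * (x \<bullet> \<xi>))))"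

definition strang_fix :: "nat \<Rightarrow> (real^'d \<Rightarrow> complex) \<Rightarrow> bool" where
  "strang_fix n \<phi> \<longleftrightarrow> (\<forall>k\<in>int_lattice - {0}. \<forall>\<beta>\<in>Delta n. mi_deriv \<beta> (fourier \<phi>) k = 0)"

text \<open>Distributions supported at the origin are represented by their action on smooth functions.\<close>

definition dirac_deriv :: "('d::finite \<Rightarrow> nat) \<Rightarrow> (real^'d \<Rightarrow> complex) \<Rightarrow> complex" where
  "dirac_deriv \<beta> u = (-1) ^ mi_abs \<beta> * mi_deriv \<beta> u 0"

definition avg_coeff :: "real \<Rightarrow> ('d::finite \<Rightarrow> nat) \<Rightarrow> complex" where
  "avg_coeff h \<beta> = complex_of_real
     (1 / (mi_fact \<beta> * measure lebesgue (cball (0 :: real^'d) h)) *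
      (LINT t:cball (0 :: real^'d) h|lebesgue. mi_power t \<beta>))"

definition phi_tilde :: "real \<Rightarrow> nat \<Rightarrow> (real^'d \<Rightarrow> complex) \<Rightarrow> complex" where
  "phi_tilde h N u = (\<Sum>\<beta>\<in>Delta (N + 1). cnj (avg_coeff h \<beta>) * (-1) ^ mi_abs \<beta> * dirac_deriv \<beta> u)"

text \<open>A compactly supported distribution \<open>T\<close> acts on all smooth functions, and its Fourier transform
  is the function \<open>\<xi> \<mapsto> \<langle>T, e\<^bsup>-2\<pi>i(\<cdot>,\<xi>)\<^esup>\<rangle>\<close>. For \<open>phi_tilde\<close> the lemma \<open>fourier_distr_phi_tilde\<close> below
  computes this function, and \<open>phi_tilde_fourier\<close> shows that it is the Fourier transform in the
  sense of tempered distributions: the assumption there holds for every Schwartz function \<open>u\<close>.\<close>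

definition fourier_distr :: "((real^'d \<Rightarrow> complex) \<Rightarrow> complex) \<Rightarrow> real^'d \<Rightarrow> complex" where
  "fourier_distr T \<xi> = T (\<lambda>x. exp (- (2 * pi * \<i> * (x \<bullet> \<xi>))))"


section \<open>The Fourier transform of the distribution\<close>

lemma ex_list_count: "\<exists>is. \<forall>i. count_list is i = (\<beta> :: 'd::finite \<Rightarrow> nat) i"
proof -
  have rep: "count_list (replicate n a) b = (if a = b then n else 0)" for n and a b :: 'd
    by (induction n) auto
  have "\<exists>is. \<forall>i. count_list is i = (if i \<in> A then \<beta> i else 0)" if "finite A" for A
    using that
  proof (induction A rule: finite_induct)
    case empty
    show ?case by (rule exI[of _ "[]"]) auto
  next
    case (insert a A)
    then obtain js where cnt: "\<forall>i. count_list js i = (if i \<in> A then \<beta> i else 0)" by blast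
    show ?case
      using insert.hyps
      by (intro exI[of _ "replicate (\<beta> a) a @ js"]) (auto simp: rep cnt)
  qed
  from this[of UNIV] show ?thesis by simp
qed

lemma prod_list_count:
  "prod_list (map c is) = (\<Prod>i\<in>UNIV. c i ^ count_list is i)"
  for c :: "'d::finite \<Rightarrow> 'a::comm_semiring_1"
proof (induction "is")
  case (Cons a xs)
  have "(\<Prod>i\<in>UNIV. c i ^ count_list (a # xs) i) = (\<Prod>i\<in>UNIV. (if i = a then c i else 1) * c i ^ count_list xs i)"
    by (rule prod.cong) auto
  also have "\<dots> = c a * (\<Prod>i\<in>UNIV. c i ^ count_list xs i)"
    by (simp add: prod.distrib prod.delta)
  finally show ?case using Cons by simp
qed simp

lemma mi_deriv_eqI:
  assumes "\<And>is. foldr partial_deriv is f = (\<lambda>x. prod_list (map c is) * u x)"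
  shows "mi_deriv \<beta> f x = (\<Prod>i\<in>UNIV. c i ^ \<beta> i) * u x"
proof -
  define js where "js = (SOME is. \<forall>i. count_list is i = \<beta> i)"
  have "\<forall>i. count_list js i = \<beta> i"
    unfolding js_def by (rule someI_ex) (rule ex_list_count)
  thus ?thesis
    unfolding mi_deriv_def js_def[symmetric] assms by (simp add: prod_list_count)
qed

lemma foldr_partial_deriv_exp:
  "foldr partial_deriv is (\<lambda>x. exp (- (2 * pi * \<i> * (x \<bullet> \<xi>)))) =
     (\<lambda>x. prod_list (map (\<lambda>i. - (2 * pi * \<i> * (\<xi> $ i))) is) * exp (- (2 * pi * \<i> * (x \<bullet> \<xi>))))"
proof (induction "is")
  case (Cons i xs)
  have "partial_deriv i (\<lambda>x. c * exp (- (2 * pi * \<i> * (x \<bullet> \<xi>)))) =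
        (\<lambda>x. - (2 * pi * \<i> * (\<xi> $ i)) * c * exp (- (2 * pi * \<i> * (x \<bullet> \<xi>))))" for c
  proof
    fix x
    have "((\<lambda>z. c * exp (- (2 * pi * \<i> * (complex_of_real (x \<bullet> \<xi>) + z * complex_of_real (\<xi> $ i)))))
        has_field_derivative - (2 * pi * \<i> * (\<xi> $ i)) * c * exp (- (2 * pi * \<i> * (x \<bullet> \<xi>))))
        (at (complex_of_real 0))"
      by (auto intro!: derivative_eq_intros)
    from has_vector_derivative_real_field[OF this]
    have "((\<lambda>t. c * exp (- (2 * pi * \<i> * complex_of_real ((x + t *\<^sub>R axis i 1) \<bullet> \<xi>))))
        has_vector_derivative - (2 * pi * \<i> * (\<xi> $ i)) * c * exp (- (2 * pi * \<i> * (x \<bullet> \<xi>)))) (at 0)"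
      by (simp add: inner_add_left inner_axis')
    thus "partial_deriv i (\<lambda>x. c * exp (- (2 * pi * \<i> * (x \<bullet> \<xi>)))) x =
        - (2 * pi * \<i> * (\<xi> $ i)) * c * exp (- (2 * pi * \<i> * (x \<bullet> \<xi>)))"
      unfolding partial_deriv_def by (rule vector_derivative_at)
  qed
  thus ?case using Cons by simp
qed simp


lemma finite_Delta: "finite (Delta n)"
proof (rule finite_subset)
  show "Delta n \<subseteq> PiE UNIV (\<lambda>_. {..<n})"
    unfolding Delta_def mi_abs_def PiE_UNIV_domain
    by (force intro: le_less_trans[OF member_le_sum])
  show "finite (PiE (UNIV :: 'a set) (\<lambda>_. {..<n}))" by (intro finite_PiE) auto
qed

lemma prod_neg_power: "(\<Prod>i\<in>UNIV. (- a i) ^ \<beta> i) = (-1) ^ mi_abs \<beta> * (\<Prod>i\<in>UNIV. a i ^ \<beta> i)"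
  for a :: "'d::finite \<Rightarrow> 'a::comm_ring_1"
proof -
  have "(\<Prod>i\<in>UNIV. (- a i) ^ \<beta> i) = (\<Prod>i\<in>UNIV. (-1) ^ \<beta> i * a i ^ \<beta> i)"
    by (rule prod.cong) (auto simp: power_minus[of "a _"])
  thus ?thesis by (simp add: prod.distrib mi_abs_def power_sum)
qed

lemma neg_one_power_cancel: "(-1) ^ n * ((-1) ^ n * x) = (x :: complex)"
  by (induction n) auto

lemma fourier_distr_phi_tilde:
  "fourier_distr (phi_tilde h N) \<xi> =
     (\<Sum>\<beta>\<in>Delta (N + 1). cnj (avg_coeff h \<beta>) * (-1) ^ mi_abs \<beta> *
        mi_power (\<chi> i. 2 * pi * \<i> * (\<xi> $ i)) \<beta>)"
  unfolding fourier_distr_def phi_tilde_def dirac_deriv_def mi_power_def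
    mi_deriv_eqI[OF foldr_partial_deriv_exp] prod_neg_power vec_lambda_beta
  by (simp only: inner_zero_left of_real_0 mult_zero_right minus_zero exp_zero mult_1_right neg_one_power_cancel)

lemma has_vector_derivative_0_iff:
  "(F has_vector_derivative F') (at 0) \<longleftrightarrow>
     ((\<lambda>t. (F t - F 0) / complex_of_real t) \<longlongrightarrow> F') (at 0)"
proof -
  have "(F has_vector_derivative F') (at 0) \<longleftrightarrow>
      ((\<lambda>t. norm (F t - F 0 - t *\<^sub>R F') / norm t) \<longlongrightarrow> 0) (at 0)"
    unfolding has_vector_derivative_def has_derivative_iff_norm
    by (simp add: bounded_linear_scaleR_left)
  also have "\<dots> \<longleftrightarrow> ((\<lambda>t. norm ((F t - F 0) / complex_of_real t - F')) \<longlongrightarrow> 0) (at 0)"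
  proof (rule filterlim_cong[OF refl refl])
    have "norm (F t - F 0 - t *\<^sub>R F') / norm t = norm ((F t - F 0) / complex_of_real t - F')" if "t \<noteq> 0" for t
    proof -
      have "norm (F t - F 0 - t *\<^sub>R F') / norm t = norm ((F t - F 0 - complex_of_real t * F') / complex_of_real t)"
        by (simp only: norm_divide norm_of_real scaleR_conv_of_real real_norm_def)
      also have "(F t - F 0 - complex_of_real t * F') / complex_of_real t = (F t - F 0) / complex_of_real t - F'"
        using that by (simp add: diff_divide_distrib)
      finally show ?thesis .
    qed
    thus "\<forall>\<^sub>F t in at 0. norm (F t - F 0 - t *\<^sub>R F') / norm t = norm ((F t - F 0) / complex_of_real t - F')"
      by (auto simp: eventually_at_filter)
  qed
  also have "\<dots> \<longleftrightarrow> ((\<lambda>t. (F t - F 0) / complex_of_real t) \<longlongrightarrow> F') (at 0)"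
    by (simp only: tendsto_norm_zero_iff LIM_zero_iff)
  finally show ?thesis .
qed

lemma partial_deriv_fourier:
  assumes v: "integrable lebesgue v" and xv: "integrable lebesgue (\<lambda>x. complex_of_real (x $ i) * v x)"
  shows "partial_deriv i (fourier v) = fourier (\<lambda>x. - (2 * pi * \<i> * (x $ i)) * v x)"
proof
  fix \<xi>
  define E where "E = (\<lambda>(x :: real^'a) (\<xi> :: real^'a). exp (- (2 * pi * \<i> * (x \<bullet> \<xi>))))"
  have [measurable]: "v \<in> borel_measurable lebesgue" using v by auto
  have Em [measurable]: "(\<lambda>x. E x \<xi>) \<in> borel_measurable lebesgue" for \<xi>
  proof -
    have "(\<lambda>x. E x \<xi>) \<in> borel_measurable borel"
      unfolding E_def by (intro borel_measurable_continuous_onI continuous_intros)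
    thus ?thesis by (simp add: measurable_completion)
  qed
  have [measurable]: "(\<lambda>x :: real^'a. x $ i) \<in> borel_measurable lebesgue"
  proof -
    have "(\<lambda>x :: real^'a. x $ i) \<in> borel_measurable borel"
      by (intro borel_measurable_continuous_onI continuous_intros)
    thus ?thesis by (simp add: measurable_completion)
  qed
  have nE: "norm (E x \<xi>) = 1" for x \<xi> unfolding E_def by simp
  have intE: "integrable lebesgue (\<lambda>x. w x * E x \<xi>)" if "integrable lebesgue w" for w \<xi>
    by (rule Bochner_Integration.integrable_bound[OF that])
       (use that in \<open>auto simp: norm_mult nE\<close>)
  have Eadd: "E x (\<xi> + t *\<^sub>R axis i 1) = E x \<xi> * exp (\<i> * complex_of_real (- (2 * pi * t * (x $ i))))"
    for x t
    unfolding E_def by (simp add: inner_add_right inner_axis exp_add[symmetric] algebra_simps)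
  have F: "fourier w \<xi> = (LINT x|lebesgue. w x * E x \<xi>)" for w \<xi>
    unfolding fourier_def E_def ..
  let ?L = "fourier (\<lambda>x. - (2 * pi * \<i> * (x $ i)) * v x) \<xi>"
  have "((\<lambda>t. (fourier v (\<xi> + t *\<^sub>R axis i 1) - fourier v \<xi>) / complex_of_real t) \<longlongrightarrow> ?L) (at 0)"
    unfolding tendsto_at_iff_sequentially comp_def
  proof (intro allI impI)
    fix X :: "nat \<Rightarrow> real" assume X: "\<forall>n. X n \<in> UNIV - {0}" "X \<longlonglongrightarrow> 0"
    define q where "q = (\<lambda>n x. v x * E x \<xi> * ((exp (\<i> * complex_of_real (- (2 * pi * X n * (x $ i)))) - 1) / complex_of_real (X n)))"
    have "(\<lambda>n. LINT x|lebesgue. q n x) \<longlonglongrightarrow> (LINT x|lebesgue. - (2 * pi * \<i> * (x $ i)) * v x * E x \<xi>)"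
    proof (rule integral_dominated_convergence[where w = "\<lambda>x. 2 * pi * norm (complex_of_real (x $ i) * v x)"])
      show "integrable lebesgue (\<lambda>x. 2 * pi * norm (complex_of_real (x $ i) * v x))"
        using xv by auto
      show "AE x in lebesgue. norm (q n x) \<le> 2 * pi * norm (complex_of_real (x $ i) * v x)" for n
      proof (rule AE_I2)
        fix x :: "real^'a"
        have "norm (exp (\<i> * complex_of_real (- (2 * pi * X n * (x $ i)))) - 1) \<le> \<bar>2 * pi * X n * (x $ i)\<bar>"
          unfolding dist_exp_i_1 using abs_sin_x_le_abs_x[of "- (2 * pi * X n * (x $ i)) / 2"] by simp
        hence "norm ((exp (\<i> * complex_of_real (- (2 * pi * X n * (x $ i)))) - 1) / complex_of_real (X n))
            \<le> 2 * pi * \<bar>x $ i\<bar>"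
          using X(1) by (auto simp: norm_divide divide_simps abs_mult mult_ac)
        hence "norm (v x) * norm ((exp (\<i> * complex_of_real (- (2 * pi * X n * (x $ i)))) - 1) / complex_of_real (X n))
            \<le> norm (v x) * (2 * pi * \<bar>x $ i\<bar>)"
          by (intro mult_left_mono) auto
        thus "norm (q n x) \<le> 2 * pi * norm (complex_of_real (x $ i) * v x)"
          unfolding q_def norm_mult nE by (simp add: mult_ac)
      qed
      show "AE x in lebesgue. (\<lambda>n. q n x) \<longlonglongrightarrow> - (2 * pi * \<i> * (x $ i)) * v x * E x \<xi>"
      proof (rule AE_I2)
        fix x :: "real^'a"
        have "((\<lambda>t. exp (- (2 * pi * \<i> * (x $ i)) * complex_of_real t)) has_vector_derivative - (2 * pi * \<i> * (x $ i))) (at 0)"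
          apply (rule has_vector_derivative_eq_rhs)
           apply (rule has_vector_derivative_real_field)
           apply (auto intro!: derivative_eq_intros)
          done
        hence "((\<lambda>t. (exp (- (2 * pi * \<i> * (x $ i)) * complex_of_real t) - 1) / complex_of_real t)
            \<longlongrightarrow> - (2 * pi * \<i> * (x $ i))) (at 0)"
          unfolding has_vector_derivative_0_iff by simp
        hence "(\<lambda>n. (exp (- (2 * pi * \<i> * (x $ i)) * complex_of_real (X n)) - 1) / complex_of_real (X n))
            \<longlonglongrightarrow> - (2 * pi * \<i> * (x $ i))"
          using X unfolding tendsto_at_iff_sequentially comp_def by blast
        from tendsto_mult[OF tendsto_const[of "v x * E x \<xi>"] this]
        show "(\<lambda>n. q n x) \<longlonglongrightarrow> - (2 * pi * \<i> * (x $ i)) * v x * E x \<xi>"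
          unfolding q_def by (simp add: mult_ac)
      qed
    qed (unfold q_def, measurable)
    moreover have "(LINT x|lebesgue. q n x) =
        (fourier v (\<xi> + X n *\<^sub>R axis i 1) - fourier v \<xi>) / complex_of_real (X n)" for n
    proof -
      have "(fourier v (\<xi> + X n *\<^sub>R axis i 1) - fourier v \<xi>) / complex_of_real (X n) =
          (LINT x|lebesgue. (v x * E x (\<xi> + X n *\<^sub>R axis i 1) - v x * E x \<xi>) / complex_of_real (X n))"
        unfolding F by (simp add: intE[OF v] Bochner_Integration.integral_diff)
      also have "\<dots> = (LINT x|lebesgue. q n x)"
        unfolding q_def Eadd by (intro Bochner_Integration.integral_cong) (auto simp: field_simps)
      finally show ?thesis ..
    qed
    ultimately show "(\<lambda>n. (fourier v (\<xi> + X n *\<^sub>R axis i 1) - fourier v \<xi>) / complex_of_real (X n)) \<longlonglongrightarrow> ?L"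
      unfolding F[of "\<lambda>x. - (2 * pi * \<i> * (x $ i)) * v x"] by simp
  qed
  hence "((\<lambda>t. fourier v (\<xi> + t *\<^sub>R axis i 1)) has_vector_derivative ?L) (at 0)"
    unfolding has_vector_derivative_0_iff by simp
  thus "partial_deriv i (fourier v) \<xi> = ?L"
    unfolding partial_deriv_def by (rule vector_derivative_at)
qed

lemma prod_list_scale:
  "prod_list (map (\<lambda>i. c * a i) is) = c ^ length is * prod_list (map a is)"
  for c :: complex
  by (induction "is") (auto simp: mult_ac)

lemma prod_list_neg_scale:
  "prod_list (map (\<lambda>i. - (c * a i)) is) = (- c) ^ length is * prod_list (map a is)"
  for c :: complex
  using prod_list_scale[of "- c" a "is"] by simp

lemma foldr_partial_deriv_fourier:
  assumes "\<And>is. integrable lebesgue (\<lambda>x. prod_list (map (\<lambda>i. complex_of_real (x $ i)) is) * u x)"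
  shows "foldr partial_deriv is (fourier u) =
    fourier (\<lambda>x. prod_list (map (\<lambda>i. - (2 * pi * \<i> * (x $ i))) is) * u x)"
proof (induction "is")
  case (Cons i xs)
  let ?v = "\<lambda>x. prod_list (map (\<lambda>i. - (2 * pi * \<i> * (x $ i))) xs) * u x"
  have v: "?v = (\<lambda>x. (- (2 * pi * \<i>)) ^ length xs * (prod_list (map (\<lambda>i. complex_of_real (x $ i)) xs) * u x))"
    by (simp only: prod_list_neg_scale[of "complex_of_real (2 * pi) * \<i>"]) (simp only: mult.assoc)
  have xv: "(\<lambda>x. complex_of_real (x $ i) * ?v x) =
      (\<lambda>x. (- (2 * pi * \<i>)) ^ length xs * (prod_list (map (\<lambda>i. complex_of_real (x $ i)) (i # xs)) * u x))"
    by (simp only: prod_list_neg_scale[of "complex_of_real (2 * pi) * \<i>"] list.map prod_list.Cons)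
       (simp only: mult_ac)
  have 1: "integrable lebesgue ?v"
    unfolding v by (rule integrable_mult_right) (rule assms)
  have 2: "integrable lebesgue (\<lambda>x. complex_of_real (x $ i) * ?v x)"
    unfolding xv by (rule integrable_mult_right) (rule assms)
  have "foldr partial_deriv (i # xs) (fourier u) = partial_deriv i (fourier ?v)"
    by (simp only: foldr.simps comp_apply Cons.IH)
  also have "\<dots> = fourier (\<lambda>x. - (2 * pi * \<i> * (x $ i)) * ?v x)"
    by (rule partial_deriv_fourier[OF 1 2])
  finally show ?case
    by (simp only: list.map prod_list.Cons mult.assoc)
qed (simp only: list.map prod_list.Nil foldr.simps id_apply mult_1_left)

lemma phi_tilde_fourier:
  fixes u :: "real^'d \<Rightarrow> complex"
  assumes "\<And>is. integrable lebesgue (\<lambda>x. prod_list (map (\<lambda>i. complex_of_real (x $ i)) is) * u x)"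
  shows "phi_tilde h N (fourier u) = (LINT \<xi>|lebesgue. fourier_distr (phi_tilde h N) \<xi> * u \<xi>)"
proof -
  let ?P = "\<lambda>\<beta> x. mi_power (\<chi> i. 2 * pi * \<i> * (x $ i)) \<beta> * u x"
  have int: "integrable lebesgue (?P \<beta>)" for \<beta>
  proof -
    obtain js where js: "\<forall>i. count_list js i = \<beta> i" using ex_list_count[of \<beta>] by blast
    have "?P \<beta> = (\<lambda>x. (complex_of_real (2 * pi) * \<i>) ^ length js * (prod_list (map (\<lambda>i. complex_of_real (x $ i)) js) * u x))"
    proof
      fix x :: "real^'d"
      have "mi_power (\<chi> i. 2 * pi * \<i> * (x $ i)) \<beta> = prod_list (map (\<lambda>i. 2 * pi * \<i> * (x $ i)) js)"
        unfolding mi_power_def prod_list_count vec_lambda_beta js[rule_format] ..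
      also have "\<dots> = (complex_of_real (2 * pi) * \<i>) ^ length js * prod_list (map (\<lambda>i. complex_of_real (x $ i)) js)"
        by (rule prod_list_scale)
      finally show "?P \<beta> x = (complex_of_real (2 * pi) * \<i>) ^ length js * (prod_list (map (\<lambda>i. complex_of_real (x $ i)) js) * u x)"
        by (simp only: mult.assoc)
    qed
    moreover have "integrable lebesgue (\<lambda>x. (complex_of_real (2 * pi) * \<i>) ^ length js * (prod_list (map (\<lambda>i. complex_of_real (x $ i)) js) * u x))"
      by (rule integrable_mult_right) (rule assms)
    ultimately show ?thesis by (simp only:)
  qed
  have D: "mi_deriv \<beta> (fourier u) 0 = (-1) ^ mi_abs \<beta> * (LINT x|lebesgue. ?P \<beta> x)" for \<beta>
  proof -
    define js where "js = (SOME is. \<forall>i. count_list is i = \<beta> i)"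
    have js: "\<forall>i. count_list js i = \<beta> i"
      unfolding js_def by (rule someI_ex) (rule ex_list_count)
    show ?thesis
      unfolding mi_deriv_def js_def[symmetric] foldr_partial_deriv_fourier[OF assms]
      unfolding fourier_def mi_power_def
      by (simp add: prod_list_count js prod_neg_power mult.assoc)
  qed
  have "phi_tilde h N (fourier u) =
      (\<Sum>\<beta>\<in>Delta (N + 1). cnj (avg_coeff h \<beta>) * (-1) ^ mi_abs \<beta> * (LINT x|lebesgue. ?P \<beta> x))"
    unfolding phi_tilde_def dirac_deriv_def D neg_one_power_cancel ..
  also have "\<dots> = (LINT \<xi>|lebesgue. (\<Sum>\<beta>\<in>Delta (N + 1). cnj (avg_coeff h \<beta>) * (-1) ^ mi_abs \<beta> * ?P \<beta> \<xi>))"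
    using int by (subst Bochner_Integration.integral_sum) auto
  also have "\<dots> = (LINT \<xi>|lebesgue. fourier_distr (phi_tilde h N) \<xi> * u \<xi>)"
    unfolding fourier_distr_phi_tilde by (simp add: sum_distrib_right mult.assoc)
  finally show ?thesis .
qed

end

theory Submission
  imports Defs "HOL-Probability.Sinc_Integral" "HOL-Probability.Characteristic_Functions"
begin

text \<open>After the substitution \<open>y = M\<^sup>j x\<close> the approximation error is the inverse Fourier transform of
  \<open>G\<close> minus a shift series of \<open>\<phi>\<close> whose coefficients are the Fourier transform of \<open>G A\<close> at lattice points; here
  \<open>G\<close> is a dilate of \<open>g\<close> and \<open>A\<close> is the symbol of averaging over the ball. Poisson summation turns the error
  into the Fourier transform of \<open>G\<close> minus the transform of \<open>\<phi>\<close> times the periodization of \<open>G A\<close>.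
  The Hausdorff--Young inequality (with a constant, by splitting \<open>G\<close> into levels as in Marcinkiewicz interpolation)
  reduces the claim to an \<open>L\<^sub>q\<close> bound, which is proved on each coset of the lattice: near the origin by Taylor
  expansion from the Strang-Fix and compatibility conditions, away from it by the bound on the lattice sums of the
  transform of \<open>\<phi>\<close>; the tails are summed by Hoelder's inequality, which is where \<open>p > d\<close> enters. The result is
  a multiple of the \<open>L\<^sub>q\<close> norm of \<open>|\<eta>|\<^sup>r G(\<eta>)\<close>, \<open>r = min n (N + 1)\<close>, and undoing the dilation gains \<open>|\<lambda>|\<close>
  to the power \<open>- j r\<close>.\<close>

text \<open>The obstacle is convergence: the transform of \<phi> times the periodization is not
  known to be integrable, and \<phi> is merely integrable, so neither Hausdorff--Young nor Poisson
  summation applies directly. All frequencies are therefore damped by \<open>Tent_ft\<close>, which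
  convolves \<phi> with a narrow tent, and the damping is removed at the end by Fatou's lemma; it is
  harmless for the estimates because the factor lies between 0 and 1. The tent is chosen because its
  transform is explicit, nonnegative and quadratically decaying in each coordinate; the same pair
  also supplies the weights of the L2 bound. The two regimes of the theorem come from one
  replacement: averaging has a symbol bounded by 1, the conditions are stated for the transform of
  \<open>phi_tilde\<close>, a polynomial, and the two agree only to order N + 1. The determinants
  cancel: passing to \<open>G\<close> and returning contribute reciprocal powers of them, so only
  the expansion of the transposed powers of \<open>M\<close> is left in the rate.\<close>

section \<open>The integer lattice and the tiling of space by unit cells\<close>

lemma int_lattice_add: "k \<in> int_lattice \<Longrightarrow> l \<in> int_lattice \<Longrightarrow> k + l \<in> int_lattice"
  and int_lattice_diff: "k \<in> int_lattice \<Longrightarrow> l \<in> int_lattice \<Longrightarrow> k - l \<in> int_lattice"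
  and int_lattice_minus: "k \<in> int_lattice \<Longrightarrow> - k \<in> int_lattice"
  and int_lattice_zero: "0 \<in> int_lattice"
  by (auto simp: int_lattice_def)

text \<open>Indexing the lattice by functions into \<open>int\<close> makes sums over it sums over a
  finite product of countable sets, where sums of products factor into products of sums.\<close>

definition lattice_vec :: "('d::finite \<Rightarrow> int) \<Rightarrow> real^'d" where
  "lattice_vec a = (\<chi> i. of_int (a i))"

lemma bij_lattice_vec: "bij_betw lattice_vec UNIV (int_lattice :: (real^'d) set)"
  unfolding bij_betw_def
proof
  show "inj (lattice_vec :: _ \<Rightarrow> real^'d)"
    by (auto simp: inj_def lattice_vec_def vec_eq_iff fun_eq_iff)
  show "range lattice_vec = (int_lattice :: (real^'d) set)"
  proof (rule set_eqI)
    fix k :: "real^'d"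
    show "k \<in> range lattice_vec \<longleftrightarrow> k \<in> int_lattice"
    proof
      assume "k \<in> int_lattice"
      hence "k = lattice_vec (\<lambda>i. \<lfloor>k $ i\<rfloor>)"
        by (auto simp: int_lattice_def lattice_vec_def vec_eq_iff elim!: Ints_cases)
      thus "k \<in> range lattice_vec" by blast
    qed (auto simp: int_lattice_def lattice_vec_def)
  qed
qed

lemma countable_int_lattice: "countable (int_lattice :: (real^'d) set)"
proof -
  have "countable (UNIV :: ('d \<Rightarrow> int) set)"
    using countable_PiE[of "UNIV :: 'd set" "\<lambda>_. UNIV :: int set"] by (simp add: PiE_UNIV_domain)
  hence "countable (range (lattice_vec :: _ \<Rightarrow> real^'d))" by (rule countable_image)
  thus ?thesis
    using bij_lattice_vec by (metis bij_betw_def)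
qed

text \<open>Lattice sums are written as integrals for counting measure, so that Tonelli, Fubini and
  dominated convergence apply to them as to integrals over space; countability makes the measure
  sigma-finite.\<close>

abbreviation lattice_measure :: "(real^'d) measure" where
  "lattice_measure \<equiv> count_space int_lattice"

interpretation lattice: sigma_finite_measure "lattice_measure :: (real^'d) measure"
  by (rule sigma_finite_measure_count_space_countable[OF countable_int_lattice])

interpretation lattice_lborel: pair_sigma_finite "lattice_measure :: (real^'d) measure" "lborel :: (real^'d) measure"
  by unfold_locales

lemma nn_integral_lattice_shift:
  assumes "k \<in> int_lattice"
  shows "(\<integral>\<^sup>+l. u (l + k) \<partial>lattice_measure) = (\<integral>\<^sup>+l. u l \<partial>lattice_measure)"
proof (rule nn_integral_bij_count_space)
  show "bij_betw (\<lambda>l. l + k) int_lattice int_lattice"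
    by (rule bij_betwI[where g = "\<lambda>l. l - k"])
       (auto simp: assms int_lattice_add int_lattice_diff)
qed

lemma nn_integral_lattice_minus:
  "(\<integral>\<^sup>+l. u (- l) \<partial>lattice_measure) = (\<integral>\<^sup>+l. u l \<partial>lattice_measure)"
proof (rule nn_integral_bij_count_space)
  show "bij_betw uminus int_lattice int_lattice"
    by (rule bij_betwI[where g = uminus]) (auto simp: int_lattice_minus)
qed

text \<open>The hypotheses speak of \<open>infsum\<close>, the estimates of integrals over counting
  measure. One inequality compares with finite partial sums; for the other, a simple function below
  \<open>u\<close> splits \<open>A\<close> into finitely many level sets, on each of which a
  constant is summed.\<close>

lemma infsum_eq_nn_integral:
  fixes u :: "'a \<Rightarrow> ennreal"
  shows "(\<Sum>\<^sub>\<infinity>k\<in>A. u k) = (\<integral>\<^sup>+k. u k \<partial>count_space A)"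
proof (rule antisym)
  have fin: "(\<integral>\<^sup>+k. u k * indicator F k \<partial>count_space A) = sum u F" if "finite F" "F \<subseteq> A" for F
  proof -
    have "(\<integral>\<^sup>+k. u k * indicator F k \<partial>count_space A) = (\<Sum>k\<in>F. u k * indicator F k)"
      by (rule nn_integral_count_space') (use that in auto)
    thus ?thesis by simp
  qed
  show "(\<Sum>\<^sub>\<infinity>k\<in>A. u k) \<le> (\<integral>\<^sup>+k. u k \<partial>count_space A)"
  proof (rule infsum_le_finite_sums)
    fix F assume F: "finite F" "F \<subseteq> A"
    show "sum u F \<le> (\<integral>\<^sup>+k. u k \<partial>count_space A)"
      unfolding fin[OF F, symmetric] by (intro nn_integral_mono) (auto split: split_indicator)
  qed (rule nonneg_summable_on_complete, simp)
  show "(\<integral>\<^sup>+k. u k \<partial>count_space A) \<le> (\<Sum>\<^sub>\<infinity>k\<in>A. u k)"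
  proof (subst nn_integral_def, rule SUP_least, safe)
    fix g assume g: "simple_function (count_space A) g" "g \<le> u"
    have "integral\<^sup>S (count_space A) g = (\<integral>\<^sup>+k. g k \<partial>count_space A)"
      using g by (simp add: nn_integral_eq_simple_integral)
    also have "\<dots> \<le> (\<Sum>\<^sub>\<infinity>k\<in>A. g k)"
    proof -
      have "integral\<^sup>S (count_space A) g =
         (\<Sum>c\<in>g ` A. c * emeasure (count_space A) (g -` {c} \<inter> A))"
        by (simp add: simple_integral_def)
      also have "\<dots> \<le> (\<Sum>c\<in>g ` A. \<Sum>\<^sub>\<infinity>k\<in>g -` {c} \<inter> A. g k)"
      proof (rule sum_mono)
        fix c assume "c \<in> g ` A"
        have "(\<Sum>\<^sub>\<infinity>k\<in>g -` {c} \<inter> A. g k) = (\<Sum>\<^sub>\<infinity>k\<in>g -` {c} \<inter> A. c)"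
          by (rule infsum_cong) auto
        also have "c * emeasure (count_space A) (g -` {c} \<inter> A) \<le> \<dots>"
        proof (cases "finite (g -` {c} \<inter> A)")
          case True thus ?thesis by (simp add: mult.commute)
        next
          case False
          show ?thesis
          proof (cases "c = 0")
            case False
            \<comment> \<open>A nonzero constant on an infinite level set sums to infinity, so the
              bound is trivial there.\<close>
            have "infsum (\<lambda>k. c) (g -` {c} \<inter> A) = \<infinity>"
              by (rule infsum_superconst_infinite_ennreal[of _ c]) (use False \<open>\<not> finite _\<close> in \<open>auto simp: zero_less_iff_neq_zero\<close>)
            thus ?thesis by simp
          qed simp
        qed
        finally show "c * emeasure (count_space A) (g -` {c} \<inter> A) \<le> (\<Sum>\<^sub>\<infinity>k\<in>g -` {c} \<inter> A. g k)" .
      qed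
      also have "\<dots> = (\<Sum>\<^sub>\<infinity>k\<in>(\<Union>c\<in>g ` A. g -` {c} \<inter> A). g k)"
      proof (rule sum_infsum)
        show "finite (g ` A)" using g by (auto simp: simple_function_def)
      qed (rule nonneg_summable_on_complete, auto)
      also have "(\<Union>c\<in>g ` A. g -` {c} \<inter> A) = A" by auto
      finally show ?thesis using \<open>integral\<^sup>S (count_space A) g = (\<integral>\<^sup>+k. g k \<partial>count_space A)\<close> by simp
    qed
    also have "\<dots> \<le> (\<Sum>\<^sub>\<infinity>k\<in>A. u k)"
      by (rule infsum_mono[OF nonneg_summable_on_complete nonneg_summable_on_complete])
         (use g in \<open>auto simp: le_fun_def\<close>)
    finally show "integral\<^sup>S (count_space A) g \<le> (\<Sum>\<^sub>\<infinity>k\<in>A. u k)" .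
  qed
qed

text \<open>The cell is half open, unlike the closed cube \<open>unit_torus\<close>, so that its
  lattice translates are disjoint and every point has exactly one representative in it.\<close>

definition unit_cell :: "(real^'d) set" where
  "unit_cell = {x. \<forall>i. - (1/2) \<le> x $ i \<and> x $ i < 1/2}"

lemma borel_unit_cell [measurable]: "unit_cell \<in> sets borel"
  unfolding unit_cell_def by measurable

text \<open>Rounding each coordinate by \<open>\<lfloor>x $ i + 1/2\<rfloor>\<close> gives the
  lattice point; the half-open cell makes the choice unique.\<close>

lemma unit_cell_minus_lattice:
  obtains l where "l \<in> int_lattice" "x - l \<in> unit_cell" "\<And>k. k \<in> int_lattice \<Longrightarrow> x - k \<in> unit_cell \<longleftrightarrow> k = l"
proof -
  define l where "l = (\<chi> i. real_of_int \<lfloor>x $ i + 1/2\<rfloor>)"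
  have l: "l \<in> int_lattice" by (auto simp: l_def int_lattice_def)
  have "x - k \<in> unit_cell \<longleftrightarrow> k = l" if "k \<in> int_lattice" for k
  proof -
    have "- (1/2) \<le> (x - k) $ i \<and> (x - k) $ i < 1/2 \<longleftrightarrow> k $ i = l $ i" for i
    proof -
      obtain m where m: "k $ i = of_int m" using \<open>k \<in> int_lattice\<close> by (auto simp: int_lattice_def elim: Ints_cases)
      have "m = \<lfloor>x $ i + 1/2\<rfloor> \<longleftrightarrow> of_int m \<le> x $ i + 1/2 \<and> x $ i + 1/2 < of_int m + 1"
        using floor_correct[of "x $ i + 1/2"] floor_unique[of m "x $ i + 1/2"]
        by (metis of_int_add of_int_1)
      moreover have "- (1/2) \<le> (x - k) $ i \<and> (x - k) $ i < 1/2 \<longleftrightarrow> of_int m \<le> x $ i + 1/2 \<and> x $ i + 1/2 < of_int m + 1"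
        by (auto simp: m)
      moreover have "k $ i = l $ i \<longleftrightarrow> m = \<lfloor>x $ i + 1/2\<rfloor>" by (simp add: m l_def)
      ultimately show ?thesis by simp
    qed
    thus ?thesis unfolding unit_cell_def vec_eq_iff by blast
  qed
  thus ?thesis using that[OF l] l by blast
qed

lemma nn_integral_lattice_indicator_unit_cell:
  "(\<integral>\<^sup>+l. indicator unit_cell (x - l) \<partial>lattice_measure) = (1::ennreal)"
proof -
  obtain l where l: "l \<in> int_lattice" "x - l \<in> unit_cell" "\<And>k. k \<in> int_lattice \<Longrightarrow> x - k \<in> unit_cell \<longleftrightarrow> k = l"
    by (rule unit_cell_minus_lattice[of x]) blast
  have "(\<integral>\<^sup>+l. indicator unit_cell (x - l) \<partial>lattice_measure) = (\<integral>\<^sup>+k. indicator {l} k \<partial>lattice_measure)"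
    using l by (intro nn_integral_cong) (auto split: split_indicator)
  also have "\<dots> = 1" using l by (subst nn_integral_indicator) (auto simp: emeasure_count_space)
  finally show ?thesis .
qed

lemma measurable_lattice_pair [measurable (raw)]:
  assumes "\<And>l. l \<in> int_lattice \<Longrightarrow> (\<lambda>x. u l x) \<in> M \<rightarrow>\<^sub>M N"
  shows "case_prod u \<in> lattice_measure \<Otimes>\<^sub>M M \<rightarrow>\<^sub>M N"
  using assms by (intro measurable_pair_measure_countable1 countable_int_lattice) auto

lemma measurable_shift_lborel [measurable]:
  fixes u :: "real^'d \<Rightarrow> 'a::topological_space"
  assumes "u \<in> borel_measurable borel"
  shows "(\<lambda>x. u (x + l)) \<in> borel_measurable borel"
  using assms by measurable

lemma borel_measurable_nn_integral_lattice:
  fixes u :: "'b \<Rightarrow> real^'d \<Rightarrow> ennreal"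
  assumes "\<And>l. l \<in> int_lattice \<Longrightarrow> (\<lambda>x. u x l) \<in> borel_measurable M"
  shows "(\<lambda>x. \<integral>\<^sup>+l. u x l \<partial>lattice_measure) \<in> borel_measurable M"
proof -
  have "(\<lambda>(l, x). u x l) \<in> borel_measurable (lattice_measure \<Otimes>\<^sub>M M)"
    by (rule measurable_lattice_pair) (use assms in auto)
  hence "(\<lambda>(x, l). u x l) \<in> borel_measurable (M \<Otimes>\<^sub>M lattice_measure)"
    by (subst measurable_pair_swap_iff) (simp add: case_prod_beta)
  thus ?thesis by (rule lattice.borel_measurable_nn_integral)
qed

lemma nn_integral_lattice_lborel_swap:
  fixes u :: "real^'d \<Rightarrow> real^'d \<Rightarrow> ennreal"
  assumes "\<And>l. l \<in> int_lattice \<Longrightarrow> (\<lambda>x. u l x) \<in> borel_measurable borel"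
  shows "(\<integral>\<^sup>+x. \<integral>\<^sup>+l. u l x \<partial>lattice_measure \<partial>lborel) = (\<integral>\<^sup>+l. \<integral>\<^sup>+x. u l x \<partial>lborel \<partial>lattice_measure)"
proof (rule lattice_lborel.Fubini')
  show "case_prod u \<in> borel_measurable (lattice_measure \<Otimes>\<^sub>M lborel)"
    by (rule measurable_lattice_pair) (use assms in simp)
qed

lemma nn_integral_lborel_shift:
  fixes u :: "'a::euclidean_space \<Rightarrow> ennreal"
  assumes [measurable]: "u \<in> borel_measurable borel"
  shows "(\<integral>\<^sup>+x. u (x + l) \<partial>lborel) = (\<integral>\<^sup>+x. u x \<partial>lborel)"
proof -
  have "(\<integral>\<^sup>+x. u x \<partial>lborel) = (\<integral>\<^sup>+x. u x \<partial>distr lborel borel ((+) l))"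
    by (simp add: lborel_distr_plus)
  also have "\<dots> = (\<integral>\<^sup>+x. u (l + x) \<partial>lborel)"
    by (subst nn_integral_distr) auto
  finally show ?thesis by (simp add: add.commute)
qed

text \<open>The indicators of the cell translates sum to 1; inserting this sum, exchanging it with
  the integral and shifting the \<open>l\<close>-th piece back to the cell gives the identity. It
  reduces estimates on the whole space to estimates on single cosets.\<close>

lemma nn_integral_tiling:
  fixes u :: "real^'d \<Rightarrow> ennreal"
  assumes [measurable]: "u \<in> borel_measurable borel"
  shows "(\<integral>\<^sup>+x. u x \<partial>lborel) = (\<integral>\<^sup>+x. indicator unit_cell x * (\<integral>\<^sup>+l. u (x + l) \<partial>lattice_measure) \<partial>lborel)"
proof -
  have "(\<integral>\<^sup>+x. u x \<partial>lborel) = (\<integral>\<^sup>+x. \<integral>\<^sup>+l. u x * indicator unit_cell (x - l) \<partial>lattice_measure \<partial>lborel)"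
    by (simp add: nn_integral_cmult nn_integral_lattice_indicator_unit_cell)
  also have "\<dots> = (\<integral>\<^sup>+l. \<integral>\<^sup>+x. u x * indicator unit_cell (x - l) \<partial>lborel \<partial>lattice_measure)"
    by (rule nn_integral_lattice_lborel_swap) measurable
  also have "\<dots> = (\<integral>\<^sup>+l. \<integral>\<^sup>+x. u (x + l) * indicator unit_cell x \<partial>lborel \<partial>lattice_measure)"
  proof (rule nn_integral_cong)
    fix l :: "real^'d"
    show "(\<integral>\<^sup>+x. u x * indicator unit_cell (x - l) \<partial>lborel) = (\<integral>\<^sup>+x. u (x + l) * indicator unit_cell x \<partial>lborel)"
      by (subst nn_integral_lborel_shift[symmetric, of _ l]) auto
  qed
  also have "\<dots> = (\<integral>\<^sup>+x. \<integral>\<^sup>+l. u (x + l) * indicator unit_cell x \<partial>lattice_measure \<partial>lborel)"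
    by (rule nn_integral_lattice_lborel_swap[symmetric]) measurable
  also have "\<dots> = (\<integral>\<^sup>+x. indicator unit_cell x * (\<integral>\<^sup>+l. u (x + l) \<partial>lattice_measure) \<partial>lborel)"
    by (simp add: nn_integral_cmult mult.commute[of _ "indicator _ _"])
  finally show ?thesis .
qed

text \<open>The floor only turns a real coordinate of a lattice point back into an integer; via
  \<open>lattice_vec\<close> the claim becomes the product formula for absolutely convergent sums
  over a product of index sets.\<close>

lemma 
  fixes f :: "'d::finite \<Rightarrow> int \<Rightarrow> 'a::{real_normed_field,banach,second_countable_topology}"
  assumes "\<And>i. integrable (count_space UNIV) (f i)"
  shows integrable_lattice_prod: "integrable (lattice_measure :: (real^'d) measure) (\<lambda>l. \<Prod>i\<in>UNIV. f i \<lfloor>l $ i\<rfloor>)"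
    and integral_lattice_prod:
      "(LINT l|(lattice_measure :: (real^'d) measure). (\<Prod>i\<in>UNIV. f i \<lfloor>l $ i\<rfloor>)) = (\<Prod>i\<in>UNIV. LINT z|count_space UNIV. f i z)"
proof -
  have *: "(\<Prod>i\<in>UNIV. f i \<lfloor>lattice_vec a $ i\<rfloor>) = (\<Prod>i\<in>UNIV. f i (a i))" for a
    by (simp add: lattice_vec_def)
  have s: "Infinite_Set_Sum.abs_summable_on (f i) UNIV" for i
    using assms by (simp add: abs_summable_on_def)
  show "integrable (lattice_measure :: (real^'d) measure) (\<lambda>l. \<Prod>i\<in>UNIV. f i \<lfloor>l $ i\<rfloor>)"
    unfolding integrable_bij_count_space[OF bij_lattice_vec, symmetric] *
    using abs_summable_on_prod_PiE[of "UNIV :: 'd set" "\<lambda>_. UNIV" f] s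
    by (simp add: abs_summable_on_def PiE_UNIV_domain)
  show "(LINT l|(lattice_measure :: (real^'d) measure). (\<Prod>i\<in>UNIV. f i \<lfloor>l $ i\<rfloor>)) = (\<Prod>i\<in>UNIV. LINT z|count_space UNIV. f i z)"
    unfolding integral_bij_count_space[OF bij_lattice_vec, symmetric] *
    using infsetsum_prod_PiE[of "UNIV :: 'd set" "\<lambda>_. UNIV" f] s
    by (simp add: infsetsum_def PiE_UNIV_domain)
qed

lemma integrable_count_space_int:
  fixes a :: "int \<Rightarrow> real"
  assumes "summable (\<lambda>n. norm (a (int n)))" "summable (\<lambda>n. norm (a (- int n)))"
  shows "integrable (count_space UNIV) a"
proof -
  have 1: "Infinite_Set_Sum.abs_summable_on a (range int)"
    using assms(1) by (subst abs_summable_on_reindex_iff[symmetric]) (auto simp: abs_summable_on_nat_iff')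
  have 2: "Infinite_Set_Sum.abs_summable_on a (range (\<lambda>n. - int n))"
    using assms(2) by (subst abs_summable_on_reindex_iff[symmetric]) (auto simp: abs_summable_on_nat_iff' inj_on_def)
  have "(UNIV :: int set) = range int \<union> range (\<lambda>n. - int n)"
  proof (intro set_eqI iffI UnCI)
    fix z :: int assume "z \<notin> range (\<lambda>n. - int n)"
    thus "z \<in> range int"
      by (metis int_cases2 range_eqI)
  qed auto
  thus ?thesis
    using abs_summable_on_union[OF 1 2] by (simp add: abs_summable_on_def)
qed

lemma integrable_count_space_int_powr:
  assumes "1 < t"
  shows "integrable (count_space UNIV) (\<lambda>z::int. max 1 \<bar>real_of_int z\<bar> powr (- t))"
proof (rule integrable_count_space_int)
  have "summable (\<lambda>n. max 1 (real n) powr (- t))"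
    using assms
    by (subst summable_cong[of _ "\<lambda>n. real n powr (- t)"])
       (auto simp: summable_real_powr_iff eventually_at_top_linorder max_def intro!: exI[of _ 1])
  thus "summable (\<lambda>n. norm (max 1 \<bar>real_of_int (int n)\<bar> powr (- t)))"
    and "summable (\<lambda>n. norm (max 1 \<bar>real_of_int (- int n)\<bar> powr (- t)))"
    by simp_all
qed

text \<open>The norm dominates every coordinate, so distributing the exponent evenly over the
  coordinates bounds the term by a product of \<open>CARD('d)\<close> one-dimensional terms, each
  with exponent \<open>s / CARD('d) > 1\<close>.\<close>

lemma integrable_lattice_powr:
  assumes "real CARD('d) < s"
  shows "integrable lattice_measure (\<lambda>l :: real^'d. max 1 (norm l) powr (- s))"
proof -
  let ?t = "s / real CARD('d)"
  have t: "1 < ?t" using assms by simp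
  have "integrable lattice_measure (\<lambda>l :: real^'d. \<Prod>i\<in>UNIV. max 1 \<bar>real_of_int \<lfloor>l $ i\<rfloor>\<bar> powr (- ?t))"
    by (rule integrable_lattice_prod) (rule integrable_count_space_int_powr[OF t])
  thus ?thesis
  proof (rule Bochner_Integration.integrable_bound)
    show "AE l :: real^'d in lattice_measure. norm (max 1 (norm l) powr (- s)) \<le>
      norm (\<Prod>i\<in>UNIV. max 1 \<bar>real_of_int \<lfloor>l $ i\<rfloor>\<bar> powr (- ?t))"
    proof (rule AE_I2)
      fix l :: "real^'d" assume "l \<in> space lattice_measure"
      hence fl: "real_of_int \<lfloor>l $ i\<rfloor> = l $ i" for i
        by (auto simp: int_lattice_def elim!: Ints_cases)
      have "max 1 (norm l) powr (- s) = (\<Prod>i\<in>(UNIV :: 'd set). max 1 (norm l) powr (- ?t))"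
        by (simp add: powr_realpow[symmetric] powr_powr)
      also have "\<dots> \<le> (\<Prod>i\<in>UNIV. max 1 \<bar>real_of_int \<lfloor>l $ i\<rfloor>\<bar> powr (- ?t))"
        unfolding fl
      proof (intro prod_mono conjI)
        fix i
        show "max 1 (norm l) powr (- ?t) \<le> max 1 \<bar>l $ i\<bar> powr (- ?t)"
          using t component_le_norm_cart[of l i] by (intro powr_mono2') auto
      qed auto
      finally show "norm (max 1 (norm l) powr (- s)) \<le> norm (\<Prod>i\<in>UNIV. max 1 \<bar>real_of_int \<lfloor>l $ i\<rfloor>\<bar> powr (- ?t))"
        by (simp add: prod_nonneg)
    qed
  qed auto
qed

lemma int_lattice_norm_ge_1:
  fixes l :: "real^'d"
  assumes "l \<in> int_lattice" "l \<noteq> 0"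
  shows "1 \<le> norm l"
proof -
  obtain i where "l $ i \<noteq> 0" using assms(2) by (auto simp: vec_eq_iff)
  moreover obtain m where "l $ i = of_int m" using assms(1) by (auto simp: int_lattice_def elim: Ints_cases)
  ultimately have "1 \<le> \<bar>l $ i\<bar>" by (simp add: abs_if)
  thus ?thesis using component_le_norm_cart[of l i] by linarith
qed

text \<open>A coordinate of \<zeta> is at most 1/2 in modulus, which is at most half of any nonzero
  integer, so it cannot cancel more than half of the lattice coordinate.\<close>

lemma unit_cell_component_ge:
  assumes "\<zeta> \<in> unit_cell" "l \<in> int_lattice"
  shows "\<bar>l $ i\<bar> / 2 \<le> \<bar>(\<zeta> + l) $ i\<bar>"
proof -
  obtain m where m: "l $ i = of_int m" using assms(2) by (auto simp: int_lattice_def elim: Ints_cases)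
  have "- (1/2) \<le> \<zeta> $ i \<and> \<zeta> $ i < 1/2" using assms(1) by (simp add: unit_cell_def)
  hence "\<bar>\<zeta> $ i\<bar> \<le> 1/2" by linarith
  moreover have "m = 0 \<or> 1 \<le> \<bar>real_of_int m\<bar>" by auto
  ultimately show ?thesis unfolding m vector_add_component by (elim disjE) (simp, linarith)
qed

lemma unit_cell_norm_ge:
  fixes \<zeta> l :: "real^'d"
  assumes "\<zeta> \<in> unit_cell" "l \<in> int_lattice"
  shows "norm l / 2 \<le> norm (\<zeta> + l)"
proof -
  have "norm ((1/2) *\<^sub>R l) \<le> norm (\<zeta> + l)"
    by (rule norm_le_componentwise_cart)
       (use unit_cell_component_ge[OF assms] in \<open>simp add: abs_mult\<close>)
  thus ?thesis by simp
qed

section \<open>Products of one-dimensional integrals and the tent function\<close>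

text \<open>\<open>lborel\<close> on vectors is the image of a product measure indexed by the basis
  vectors; \<open>idx\<close> translates basis vectors back to coordinates, so the one-dimensional
  integrals multiply.\<close>

lemma
  fixes f :: "'d::finite \<Rightarrow> real \<Rightarrow> complex"
  assumes f: "\<And>i. integrable lborel (f i)"
  shows integrable_lborel_prod: "integrable lborel (\<lambda>x::real^'d. \<Prod>i\<in>UNIV. f i (x $ i))"
    and integral_lborel_prod: "(LINT x|(lborel :: (real^'d) measure). (\<Prod>i\<in>UNIV. f i (x $ i))) = (\<Prod>i\<in>UNIV. LINT t|lborel. f i t)"
proof -
  interpret P: product_sigma_finite "\<lambda>_::real^'d. lborel :: real measure" by unfold_locales
  define idx where "idx = the_inv_into UNIV (\<lambda>i::'d. axis i (1::real))"
  have inj: "inj (\<lambda>i::'d. axis i (1::real))" by (auto simp: inj_def axis_eq_axis)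
  have B: "Basis = range (\<lambda>i::'d. axis i (1::real))" by (auto simp: Basis_vec_def)
  have idx: "idx (axis i 1) = i" for i
    unfolding idx_def using inj by (rule the_inv_into_f_f) simp
  have reidx: "(\<Prod>b\<in>Basis. F b) = (\<Prod>i\<in>UNIV. F (axis i 1))" for F :: "real^'d \<Rightarrow> complex"
    unfolding B using inj by (subst prod.reindex) auto
  have comp: "(\<Sum>b\<in>Basis. w b *\<^sub>R b) $ i = w (axis i 1)" for w :: "real^'d \<Rightarrow> real" and i
  proof -
    have "(\<Sum>b\<in>Basis. w b *\<^sub>R b) \<bullet> axis i 1 = w (axis i 1)"
      by (rule inner_sum_left_Basis) (auto simp: B)
    thus ?thesis by (simp add: cart_eq_inner_axis)
  qed
  have fm: "f i \<in> borel_measurable borel" for i using borel_measurable_integrable[OF f[of i]] by simp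
  have m: "(\<lambda>w. \<Sum>b\<in>Basis. w b *\<^sub>R b) \<in> PiM Basis (\<lambda>_::real^'d. lborel :: real measure) \<rightarrow>\<^sub>M borel"
    by measurable
  have m2: "(\<lambda>x::real^'d. \<Prod>i\<in>UNIV. f i (x $ i)) \<in> borel_measurable borel"
    using fm by measurable
  have eq: "(\<Prod>i\<in>UNIV. f i ((\<Sum>b\<in>Basis. w b *\<^sub>R b) $ i)) = (\<Prod>b\<in>Basis. f (idx b) (w b))" for w
    unfolding comp reidx idx ..
  show "integrable lborel (\<lambda>x::real^'d. \<Prod>i\<in>UNIV. f i (x $ i))"
    by (subst lborel_eq, subst integrable_distr_eq[OF m m2], unfold eq)
       (rule P.product_integrable_prod, auto intro: f)
  have "(LINT x|(lborel :: (real^'d) measure). (\<Prod>i\<in>UNIV. f i (x $ i))) =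
      (LINT w|PiM Basis (\<lambda>_::real^'d. lborel). (\<Prod>b\<in>Basis. f (idx b) (w b)))"
    by (subst lborel_eq, subst integral_distr[OF m m2], unfold eq) rule
  also have "\<dots> = (\<Prod>b\<in>Basis. LINT t|lborel. f (idx b) t)"
    by (rule P.product_integral_prod) (auto intro: f)
  finally show "(LINT x|(lborel :: (real^'d) measure). (\<Prod>i\<in>UNIV. f i (x $ i))) = (\<Prod>i\<in>UNIV. LINT t|lborel. f i t)"
    unfolding reidx idx .
qed

lemma borel_measurable_cis [measurable (raw)]:
  assumes "f \<in> borel_measurable M"
  shows "(\<lambda>x. cis (f x)) \<in> borel_measurable M"
  by (rule borel_measurable_continuous_on[OF _ assms]) (intro continuous_intros)

definition tent :: "real \<Rightarrow> real" where
  "tent x = max 0 (1 - \<bar>x\<bar>)"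

text \<open>This is the square of \<open>sin (pi * s) / (pi * s)\<close>, written through the
  double-angle formula and completed by its limit 1 at the origin. Its nonnegativity and quadratic
  decay serve the positivity and summability arguments.\<close>

definition tent_ft :: "real \<Rightarrow> real" where
  "tent_ft s = (if s = 0 then 1 else (1 - cos (2 * pi * s)) / (2 * pi\<^sup>2 * s\<^sup>2))"

lemma tent_nonneg: "0 \<le> tent x" and tent_le_1: "tent x \<le> 1" and tent_zero: "1 \<le> \<bar>x\<bar> \<Longrightarrow> tent x = 0"
  by (auto simp: tent_def)

lemma continuous_on_tent [continuous_intros]: "continuous_on A f \<Longrightarrow> continuous_on A (\<lambda>x. tent (f x))"
  unfolding tent_def by (intro continuous_intros)

lemma borel_measurable_tent [measurable]: "tent \<in> borel_measurable borel"
  by (intro borel_measurable_continuous_onI continuous_intros)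

lemma tent_lipschitz: "\<bar>tent x - tent y\<bar> \<le> \<bar>x - y\<bar>"
  by (auto simp: tent_def)

lemma
  shows integrable_tent_cis: "integrable lborel (\<lambda>x. of_real (tent x) * cis (- 2 * pi * (x * s)))"
    and integral_tent_cis: "(LINT x|lborel. of_real (tent x) * cis (- 2 * pi * (x * s))) = of_real (tent_ft s)"
proof -
  define f where "f = (\<lambda>x. of_real (tent x) * cis (- 2 * pi * (x * s)))"
  \<comment> \<open>The tent is linear on each side of 0, and the two pieces overlap only in the
    point 0, a null set.\<close>
  have hb: "has_bochner_integral lborel f (I1 + I2)"
    if "has_bochner_integral lborel (\<lambda>x. indicator {-1..0} x *\<^sub>R f1 x) I1"
      and "has_bochner_integral lborel (\<lambda>x. indicator {0..1} x *\<^sub>R f2 x) I2"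
      and "\<And>x. -1 \<le> x \<Longrightarrow> x \<le> 0 \<Longrightarrow> f1 x = f x" "\<And>x. 0 \<le> x \<Longrightarrow> x \<le> 1 \<Longrightarrow> f2 x = f x"
    for I1 I2 f1 f2
  proof -
    have "has_bochner_integral lborel (\<lambda>x. indicator {-1..0} x *\<^sub>R f1 x + indicator {0..1} x *\<^sub>R f2 x) (I1 + I2)"
      using that by (intro has_bochner_integral_add)
    moreover have "AE x in lborel. indicator {-1..0} x *\<^sub>R f1 x + indicator {0..1} x *\<^sub>R f2 x = f x"
      using AE_lborel_singleton[of "0::real"]
    proof eventually_elim
      fix x :: real assume "x \<noteq> 0"
      thus "indicator {-1..0} x *\<^sub>R f1 x + indicator {0..1} x *\<^sub>R f2 x = f x"
        using that(3,4)[of x] by (auto simp: indicator_def f_def tent_def)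
    qed
    moreover have "f \<in> borel_measurable lborel" unfolding f_def by measurable
    ultimately show ?thesis
      by (subst has_bochner_integral_cong_AE[symmetric, rotated 2])
         (auto simp: has_bochner_integral_iff)
  qed
  have hb: "has_bochner_integral lborel f (of_real (tent_ft s))"
  proof (cases "s = 0")
    case True
    have f: "f x = of_real (tent x)" for x by (simp add: f_def True)
    have D: "((\<lambda>x::real. F (of_real x)) has_vector_derivative f') (at x within A)"
      if "(F has_field_derivative f') (at (of_real x))" for F :: "complex \<Rightarrow> complex" and f' x A
      using has_vector_derivative_real_field[OF that] by (rule has_vector_derivative_at_within)
    have 1: "has_bochner_integral lborel (\<lambda>x. indicator {-1..0} x *\<^sub>R (1 + of_real x))
        ((of_real 0 + (of_real 0)\<^sup>2/2) - (of_real (-1) + (of_real (-1))\<^sup>2/2) :: complex)"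
      by (rule has_bochner_integral_FTC_Icc, simp, rule D)
         (auto intro!: derivative_eq_intros continuous_intros)
    have 2: "has_bochner_integral lborel (\<lambda>x. indicator {0..1} x *\<^sub>R (1 - of_real x))
        ((of_real 1 - (of_real 1)\<^sup>2/2) - (of_real 0 - (of_real 0)\<^sup>2/2) :: complex)"
      by (rule has_bochner_integral_FTC_Icc, simp, rule D)
         (auto intro!: derivative_eq_intros continuous_intros)
    show ?thesis
      using hb[OF 1 2] by (auto simp: f tent_def tent_ft_def True)
  next
    case False
    \<comment> \<open>With \<open>c\<close> the exponent, integration by parts on each half leaves
      boundary terms that combine to \<open>(exp c + exp (- c) - 2) / c\<^sup>2\<close>.\<close>
    define c where "c = - 2 * pi * \<i> * s"
    have c: "c \<noteq> 0" using False by (simp add: c_def)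
    have f: "f x = of_real (tent x) * exp (c * of_real x)" for x
      by (simp add: f_def cis_conv_exp c_def mult_ac)
    have D: "((\<lambda>x::real. F (of_real x)) has_vector_derivative f') (at x within A)"
      if "(F has_field_derivative f') (at (of_real x))" for F f' x A
      using has_vector_derivative_real_field[OF that] by (rule has_vector_derivative_at_within)
    have 1: "has_bochner_integral lborel (\<lambda>x. indicator {-1..0} x *\<^sub>R ((1 + of_real x) * exp (c * of_real x)))
        ((1 + of_real 0) * exp (c * of_real 0) / c - exp (c * of_real 0) / c\<^sup>2 - ((1 + of_real (-1)) * exp (c * of_real (-1)) / c - exp (c * of_real (-1)) / c\<^sup>2))"
    proof (rule has_bochner_integral_FTC_Icc)
      fix x :: real
      show "((\<lambda>x. (1 + of_real x) * exp (c * of_real x) / c - exp (c * of_real x) / c\<^sup>2) has_vector_derivative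
         (1 + of_real x) * exp (c * of_real x)) (at x within {-1..0})"
        by (rule D) (use c in \<open>auto intro!: derivative_eq_intros simp: field_simps power2_eq_square\<close>)
    qed (auto intro!: continuous_intros)
    have 2: "has_bochner_integral lborel (\<lambda>x. indicator {0..1} x *\<^sub>R ((1 - of_real x) * exp (c * of_real x)))
        ((1 - of_real 1) * exp (c * of_real 1) / c + exp (c * of_real 1) / c\<^sup>2 - ((1 - of_real 0) * exp (c * of_real 0) / c + exp (c * of_real 0) / c\<^sup>2))"
    proof (rule has_bochner_integral_FTC_Icc)
      fix x :: real
      show "((\<lambda>x. (1 - of_real x) * exp (c * of_real x) / c + exp (c * of_real x) / c\<^sup>2) has_vector_derivative
         (1 - of_real x) * exp (c * of_real x)) (at x within {0..1})"
        by (rule D) (use c in \<open>auto intro!: derivative_eq_intros simp: field_simps power2_eq_square\<close>)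
    qed (auto intro!: continuous_intros)
    have e: "exp c + exp (- c) = of_real (2 * cos (2 * pi * s))"
    proof -
      have "exp c = cis (- (2 * pi * s))" "exp (- c) = cis (2 * pi * s)"
        by (simp_all add: c_def cis_conv_exp mult_ac)
      thus ?thesis by (simp add: complex_eq_iff)
    qed
    have c2: "c\<^sup>2 = - of_real (4 * pi\<^sup>2 * s\<^sup>2)" by (simp add: c_def power_mult_distrib)
    have "((1 + of_real 0) * exp (c * of_real 0) / c - exp (c * of_real 0) / c\<^sup>2 - ((1 + of_real (-1)) * exp (c * of_real (-1)) / c - exp (c * of_real (-1)) / c\<^sup>2))
        + ((1 - of_real 1) * exp (c * of_real 1) / c + exp (c * of_real 1) / c\<^sup>2 - ((1 - of_real 0) * exp (c * of_real 0) / c + exp (c * of_real 0) / c\<^sup>2))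
        = (exp c + exp (- c) - 2) / c\<^sup>2"
      by (simp add: diff_divide_distrib add_divide_distrib)
    also have "\<dots> = of_real (tent_ft s)"
      unfolding e c2 tent_ft_def using False
      by (simp add: complex_eq_iff divide_simps)
    finally show ?thesis
      using hb[OF 1 2] by (auto simp: f tent_def)
  qed
  thus "integrable lborel f" "integral\<^sup>L lborel f = of_real (tent_ft s)"
    by (auto simp: has_bochner_integral_iff)
qed

lemma tent_ft_nonneg: "0 \<le> tent_ft s"
  by (auto simp: tent_ft_def)

text \<open>The transform of a nonnegative function is bounded by its value at the origin, which is
  the total mass 1.\<close>

lemma tent_ft_le_1: "tent_ft s \<le> 1"
proof -
  have "norm (complex_of_real (tent_ft s)) \<le> (LINT x|lborel. norm (of_real (tent x) * cis (- 2 * pi * (x * s))))"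
    unfolding integral_tent_cis[symmetric] by (rule integral_norm_bound)
  also have "\<dots> = norm (LINT x|lborel. of_real (tent x) * cis (- 2 * pi * (x * 0)))"
    by (simp add: norm_mult tent_nonneg integral_nonneg_AE)
  also have "\<dots> = 1" unfolding integral_tent_cis by (simp add: tent_ft_def)
  finally show ?thesis by simp
qed

lemma tent_ft_decay:
  assumes "s \<noteq> 0"
  shows "tent_ft s \<le> 1 / s\<^sup>2"
proof -
  have "(1 - cos (2 * pi * s)) / (2 * pi\<^sup>2) \<le> 2 / (2 * pi\<^sup>2)"
    using cos_ge_minus_one[of "2 * pi * s"] by (intro divide_right_mono) (auto simp: linorder_not_less)
  also have "\<dots> \<le> 1"
    using pi_gt3 by (simp add: power2_eq_square) (smt (verit) mult_less_cancel_left2)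
  finally have "(1 - cos (2 * pi * s)) / (2 * pi\<^sup>2) / s\<^sup>2 \<le> 1 / s\<^sup>2" by (rule divide_right_mono) simp
  thus ?thesis using assms by (simp add: tent_ft_def)
qed

lemma borel_measurable_tent_ft [measurable]: "tent_ft \<in> borel_measurable borel"
  unfolding tent_ft_def[abs_def] by measurable

section \<open>The Fourier transform of integrable functions\<close>

lemma (in pair_sigma_finite)
  fixes u :: "'a \<Rightarrow> 'b \<Rightarrow> 'c::{banach, second_countable_topology}"
  assumes [measurable]: "case_prod u \<in> borel_measurable (M1 \<Otimes>\<^sub>M M2)"
    and fin: "(\<integral>\<^sup>+x. \<integral>\<^sup>+y. norm (u x y) \<partial>M2 \<partial>M1) < \<infinity>"
  shows integrable_pairI: "integrable (M1 \<Otimes>\<^sub>M M2) (case_prod u)"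
    and integral_swapI: "(LINT x|M1. LINT y|M2. u x y) = (LINT y|M2. LINT x|M1. u x y)"
proof -
  show *: "integrable (M1 \<Otimes>\<^sub>M M2) (case_prod u)"
    unfolding integrable_iff_bounded
    using fin by (subst M2.nn_integral_fst[symmetric]) (auto simp: case_prod_beta)
  show "(LINT x|M1. LINT y|M2. u x y) = (LINT y|M2. LINT x|M1. u x y)"
    using Fubini_integral[OF *] by simp
qed

lemma nn_integral_norm_lt_top:
  fixes f :: "'a \<Rightarrow> 'b::{banach, second_countable_topology}"
  shows "integrable M f \<Longrightarrow> (\<integral>\<^sup>+x. ennreal (norm (f x)) \<partial>M) < \<infinity>"
  unfolding integrable_iff_bounded by blast

text \<open>The integral of \<open>fourier\<close> taken over the Borel measure
  \<open>lborel\<close> and written with \<open>cis\<close>: for Borel functions product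
  measurability, and hence Fubini, is at hand, and \<open>fourier_eq_ft\<close> transfers the
  results.\<close>

definition ft :: "(real^'d \<Rightarrow> complex) \<Rightarrow> real^'d \<Rightarrow> complex" where
  "ft f \<xi> = (LINT x|lborel. f x * cis (- 2 * pi * (x \<bullet> \<xi>)))"

lemma fourier_eq_ft:
  assumes [measurable]: "f \<in> borel_measurable borel"
  shows "fourier f = ft f"
proof
  fix \<xi> :: "real^'a"
  have "exp (- (2 * pi * \<i> * (x \<bullet> \<xi>))) = cis (- 2 * pi * (x \<bullet> \<xi>))" for x :: "real^'a"
    by (simp add: cis_conv_exp mult_ac)
  thus "fourier f \<xi> = ft f \<xi>"
    unfolding fourier_def ft_def by (simp only:) (rule integral_completion, measurable)
qed

lemma integrable_mult_cis:
  fixes f :: "'a::euclidean_space \<Rightarrow> complex"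
  assumes "integrable lborel f" "c \<in> borel_measurable borel"
  shows "integrable lborel (\<lambda>x. f x * cis (c x))"
  by (rule Bochner_Integration.integrable_bound[OF assms(1)])
     (use assms borel_measurable_integrable[OF assms(1)] in \<open>auto simp: norm_mult\<close>)

lemma norm_ft_le: "norm (ft f \<xi>) \<le> (LINT x|lborel. norm (f x))"
proof -
  have "norm (ft f \<xi>) \<le> (LINT x|lborel. norm (f x * cis (- 2 * pi * (x \<bullet> \<xi>))))"
    unfolding ft_def by (rule integral_norm_bound)
  thus ?thesis by (simp add: norm_mult)
qed

lemma ft_add:
  assumes "integrable lborel f" "integrable lborel g"
  shows "ft (\<lambda>x. f x + g x) \<xi> = ft f \<xi> + ft g \<xi>"
  unfolding ft_def ring_distribs
  by (rule Bochner_Integration.integral_add) (auto intro!: integrable_mult_cis assms)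

lemma ft_diff:
  assumes "integrable lborel f" "integrable lborel g"
  shows "ft (\<lambda>x. f x - g x) \<xi> = ft f \<xi> - ft g \<xi>"
  unfolding ft_def ring_distribs
  by (rule Bochner_Integration.integral_diff) (auto intro!: integrable_mult_cis assms)

lemma continuous_on_ft:
  assumes f: "integrable lborel f"
  shows "continuous_on UNIV (ft f)"
proof (rule continuous_on_sequentiallyI)
  fix u :: "nat \<Rightarrow> real^'a" and a assume u: "u \<longlonglongrightarrow> a"
  have [measurable]: "f \<in> borel_measurable borel" using borel_measurable_integrable[OF f] by simp
  show "(\<lambda>n. ft f (u n)) \<longlonglongrightarrow> ft f a"
    unfolding ft_def
  proof (rule integral_dominated_convergence[where w = "\<lambda>x. norm (f x)"])
    show "AE x in lborel. (\<lambda>n. f x * cis (- 2 * pi * (x \<bullet> u n))) \<longlonglongrightarrow> f x * cis (- 2 * pi * (x \<bullet> a))"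
    proof (rule AE_I2)
      fix x
      have "isCont cis t" for t
        using continuous_on_eq_continuous_at[of UNIV cis] by (simp add: continuous_intros)
      thus "(\<lambda>n. f x * cis (- 2 * pi * (x \<bullet> u n))) \<longlonglongrightarrow> f x * cis (- 2 * pi * (x \<bullet> a))"
        by (intro tendsto_intros u isCont_tendsto_compose[where g = cis])
    qed
  qed (use f in \<open>auto simp: norm_mult\<close>)
qed

lemma borel_measurable_ft [measurable]:
  "integrable lborel f \<Longrightarrow> ft f \<in> borel_measurable borel"
  by (rule borel_measurable_continuous_onI[OF continuous_on_ft])

text \<open>The multiplication formula: Fubini moves the transform from one factor to the other. It
  drives both the square estimate below and the computation of the ball averages.\<close>

lemma integral_ft_mult:
  fixes f v :: "real^'d \<Rightarrow> complex"
  assumes f: "integrable lborel f" and v: "integrable lborel v"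
  shows "(LINT x|lborel. ft f x * v x) = (LINT \<xi>|lborel. f \<xi> * ft v \<xi>)"
proof -
  have [measurable]: "f \<in> borel_measurable borel" "v \<in> borel_measurable borel"
    using borel_measurable_integrable[OF f] borel_measurable_integrable[OF v] by simp_all
  have "(LINT x|lborel. ft f x * v x) = (LINT x|lborel. LINT \<xi>|lborel. f \<xi> * cis (- 2 * pi * (\<xi> \<bullet> x)) * v x)"
    unfolding ft_def by simp
  also have "\<dots> = (LINT \<xi>|lborel. LINT x|lborel. f \<xi> * cis (- 2 * pi * (\<xi> \<bullet> x)) * v x)"
  proof (rule lborel_pair.integral_swapI)
    have "(\<integral>\<^sup>+ x. \<integral>\<^sup>+ y. ennreal (norm (f y * cis (- 2 * pi * (y \<bullet> x)) * v x)) \<partial>lborel \<partial>lborel)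
        = (\<integral>\<^sup>+ x. ennreal (norm (v x)) * (\<integral>\<^sup>+ y. ennreal (norm (f y)) \<partial>lborel) \<partial>lborel)"
      by (simp add: norm_mult ennreal_mult mult.commute nn_integral_cmult[symmetric])
    also have "\<dots> = (\<integral>\<^sup>+ x. ennreal (norm (v x)) \<partial>lborel) * (\<integral>\<^sup>+ y. ennreal (norm (f y)) \<partial>lborel)"
      by (rule nn_integral_multc) measurable
    also have "\<dots> < \<infinity>"
      using nn_integral_norm_lt_top[OF f] nn_integral_norm_lt_top[OF v] by (simp add: ennreal_mult_less_top)
    finally show "(\<integral>\<^sup>+ x. \<integral>\<^sup>+ y. ennreal (norm (f y * cis (- 2 * pi * (y \<bullet> x)) * v x)) \<partial>lborel \<partial>lborel) < \<infinity>" .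
  qed measurable
  also have "\<dots> = (LINT \<xi>|lborel. f \<xi> * ft v \<xi>)"
    unfolding ft_def by (simp add: mult_ac inner_commute)
  finally show ?thesis .
qed

lemma nn_integral_lborel_scale:
  fixes u :: "'a::euclidean_space \<Rightarrow> ennreal"
  assumes [measurable]: "u \<in> borel_measurable borel" and c: "c > 0"
  shows "(\<integral>\<^sup>+x. u x \<partial>lborel) = ennreal (c ^ DIM('a)) * (\<integral>\<^sup>+x. u (c *\<^sub>R x) \<partial>lborel)"
  by (subst lborel_affine[of c 0]) (use c in \<open>simp_all add: nn_integral_density nn_integral_distr nn_integral_cmult\<close>)

lemma integral_lborel_scale:
  fixes u :: "'a::euclidean_space \<Rightarrow> complex"
  assumes [measurable]: "u \<in> borel_measurable borel" and c: "c > 0"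
  shows "(LINT x|lborel. u x) = of_real (c ^ DIM('a)) * (LINT x|lborel. u (c *\<^sub>R x))"
  by (subst lborel_affine[of c 0])
     (use c in \<open>simp_all add: integral_density integral_distr scaleR_conv_of_real\<close>)

lemma ft_scale:
  fixes f :: "real^'d \<Rightarrow> complex"
  assumes [measurable]: "f \<in> borel_measurable borel" and c: "c > 0"
  shows "ft (\<lambda>x. f (c *\<^sub>R x)) \<xi> = of_real ((1 / c) ^ CARD('d)) * ft f ((1 / c) *\<^sub>R \<xi>)"
proof -
  have "ft f ((1 / c) *\<^sub>R \<xi>) = of_real (c ^ CARD('d)) * (LINT x|lborel. f (c *\<^sub>R x) * cis (- 2 * pi * ((c *\<^sub>R x) \<bullet> ((1 / c) *\<^sub>R \<xi>))))"
    unfolding ft_def using integral_lborel_scale[OF _ c, of "\<lambda>x. f x * cis (- 2 * pi * (x \<bullet> ((1 / c) *\<^sub>R \<xi>)))"] by simp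
  also have "(LINT x|lborel. f (c *\<^sub>R x) * cis (- 2 * pi * ((c *\<^sub>R x) \<bullet> ((1 / c) *\<^sub>R \<xi>)))) = ft (\<lambda>x. f (c *\<^sub>R x)) \<xi>"
    unfolding ft_def using c by simp
  finally show ?thesis using c by (simp add: power_one_over field_simps)
qed

definition Tent :: "real^'d \<Rightarrow> real" where
  "Tent x = (\<Prod>i\<in>UNIV. tent (x $ i))"

definition Tent_ft :: "real^'d \<Rightarrow> real" where
  "Tent_ft \<xi> = (\<Prod>i\<in>UNIV. tent_ft (\<xi> $ i))"

lemma Tent_nonneg: "0 \<le> Tent x" and Tent_le_1: "Tent x \<le> 1"
  and Tent_ft_nonneg: "0 \<le> Tent_ft x" and Tent_ft_le_1: "Tent_ft x \<le> 1"
  unfolding Tent_def Tent_ft_def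
  by (auto intro!: prod_nonneg prod_le_1 simp: tent_nonneg tent_le_1 tent_ft_nonneg tent_ft_le_1)

lemma borel_measurable_Tent [measurable]: "Tent \<in> borel_measurable borel"
  and borel_measurable_Tent_ft [measurable]: "Tent_ft \<in> borel_measurable borel"
  unfolding Tent_def[abs_def] Tent_ft_def[abs_def] by measurable

lemma continuous_on_Tent: "continuous_on UNIV Tent"
  unfolding Tent_def[abs_def] by (intro continuous_intros)

lemma Tent_zero: "Tent 0 = 1" by (simp add: Tent_def tent_def)

lemma Tent_ft_zero: "Tent_ft 0 = 1" by (simp add: Tent_ft_def tent_ft_def)

lemma Tent_eq_0:
  assumes "1 \<le> \<bar>x $ i\<bar>" shows "Tent x = 0"
  using tent_zero[OF assms] by (auto simp: Tent_def prod_zero_iff)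

text \<open>The exponential of an inner product factors over the coordinates, so the one-dimensional
  formula for the tent is multiplied up.\<close>

lemma
  shows integrable_Tent: "integrable lborel (\<lambda>x :: real^'d. complex_of_real (Tent x))"
    and ft_Tent: "ft (\<lambda>x :: real^'d. complex_of_real (Tent x)) \<xi> = of_real (Tent_ft \<xi>)"
proof -
  have e: "of_real (Tent x) * cis (- 2 * pi * (x \<bullet> \<xi>)) = (\<Prod>i\<in>UNIV. of_real (tent (x $ i)) * cis (- 2 * pi * (x $ i * \<xi> $ i)))"
    for x \<xi> :: "real^'d"
  proof -
    have "cis (\<Sum>i\<in>A. c i) = (\<Prod>i\<in>A. cis (c i))" if "finite A" for A :: "'d set" and c
      using that by (induction A rule: finite_induct) (auto simp: cis_mult[symmetric])
    from this[of UNIV "\<lambda>i. - 2 * pi * (x $ i * \<xi> $ i)"]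
    show ?thesis by (simp add: inner_vec_def sum_distrib_left prod.distrib Tent_def)
  qed
  have "integrable lborel (\<lambda>x :: real^'d. of_real (Tent x) * cis (- 2 * pi * (x \<bullet> 0)))"
    unfolding e by (rule integrable_lborel_prod) (rule integrable_tent_cis)
  thus "integrable lborel (\<lambda>x :: real^'d. complex_of_real (Tent x))" by simp
  show "ft (\<lambda>x :: real^'d. complex_of_real (Tent x)) \<xi> = of_real (Tent_ft \<xi>)"
    unfolding ft_def e
    by (subst integral_lborel_prod[OF integrable_tent_cis]) (simp only: integral_tent_cis Tent_ft_def of_real_prod)
qed

text \<open>The bounds 1 and \<open>1 / s\<^sup>2\<close> are merged into one function that is
  integrable over the whole line.\<close>

lemma tent_ft_le: "tent_ft s \<le> 2 * inverse (1 + s\<^sup>2)"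
proof (cases "1 \<le> \<bar>s\<bar>")
  case True
  have s: "1 \<le> s\<^sup>2" using True by (metis abs_le_square_iff abs_one one_power2)
  have "tent_ft s \<le> 1 / s\<^sup>2" using True by (intro tent_ft_decay) auto
  also have "\<dots> \<le> 2 * inverse (1 + s\<^sup>2)" using s by (simp add: divide_simps)
  finally show ?thesis .
next
  case False
  hence "s\<^sup>2 \<le> 1" using abs_square_le_1 by fastforce
  hence "1 \<le> 2 * inverse (1 + s\<^sup>2)" by (simp add: divide_simps add_pos_nonneg)
  thus ?thesis using tent_ft_le_1[of s] by linarith
qed

lemma integrable_Tent_ft: "integrable lborel (\<lambda>x :: real^'d. complex_of_real (Tent_ft x))"
proof -
  have "integrable lborel (\<lambda>s. complex_of_real (tent_ft s))"
  proof (rule Bochner_Integration.integrable_bound)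
    show "integrable lborel (\<lambda>s::real. 2 * inverse (1 + s\<^sup>2))"
      using integrable_inverse_1_plus_square by (simp add: set_integrable_def)
  qed (auto simp: tent_ft_nonneg intro!: AE_I2 order_trans[OF tent_ft_le])
  hence "integrable lborel (\<lambda>x :: real^'d. \<Prod>i\<in>UNIV. complex_of_real (tent_ft (x $ i)))"
    by (intro integrable_lborel_prod)
  thus ?thesis by (simp add: Tent_ft_def)
qed

section \<open>A Plancherel inequality\<close>

lemma lborel_distr_uminus_vec: "distr lborel borel uminus = (lborel :: 'a::euclidean_space measure)"
  using lborel_affine[of "-1" "0::'a"] by (simp add: density_1)

lemma borel_measurable_cnj [measurable (raw)]:
  assumes "f \<in> borel_measurable M"
  shows "(\<lambda>x. cnj (f x)) \<in> borel_measurable M"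
  by (rule borel_measurable_continuous_on[OF _ assms]) (intro continuous_intros)

lemma integrable_mult_bounded:
  fixes f u :: "'a \<Rightarrow> complex"
  assumes f: "integrable M f" and [measurable]: "u \<in> borel_measurable M" and u: "\<And>x. norm (u x) \<le> B"
  shows "integrable M (\<lambda>x. f x * u x)"
proof (rule Bochner_Integration.integrable_bound)
  show "integrable M (\<lambda>x. B * norm (f x))" using f by auto
  have "norm (f x * u x) \<le> norm (B * norm (f x))" for x
  proof -
    have "0 \<le> B" using u[of x] norm_ge_zero order_trans by blast
    thus ?thesis using u[of x] by (simp add: norm_mult mult.commute[of B] mult_left_mono)
  qed
  thus "AE x in M. norm (f x * u x) \<le> norm (B * norm (f x))" by simp
qed (use borel_measurable_integrable[OF f] in measurable)

text \<open>Pairing with the weight \<open>\<rho>\<close> twice through the multiplication formula turns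
  \<open>\<integral>|f\<^sup>^|\<^sup>2 \<rho>\<close> into a quadratic form with kernel \<open>\<rho>\<^sup>^(\<eta> - \<xi>)\<close>, which Schur's test bounds.\<close>

lemma nn_integral_ft_square_weight:
  fixes f :: "real^'d \<Rightarrow> complex" and \<rho> :: "real^'d \<Rightarrow> real"
  assumes f: "integrable lborel f"
    and \<rho>: "integrable lborel (\<lambda>x. complex_of_real (\<rho> x))" "\<And>x. 0 \<le> \<rho> x"
    and k: "\<And>\<xi>. ft (\<lambda>x. complex_of_real (\<rho> x)) \<xi> = of_real (k \<xi>)" "\<And>\<xi>. 0 \<le> k \<xi>"
    and km [measurable]: "k \<in> borel_measurable borel"
  shows "(\<integral>\<^sup>+x. ennreal ((norm (ft f x))\<^sup>2 * \<rho> x) \<partial>lborel) \<le>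
    (\<integral>\<^sup>+x. ennreal (k x) \<partial>lborel) * (\<integral>\<^sup>+x. ennreal ((norm (f x))\<^sup>2) \<partial>lborel)"
proof -
  have [measurable]: "f \<in> borel_measurable borel" using borel_measurable_integrable[OF f] by simp
  have [measurable]: "ft f \<in> borel_measurable borel" using f by measurable
  have [measurable]: "\<rho> \<in> borel_measurable borel"
    using measurable_compose[OF borel_measurable_integrable[OF \<rho>(1)], of Re borel] by simp
  define B where "B = (LINT x|lborel. norm (f x))"
  have fB: "norm (ft f x) \<le> B" for x unfolding B_def by (rule norm_ft_le)
  have kb: "norm (complex_of_real (k (\<eta> - \<xi>))) \<le> (LINT x|lborel. norm (complex_of_real (\<rho> x)))" for \<xi> \<eta>
    unfolding k(1)[symmetric] by (rule norm_ft_le)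
  \<comment> \<open>With this \<open>v\<close> the product \<open>ft f x * v x\<close> is the
    integrand to be estimated, so the multiplication formula applies; boundedness of
    \<open>ft f\<close> makes \<open>v\<close> integrable.\<close>
  define v where "v = (\<lambda>x. of_real (\<rho> x) * cnj (ft f x))"
  have v: "integrable lborel v"
  proof (rule Bochner_Integration.integrable_bound)
    show "integrable lborel (\<lambda>x. of_real B * complex_of_real (\<rho> x))"
      using \<rho>(1) by (rule integrable_mult_right)
    have "norm (v x) \<le> norm (of_real B * complex_of_real (\<rho> x))" for x
    proof -
      have "0 \<le> B" using fB[of x] norm_ge_zero order_trans by blast
      thus ?thesis using fB[of x] \<rho>(2)[of x] by (simp add: v_def norm_mult mult.commute[of B] mult_left_mono)
    qed
    thus "AE x in lborel. norm (v x) \<le> norm (of_real B * complex_of_real (\<rho> x))" by simp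
  qed (simp add: v_def)
  have ftv: "ft v \<xi> = cnj (LINT \<eta>|lborel. f \<eta> * of_real (k (\<eta> - \<xi>)))" for \<xi>
  proof -
    have "ft v \<xi> = (LINT x|lborel. cnj (ft f x * (of_real (\<rho> x) * cis (2 * pi * (x \<bullet> \<xi>)))))"
      unfolding ft_def[of v] by (rule Bochner_Integration.integral_cong) (auto simp: v_def cis_cnj)
    also have "\<dots> = cnj (LINT x|lborel. ft f x * (of_real (\<rho> x) * cis (2 * pi * (x \<bullet> \<xi>))))"
      by (rule Bochner_Integration.integral_cnj)
    also have "(LINT x|lborel. ft f x * (of_real (\<rho> x) * cis (2 * pi * (x \<bullet> \<xi>)))) =
        (LINT \<eta>|lborel. f \<eta> * ft (\<lambda>x. of_real (\<rho> x) * cis (2 * pi * (x \<bullet> \<xi>))) \<eta>)"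
      by (intro integral_ft_mult f integrable_mult_cis \<rho>) measurable
    \<comment> \<open>Modulating \<rho> shifts its transform: this is how a kernel in the difference
      of the variables arises.\<close>
    also have "ft (\<lambda>x. of_real (\<rho> x) * cis (2 * pi * (x \<bullet> \<xi>))) = (\<lambda>\<eta>. of_real (k (\<eta> - \<xi>)))"
      unfolding k(1)[symmetric] ft_def
      by (intro ext Bochner_Integration.integral_cong)
         (auto simp: mult.assoc cis_mult inner_diff_right algebra_simps)
    finally show ?thesis .
  qed
  have "(LINT x|lborel. complex_of_real ((norm (ft f x))\<^sup>2 * \<rho> x)) = (LINT x|lborel. ft f x * v x)"
  proof (intro Bochner_Integration.integral_cong refl)
    fix x
    have "ft f x * v x = of_real (\<rho> x) * (ft f x * cnj (ft f x))" by (simp add: v_def mult_ac)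
    thus "complex_of_real ((norm (ft f x))\<^sup>2 * \<rho> x) = ft f x * v x"
      by (simp only: complex_norm_square[symmetric] of_real_mult mult.commute)
  qed
  also have "\<dots> = (LINT \<xi>|lborel. f \<xi> * ft v \<xi>)" by (rule integral_ft_mult[OF f v])
  finally have eq: "(LINT x|lborel. complex_of_real ((norm (ft f x))\<^sup>2 * \<rho> x)) = (LINT \<xi>|lborel. f \<xi> * ft v \<xi>)" .
  have int: "integrable lborel (\<lambda>x. (norm (ft f x))\<^sup>2 * \<rho> x)"
  proof (rule Bochner_Integration.integrable_bound)
    show "integrable lborel (\<lambda>x. B\<^sup>2 * norm (complex_of_real (\<rho> x)))"
      by (rule integrable_mult_right[OF integrable_norm[OF \<rho>(1)]])
    show "AE x in lborel. norm ((norm (ft f x))\<^sup>2 * \<rho> x) \<le> norm (B\<^sup>2 * norm (complex_of_real (\<rho> x)))"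
      using fB \<rho>(2) by (auto simp: abs_mult intro!: mult_right_mono power_mono AE_I2)
  qed simp
  have "(\<integral>\<^sup>+x. ennreal ((norm (ft f x))\<^sup>2 * \<rho> x) \<partial>lborel) = ennreal (LINT x|lborel. (norm (ft f x))\<^sup>2 * \<rho> x)"
    using int \<rho>(2) by (intro nn_integral_eq_integral) auto
  also have "\<dots> \<le> ennreal (norm (LINT \<xi>|lborel. f \<xi> * ft v \<xi>))"
    unfolding eq[symmetric] integral_complex_of_real by (auto intro: ennreal_leI)
  also have "\<dots> \<le> (\<integral>\<^sup>+\<xi>. ennreal (norm (f \<xi> * ft v \<xi>)) \<partial>lborel)"
    by (rule integral_norm_bound_ennreal, rule integrable_mult_bounded[OF f _ norm_ft_le[of v]]) (use v in measurable)
  also have "\<dots> \<le> (\<integral>\<^sup>+\<xi>. \<integral>\<^sup>+\<eta>. ennreal (norm (f \<xi>) * norm (f \<eta>) * k (\<eta> - \<xi>)) \<partial>lborel \<partial>lborel)"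
  proof (rule nn_integral_mono)
    fix \<xi>
    have "ennreal (norm (ft v \<xi>)) \<le> (\<integral>\<^sup>+\<eta>. ennreal (norm (f \<eta> * of_real (k (\<eta> - \<xi>)))) \<partial>lborel)"
      unfolding ftv complex_mod_cnj
      by (rule integral_norm_bound_ennreal, rule integrable_mult_bounded[OF f _ kb]) measurable
    hence "ennreal (norm (f \<xi>)) * ennreal (norm (ft v \<xi>)) \<le> ennreal (norm (f \<xi>)) * (\<integral>\<^sup>+\<eta>. ennreal (norm (f \<eta> * of_real (k (\<eta> - \<xi>)))) \<partial>lborel)"
      by (rule mult_left_mono) simp
    also have "\<dots> = (\<integral>\<^sup>+\<eta>. ennreal (norm (f \<xi>) * norm (f \<eta>) * k (\<eta> - \<xi>)) \<partial>lborel)"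
      using k(2) by (subst nn_integral_cmult[symmetric]) (auto simp: norm_mult ennreal_mult mult.assoc)
    finally show "ennreal (norm (f \<xi> * ft v \<xi>)) \<le> (\<integral>\<^sup>+\<eta>. ennreal (norm (f \<xi>) * norm (f \<eta>) * k (\<eta> - \<xi>)) \<partial>lborel)"
      by (simp add: norm_mult ennreal_mult)
  qed
  \<comment> \<open>Bounding the product by half the sum of the squares separates the variables; in
    each half the kernel integrates out to the same constant, by translation invariance and, in the
    second half, also by reflection.\<close>
  also have "\<dots> \<le> (\<integral>\<^sup>+\<xi>. \<integral>\<^sup>+\<eta>. (ennreal ((norm (f \<xi>))\<^sup>2 / 2) * ennreal (k (\<eta> - \<xi>)) + ennreal ((norm (f \<eta>))\<^sup>2 / 2) * ennreal (k (\<eta> - \<xi>))) \<partial>lborel \<partial>lborel)"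
  proof (intro nn_integral_mono)
    fix \<xi> \<eta>
    have "norm (f \<xi>) * norm (f \<eta>) \<le> (norm (f \<xi>))\<^sup>2 / 2 + (norm (f \<eta>))\<^sup>2 / 2"
      using sum_squares_bound[of "norm (f \<xi>)" "norm (f \<eta>)"] by simp
    hence "norm (f \<xi>) * norm (f \<eta>) * k (\<eta> - \<xi>) \<le> ((norm (f \<xi>))\<^sup>2 / 2 + (norm (f \<eta>))\<^sup>2 / 2) * k (\<eta> - \<xi>)"
      using k(2) by (rule mult_right_mono)
    thus "ennreal (norm (f \<xi>) * norm (f \<eta>) * k (\<eta> - \<xi>)) \<le>
      ennreal ((norm (f \<xi>))\<^sup>2 / 2) * ennreal (k (\<eta> - \<xi>)) + ennreal ((norm (f \<eta>))\<^sup>2 / 2) * ennreal (k (\<eta> - \<xi>))"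
      using k(2) by (simp add: ennreal_mult'[symmetric] ennreal_plus[symmetric] ring_distribs ennreal_leI del: ennreal_plus)
  qed
  also have "\<dots> = (\<integral>\<^sup>+\<xi>. \<integral>\<^sup>+\<eta>. ennreal ((norm (f \<xi>))\<^sup>2 / 2) * ennreal (k (\<eta> - \<xi>)) \<partial>lborel \<partial>lborel) +
      (\<integral>\<^sup>+\<xi>. \<integral>\<^sup>+\<eta>. ennreal ((norm (f \<eta>))\<^sup>2 / 2) * ennreal (k (\<eta> - \<xi>)) \<partial>lborel \<partial>lborel)"
    by (simp add: nn_integral_add)
  also have "(\<integral>\<^sup>+\<xi>. \<integral>\<^sup>+\<eta>. ennreal ((norm (f \<xi>))\<^sup>2 / 2) * ennreal (k (\<eta> - \<xi>)) \<partial>lborel \<partial>lborel) =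
      (\<integral>\<^sup>+x. ennreal ((norm (f x))\<^sup>2 / 2) \<partial>lborel) * (\<integral>\<^sup>+x. ennreal (k x) \<partial>lborel)"
  proof -
    have "(\<integral>\<^sup>+\<eta>. ennreal (k (\<eta> - \<xi>)) \<partial>lborel) = (\<integral>\<^sup>+x. ennreal (k x) \<partial>lborel)" for \<xi>
      using nn_integral_lborel_shift[of "\<lambda>x. ennreal (k x)" "- \<xi>"] by simp
    thus ?thesis by (simp add: nn_integral_cmult nn_integral_multc)
  qed
  also have "(\<integral>\<^sup>+\<xi>. \<integral>\<^sup>+\<eta>. ennreal ((norm (f \<eta>))\<^sup>2 / 2) * ennreal (k (\<eta> - \<xi>)) \<partial>lborel \<partial>lborel) =
      (\<integral>\<^sup>+x. ennreal ((norm (f x))\<^sup>2 / 2) \<partial>lborel) * (\<integral>\<^sup>+x. ennreal (k x) \<partial>lborel)"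
  proof -
    have "(\<integral>\<^sup>+\<xi>. ennreal (k (\<eta> - \<xi>)) \<partial>lborel) = (\<integral>\<^sup>+x. ennreal (k x) \<partial>lborel)" for \<eta>
    proof -
      have "(\<integral>\<^sup>+\<xi>. ennreal (k (\<eta> - \<xi>)) \<partial>lborel) = (\<integral>\<^sup>+\<xi>. ennreal (k (\<eta> - \<xi>)) \<partial>distr lborel borel uminus)"
        by (simp add: lborel_distr_uminus_vec)
      also have "\<dots> = (\<integral>\<^sup>+\<xi>. ennreal (k (\<eta> + \<xi>)) \<partial>lborel)"
        by (subst nn_integral_distr) auto
      also have "\<dots> = (\<integral>\<^sup>+x. ennreal (k x) \<partial>lborel)"
        using nn_integral_lborel_shift[of "\<lambda>x. ennreal (k x)" "\<eta>"] by (simp add: add.commute)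
      finally show ?thesis .
    qed
    thus ?thesis
      by (subst lborel_pair.Fubini') (auto simp: nn_integral_cmult nn_integral_multc)
  qed
  also have "(\<integral>\<^sup>+x. ennreal ((norm (f x))\<^sup>2 / 2) \<partial>lborel) * (\<integral>\<^sup>+x. ennreal (k x) \<partial>lborel) + (\<integral>\<^sup>+x. ennreal ((norm (f x))\<^sup>2 / 2) \<partial>lborel) * (\<integral>\<^sup>+x. ennreal (k x) \<partial>lborel)
      = (\<integral>\<^sup>+x. ennreal (k x) \<partial>lborel) * (\<integral>\<^sup>+x. ennreal ((norm (f x))\<^sup>2) \<partial>lborel)"
  proof -
    have "(\<integral>\<^sup>+x. ennreal ((norm (f x))\<^sup>2) \<partial>lborel) = (\<integral>\<^sup>+x. ennreal ((norm (f x))\<^sup>2 / 2) + ennreal ((norm (f x))\<^sup>2 / 2) \<partial>lborel)"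
      by (simp add: ennreal_plus[symmetric] del: ennreal_plus)
    also have "\<dots> = (\<integral>\<^sup>+x. ennreal ((norm (f x))\<^sup>2 / 2) \<partial>lborel) + (\<integral>\<^sup>+x. ennreal ((norm (f x))\<^sup>2 / 2) \<partial>lborel)"
      by (rule nn_integral_add) auto
    finally show ?thesis by (simp add: ring_distribs mult.commute)
  qed
  finally show ?thesis .
qed

text \<open>The weights \<open>Tent (c *\<^sub>R x)\<close> tend to 1 as \<open>c\<close> tends to
  0, and their kernels, the dilates of \<open>Tent_ft\<close> normalised by a power of
  \<open>1 / c\<close>, all have the same integral. The weighted bound is thus uniform in
  \<open>c\<close>, and Fatou's lemma passes to the limit. Only finiteness of the constant matters
  later.\<close>

lemma plancherel_le:
  fixes f :: "real^'d \<Rightarrow> complex"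
  assumes f: "integrable lborel f"
  shows "(\<integral>\<^sup>+x. ennreal ((norm (ft f x))\<^sup>2) \<partial>lborel) \<le>
    (\<integral>\<^sup>+x. ennreal (Tent_ft (x :: real^'d)) \<partial>lborel) * (\<integral>\<^sup>+x. ennreal ((norm (f x))\<^sup>2) \<partial>lborel)"
proof -
  have [measurable]: "ft f \<in> borel_measurable borel" using f by measurable
  define c where "c = (\<lambda>n. 1 / real (Suc n))"
  have c: "c n > 0" for n by (simp add: c_def)
  have c0: "c \<longlonglongrightarrow> 0" unfolding c_def by (rule LIMSEQ_Suc[OF lim_1_over_n])
  have "(\<integral>\<^sup>+x. ennreal ((norm (ft f x))\<^sup>2) \<partial>lborel) =
      (\<integral>\<^sup>+x. liminf (\<lambda>n. ennreal ((norm (ft f x))\<^sup>2 * Tent (c n *\<^sub>R x))) \<partial>lborel)"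
  proof (rule nn_integral_cong)
    fix x :: "real^'d"
    have "isCont Tent (0 :: real^'d)" using continuous_on_Tent[where 'a = 'd] by (simp add: continuous_on_eq_continuous_at)
    moreover have "(\<lambda>n. c n *\<^sub>R x) \<longlonglongrightarrow> 0 *\<^sub>R x" by (intro tendsto_intros c0)
    ultimately have "(\<lambda>n. Tent (c n *\<^sub>R x)) \<longlonglongrightarrow> Tent (0 :: real^'d)"
      by (intro isCont_tendsto_compose[of 0 Tent]) auto
    hence "(\<lambda>n. ennreal ((norm (ft f x))\<^sup>2 * Tent (c n *\<^sub>R x))) \<longlonglongrightarrow> ennreal ((norm (ft f x))\<^sup>2 * 1)"
      by (intro tendsto_intros) (simp add: Tent_zero)
    thus "ennreal ((norm (ft f x))\<^sup>2) = liminf (\<lambda>n. ennreal ((norm (ft f x))\<^sup>2 * Tent (c n *\<^sub>R x)))"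
      by (simp add: lim_imp_Liminf)
  qed
  also have "\<dots> \<le> liminf (\<lambda>n. \<integral>\<^sup>+x. ennreal ((norm (ft f x))\<^sup>2 * Tent (c n *\<^sub>R x)) \<partial>lborel)"
    by (rule nn_integral_liminf) measurable
  also have "\<dots> \<le> liminf (\<lambda>n. (\<integral>\<^sup>+x. ennreal (Tent_ft (x :: real^'d)) \<partial>lborel) * (\<integral>\<^sup>+x. ennreal ((norm (f x))\<^sup>2) \<partial>lborel))"
  proof (rule Liminf_mono, rule always_eventually, rule allI)
    fix n
    have "(\<integral>\<^sup>+x. ennreal ((norm (ft f x))\<^sup>2 * Tent (c n *\<^sub>R x)) \<partial>lborel) \<le>
      (\<integral>\<^sup>+x. ennreal ((1 / c n) ^ CARD('d) * Tent_ft ((1 / c n) *\<^sub>R x :: real^'d)) \<partial>lborel) * (\<integral>\<^sup>+x. ennreal ((norm (f x))\<^sup>2) \<partial>lborel)"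
    proof (rule nn_integral_ft_square_weight[OF f])
      show "integrable lborel (\<lambda>x::real^'d. complex_of_real (Tent (c n *\<^sub>R x)))"
        unfolding integrable_iff_bounded
      proof
        have "(\<integral>\<^sup>+x. ennreal (norm (complex_of_real (Tent (x :: real^'d)))) \<partial>lborel) =
          ennreal (c n ^ CARD('d)) * (\<integral>\<^sup>+x. ennreal (norm (complex_of_real (Tent (c n *\<^sub>R x :: real^'d)))) \<partial>lborel)"
          by (subst nn_integral_lborel_scale[OF _ c[of n]]) auto
        hence "ennreal (c n ^ CARD('d)) * (\<integral>\<^sup>+x. ennreal (norm (complex_of_real (Tent (c n *\<^sub>R x :: real^'d)))) \<partial>lborel) < \<infinity>"
          using nn_integral_norm_lt_top[OF integrable_Tent[where 'd = 'd]] by simp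
        thus "(\<integral>\<^sup>+x. ennreal (norm (complex_of_real (Tent (c n *\<^sub>R x :: real^'d)))) \<partial>lborel) < \<infinity>"
          using c[of n] by (auto simp: ennreal_mult_less_top)
      qed measurable
      show "ft (\<lambda>x::real^'d. complex_of_real (Tent (c n *\<^sub>R x))) \<xi> = of_real ((1 / c n) ^ CARD('d) * Tent_ft ((1 / c n) *\<^sub>R \<xi>))" for \<xi>
        using ft_scale[OF _ c[of n], of "\<lambda>x::real^'d. complex_of_real (Tent x)" \<xi>] by (simp add: ft_Tent)
    qed (use c[of n] in \<open>auto simp: Tent_nonneg Tent_ft_nonneg\<close>)
    also have "(\<integral>\<^sup>+x. ennreal ((1 / c n) ^ CARD('d) * Tent_ft ((1 / c n) *\<^sub>R x :: real^'d)) \<partial>lborel) = (\<integral>\<^sup>+x. ennreal (Tent_ft (x :: real^'d)) \<partial>lborel)"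
      using c[of n]
      by (subst nn_integral_lborel_scale[of "\<lambda>x. ennreal (Tent_ft x)" "1 / c n"])
         (auto simp: ennreal_mult nn_integral_cmult Tent_ft_nonneg)
    finally show "(\<integral>\<^sup>+x. ennreal ((norm (ft f x))\<^sup>2 * Tent (c n *\<^sub>R x)) \<partial>lborel) \<le>
      (\<integral>\<^sup>+x. ennreal (Tent_ft (x :: real^'d)) \<partial>lborel) * (\<integral>\<^sup>+x. ennreal ((norm (f x))\<^sup>2) \<partial>lborel)" .
  qed
  finally show ?thesis by (simp only: Liminf_const[OF sequentially_bot])
qed

section \<open>The Hausdorff--Young inequality\<close>

lemma nn_integral_powr_Ioo:
  fixes a b :: real
  assumes a: "-1 < a" and b: "0 \<le> b"
  shows "(\<integral>\<^sup>+s. ennreal (s powr a) * indicator {0<..b} s \<partial>lborel) = ennreal (b powr (a + 1) / (a + 1))"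
proof -
  have "(\<integral>\<^sup>+s. ennreal (s powr a) * indicator {0<..b} s \<partial>lborel) = (\<integral>\<^sup>+s. ennreal (s powr a * indicator {0<..b} s) \<partial>lborel)"
    by (intro nn_integral_cong) (auto split: split_indicator)
  also have "\<dots> = ennreal (b powr (a + 1) / (a + 1))"
  proof (rule nn_integral_has_integral_lborel)
    have "((\<lambda>s. s powr a) has_integral (b powr (a + 1) / (a + 1))) {0..b}"
      by (rule has_integral_powr_from_0[OF a b])
    hence "((\<lambda>s. if s \<in> {0..b} then s powr a else 0) has_integral (b powr (a + 1) / (a + 1))) UNIV"
      by (simp only: has_integral_restrict_UNIV)
    thus "((\<lambda>s. s powr a * indicator {0<..b} s) has_integral (b powr (a + 1) / (a + 1))) UNIV"
      by (rule has_integral_eq[rotated]) (auto simp: indicator_def)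
  qed auto
  finally show ?thesis .
qed

text \<open>Marcinkiewicz interpolation between \<open>L\<^sub>1 \<rightarrow> L\<^sub>\<infinity>\<close> and \<open>L\<^sub>2 \<rightarrow> L\<^sub>2\<close>: for each level \<open>s\<close> the
  function is cut at height \<open>(s/2)\<^bsup>-(p-1)\<^esup>\<close>, so that the transform of the large part stays below \<open>s/2\<close>.\<close>

lemma hausdorff_young_gt_2:
  fixes p :: real
  assumes p: "2 < p"
  obtains C where "0 < C" "\<And>F :: real^'d \<Rightarrow> complex. integrable lborel F \<Longrightarrow>
    (\<integral>\<^sup>+x. ennreal (norm (F x) powr (p / (p - 1))) \<partial>lborel) \<le> 1 \<Longrightarrow>
    (\<integral>\<^sup>+x. ennreal (norm (ft F x) powr p) \<partial>lborel) \<le> ennreal C"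
proof -
  define q where "q = p / (p - 1)"
  have q: "1 < q" using p by (simp add: q_def field_simps)
  have pq: "(p - 1) * (q - 1) = 1" using p by (simp add: q_def field_simps)
  define c0 where "c0 = enn2real (\<integral>\<^sup>+x. ennreal (Tent_ft (x :: real^'d)) \<partial>lborel)"
  have c0_nonneg: "0 \<le> c0" by (simp add: c0_def)
  have c0: "(\<integral>\<^sup>+x. ennreal (Tent_ft (x :: real^'d)) \<partial>lborel) = ennreal c0"
    using nn_integral_norm_lt_top[OF integrable_Tent_ft[where 'd = 'd]]
    by (simp add: c0_def Tent_ft_nonneg abs_of_nonneg)
  \<comment> \<open>The factor 4 comes from Chebyshev's inequality at level \<open>s / 2\<close>,
    \<open>p\<close> from the layer-cake formula, \<open>c0\<close> from Plancherel, and the last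
    factor from integrating \<open>s powr (p - 3)\<close> up to the level at which a given height
    leaves the small part.\<close>
  define C where "C = 4 * p * c0 * (2 powr (p - 2) / (p - 2))"
  have main: "(\<integral>\<^sup>+x. ennreal (norm (ft F x) powr p) \<partial>lborel) \<le> ennreal C"
    if F: "integrable lborel F" and Fq: "(\<integral>\<^sup>+x. ennreal (norm (F x) powr q) \<partial>lborel) \<le> 1" for F :: "real^'d \<Rightarrow> complex"
  proof -
    have [measurable]: "F \<in> borel_measurable borel" using borel_measurable_integrable[OF F] by simp
    have [measurable]: "ft F \<in> borel_measurable borel" using F by measurable
    define lev where "lev = (\<lambda>s::real. (s / 2) powr (- (p - 1)))"
    have [measurable]: "lev \<in> borel_measurable borel" unfolding lev_def by measurable
    have weak: "emeasure lborel {x. s < norm (ft F x)} \<le>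
        ennreal (4 * c0 / s\<^sup>2) * (\<integral>\<^sup>+x. ennreal ((norm (F x))\<^sup>2) * indicator {x. norm (F x) \<le> lev s} x \<partial>lborel)"
      if s: "0 < s" for s
    proof -
      define A where "A = {x. norm (F x) \<le> lev s}"
      have [measurable]: "A \<in> sets borel" unfolding A_def by measurable
      \<comment> \<open>\<open>F1\<close> is the large part and \<open>F2\<close> the small one. The
        bound on the q-th powers of \<open>F\<close> and the cut height give
        \<open>norm (ft F1 x) <= s / 2\<close> everywhere, so a value above \<open>s\<close> forces
        \<open>ft F2\<close> above \<open>s / 2\<close>, and there the square estimate is
        available.\<close>
      define F1 where "F1 = (\<lambda>x. indicator (- A) x *\<^sub>R F x)"
      define F2 where "F2 = (\<lambda>x. indicator A x *\<^sub>R F x)"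
      have F1: "integrable lborel F1" unfolding F1_def by (rule integrable_mult_indicator[OF _ F]) simp
      have F2: "integrable lborel F2" unfolding F2_def by (rule integrable_mult_indicator[OF _ F]) simp
      have lev: "0 < lev s" using s by (simp add: lev_def)
      have "ennreal (LINT x|lborel. norm (F1 x)) = (\<integral>\<^sup>+x. ennreal (norm (F1 x)) \<partial>lborel)"
        using F1 by (intro nn_integral_eq_integral[symmetric]) auto
      also have "\<dots> \<le> (\<integral>\<^sup>+x. ennreal (lev s powr (1 - q)) * ennreal (norm (F x) powr q) \<partial>lborel)"
      proof (rule nn_integral_mono)
        fix x
        show "ennreal (norm (F1 x)) \<le> ennreal (lev s powr (1 - q)) * ennreal (norm (F x) powr q)"
        proof (cases "x \<in> A")
          case False
          hence gt: "lev s < norm (F x)" by (simp add: A_def)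
          have "norm (F x) = norm (F x) powr (1 - q) * norm (F x) powr q"
            using gt lev by (simp add: powr_add[symmetric])
          also have "\<dots> \<le> lev s powr (1 - q) * norm (F x) powr q"
            using gt lev q by (intro mult_right_mono powr_mono2') auto
          finally show ?thesis
            using False by (simp add: F1_def ennreal_mult[symmetric] ennreal_leI)
        qed (simp add: F1_def)
      qed
      also have "\<dots> \<le> ennreal (lev s powr (1 - q)) * 1"
        using mult_left_mono[OF Fq, of "ennreal (lev s powr (1 - q))"] by (subst nn_integral_cmult) auto
      \<comment> \<open>The identity \<open>(p - 1) * (q - 1) = 1\<close> is used here; it is what
        dictates the exponent in \<open>lev\<close>.\<close>
      also have "lev s powr (1 - q) = s / 2"
      proof -
        have "- (p - 1) * (1 - q) = 1" using pq by (simp add: algebra_simps)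
        thus ?thesis using s by (simp add: lev_def powr_powr)
      qed
      finally have "(LINT x|lborel. norm (F1 x)) \<le> s / 2" using s by simp
      hence ft1: "norm (ft F1 x) \<le> s / 2" for x using norm_ft_le[of F1 x] by linarith
      have "ft F x = ft F1 x + ft F2 x" for x
      proof -
        have "F = (\<lambda>x. F1 x + F2 x)" by (auto simp: F1_def F2_def fun_eq_iff split: split_indicator)
        thus ?thesis using ft_add[OF F1 F2, of x] by simp
      qed
      hence sub: "{x. s < norm (ft F x)} \<subseteq> {x\<in>UNIV. 1 \<le> ennreal (4 / s\<^sup>2) * ennreal ((norm (ft F2 x))\<^sup>2)}"
      proof (intro subsetI CollectI conjI)
        fix x assume x: "x \<in> {x. s < norm (ft F x)}"
        have "s / 2 \<le> norm (ft F2 x)"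
          using x ft1[of x] norm_triangle_ineq[of "ft F1 x" "ft F2 x"] \<open>\<And>x. ft F x = ft F1 x + ft F2 x\<close> by auto
        hence "(s / 2)\<^sup>2 \<le> (norm (ft F2 x))\<^sup>2" using s by (intro power_mono) auto
        hence "1 \<le> 4 / s\<^sup>2 * (norm (ft F2 x))\<^sup>2" using s by (simp add: field_simps power2_eq_square)
        thus "1 \<le> ennreal (4 / s\<^sup>2) * ennreal ((norm (ft F2 x))\<^sup>2)"
          by (simp add: ennreal_mult[symmetric] ennreal_1[symmetric] ennreal_leI del: ennreal_1)
      qed simp
      have [measurable]: "ft F2 \<in> borel_measurable borel" using F2 by measurable
      have "emeasure lborel {x. s < norm (ft F x)} \<le> emeasure lborel {x\<in>UNIV. 1 \<le> ennreal (4 / s\<^sup>2) * ennreal ((norm (ft F2 x))\<^sup>2)}"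
        by (rule emeasure_mono[OF sub]) measurable
      also have "\<dots> \<le> ennreal (4 / s\<^sup>2) * (\<integral>\<^sup>+x. ennreal ((norm (ft F2 x))\<^sup>2) * indicator UNIV x \<partial>lborel)"
        by (rule nn_integral_Markov_inequality) auto
      also have "\<dots> \<le> ennreal (4 / s\<^sup>2) * (ennreal c0 * (\<integral>\<^sup>+x. ennreal ((norm (F2 x))\<^sup>2) \<partial>lborel))"
        using plancherel_le[OF F2] by (intro mult_left_mono) (auto simp: c0)
      also have "(\<integral>\<^sup>+x. ennreal ((norm (F2 x))\<^sup>2) \<partial>lborel) = (\<integral>\<^sup>+x. ennreal ((norm (F x))\<^sup>2) * indicator A x \<partial>lborel)"
        by (intro nn_integral_cong) (auto simp: F2_def split: split_indicator)
      finally show ?thesis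
        using c0_nonneg by (simp add: A_def ennreal_mult'' mult.assoc[symmetric] ennreal_mult'[symmetric])
    qed
    \<comment> \<open>Layer-cake formula: integrated over \<open>x\<close>, it turns the p-th power
      of the norm into an integral of measures of level sets.\<close>
    have cake: "ennreal (t powr p) = (\<integral>\<^sup>+s. ennreal (p * s powr (p - 1)) * indicator {s. 0 < s \<and> s < t} s \<partial>lborel)" if "0 \<le> t" for t
    proof -
      have "(\<integral>\<^sup>+s. ennreal (p * s powr (p - 1)) * indicator {s. 0 < s \<and> s < t} s \<partial>lborel) = (\<integral>\<^sup>+s. ennreal p * (ennreal (s powr (p - 1)) * indicator {0<..t} s) \<partial>lborel)"
      proof (rule nn_integral_cong_AE)
        show "AE s in lborel. ennreal (p * s powr (p - 1)) * indicator {s. 0 < s \<and> s < t} s = ennreal p * (ennreal (s powr (p - 1)) * indicator {0<..t} s)"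
          using AE_lborel_singleton[of t]
          by eventually_elim (use p in \<open>auto split: split_indicator simp: ennreal_mult\<close>)
      qed
      also have "\<dots> = ennreal p * ennreal (t powr p / p)"
        using nn_integral_powr_Ioo[of "p - 1" t] p that by (subst nn_integral_cmult) auto
      finally show ?thesis using p by (simp add: ennreal_mult[symmetric])
    qed
    have "(\<integral>\<^sup>+x. ennreal (norm (ft F x) powr p) \<partial>lborel) =
        (\<integral>\<^sup>+x. \<integral>\<^sup>+s. ennreal (p * s powr (p - 1)) * indicator {s. 0 < s \<and> s < norm (ft F x)} s \<partial>lborel \<partial>lborel)"
      by (simp add: cake)
    also have "\<dots> = (\<integral>\<^sup>+s. \<integral>\<^sup>+x. ennreal (p * s powr (p - 1)) * indicator {s. 0 < s \<and> s < norm (ft F x)} s \<partial>lborel \<partial>lborel)"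
      by (rule lborel_pair.Fubini'[symmetric]) measurable
    also have "\<dots> = (\<integral>\<^sup>+s. ennreal (p * s powr (p - 1)) * indicator {0<..} s * emeasure lborel {x. s < norm (ft F x)} \<partial>lborel)"
    proof (rule nn_integral_cong)
      fix s :: real
      have "(\<integral>\<^sup>+x. ennreal (p * s powr (p - 1)) * indicator {s. 0 < s \<and> s < norm (ft F x)} s \<partial>lborel) =
        (\<integral>\<^sup>+x. ennreal (p * s powr (p - 1)) * indicator {0<..} s * indicator {x. s < norm (ft F x)} x \<partial>lborel)"
        by (intro nn_integral_cong) (auto split: split_indicator)
      thus "(\<integral>\<^sup>+x. ennreal (p * s powr (p - 1)) * indicator {s. 0 < s \<and> s < norm (ft F x)} s \<partial>lborel) =
        ennreal (p * s powr (p - 1)) * indicator {0<..} s * emeasure lborel {x. s < norm (ft F x)}"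
        by (simp add: nn_integral_cmult_indicator)
    qed
    also have "\<dots> \<le> (\<integral>\<^sup>+s. \<integral>\<^sup>+x. ennreal (4 * p * c0) * ennreal ((norm (F x))\<^sup>2) * (ennreal (s powr (p - 3)) * indicator {s. 0 < s \<and> norm (F x) \<le> lev s} s) \<partial>lborel \<partial>lborel)"
    proof (rule nn_integral_mono)
      fix s :: real
      show "ennreal (p * s powr (p - 1)) * indicator {0<..} s * emeasure lborel {x. s < norm (ft F x)} \<le>
        (\<integral>\<^sup>+x. ennreal (4 * p * c0) * ennreal ((norm (F x))\<^sup>2) * (ennreal (s powr (p - 3)) * indicator {s. 0 < s \<and> norm (F x) \<le> lev s} s) \<partial>lborel)"
      proof (cases "0 < s")
        case True
        have "p * s powr (p - 1) * (4 * c0 / s\<^sup>2) = 4 * p * c0 * s powr (p - 3)"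
        proof -
          have "s powr (p - 1) = s powr (p - 3) * s\<^sup>2"
            using True powr_add[of s "p - 3" 2] by (simp add: powr_numeral)
          thus ?thesis using True by simp
        qed
        hence "ennreal (p * s powr (p - 1)) * (ennreal (4 * c0 / s\<^sup>2) * (\<integral>\<^sup>+x. ennreal ((norm (F x))\<^sup>2) * indicator {x. norm (F x) \<le> lev s} x \<partial>lborel))
          = ennreal (4 * p * c0 * s powr (p - 3)) * (\<integral>\<^sup>+x. ennreal ((norm (F x))\<^sup>2) * indicator {x. norm (F x) \<le> lev s} x \<partial>lborel)"
          using p c0_nonneg by (simp add: mult.assoc[symmetric] ennreal_mult[symmetric])
        also have "\<dots> = (\<integral>\<^sup>+x. ennreal (4 * p * c0 * s powr (p - 3)) * (ennreal ((norm (F x))\<^sup>2) * indicator {x. norm (F x) \<le> lev s} x) \<partial>lborel)"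
          by (rule nn_integral_cmult[symmetric]) measurable
        also have "\<dots> = (\<integral>\<^sup>+x. ennreal (4 * p * c0) * ennreal ((norm (F x))\<^sup>2) * (ennreal (s powr (p - 3)) * indicator {s. 0 < s \<and> norm (F x) \<le> lev s} s) \<partial>lborel)"
        proof -
          have "ennreal (4 * p * c0 * s powr (p - 3)) = ennreal (4 * p * c0) * ennreal (s powr (p - 3))"
            using p c0_nonneg by (intro ennreal_mult) auto
          thus ?thesis
            using True by (intro nn_integral_cong) (simp split: split_indicator add: mult_ac)
        qed
        finally show ?thesis
          using mult_left_mono[OF weak[OF True], of "ennreal (p * s powr (p - 1))"] True by simp
      qed simp
    qed
    also have "\<dots> = (\<integral>\<^sup>+x. \<integral>\<^sup>+s. ennreal (4 * p * c0) * ennreal ((norm (F x))\<^sup>2) * (ennreal (s powr (p - 3)) * indicator {s. 0 < s \<and> norm (F x) \<le> lev s} s) \<partial>lborel \<partial>lborel)"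
      by (rule lborel_pair.Fubini') measurable
    also have "\<dots> \<le> (\<integral>\<^sup>+x. ennreal C * ennreal (norm (F x) powr q) \<partial>lborel)"
    proof (rule nn_integral_mono)
      fix x
      show "(\<integral>\<^sup>+s. ennreal (4 * p * c0) * ennreal ((norm (F x))\<^sup>2) * (ennreal (s powr (p - 3)) * indicator {s. 0 < s \<and> norm (F x) \<le> lev s} s) \<partial>lborel) \<le>
          ennreal C * ennreal (norm (F x) powr q)"
      proof (cases "F x = 0")
        case False
        define a where "a = norm (F x)"
        have a: "0 < a" using False by (simp add: a_def)
        \<comment> \<open>\<open>b\<close> inverts \<open>lev\<close>: height \<open>a\<close>
          belongs to the small part at level \<open>s\<close> only for \<open>s <= b\<close>. Since
          \<open>p > 2\<close>, the power \<open>s powr (p - 3)\<close> is integrable at 0.\<close>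
        define b where "b = 2 * a powr (- 1 / (p - 1))"
        have b: "s \<le> b" if "0 < s" "a \<le> lev s" for s
        proof -
          have "lev s powr (- 1 / (p - 1)) \<le> a powr (- 1 / (p - 1))"
            using that a p by (intro powr_mono2') auto
          moreover have "lev s powr (- 1 / (p - 1)) = s / 2"
          proof -
            have "- (p - 1) * (- 1 / (p - 1)) = 1" using p by (simp add: field_simps)
            thus ?thesis using that unfolding lev_def powr_powr by simp
          qed
          ultimately show ?thesis by (simp add: b_def)
        qed
        have "(\<integral>\<^sup>+s. ennreal (s powr (p - 3)) * indicator {s. 0 < s \<and> norm (F x) \<le> lev s} s \<partial>lborel) \<le>
            (\<integral>\<^sup>+s. ennreal (s powr (p - 3)) * indicator {0<..b} s \<partial>lborel)"
          using b by (intro nn_integral_mono mult_left_mono) (auto split: split_indicator simp: a_def)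
        also have "\<dots> = ennreal (b powr (p - 2) / (p - 2))"
          using nn_integral_powr_Ioo[of "p - 3" b] p by (simp add: b_def)
        finally have le: "(\<integral>\<^sup>+s. ennreal (s powr (p - 3)) * indicator {s. 0 < s \<and> norm (F x) \<le> lev s} s \<partial>lborel) \<le> ennreal (b powr (p - 2) / (p - 2))" .
        have "(\<integral>\<^sup>+s. ennreal (4 * p * c0) * ennreal ((norm (F x))\<^sup>2) * (ennreal (s powr (p - 3)) * indicator {s. 0 < s \<and> norm (F x) \<le> lev s} s) \<partial>lborel) =
          ennreal (4 * p * c0) * ennreal (a\<^sup>2) * (\<integral>\<^sup>+s. ennreal (s powr (p - 3)) * indicator {s. 0 < s \<and> norm (F x) \<le> lev s} s \<partial>lborel)"
          unfolding a_def by (rule nn_integral_cmult) measurable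
        also have "\<dots> \<le> ennreal (4 * p * c0) * ennreal (a\<^sup>2) * ennreal (b powr (p - 2) / (p - 2))"
          by (rule mult_left_mono[OF le]) simp
        also have "\<dots> = ennreal (4 * p * c0 * a\<^sup>2 * (b powr (p - 2) / (p - 2)))"
          using p c0_nonneg by (simp add: ennreal_mult[symmetric])
        also have "4 * p * c0 * a\<^sup>2 * (b powr (p - 2) / (p - 2)) = C * a powr q"
        proof -
          have "a\<^sup>2 * a powr (- 1 / (p - 1) * (p - 2)) = a powr (2 + - 1 / (p - 1) * (p - 2))"
            using a by (simp only: powr_add powr_numeral)
          also have "2 + - 1 / (p - 1) * (p - 2) = q" using p by (simp add: q_def field_simps)
          finally have "a\<^sup>2 * b powr (p - 2) = 2 powr (p - 2) * a powr q"
            using a by (simp add: b_def powr_mult powr_powr mult_ac)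
          thus ?thesis by (simp add: C_def)
        qed
        also have "ennreal (C * a powr q) = ennreal C * ennreal (norm (F x) powr q)"
          using p c0_nonneg by (simp add: C_def a_def ennreal_mult[symmetric])
        finally show ?thesis .
      qed simp
    qed
    also have "\<dots> = ennreal C * (\<integral>\<^sup>+x. ennreal (norm (F x) powr q) \<partial>lborel)"
      by (rule nn_integral_cmult) measurable
    also have "\<dots> \<le> ennreal C * 1" by (rule mult_left_mono[OF Fq]) simp
    finally show ?thesis by simp
  qed
  have "0 \<le> C" using p c0_nonneg by (simp add: C_def)
  show ?thesis
  \<comment> \<open>The summand 1 guarantees a positive constant without a lower bound on
    \<open>c0\<close>.\<close>
  proof (rule that[of "C + 1"])
    fix F :: "real^'d \<Rightarrow> complex"
    assume "integrable lborel F" "(\<integral>\<^sup>+x. ennreal (norm (F x) powr (p / (p - 1))) \<partial>lborel) \<le> 1"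
    from main[OF this[folded q_def]] show "(\<integral>\<^sup>+x. ennreal (norm (ft F x) powr p) \<partial>lborel) \<le> ennreal (C + 1)"
      by (rule order_trans) (auto intro: ennreal_leI)
  qed (use \<open>0 \<le> C\<close> in simp)
qed

text \<open>A bound by a real number in place of a norm: it avoids roots in \<open>ennreal\<close>
  and is stable under almost everywhere limits. Only the final estimate is translated back to
  \<open>Lp_norm\<close>.\<close>

definition Lp_le :: "ennreal \<Rightarrow> real \<Rightarrow> (real^'d \<Rightarrow> complex) \<Rightarrow> bool" where
  "Lp_le p K u \<longleftrightarrow> (if p = \<infinity> then AE x in lborel. norm (u x) \<le> K
     else (\<integral>\<^sup>+x. ennreal (norm (u x) powr enn2real p) \<partial>lborel) \<le> ennreal (K powr enn2real p))"

text \<open>\<open>q\<close> is real although \<open>p\<close> may be infinite, because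
  \<open>2 <= p\<close> keeps the conjugate exponent at most 2. Once the reciprocals are known to be
  finite, the equation in \<open>ennreal\<close> is solved in the reals.\<close>

lemma conjugate_exponent_cases [consumes 2, case_names infinite finite]:
  fixes p :: ennreal and q :: real
  assumes "2 \<le> p" "1 / p + 1 / ennreal q = 1"
  obtains (infinite) "p = \<infinity>" "q = 1"
  | (finite) r where "p = ennreal r" "2 \<le> r" "1 < q" "q = r / (r - 1)"
proof -
  \<comment> \<open>A nonpositive \<open>q\<close> becomes 0 in \<open>ennreal\<close>, where
    \<open>1 / 0\<close> is infinite, contradicting the equation.\<close>
  have q: "0 < q"
  proof (rule ccontr)
    assume "\<not> 0 < q"
    hence "ennreal q = 0" by (simp add: ennreal_neg)
    thus False using assms(2) by (simp add: divide_ennreal_def)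
  qed
  have iq: "1 / ennreal q = ennreal (1 / q)" using q by (simp add: divide_ennreal flip: ennreal_1)
  show ?thesis
  proof (cases p)
    case (real r)
    have "ennreal 2 \<le> ennreal r" using assms(1) real by simp
    hence r: "2 \<le> r" using real by (subst (asm) ennreal_le_iff) auto
    have "1 / p = ennreal (1 / r)" using r real by (simp add: divide_ennreal flip: ennreal_1)
    hence "ennreal (1 / r + 1 / q) = ennreal 1" using assms(2) iq r q by simp
    hence e: "1 / r + 1 / q = 1" using r q by (subst (asm) ennreal_inj) auto
    have "q * (r - 1) = r" using e r q by (simp add: field_simps)
    hence "q = r / (r - 1)" using r by (simp add: field_simps)
    moreover have "1 < q"
    proof (rule ccontr)
      assume "\<not> 1 < q"
      hence "q * (r - 1) \<le> 1 * (r - 1)" using r by (intro mult_right_mono) auto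
      thus False using \<open>q * (r - 1) = r\<close> by simp
    qed
    ultimately show ?thesis using finite real r by blast
  next
    case top
    hence "ennreal (1 / q) = ennreal 1" using assms(2) iq by simp
    hence "q = 1" using q by (subst (asm) ennreal_inj) (auto simp: field_simps)
    thus ?thesis using infinite top by simp
  qed
qed

text \<open>Infinite \<open>p\<close> is the trivial bound by the integral, \<open>p = 2\<close> is
  the square estimate, and interpolation handles what lies between; the bound normalised to 1
  extends to all \<open>K\<close> by homogeneity.\<close>

lemma hausdorff_young:
  fixes p :: ennreal and q :: real
  assumes p: "2 \<le> p" and pq: "1 / p + 1 / ennreal q = 1"
  obtains C where "0 < C" "\<And>(F :: real^'d \<Rightarrow> complex) K. integrable lborel F \<Longrightarrow> 0 < K \<Longrightarrow>
    (\<integral>\<^sup>+x. ennreal (norm (F x) powr q) \<partial>lborel) \<le> ennreal (K powr q) \<Longrightarrow> Lp_le p (C * K) (ft F)"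
  using p pq
proof (cases rule: conjugate_exponent_cases)
  case infinite
  show ?thesis
  proof (rule that[of 1])
    fix F :: "real^'d \<Rightarrow> complex" and K :: real
    assume F: "integrable lborel F" and K: "0 < K" "(\<integral>\<^sup>+x. ennreal (norm (F x) powr q) \<partial>lborel) \<le> ennreal (K powr q)"
    have "ennreal (LINT x|lborel. norm (F x)) = (\<integral>\<^sup>+x. ennreal (norm (F x)) \<partial>lborel)"
      using F by (intro nn_integral_eq_integral[symmetric]) auto
    also have "\<dots> \<le> ennreal K" using K infinite by simp
    finally have "(LINT x|lborel. norm (F x)) \<le> K" using K(1) by simp
    hence "norm (ft F x) \<le> K" for x using norm_ft_le[of F x] by linarith
    thus "Lp_le p (1 * K) (ft F)" using infinite by (simp add: Lp_le_def)
  qed simp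
next
  case (finite r)
  have ex: "\<exists>C>0. \<forall>F :: real^'d \<Rightarrow> complex. integrable lborel F \<longrightarrow> (\<integral>\<^sup>+x. ennreal (norm (F x) powr q) \<partial>lborel) \<le> 1 \<longrightarrow>
      (\<integral>\<^sup>+x. ennreal (norm (ft F x) powr r) \<partial>lborel) \<le> ennreal C"
  proof (cases "r = 2")
    case True
    define c0 where "c0 = enn2real (\<integral>\<^sup>+x. ennreal (Tent_ft (x :: real^'d)) \<partial>lborel)"
    have c0: "(\<integral>\<^sup>+x. ennreal (Tent_ft (x :: real^'d)) \<partial>lborel) = ennreal c0"
      using nn_integral_norm_lt_top[OF integrable_Tent_ft[where 'd = 'd]]
      by (simp add: c0_def Tent_ft_nonneg abs_of_nonneg)
    have "(\<integral>\<^sup>+x. ennreal (norm (ft F x) powr r) \<partial>lborel) \<le> ennreal (c0 + 1)"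
      if F: "integrable lborel F" "(\<integral>\<^sup>+x. ennreal (norm (F x) powr q) \<partial>lborel) \<le> 1" for F :: "real^'d \<Rightarrow> complex"
    proof -
      have "(\<integral>\<^sup>+x. ennreal (norm (ft F x) powr r) \<partial>lborel) \<le> ennreal c0 * (\<integral>\<^sup>+x. ennreal (norm (F x) powr q) \<partial>lborel)"
        using plancherel_le[OF F(1)] finite True by (simp add: c0 powr_numeral)
      also have "\<dots> \<le> ennreal c0 * 1" by (rule mult_left_mono[OF F(2)]) simp
      also have "\<dots> \<le> ennreal (c0 + 1)" by (simp add: ennreal_leI)
      finally show ?thesis .
    qed
    moreover have "0 < c0 + 1" unfolding c0_def using enn2real_nonneg by (rule add_nonneg_pos) simp
    ultimately show ?thesis by blast
  next
    case False
    hence "2 < r" using finite by simp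
    from hausdorff_young_gt_2[OF this, where 'd = 'd] show ?thesis
      unfolding finite by metis
  qed
  then obtain C where C: "0 < C" "\<And>F :: real^'d \<Rightarrow> complex. integrable lborel F \<Longrightarrow> (\<integral>\<^sup>+x. ennreal (norm (F x) powr q) \<partial>lborel) \<le> 1 \<Longrightarrow>
      (\<integral>\<^sup>+x. ennreal (norm (ft F x) powr r) \<partial>lborel) \<le> ennreal C" by blast
  show ?thesis
  proof (rule that[of "C powr (1 / r)"])
    fix F :: "real^'d \<Rightarrow> complex" and K :: real
    assume F: "integrable lborel F" and K: "0 < K" "(\<integral>\<^sup>+x. ennreal (norm (F x) powr q) \<partial>lborel) \<le> ennreal (K powr q)"
    have [measurable]: "F \<in> borel_measurable borel" using borel_measurable_integrable[OF F] by simp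
    have [measurable]: "ft F \<in> borel_measurable borel" using F by measurable
    define G where "G = (\<lambda>x. of_real (1 / K) * F x)"
    have G: "integrable lborel G" unfolding G_def using F by (rule integrable_mult_right)
    have "(\<integral>\<^sup>+x. ennreal (norm (G x) powr q) \<partial>lborel) = (\<integral>\<^sup>+x. ennreal ((1 / K) powr q) * ennreal (norm (F x) powr q) \<partial>lborel)"
      using K(1) by (intro nn_integral_cong)
        (simp add: G_def norm_mult norm_divide ennreal_mult[symmetric] powr_mult[symmetric])
    also have "\<dots> = ennreal ((1 / K) powr q) * (\<integral>\<^sup>+x. ennreal (norm (F x) powr q) \<partial>lborel)"
      by (rule nn_integral_cmult) measurable
    also have "\<dots> \<le> ennreal ((1 / K) powr q) * ennreal (K powr q)" by (rule mult_left_mono[OF K(2)]) simp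
    also have "\<dots> = 1" using K(1) by (simp add: ennreal_mult[symmetric] powr_mult[symmetric])
    finally have G1: "(\<integral>\<^sup>+x. ennreal (norm (G x) powr q) \<partial>lborel) \<le> 1" .
    have ftF: "ft F x = of_real K * ft G x" for x
    proof -
      have "ft G x = of_real (1 / K) * ft F x"
        unfolding ft_def G_def mult.assoc by (rule integral_mult_right_zero)
      thus ?thesis using K(1) by simp
    qed
    have [measurable]: "ft G \<in> borel_measurable borel" using G by measurable
    have "(\<integral>\<^sup>+x. ennreal (norm (ft F x) powr r) \<partial>lborel) = (\<integral>\<^sup>+x. ennreal (K powr r) * ennreal (norm (ft G x) powr r) \<partial>lborel)"
      using K(1) by (intro nn_integral_cong)
        (simp add: ftF norm_mult ennreal_mult[symmetric] powr_mult)
    also have "\<dots> = ennreal (K powr r) * (\<integral>\<^sup>+x. ennreal (norm (ft G x) powr r) \<partial>lborel)"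
      by (rule nn_integral_cmult) measurable
    also have "\<dots> \<le> ennreal (K powr r) * ennreal C" by (rule mult_left_mono[OF C(2)[OF G G1]]) simp
    also have "\<dots> = ennreal ((C powr (1 / r) * K) powr r)"
      using C(1) K(1) finite by (simp add: powr_mult powr_powr ennreal_mult[symmetric] mult.commute)
    finally show "Lp_le p (C powr (1 / r) * K) (ft F)"
      using finite by (simp add: Lp_le_def)
  qed (use C in simp)
qed

section \<open>Continuity of translations and the Riemann--Lebesgue lemma\<close>

lemma nn_integral_norm_triangle:
  fixes a b :: "'a \<Rightarrow> 'b::{banach, second_countable_topology}"
  assumes [measurable]: "a \<in> borel_measurable M" "b \<in> borel_measurable M"
  shows "(\<integral>\<^sup>+x. ennreal (norm (a x + b x)) \<partial>M) \<le> (\<integral>\<^sup>+x. ennreal (norm (a x)) \<partial>M) + (\<integral>\<^sup>+x. ennreal (norm (b x)) \<partial>M)"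
proof -
  have "(\<integral>\<^sup>+x. ennreal (norm (a x + b x)) \<partial>M) \<le> (\<integral>\<^sup>+x. ennreal (norm (a x)) + ennreal (norm (b x)) \<partial>M)"
    by (intro nn_integral_mono) (simp add: ennreal_plus[symmetric] norm_triangle_ineq ennreal_leI del: ennreal_plus)
  thus ?thesis by (simp add: nn_integral_add)
qed

text \<open>Only the points leaving \<open>U\<close> need an estimate: by openness every point of
  \<open>U\<close> stays inside under small shifts, and dominated convergence applies. Translation
  invariance makes the measure gained equal to the measure lost.\<close>

lemma open_translation_L1:
  fixes U :: "'a::euclidean_space set"
  assumes U: "open U" "emeasure lborel U < \<infinity>" and e: "0 < (e::real)"
  obtains d where "0 < d" "\<And>t. norm t < d \<Longrightarrow>
    (\<integral>\<^sup>+x. ennreal (norm (indicator U (x + t) - indicator U x :: real)) \<partial>lborel) \<le> ennreal e"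
proof -
  have [measurable]: "U \<in> sets borel" using U(1) by simp
  define D where "D = (\<lambda>t. \<integral>\<^sup>+x. indicator U x * indicator (- U) (x + t) \<partial>lborel :: ennreal)"
  have "(D \<longlongrightarrow> 0) (at 0)"
    unfolding tendsto_at_iff_sequentially comp_def
  proof (intro allI impI)
    fix X :: "nat \<Rightarrow> 'a" assume X: "\<forall>n. X n \<in> UNIV - {0}" "X \<longlonglongrightarrow> 0"
    have "(\<lambda>n. D (X n)) \<longlonglongrightarrow> (\<integral>\<^sup>+(x::'a). 0 \<partial>lborel)"
      unfolding D_def
    proof (rule nn_integral_dominated_convergence[where w = "indicator U"])
      show "AE x in lborel. (\<lambda>n. indicator U x * indicator (- U) (x + X n)) \<longlonglongrightarrow> (0::ennreal)"
      proof (rule AE_I2)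
        fix x :: 'a
        show "(\<lambda>n. indicator U x * indicator (- U) (x + X n)) \<longlonglongrightarrow> (0::ennreal)"
        proof (cases "x \<in> U")
          case True
          have "(\<lambda>n. x + X n) \<longlonglongrightarrow> x + 0" by (intro tendsto_intros X)
          hence "eventually (\<lambda>n. x + X n \<in> U) sequentially"
            using U(1) True by (intro topological_tendstoD[of _ x]) auto
          hence "eventually (\<lambda>n. indicator U x * indicator (- U) (x + X n) = (0::ennreal)) sequentially"
            by eventually_elim auto
          thus ?thesis by (rule tendsto_eventually)
        qed simp
      qed
    qed (use U in \<open>auto split: split_indicator\<close>)
    thus "(\<lambda>n. D (X n)) \<longlonglongrightarrow> 0" by simp
  qed
  hence "eventually (\<lambda>t. D t < ennreal (e / 2)) (at 0)"
    using e by (intro order_tendstoD) auto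
  then obtain d where d: "0 < d" "\<And>t. t \<noteq> 0 \<Longrightarrow> norm t < d \<Longrightarrow> D t < ennreal (e / 2)"
    unfolding eventually_at by (auto simp: dist_norm)
  have D0: "D 0 = 0" unfolding D_def by (intro nn_integral_0_iff_AE[THEN iffD2]) (auto simp: indicator_def)
  show ?thesis
  proof (rule that[OF d(1)])
    fix t :: 'a assume t: "norm t < d"
    have Dt: "D t \<le> ennreal (e / 2)" using d(2)[OF _ t] D0 by (cases "t = 0") (auto intro: less_imp_le)
    define a where "a = (\<integral>\<^sup>+x. indicator U x * indicator U (x + t) \<partial>lborel :: ennreal)"
    define b where "b = (\<integral>\<^sup>+x. indicator U (x + t) * indicator (- U) x \<partial>lborel :: ennreal)"
    have "a + D t = (\<integral>\<^sup>+x. indicator U x * indicator U (x + t) + indicator U x * indicator (- U) (x + t) \<partial>lborel)"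
      unfolding a_def D_def by (subst nn_integral_add[symmetric]) auto
    also have "\<dots> = (\<integral>\<^sup>+x. indicator U x \<partial>lborel)"
      by (intro nn_integral_cong) (auto split: split_indicator)
    also have "\<dots> = (\<integral>\<^sup>+x. indicator U (x + t) \<partial>lborel)"
      by (rule nn_integral_lborel_shift[symmetric]) measurable
    also have "\<dots> = a + b"
      unfolding a_def b_def by (subst nn_integral_add[symmetric]) (auto intro!: nn_integral_cong split: split_indicator)
    \<comment> \<open>Both sides are the measure of \<open>U\<close>; \<open>a\<close> is finite, so
      it can be cancelled.\<close>
    finally have "a + D t = a + b" .
    moreover have "a < \<infinity>"
    proof -
      have "a \<le> (\<integral>\<^sup>+x. indicator U x \<partial>lborel)" unfolding a_def by (intro nn_integral_mono) (auto split: split_indicator)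
      thus ?thesis using U by (simp add: le_less_trans)
    qed
    ultimately have ab: "b = D t" by (auto simp: ennreal_add_left_cancel)
    have "(\<integral>\<^sup>+x. ennreal (norm (indicator U (x + t) - indicator U x :: real)) \<partial>lborel) = D t + b"
      unfolding D_def b_def by (subst nn_integral_add[symmetric]) (auto intro!: nn_integral_cong split: split_indicator)
    also have "\<dots> \<le> ennreal (e / 2) + ennreal (e / 2)" unfolding ab using Dt by (intro add_mono)
    also have "\<dots> = ennreal e" using e by (simp add: ennreal_plus[symmetric] del: ennreal_plus)
    finally show "(\<integral>\<^sup>+x. ennreal (norm (indicator U (x + t) - indicator U x :: real)) \<partial>lborel) \<le> ennreal e" .
  qed
qed

text \<open>Induction over integrable functions: indicators are compared with those of open
  supersets by outer regularity, sums share the tolerance, and limits work because a translation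
  does not change the L1 distance to an approximant.\<close>

lemma integrable_translation_L1:
  fixes f :: "'a::euclidean_space \<Rightarrow> complex"
  assumes "integrable lborel f"
  shows "\<forall>e>0. \<exists>d>0. \<forall>t. norm t < d \<longrightarrow> (\<integral>\<^sup>+x. ennreal (norm (f (x + t) - f x)) \<partial>lborel) \<le> ennreal e"
  using assms
proof (induction rule: integrable_induct)
  case (base A c)
  hence [measurable]: "A \<in> sets borel" by simp
  show ?case
  proof (intro allI impI)
    fix e :: real assume e: "0 < e"
    \<comment> \<open>The summand 1 in the denominator covers \<open>c = 0\<close>; one third of the
      tolerance goes to the shift of \<open>U\<close> and one third to each of the two copies of
      \<open>U - A\<close>.\<close>
    define e0 where "e0 = e / (norm c + 1)"
    define e' where "e' = e0 / 3"
    have e': "0 < e'" using e by (auto simp: e'_def e0_def intro!: divide_pos_pos add_nonneg_pos)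
    obtain U where U: "open U" "A \<subseteq> U" "emeasure lborel (U - A) < ennreal e'"
      using outer_regular_lborel[of A e'] e' by auto
    have [measurable]: "U \<in> sets borel" using U(1) by simp
    have "emeasure lborel U = emeasure lborel (A \<union> (U - A))"
      using U(2) by (intro arg_cong[where f = "emeasure lborel"]) auto
    also have "\<dots> \<le> emeasure lborel A + emeasure lborel (U - A)" by (rule emeasure_subadditive) auto
    also have "\<dots> < \<infinity>"
      using base(2) less_trans[OF U(3) ennreal_less_top] by simp
    finally have "emeasure lborel U < \<infinity>" .
    then obtain d where d: "0 < d" "\<And>t. norm t < d \<Longrightarrow>
        (\<integral>\<^sup>+x. ennreal (norm (indicator U (x + t) - indicator U x :: real)) \<partial>lborel) \<le> ennreal e'"
      using open_translation_L1[OF U(1) _ e'] by blast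
    show "\<exists>d>0. \<forall>t. norm t < d \<longrightarrow> (\<integral>\<^sup>+x. ennreal (norm (indicator A (x + t) *\<^sub>R c - indicator A x *\<^sub>R c)) \<partial>lborel) \<le> ennreal e"
    proof (intro exI[of _ d] conjI allI impI d(1))
      fix t :: 'a assume t: "norm t < d"
      have "(\<integral>\<^sup>+x. ennreal (norm (indicator A (x + t) *\<^sub>R c - indicator A x *\<^sub>R c)) \<partial>lborel) \<le>
        (\<integral>\<^sup>+x. ennreal (norm c) * (ennreal (norm (indicator U (x + t) - indicator U x :: real)) + (indicator (U - A) (x + t) + indicator (U - A) x)) \<partial>lborel)"
      proof (rule nn_integral_mono)
        fix x
        have "ennreal (norm (indicator A (x + t) - indicator A x :: real)) \<le>
            ennreal (norm (indicator U (x + t) - indicator U x :: real)) + (indicator (U - A) (x + t) + indicator (U - A) x)"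
          using U(2) by (auto split: split_indicator)
        hence "ennreal (norm c) * ennreal (norm (indicator A (x + t) - indicator A x :: real)) \<le>
          ennreal (norm c) * (ennreal (norm (indicator U (x + t) - indicator U x :: real)) + (indicator (U - A) (x + t) + indicator (U - A) x))"
          by (rule mult_left_mono) simp
        thus "ennreal (norm (indicator A (x + t) *\<^sub>R c - indicator A x *\<^sub>R c)) \<le>
          ennreal (norm c) * (ennreal (norm (indicator U (x + t) - indicator U x :: real)) + (indicator (U - A) (x + t) + indicator (U - A) x))"
          by (simp add: scaleR_diff_left[symmetric] ennreal_mult[symmetric] mult.commute)
      qed
      also have "\<dots> = ennreal (norm c) * ((\<integral>\<^sup>+x. ennreal (norm (indicator U (x + t) - indicator U x :: real)) \<partial>lborel) +
          ((\<integral>\<^sup>+x. indicator (U - A) (x + t) \<partial>lborel) + (\<integral>\<^sup>+x. indicator (U - A) x \<partial>lborel)))"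
        by (simp add: nn_integral_cmult nn_integral_add)
      also have "\<dots> \<le> ennreal (norm c) * (ennreal e' + (ennreal e' + ennreal e'))"
      proof (intro mult_left_mono add_mono d(2)[OF t])
        show *: "(\<integral>\<^sup>+x. indicator (U - A) x \<partial>lborel) \<le> ennreal e'" using U(3) by simp
        show "(\<integral>\<^sup>+x. indicator (U - A) (x + t) \<partial>lborel) \<le> ennreal e'"
          using * by (subst nn_integral_lborel_shift) auto
      qed simp
      also have "\<dots> = ennreal (norm c * (3 * e'))"
      proof -
        have "ennreal e' + (ennreal e' + ennreal e') = ennreal (e' + (e' + e'))"
          using e' by (simp only: ennreal_plus less_imp_le add_nonneg_nonneg)
        thus ?thesis using e' by (simp add: ennreal_mult[symmetric])
      qed
      also have "\<dots> \<le> ennreal e"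
      proof (rule ennreal_leI)
        have "norm c * (3 * e') = norm c * e0" by (simp add: e'_def)
        also have "\<dots> = e * (norm c / (norm c + 1))"
          unfolding e0_def times_divide_eq_right by (simp only: mult.commute)
        also have "\<dots> \<le> e * 1" using e by (intro mult_left_mono) (auto simp: divide_le_eq add_nonneg_pos)
        finally show "norm c * (3 * e') \<le> e" by simp
      qed
      finally show "(\<integral>\<^sup>+x. ennreal (norm (indicator A (x + t) *\<^sub>R c - indicator A x *\<^sub>R c)) \<partial>lborel) \<le> ennreal e" .
    qed
  qed
next
  case (add f g)
  have [measurable]: "f \<in> borel_measurable borel" "g \<in> borel_measurable borel"
    using borel_measurable_integrable[OF add.hyps(1)] borel_measurable_integrable[OF add.hyps(2)] by simp_all
  show ?case
  proof (intro allI impI)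
    fix e :: real assume e: "0 < e"
    obtain d1 where d1: "0 < d1" "\<And>t. norm t < d1 \<Longrightarrow> (\<integral>\<^sup>+x. ennreal (norm (f (x + t) - f x)) \<partial>lborel) \<le> ennreal (e / 2)"
      using add.IH(1) e by (elim allE[of _ "e / 2"]) auto
    obtain d2 where d2: "0 < d2" "\<And>t. norm t < d2 \<Longrightarrow> (\<integral>\<^sup>+x. ennreal (norm (g (x + t) - g x)) \<partial>lborel) \<le> ennreal (e / 2)"
      using add.IH(2) e by (elim allE[of _ "e / 2"]) auto
    show "\<exists>d>0. \<forall>t. norm t < d \<longrightarrow> (\<integral>\<^sup>+x. ennreal (norm (f (x + t) + g (x + t) - (f x + g x))) \<partial>lborel) \<le> ennreal e"
    proof (intro exI[of _ "min d1 d2"] conjI allI impI)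
      fix t :: 'a assume t: "norm t < min d1 d2"
      have "(\<integral>\<^sup>+x. ennreal (norm (f (x + t) + g (x + t) - (f x + g x))) \<partial>lborel) =
          (\<integral>\<^sup>+x. ennreal (norm ((f (x + t) - f x) + (g (x + t) - g x))) \<partial>lborel)"
        by (simp add: algebra_simps)
      also have "\<dots> \<le> (\<integral>\<^sup>+x. ennreal (norm (f (x + t) - f x)) \<partial>lborel) + (\<integral>\<^sup>+x. ennreal (norm (g (x + t) - g x)) \<partial>lborel)"
        by (rule nn_integral_norm_triangle) measurable
      also have "\<dots> \<le> ennreal (e / 2) + ennreal (e / 2)" using t by (intro add_mono d1 d2) auto
      also have "\<dots> = ennreal e" using e by (simp add: ennreal_plus[symmetric] del: ennreal_plus)
      finally show "(\<integral>\<^sup>+x. ennreal (norm (f (x + t) + g (x + t) - (f x + g x))) \<partial>lborel) \<le> ennreal e" .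
    qed (use d1 d2 in simp)
  qed
next
  case (lim f s)
  have m [measurable]: "f \<in> borel_measurable borel" "s i \<in> borel_measurable borel" for i
    using borel_measurable_integrable[OF lim.hyps(4)] borel_measurable_integrable[OF lim.hyps(1)[of i]] by simp_all
  have conv: "(\<lambda>i. \<integral>\<^sup>+x. ennreal (norm (f x - s i x)) \<partial>lborel) \<longlonglongrightarrow> 0"
  proof (rule nn_integral_dominated_convergence_norm[where w = "\<lambda>x. 2 * norm (f x)"])
    show "(\<integral>\<^sup>+x. ennreal (2 * norm (f x)) \<partial>lborel) < \<infinity>"
      using nn_integral_norm_lt_top[OF lim.hyps(4)] by (simp add: ennreal_mult nn_integral_cmult ennreal_mult_less_top)
  qed (use lim.hyps in auto)
  show ?case
  proof (intro allI impI)
    fix e :: real assume e: "0 < e"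
    have "eventually (\<lambda>i. (\<integral>\<^sup>+x. ennreal (norm (f x - s i x)) \<partial>lborel) < ennreal (e / 3)) sequentially"
      using e by (intro order_tendstoD(2)[OF conv]) simp
    then obtain i where i: "(\<integral>\<^sup>+x. ennreal (norm (f x - s i x)) \<partial>lborel) < ennreal (e / 3)"
      by (auto dest: eventually_happens)
    have i': "(\<integral>\<^sup>+x. ennreal (norm (s i x - f x)) \<partial>lborel) \<le> ennreal (e / 3)"
      using i by (simp add: norm_minus_commute less_imp_le)
    obtain d where d: "0 < d" "\<And>t. norm t < d \<Longrightarrow> (\<integral>\<^sup>+x. ennreal (norm (s i (x + t) - s i x)) \<partial>lborel) \<le> ennreal (e / 3)"
      using lim.IH[of i] e by (elim allE[of _ "e / 3"]) auto
    show "\<exists>d>0. \<forall>t. norm t < d \<longrightarrow> (\<integral>\<^sup>+x. ennreal (norm (f (x + t) - f x)) \<partial>lborel) \<le> ennreal e"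
    proof (intro exI[of _ d] conjI allI impI d(1))
      fix t :: 'a assume t: "norm t < d"
      have "(\<integral>\<^sup>+x. ennreal (norm (f (x + t) - f x)) \<partial>lborel) =
          (\<integral>\<^sup>+x. ennreal (norm ((f (x + t) - s i (x + t)) + ((s i (x + t) - s i x) + (s i x - f x)))) \<partial>lborel)"
        by simp
      also have "\<dots> \<le> (\<integral>\<^sup>+x. ennreal (norm (f (x + t) - s i (x + t))) \<partial>lborel) + (\<integral>\<^sup>+x. ennreal (norm ((s i (x + t) - s i x) + (s i x - f x))) \<partial>lborel)"
        by (rule nn_integral_norm_triangle) measurable
      also have "\<dots> \<le> (\<integral>\<^sup>+x. ennreal (norm (f (x + t) - s i (x + t))) \<partial>lborel) +
          ((\<integral>\<^sup>+x. ennreal (norm (s i (x + t) - s i x)) \<partial>lborel) + (\<integral>\<^sup>+x. ennreal (norm (s i x - f x)) \<partial>lborel))"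
        by (intro add_left_mono nn_integral_norm_triangle) measurable
      also have "(\<integral>\<^sup>+x. ennreal (norm (f (x + t) - s i (x + t))) \<partial>lborel) = (\<integral>\<^sup>+x. ennreal (norm (f x - s i x)) \<partial>lborel)"
        by (rule nn_integral_lborel_shift[of "\<lambda>x. ennreal (norm (f x - s i x))" t]) measurable
      also have "(\<integral>\<^sup>+x. ennreal (norm (f x - s i x)) \<partial>lborel) +
          ((\<integral>\<^sup>+x. ennreal (norm (s i (x + t) - s i x)) \<partial>lborel) + (\<integral>\<^sup>+x. ennreal (norm (s i x - f x)) \<partial>lborel))
          \<le> ennreal (e / 3) + (ennreal (e / 3) + ennreal (e / 3))"
        using i i' d(2)[OF t] by (intro add_mono) auto
      also have "\<dots> = ennreal e" using e by (simp add: ennreal_plus[symmetric] del: ennreal_plus)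
      finally show "(\<integral>\<^sup>+x. ennreal (norm (f (x + t) - f x)) \<partial>lborel) \<le> ennreal e" .
    qed
  qed
qed

lemma norm_cis_minus_1: "norm (cis t - 1) = 2 * \<bar>sin (t / 2)\<bar>"
  using dist_exp_i_1[of t] by (simp add: cis_conv_exp)

lemma norm_cis_diff_le: "norm (cis a - cis b) \<le> \<bar>a - b\<bar>"
proof -
  have "cis a - cis b = cis b * (cis (a - b) - 1)" by (simp add: algebra_simps cis_mult)
  hence "norm (cis a - cis b) = 2 * \<bar>sin ((a - b) / 2)\<bar>" by (simp add: norm_mult norm_cis_minus_1)
  thus ?thesis using abs_sin_x_le_abs_x[of "(a - b) / 2"] by simp
qed

text \<open>The modulus is twice that of \<open>sin (pi * t)\<close>, which vanishes again at
  \<open>t = 1\<close>, hence the restriction to 3/4. With \<open>v = pi * t / 2\<close> one has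
  \<open>sin (pi * t) = 2 * tan v * (cos v)\<^sup>2\<close>, and the tangent dominates its argument
  while the cosine stays away from 0.\<close>

lemma norm_cis_minus_1_ge:
  obtains \<kappa> where "0 < \<kappa>" "\<And>t. \<bar>t\<bar> \<le> 3/4 \<Longrightarrow> \<kappa> * \<bar>t\<bar> \<le> norm (cis (2 * pi * t) - 1)"
proof
  define c where "c = cos (3 * pi / 8)"
  have c: "0 < c" unfolding c_def by (intro cos_gt_zero) auto
  show "0 < 2 * pi * c\<^sup>2" using c by simp
  fix t :: real assume t: "\<bar>t\<bar> \<le> 3/4"
  define v where "v = pi * t / 2"
  have v: "\<bar>v\<bar> \<le> 3 * pi / 8" using t by (simp add: v_def abs_mult field_simps)
  hence v2: "\<bar>v\<bar> < pi / 2" using pi_gt_zero by linarith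
  have cv: "c \<le> cos v"
  proof -
    have "cos (3 * pi / 8) \<le> cos \<bar>v\<bar>" using v by (intro cos_monotone_0_pi_le) auto
    thus ?thesis by (simp add: c_def)
  qed
  have "sin (pi * t) = 2 * sin v * cos v" using sin_double[of v] by (simp add: v_def)
  also have "\<dots> = 2 * tan v * (cos v)\<^sup>2" using cv c by (simp add: tan_def power2_eq_square)
  finally have "\<bar>sin (pi * t)\<bar> = 2 * \<bar>tan v\<bar> * (cos v)\<^sup>2" by (simp add: abs_mult)
  moreover have "\<bar>v\<bar> * c\<^sup>2 \<le> \<bar>tan v\<bar> * (cos v)\<^sup>2"
    using abs_tan_ge[OF v2] cv c by (intro mult_mono power_mono) auto
  ultimately have "2 * (\<bar>v\<bar> * c\<^sup>2) \<le> \<bar>sin (pi * t)\<bar>" by linarith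
  moreover have "\<bar>v\<bar> = pi * \<bar>t\<bar> / 2" by (simp add: v_def abs_mult)
  ultimately show "2 * pi * c\<^sup>2 * \<bar>t\<bar> \<le> norm (cis (2 * pi * t) - 1)"
    by (simp add: norm_cis_minus_1 mult_ac)
qed

text \<open>Shifting by half a period changes the sign of the integral, so it is controlled by the modulus
  of continuity of \<open>f\<close> in \<open>L\<^sub>1\<close>.\<close>

lemma riemann_lebesgue:
  fixes f :: "real \<Rightarrow> complex"
  assumes f: "integrable lborel f" and e: "0 < e"
  obtains N where "0 < N" "\<And>s. N \<le> \<bar>s\<bar> \<Longrightarrow> norm (LINT x|lborel. f x * cis (2 * pi * (x * s))) \<le> e"
proof -
  have [measurable]: "f \<in> borel_measurable borel" using borel_measurable_integrable[OF f] by simp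
  obtain d where d: "0 < d" "\<And>t. norm t < d \<Longrightarrow> (\<integral>\<^sup>+x. ennreal (norm (f (x + t) - f x)) \<partial>lborel) \<le> ennreal e"
    using integrable_translation_L1[OF f] e by blast
  show ?thesis
  proof (rule that[of "1 / d"])
    fix s :: real assume s: "1 / d \<le> \<bar>s\<bar>"
    have s0: "s \<noteq> 0" "0 < \<bar>s\<bar>" using s d(1) by auto
    define t where "t = 1 / (2 * s)"
    have "\<bar>t\<bar> = 1 / (2 * \<bar>s\<bar>)" by (simp add: t_def abs_mult)
    also have "\<dots> < d" using s s0 d(1) by (simp add: field_simps)
    finally have t: "norm t < d" by simp
    define I where "I = (LINT x|lborel. f x * cis (2 * pi * (x * s)))"
    have int: "integrable lborel (\<lambda>x. f x * cis (2 * pi * (x * s)))"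
      by (rule integrable_mult_cis[OF f]) measurable
    have int': "integrable lborel (\<lambda>x. f (t + 1 * x) * cis (2 * pi * ((t + 1 * x) * s)))"
      by (rule lborel_integrable_real_affine[OF int]) simp
    have "I = (LINT x|lborel. f (t + 1 * x) * cis (2 * pi * ((t + 1 * x) * s)))"
      unfolding I_def by (subst lborel_integral_real_affine[of 1 _ t]) auto
    also have "\<dots> = (LINT x|lborel. - (f (x + t) * cis (2 * pi * (x * s))))"
    proof (intro Bochner_Integration.integral_cong refl)
      fix x :: real
      have "2 * pi * ((t + 1 * x) * s) = pi + 2 * pi * (x * s)" using s0 by (simp add: t_def field_simps)
      thus "f (t + 1 * x) * cis (2 * pi * ((t + 1 * x) * s)) = - (f (x + t) * cis (2 * pi * (x * s)))"
        by (simp add: cis_mult[symmetric] add.commute)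
    qed
    finally have I2: "I = (LINT x|lborel. - (f (x + t) * cis (2 * pi * (x * s))))" .
    have int2: "integrable lborel (\<lambda>x. f (x + t) * cis (2 * pi * (x * s)))"
      using lborel_integrable_real_affine[OF f, of 1 t] by (intro integrable_mult_cis) (auto simp: add.commute)
    have "2 * I = I + I" by simp
    also have "\<dots> = (LINT x|lborel. f x * cis (2 * pi * (x * s)) + - (f (x + t) * cis (2 * pi * (x * s))))"
      using int int2 I2 by (subst Bochner_Integration.integral_add) (auto simp: I_def)
    finally have I3: "2 * I = (LINT x|lborel. f x * cis (2 * pi * (x * s)) + - (f (x + t) * cis (2 * pi * (x * s))))" .
    have "ennreal (norm (2 * I)) \<le> (\<integral>\<^sup>+x. ennreal (norm (f x * cis (2 * pi * (x * s)) + - (f (x + t) * cis (2 * pi * (x * s))))) \<partial>lborel)"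
      unfolding I3 using int int2 by (intro integral_norm_bound_ennreal) auto
    also have "\<dots> = (\<integral>\<^sup>+x. ennreal (norm (f (x + t) - f x)) \<partial>lborel)"
    proof (intro nn_integral_cong arg_cong[where f = ennreal])
      fix x
      have "f x * cis (2 * pi * (x * s)) + - (f (x + t) * cis (2 * pi * (x * s))) = (f x - f (x + t)) * cis (2 * pi * (x * s))"
        by (simp add: algebra_simps)
      thus "norm (f x * cis (2 * pi * (x * s)) + - (f (x + t) * cis (2 * pi * (x * s)))) = norm (f (x + t) - f x)"
        by (simp only: norm_mult norm_cis mult_1_right norm_minus_commute)
    qed
    also have "\<dots> \<le> ennreal e" by (rule d(2)[OF t])
    finally have "norm (2 * I) \<le> e" using e by simp
    hence "2 * norm I \<le> e" by (simp add: norm_mult)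
    hence "norm I \<le> e" using norm_ge_zero[of I] by linarith
    thus "norm (LINT x|lborel. f x * cis (2 * pi * (x * s))) \<le> e" by (simp add: I_def)
  qed (use d in simp)
qed

section \<open>Poisson summation for the tent\<close>

text \<open>Symmetric partial sums are the ones that will telescope; absolute summability identifies
  their limit with the full sum.\<close>

lemma integral_count_space_int_symmetric:
  fixes a :: "int \<Rightarrow> complex"
  assumes a: "integrable (count_space UNIV) a"
  shows "(\<lambda>L. \<Sum>l\<in>{- int L..int L}. a l) \<longlonglongrightarrow> (LINT l|count_space UNIV. a l)"
proof -
  have "(\<lambda>L. LINT l|count_space UNIV. indicator {- int L..int L} l *\<^sub>R a l) \<longlonglongrightarrow> (LINT l|count_space UNIV. a l)"
  proof (rule integral_dominated_convergence[where w = "\<lambda>l. norm (a l)"])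
    show "AE l in count_space UNIV. (\<lambda>L. indicator {- int L..int L} l *\<^sub>R a l) \<longlonglongrightarrow> a l"
    proof (rule AE_I2)
      fix l :: int
      have "eventually (\<lambda>L. indicator {- int L..int L} l *\<^sub>R a l = a l) sequentially"
        using eventually_ge_at_top[of "nat \<bar>l\<bar>"] by eventually_elim (auto simp: indicator_def)
      thus "(\<lambda>L. indicator {- int L..int L} l *\<^sub>R a l) \<longlonglongrightarrow> a l" by (rule tendsto_eventually)
    qed
  qed (use a in \<open>auto split: split_indicator\<close>)
  moreover have "(LINT l|count_space UNIV. indicator {- int L..int L} l *\<^sub>R a l) = (\<Sum>l\<in>{- int L..int L}. a l)" for L
  proof -
    have "{l \<in> UNIV. indicator {- int L..int L} l *\<^sub>R a l \<noteq> 0} \<subseteq> {- int L..int L}" by (auto split: split_indicator)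
    hence "(LINT l|count_space UNIV. indicator {- int L..int L} l *\<^sub>R a l) = (\<Sum>l\<in>{l. indicator {- int L..int L} l *\<^sub>R a l \<noteq> 0}. indicator {- int L..int L} l *\<^sub>R a l)"
      using lebesgue_integral_count_space_finite_support[of UNIV "\<lambda>l. indicator {- int L..int L} l *\<^sub>R a l"]
      by (simp add: finite_subset[OF _ finite_atLeastAtMost_int])
    also have "\<dots> = (\<Sum>l\<in>{- int L..int L}. indicator {- int L..int L} l *\<^sub>R a l)"
      by (rule sum.mono_neutral_left) (auto split: split_indicator)
    finally show ?thesis by simp
  qed
  ultimately show ?thesis by simp
qed

lemma sum_telescope_int:
  fixes g :: "int \<Rightarrow> 'a::ab_group_add"
  shows "(\<Sum>l\<in>{- int L..int L}. g (l - 1) - g l) = g (- int L - 1) - g (int L)"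
proof (induction L)
  case (Suc L)
  have "{- int (Suc L)..int (Suc L)} = insert (- int L - 1) (insert (int L + 1) {- int L..int L})" by auto
  thus ?case using Suc by (simp add: algebra_simps)
qed simp

lemma integral_cis_period:
  "(LINT x|lborel. indicator {-1/2..1/2::real} x *\<^sub>R cis (2 * pi * ((x - y) * of_int m))) = (if m = 0 then 1 else 0)"
proof (cases "m = 0")
  case True thus ?thesis by (simp add: scaleR_conv_of_real)
next
  case False
  define c where "c = 2 * pi * real_of_int m"
  have c: "c \<noteq> 0" using False by (simp add: c_def)
  define F where "F = (\<lambda>x. exp (\<i> * of_real c * (of_real x - of_real y)) / (\<i> * of_real c))"
  have "has_bochner_integral lborel (\<lambda>x. indicator {-1/2..1/2} x *\<^sub>R exp (\<i> * of_real c * (of_real x - of_real y))) (F (1/2) - F (-1/2))"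
  proof (rule has_bochner_integral_FTC_Icc)
    fix x :: real
    have "((\<lambda>z. exp (\<i> * of_real c * (z - of_real y)) / (\<i> * of_real c)) has_field_derivative
        exp (\<i> * of_real c * (of_real x - of_real y))) (at (of_real x))"
      using c by (auto intro!: derivative_eq_intros)
    from has_vector_derivative_real_field[OF this]
    show "(F has_vector_derivative exp (\<i> * of_real c * (of_real x - of_real y))) (at x within {- 1 / 2..1 / 2})"
      unfolding F_def by (rule has_vector_derivative_at_within)
  qed (auto intro!: continuous_intros)
  moreover have "cis (2 * pi * ((x - y) * of_int m)) = exp (\<i> * of_real c * (of_real x - of_real y))" for x
    by (simp add: cis_conv_exp c_def algebra_simps)
  moreover have "F (1/2) = F (-1/2)"
  proof -
    have "exp (\<i> * of_real c * (of_real (1/2) - of_real y)) = exp (\<i> * of_real c * (of_real (-1/2) - of_real y)) * exp (\<i> * of_real c)"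
      unfolding exp_add[symmetric] by (simp add: algebra_simps)
    also have "exp (\<i> * of_real c) = 1"
      using cis_multiple_2pi[of "real_of_int m"] by (simp add: cis_conv_exp c_def mult_ac)
    finally show ?thesis by (simp add: F_def)
  qed
  ultimately show ?thesis using False by (simp add: has_bochner_integral_iff)
qed

text \<open>Chernoff's proof of the inversion of Fourier series: after division by
  \<open>e\<^bsup>2\<pi>i(x-y)\<^esup> - 1\<close> the symmetric partial sums telescope.\<close>

lemma poisson_tent:
  fixes \<epsilon> y \<eta> :: real
  assumes \<epsilon>: "0 < \<epsilon>" "\<epsilon> \<le> 1/4" and y: "-1/2 \<le> y" "y \<le> 1/2"
    and int: "integrable (count_space UNIV) (\<lambda>l::int. tent_ft (\<epsilon> * (\<eta> + of_int l)))"
  shows "(LINT l|count_space UNIV. of_real (tent_ft (\<epsilon> * (\<eta> + of_int l))) * cis (2 * pi * (y * (\<eta> + of_int l)))) = of_real (tent (y / \<epsilon>) / \<epsilon>)"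
proof -
  \<comment> \<open>A tent of width \<epsilon> and mass 1, modulated so that its \<open>l\<close>-th
    Fourier coefficient on the unit interval is
    \<open>tent_ft (\<epsilon> * (\<eta> + of_int l))\<close>.\<close>
  define \<Phi> where "\<Phi> = (\<lambda>x. of_real (tent (x / \<epsilon>) / \<epsilon>) * cis (- 2 * pi * (x * \<eta>)))"
  have [measurable]: "\<Phi> \<in> borel_measurable borel" unfolding \<Phi>_def by measurable
  \<comment> \<open>The scaled tent contributes the slope \<open>1 / \<epsilon>\<^sup>2\<close>; the
    phase contributes its speed, \<open>2 * pi\<close> times the modulus of \<eta>, multiplied by
    the height \<open>1 / \<epsilon>\<close>.\<close>
  define Lip where "Lip = 1 / \<epsilon>\<^sup>2 + 2 * pi * \<bar>\<eta>\<bar> / \<epsilon>"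
  have Lip: "norm (\<Phi> x - \<Phi> z) \<le> Lip * \<bar>x - z\<bar>" for x z
  proof -
    have "\<Phi> x - \<Phi> z = of_real ((tent (x / \<epsilon>) - tent (z / \<epsilon>)) / \<epsilon>) * cis (- 2 * pi * (x * \<eta>)) +
        of_real (tent (z / \<epsilon>) / \<epsilon>) * (cis (- 2 * pi * (x * \<eta>)) - cis (- 2 * pi * (z * \<eta>)))"
      by (simp add: \<Phi>_def algebra_simps diff_divide_distrib)
    also have "norm \<dots> \<le> \<bar>tent (x / \<epsilon>) - tent (z / \<epsilon>)\<bar> / \<epsilon> + tent (z / \<epsilon>) / \<epsilon> * norm (cis (- 2 * pi * (x * \<eta>)) - cis (- 2 * pi * (z * \<eta>)))"
      using \<epsilon> by (intro order_trans[OF norm_triangle_ineq]) (simp add: norm_mult norm_divide tent_nonneg del: of_real_diff of_real_divide)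
    also have "\<dots> \<le> \<bar>x / \<epsilon> - z / \<epsilon>\<bar> / \<epsilon> + 1 / \<epsilon> * \<bar>- 2 * pi * (x * \<eta>) - (- 2 * pi * (z * \<eta>))\<bar>"
      using \<epsilon> by (intro add_mono mult_mono divide_right_mono tent_lipschitz norm_cis_diff_le tent_le_1) (auto simp: tent_nonneg)
    also have "\<bar>x / \<epsilon> - z / \<epsilon>\<bar> / \<epsilon> = 1 / \<epsilon>\<^sup>2 * \<bar>x - z\<bar>"
      using \<epsilon> by (simp add: diff_divide_distrib[symmetric] abs_divide power2_eq_square)
    also have "\<bar>- 2 * pi * (x * \<eta>) - (- 2 * pi * (z * \<eta>))\<bar> = 2 * pi * \<bar>\<eta>\<bar> * \<bar>x - z\<bar>"
    proof -
      have "- 2 * pi * (x * \<eta>) - (- 2 * pi * (z * \<eta>)) = - (2 * pi * \<eta> * (x - z))" by (simp add: algebra_simps)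
      thus ?thesis by (simp add: abs_mult)
    qed
    finally show ?thesis by (simp add: Lip_def algebra_simps)
  qed
  \<comment> \<open>This rests on \<open>\<epsilon> <= 1/4\<close>. When \<open>x\<close> and
    \<open>y\<close> differ by more than 3/4, where the denominator
    \<open>cis (2 * pi * (x - y)) - 1\<close> may come close to 0 again, both points are outside the
    support and the numerator is 0.\<close>
  have \<Phi>0: "\<Phi> x = 0" if "1/4 \<le> \<bar>x\<bar>" for x
    using that \<epsilon> by (auto simp: \<Phi>_def intro!: tent_zero)
  obtain \<kappa> where \<kappa>: "0 < \<kappa>" "\<And>t. \<bar>t\<bar> \<le> 3/4 \<Longrightarrow> \<kappa> * \<bar>t\<bar> \<le> norm (cis (2 * pi * t) - 1)"
    using norm_cis_minus_1_ge by blast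
  define G where "G = (\<lambda>x. indicator {-1/2..1/2} x *\<^sub>R ((\<Phi> x - \<Phi> y) / (cis (2 * pi * (x - y)) - 1)))"
  have GB: "norm ((\<Phi> x - \<Phi> y) / (cis (2 * pi * (x - y)) - 1)) \<le> Lip / \<kappa>"
    and G1: "\<Phi> x - \<Phi> y = (\<Phi> x - \<Phi> y) / (cis (2 * pi * (x - y)) - 1) * (cis (2 * pi * (x - y)) - 1)"
    if x: "-1/2 \<le> x" "x \<le> 1/2" for x
  proof -
    have LK: "0 \<le> Lip / \<kappa>" using \<epsilon> \<kappa>(1) by (simp add: Lip_def)
    have "norm ((\<Phi> x - \<Phi> y) / (cis (2 * pi * (x - y)) - 1)) \<le> Lip / \<kappa> \<and>
      \<Phi> x - \<Phi> y = (\<Phi> x - \<Phi> y) / (cis (2 * pi * (x - y)) - 1) * (cis (2 * pi * (x - y)) - 1)"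
    proof (cases "\<bar>x - y\<bar> \<le> 3/4 \<and> x \<noteq> y")
      case True
      have ge: "\<kappa> * \<bar>x - y\<bar> \<le> norm (cis (2 * pi * (x - y)) - 1)" using \<kappa>(2)[of "x - y"] True by blast
      moreover have "0 < \<kappa> * \<bar>x - y\<bar>" using \<kappa>(1) True by simp
      ultimately have nz: "0 < norm (cis (2 * pi * (x - y)) - 1)" by linarith
      have "norm ((\<Phi> x - \<Phi> y) / (cis (2 * pi * (x - y)) - 1)) \<le> (Lip * \<bar>x - y\<bar>) / (\<kappa> * \<bar>x - y\<bar>)"
        unfolding norm_divide using Lip[of x y] ge \<open>0 < \<kappa> * \<bar>x - y\<bar>\<close> by (intro frac_le) (auto intro: order_trans[OF norm_ge_zero])
      thus ?thesis using nz True by simp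
    next
      case False
      hence "\<Phi> x - \<Phi> y = 0"
      proof (cases "x = y")
        case ne: False
        hence "3/4 < \<bar>x - y\<bar>" using False by auto
        hence "1/4 \<le> \<bar>x\<bar>" "1/4 \<le> \<bar>y\<bar>" using x y by (auto simp: abs_if split: if_splits)
        thus ?thesis using \<Phi>0 by simp
      qed simp
      thus ?thesis using LK by simp
    qed
    thus "norm ((\<Phi> x - \<Phi> y) / (cis (2 * pi * (x - y)) - 1)) \<le> Lip / \<kappa>"
      "\<Phi> x - \<Phi> y = (\<Phi> x - \<Phi> y) / (cis (2 * pi * (x - y)) - 1) * (cis (2 * pi * (x - y)) - 1)" by blast+
  qed
  define B where "B = Lip / \<kappa>"
  have G: "integrable lborel G"
  proof (rule Bochner_Integration.integrable_bound)
    show "integrable lborel (\<lambda>x. indicator {-1/2..1/2::real} x *\<^sub>R B)" by simp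
    have "norm (G x) \<le> norm (indicator {-1/2..1/2::real} x *\<^sub>R B)" for x
    proof (cases "x \<in> {-1/2..1/2}")
      case True
      hence "norm (G x) \<le> B" using GB[of x] by (simp add: G_def B_def)
      thus ?thesis using True by simp
    qed (simp add: G_def)
    thus "AE x in lborel. norm (G x) \<le> norm (indicator {-1/2..1/2::real} x *\<^sub>R B)" by simp
  qed (simp add: G_def)
  define g where "g = (\<lambda>l::int. LINT x|lborel. G x * cis (- 2 * pi * ((x - y) * of_int l)))"
  define a where "a = (\<lambda>l::int. of_real (tent_ft (\<epsilon> * (\<eta> + of_int l))) * cis (2 * pi * (y * of_int l)))"
  \<comment> \<open>The factor \<open>cis (2 * pi * (x - y))\<close> lowers the frequency index by
    one, so the coefficients of \<Phi> minus its value at \<open>y\<close> are differences of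
    consecutive coefficients of the quotient \<open>G\<close>; the constant itself is visible only
    at \<open>l = 0\<close>.\<close>
  have coef: "a l - (if l = 0 then \<Phi> y else 0) = g (l - 1) - g l" for l
  proof -
    have "of_real (tent_ft (\<epsilon> * (\<eta> + of_int l))) = (LINT x|lborel. of_real (tent x) * cis (- 2 * pi * (x * (\<epsilon> * (\<eta> + of_int l)))))"
      by (rule integral_tent_cis[symmetric])
    also have "\<dots> = (1 / \<epsilon>) *\<^sub>R (LINT x|lborel. of_real (tent (x / \<epsilon>)) * cis (- 2 * pi * (x / \<epsilon> * (\<epsilon> * (\<eta> + of_int l)))))"
      using \<epsilon> lborel_integral_real_affine[of "1 / \<epsilon>" "\<lambda>x. of_real (tent x) * cis (- 2 * pi * (x * (\<epsilon> * (\<eta> + of_int l))))" 0]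
      by simp
    also have "\<dots> = (LINT x|lborel. (1 / \<epsilon>) *\<^sub>R (of_real (tent (x / \<epsilon>)) * cis (- 2 * pi * (x / \<epsilon> * (\<epsilon> * (\<eta> + of_int l))))))"
      by simp
    also have "\<dots> = (LINT x|lborel. indicator {-1/2..1/2::real} x *\<^sub>R \<Phi> x * cis (- 2 * pi * (x * of_int l)))"
    proof (intro Bochner_Integration.integral_cong refl)
      fix x :: real
      have "(1 / \<epsilon>) *\<^sub>R (of_real (tent (x / \<epsilon>)) * cis (- 2 * pi * (x / \<epsilon> * (\<epsilon> * (\<eta> + of_int l))))) = \<Phi> x * cis (- 2 * pi * (x * of_int l))"
        using \<epsilon> by (simp add: \<Phi>_def scaleR_conv_of_real cis_mult mult.assoc) (simp add: algebra_simps)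
      also have "\<dots> = indicator {-1/2..1/2::real} x *\<^sub>R \<Phi> x * cis (- 2 * pi * (x * of_int l))"
        using \<Phi>0[of x] by (auto split: split_indicator)
      finally show "(1 / \<epsilon>) *\<^sub>R (of_real (tent (x / \<epsilon>)) * cis (- 2 * pi * (x / \<epsilon> * (\<epsilon> * (\<eta> + of_int l))))) =
        indicator {-1/2..1/2::real} x *\<^sub>R \<Phi> x * cis (- 2 * pi * (x * of_int l))" .
    qed
    finally have "a l = (LINT x|lborel. indicator {-1/2..1/2::real} x *\<^sub>R \<Phi> x * cis (- 2 * pi * (x * of_int l))) * cis (2 * pi * (y * of_int l))"
      by (simp add: a_def)
    also have "\<dots> = (LINT x|lborel. indicator {-1/2..1/2::real} x *\<^sub>R \<Phi> x * cis (- 2 * pi * (x * of_int l)) * cis (2 * pi * (y * of_int l)))"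
      by (rule integral_mult_left_zero[symmetric])
    also have "\<dots> = (LINT x|lborel. indicator {-1/2..1/2::real} x *\<^sub>R \<Phi> x * cis (- 2 * pi * ((x - y) * of_int l)))"
      by (intro Bochner_Integration.integral_cong refl) (simp add: mult.assoc cis_mult algebra_simps)
    finally have a: "a l = (LINT x|lborel. indicator {-1/2..1/2::real} x *\<^sub>R \<Phi> x * cis (- 2 * pi * ((x - y) * of_int l)))" .
    have "(if l = 0 then \<Phi> y else 0) = \<Phi> y * (LINT x|lborel. indicator {-1/2..1/2::real} x *\<^sub>R cis (2 * pi * ((x - y) * of_int (- l))))"
      by (subst integral_cis_period) simp
    also have "\<dots> = (LINT x|lborel. indicator {-1/2..1/2::real} x *\<^sub>R \<Phi> y * cis (- 2 * pi * ((x - y) * of_int l)))"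
      unfolding integral_mult_right_zero[symmetric] by (simp add: scaleR_conv_of_real mult_ac)
    finally have b: "(if l = 0 then \<Phi> y else 0) = (LINT x|lborel. indicator {-1/2..1/2::real} x *\<^sub>R \<Phi> y * cis (- 2 * pi * ((x - y) * of_int l)))" .
    have \<Phi>B: "norm (\<Phi> x) \<le> Lip * \<bar>x\<bar> + norm (\<Phi> 0)" for x
      using Lip[of x 0] norm_triangle_ineq[of "\<Phi> x - \<Phi> 0" "\<Phi> 0"] by simp
    have i1: "integrable lborel (\<lambda>x. indicator {-1/2..1/2::real} x *\<^sub>R \<Phi> z * cis (- 2 * pi * ((x - y) * of_int l)))" for z
      by (intro integrable_mult_cis) (auto simp: scaleR_conv_of_real)
    have i2: "integrable lborel (\<lambda>x. indicator {-1/2..1/2::real} x *\<^sub>R \<Phi> x * cis (- 2 * pi * ((x - y) * of_int l)))"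
    proof (intro integrable_mult_cis)
      have "0 \<le> Lip" using \<epsilon> by (simp add: Lip_def)
      hence "Lip * \<bar>x\<bar> \<le> Lip * 1" if "\<bar>x\<bar> \<le> 1" for x using that by (intro mult_left_mono)
      hence \<Phi>B1: "norm (\<Phi> x) \<le> Lip + norm (\<Phi> 0)" if "\<bar>x\<bar> \<le> 1" for x using \<Phi>B[of x] that by fastforce
      define B' where "B' = Lip + norm (\<Phi> 0)"
      have le: "norm (indicator {-1/2..1/2::real} x *\<^sub>R \<Phi> x) \<le> norm (indicator {-1/2..1/2::real} x *\<^sub>R B')" for x
      proof (cases "x \<in> {-1/2..1/2}")
        case True
        hence "\<bar>x\<bar> \<le> 1" by auto
        from \<Phi>B1[OF this] True show ?thesis by (simp add: B'_def)
      qed simp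
      have "integrable lborel (\<lambda>x. indicator {-1/2..1/2::real} x *\<^sub>R B')" by simp
      thus "integrable lborel (\<lambda>x. indicator {-1/2..1/2::real} x *\<^sub>R \<Phi> x)"
        by (rule Bochner_Integration.integrable_bound) (measurable, rule AE_I2, rule le)
    qed measurable
    have "a l - (if l = 0 then \<Phi> y else 0) = (LINT x|lborel. indicator {-1/2..1/2::real} x *\<^sub>R \<Phi> x * cis (- 2 * pi * ((x - y) * of_int l)) - indicator {-1/2..1/2::real} x *\<^sub>R \<Phi> y * cis (- 2 * pi * ((x - y) * of_int l)))"
      unfolding a b by (rule Bochner_Integration.integral_diff[symmetric]) (rule i2, rule i1)
    also have "\<dots> = (LINT x|lborel. G x * cis (- 2 * pi * ((x - y) * of_int (l - 1))) - G x * cis (- 2 * pi * ((x - y) * of_int l)))"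
    proof (intro Bochner_Integration.integral_cong refl)
      fix x :: real
      have "indicator {-1/2..1/2::real} x *\<^sub>R \<Phi> x * cis (- 2 * pi * ((x - y) * of_int l)) - indicator {-1/2..1/2::real} x *\<^sub>R \<Phi> y * cis (- 2 * pi * ((x - y) * of_int l)) =
        indicator {-1/2..1/2::real} x *\<^sub>R (\<Phi> x - \<Phi> y) * cis (- 2 * pi * ((x - y) * of_int l))"
        by (simp only: scaleR_diff_right left_diff_distrib)
      also have "indicator {-1/2..1/2::real} x *\<^sub>R (\<Phi> x - \<Phi> y) = G x * (cis (2 * pi * (x - y)) - 1)"
        unfolding G_def using G1[of x] by (auto split: split_indicator)
      also have "\<dots> * cis (- 2 * pi * ((x - y) * of_int l)) = G x * (cis (2 * pi * (x - y)) * cis (- 2 * pi * ((x - y) * of_int l))) - G x * cis (- 2 * pi * ((x - y) * of_int l))"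
        by (simp only: left_diff_distrib right_diff_distrib mult.assoc mult_1_left mult_1_right)
      also have "cis (2 * pi * (x - y)) * cis (- 2 * pi * ((x - y) * of_int l)) = cis (- 2 * pi * ((x - y) * of_int (l - 1)))"
        unfolding cis_mult by (simp add: algebra_simps)
      finally show "indicator {-1/2..1/2::real} x *\<^sub>R \<Phi> x * cis (- 2 * pi * ((x - y) * of_int l)) - indicator {-1/2..1/2::real} x *\<^sub>R \<Phi> y * cis (- 2 * pi * ((x - y) * of_int l)) =
        G x * cis (- 2 * pi * ((x - y) * of_int (l - 1))) - G x * cis (- 2 * pi * ((x - y) * of_int l))" .
    qed
    also have "\<dots> = g (l - 1) - g l"
      unfolding g_def by (intro Bochner_Integration.integral_diff integrable_mult_cis G) measurable
    finally show ?thesis .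
  qed
  have gn: "norm (g l) = norm (LINT x|lborel. G x * cis (2 * pi * (x * of_int (- l))))" for l
  proof -
    have "g l = (LINT x|lborel. (G x * cis (2 * pi * (x * of_int (- l)))) * cis (2 * pi * (y * of_int l)))"
      unfolding g_def by (intro Bochner_Integration.integral_cong refl) (simp add: mult.assoc cis_mult algebra_simps)
    also have "\<dots> = (LINT x|lborel. G x * cis (2 * pi * (x * of_int (- l)))) * cis (2 * pi * (y * of_int l))"
      by (rule integral_mult_left_zero)
    finally show ?thesis by (simp add: norm_mult)
  qed
  \<comment> \<open>The two end terms left by telescoping vanish in the limit by
    Riemann--Lebesgue.\<close>
  have g0: "(\<lambda>L. g (- int L - 1) - g (int L)) \<longlonglongrightarrow> 0"
  proof (rule LIMSEQ_I)
    fix e :: real assume e: "0 < e"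
    obtain N where N: "\<And>s. N \<le> \<bar>s\<bar> \<Longrightarrow> norm (LINT x|lborel. G x * cis (2 * pi * (x * s))) \<le> e / 3"
      using riemann_lebesgue[OF G, of "e / 3"] e by auto
    show "\<exists>no. \<forall>n\<ge>no. norm (g (- int n - 1) - g (int n) - 0) < e"
    proof (intro exI allI impI)
      fix n assume n: "nat \<lceil>N\<rceil> \<le> n"
      hence "N \<le> real n" by linarith
      hence "N \<le> \<bar>real_of_int (- (- int n - 1))\<bar>" "N \<le> \<bar>real_of_int (- int n)\<bar>" by simp_all
      hence "norm (g (- int n - 1)) \<le> e / 3" "norm (g (int n)) \<le> e / 3"
        unfolding gn by (auto simp only: intro: N)
      thus "norm (g (- int n - 1) - g (int n) - 0) < e"
        using norm_triangle_ineq4[of "g (- int n - 1)" "g (int n)"] e by simp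
    qed
  qed
  have a_int: "integrable (count_space UNIV) a"
    by (rule Bochner_Integration.integrable_bound[OF int]) (auto simp: a_def norm_mult)
  have "(\<Sum>l\<in>{- int L..int L}. a l) = (g (- int L - 1) - g (int L)) + \<Phi> y" for L
  proof -
    have "(\<Sum>l\<in>{- int L..int L}. a l) = (\<Sum>l\<in>{- int L..int L}. (g (l - 1) - g l) + (if l = 0 then \<Phi> y else 0))"
      by (intro sum.cong refl) (simp add: coef[symmetric])
    also have "\<dots> = (g (- int L - 1) - g (int L)) + \<Phi> y"
      by (simp add: sum.distrib sum_telescope_int sum.delta)
    finally show ?thesis .
  qed
  hence "(\<lambda>L. \<Sum>l\<in>{- int L..int L}. a l) \<longlonglongrightarrow> 0 + \<Phi> y"
    using tendsto_add[OF g0 tendsto_const[of "\<Phi> y"]] by simp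
  from LIMSEQ_unique[OF integral_count_space_int_symmetric[OF a_int] this]
  have I: "(LINT l|count_space UNIV. a l) = \<Phi> y" by simp
  have "(LINT l|count_space UNIV. of_real (tent_ft (\<epsilon> * (\<eta> + of_int l))) * cis (2 * pi * (y * (\<eta> + of_int l)))) = (LINT l|count_space UNIV. cis (2 * pi * (y * \<eta>)) * a l)"
  proof (intro Bochner_Integration.integral_cong refl)
    fix l :: int
    have "2 * pi * (y * (\<eta> + of_int l)) = 2 * pi * (y * \<eta>) + 2 * pi * (y * of_int l)" by (simp only: ring_distribs)
    hence "cis (2 * pi * (y * (\<eta> + of_int l))) = cis (2 * pi * (y * \<eta>)) * cis (2 * pi * (y * of_int l))"
      by (simp only: cis_mult)
    thus "of_real (tent_ft (\<epsilon> * (\<eta> + of_int l))) * cis (2 * pi * (y * (\<eta> + of_int l))) = cis (2 * pi * (y * \<eta>)) * a l"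
      by (simp only: a_def mult_ac)
  qed
  also have "\<dots> = cis (2 * pi * (y * \<eta>)) * \<Phi> y" unfolding I[symmetric] by (rule integral_mult_right_zero)
  also have "\<dots> = of_real (tent (y / \<epsilon>) / \<epsilon>) * (cis (- 2 * pi * (y * \<eta>)) * cis (2 * pi * (y * \<eta>)))"
    unfolding \<Phi>_def by (simp only: mult_ac)
  also have "cis (- 2 * pi * (y * \<eta>)) * cis (2 * pi * (y * \<eta>)) = 1" unfolding cis_mult by simp
  also have "of_real (tent (y / \<epsilon>) / \<epsilon>) * 1 = complex_of_real (tent (y / \<epsilon>) / \<epsilon>)" by (rule mult_1_right)
  finally show ?thesis .
qed

text \<open>The constant covers two ranges: while \<open>l\<close> is at most
  \<open>1 + 2 * \<bar>\<eta>\<bar>\<close> in modulus the bound 1 is used; beyond that,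
  \<open>\<eta> + l\<close> has at least half the modulus of \<open>l\<close> and quadratic decay
  takes over.\<close>

lemma integrable_tent_ft_int:
  assumes \<epsilon>: "0 < (\<epsilon>::real)"
  shows "integrable (count_space UNIV) (\<lambda>l::int. tent_ft (\<epsilon> * (\<eta> + of_int l)))"
proof -
  define K where "K = (1 + 2 * \<bar>\<eta>\<bar>)\<^sup>2 + 4 / \<epsilon>\<^sup>2"
  have le: "tent_ft (\<epsilon> * (\<eta> + of_int l)) \<le> K * max 1 \<bar>real_of_int l\<bar> powr (- 2)" for l
  proof -
    define m where "m = max 1 \<bar>real_of_int l\<bar>"
    have m: "1 \<le> m" by (simp add: m_def)
    have pw: "m powr (- 2) = 1 / m\<^sup>2" using m by (simp add: powr_minus powr_numeral divide_inverse)
    have "tent_ft (\<epsilon> * (\<eta> + of_int l)) * m\<^sup>2 \<le> K"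
    proof (cases "m \<le> 1 + 2 * \<bar>\<eta>\<bar>")
      case True
      have "tent_ft (\<epsilon> * (\<eta> + of_int l)) * m\<^sup>2 \<le> 1 * (1 + 2 * \<bar>\<eta>\<bar>)\<^sup>2"
        using True m by (intro mult_mono power_mono tent_ft_le_1) auto
      also have "\<dots> \<le> K" by (simp add: K_def)
      finally show ?thesis .
    next
      case False
      hence l: "m = \<bar>real_of_int l\<bar>" "2 * \<bar>\<eta>\<bar> \<le> \<bar>real_of_int l\<bar>" by (auto simp: m_def max_def split: if_splits)
      hence ge: "m / 2 \<le> \<bar>\<eta> + of_int l\<bar>" by linarith
      hence ne: "\<eta> + of_int l \<noteq> 0" using m by auto
      have "tent_ft (\<epsilon> * (\<eta> + of_int l)) \<le> 1 / (\<epsilon> * (\<eta> + of_int l))\<^sup>2"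
        using \<epsilon> ne by (intro tent_ft_decay) auto
      also have "\<dots> \<le> 1 / (\<epsilon> * (m / 2))\<^sup>2"
      proof (rule divide_left_mono)
        have "(m / 2)\<^sup>2 \<le> \<bar>\<eta> + of_int l\<bar>\<^sup>2" using ge m by (intro power_mono) auto
        thus "(\<epsilon> * (m / 2))\<^sup>2 \<le> (\<epsilon> * (\<eta> + of_int l))\<^sup>2"
          unfolding power_mult_distrib power2_abs by (rule mult_left_mono) simp
      qed (use \<epsilon> m ne in auto)
      finally have "tent_ft (\<epsilon> * (\<eta> + of_int l)) * m\<^sup>2 \<le> 1 / (\<epsilon> * (m / 2))\<^sup>2 * m\<^sup>2" by (rule mult_right_mono) simp
      also have "\<dots> = 4 / \<epsilon>\<^sup>2" using \<epsilon> m by (simp add: power_mult_distrib power_divide)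
      also have "\<dots> \<le> K" by (simp add: K_def)
      finally show ?thesis .
    qed
    hence "tent_ft (\<epsilon> * (\<eta> + of_int l)) \<le> K / m\<^sup>2" using m by (subst pos_le_divide_eq) auto
    thus ?thesis unfolding m_def[symmetric] pw by simp
  qed
  have *: "norm (tent_ft (\<epsilon> * (\<eta> + of_int l))) \<le> norm (K * max 1 \<bar>real_of_int l\<bar> powr (- 2))" for l
  proof -
    have "norm (tent_ft (\<epsilon> * (\<eta> + of_int l))) = tent_ft (\<epsilon> * (\<eta> + of_int l))" by (simp add: tent_ft_nonneg)
    also have "\<dots> \<le> K * max 1 \<bar>real_of_int l\<bar> powr (- 2)" by (rule le)
    also have "\<dots> \<le> norm (K * max 1 \<bar>real_of_int l\<bar> powr (- 2))" unfolding real_norm_def by (rule abs_ge_self)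
    finally show ?thesis .
  qed
  show ?thesis
    by (rule Bochner_Integration.integrable_bound[OF integrable_mult_right[OF integrable_count_space_int_powr[of 2], of K]])
       (use * in auto)
qed

text \<open>The sum is periodic in \<eta>, so \<eta> may be moved to the unit cell, where one
  summable product majorant serves all points.\<close>

lemma lattice_sum_Tent_ft_le:
  fixes \<epsilon> :: real
  assumes \<epsilon>: "0 < \<epsilon>"
  obtains C where "0 \<le> C" "\<And>\<eta> :: real^'d. (\<integral>\<^sup>+l. ennreal (Tent_ft (\<epsilon> *\<^sub>R (\<eta> + l))) \<partial>lattice_measure) \<le> ennreal C"
proof -
  \<comment> \<open>The summand 1 covers coordinates with \<open>l $ i = 0\<close>, and
    \<open>4 / \<epsilon>\<^sup>2\<close> the others, by decay at a point of at least half the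
    modulus of \<open>l $ i\<close>.\<close>
  define K where "K = 1 + 4 / \<epsilon>\<^sup>2"
  define b where "b = (\<lambda>z::int. K * max 1 \<bar>real_of_int z\<bar> powr (- 2))"
  have K: "1 \<le> K" by (simp add: K_def)
  have b: "integrable (count_space UNIV) b"
    unfolding b_def by (intro integrable_mult_right integrable_count_space_int_powr) simp
  have bi: "integrable lattice_measure (\<lambda>l::real^'d. \<Prod>i\<in>UNIV. b \<lfloor>l $ i\<rfloor>)"
    by (rule integrable_lattice_prod) (rule b)
  define C where "C = (LINT l|(lattice_measure :: (real^'d) measure). (\<Prod>i\<in>UNIV. b \<lfloor>l $ i\<rfloor>))"
  have b0: "0 \<le> b z" for z using K by (simp add: b_def)
  have C0: "0 \<le> C" unfolding C_def by (intro Bochner_Integration.integral_nonneg prod_nonneg b0)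
  have cell: "(\<integral>\<^sup>+l. ennreal (Tent_ft (\<epsilon> *\<^sub>R (\<zeta> + l))) \<partial>lattice_measure) \<le> ennreal C" if \<zeta>: "\<zeta> \<in> unit_cell" for \<zeta> :: "real^'d"
  proof -
    have "(\<integral>\<^sup>+l. ennreal (Tent_ft (\<epsilon> *\<^sub>R (\<zeta> + l))) \<partial>lattice_measure) \<le> (\<integral>\<^sup>+l. ennreal (\<Prod>i\<in>UNIV. b \<lfloor>l $ i\<rfloor>) \<partial>(lattice_measure :: (real^'d) measure))"
    proof (rule nn_integral_mono)
      fix l :: "real^'d" assume "l \<in> space lattice_measure"
      hence l: "l \<in> int_lattice" by simp
      have "Tent_ft (\<epsilon> *\<^sub>R (\<zeta> + l)) \<le> (\<Prod>i\<in>UNIV. b \<lfloor>l $ i\<rfloor>)"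
        unfolding Tent_ft_def
      proof (intro prod_mono conjI tent_ft_nonneg)
        fix i
        obtain z where z: "l $ i = of_int z" using l by (auto simp: int_lattice_def elim: Ints_cases)
        have ge: "\<bar>of_int z\<bar> / 2 \<le> \<bar>(\<zeta> + l) $ i\<bar>" using unit_cell_component_ge[OF \<zeta> l, of i] z by simp
        show "tent_ft ((\<epsilon> *\<^sub>R (\<zeta> + l)) $ i) \<le> b \<lfloor>l $ i\<rfloor>"
        proof (cases "z = 0")
          case True
          thus ?thesis using tent_ft_le_1[of "(\<epsilon> *\<^sub>R (\<zeta> + l)) $ i"] K by (simp add: z b_def)
        next
          case False
          have z1: "1 \<le> \<bar>real_of_int z\<bar>" using False by simp
          hence ne: "(\<zeta> + l) $ i \<noteq> 0" using ge by auto
          have "tent_ft ((\<epsilon> *\<^sub>R (\<zeta> + l)) $ i) \<le> 1 / (\<epsilon> * (\<zeta> + l) $ i)\<^sup>2"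
            unfolding vector_scaleR_component real_scaleR_def using \<epsilon> ne by (intro tent_ft_decay) auto
          also have "\<dots> \<le> 1 / (\<epsilon> * (\<bar>of_int z\<bar> / 2))\<^sup>2"
          proof (rule divide_left_mono)
            have "(\<bar>of_int z\<bar> / 2)\<^sup>2 \<le> \<bar>(\<zeta> + l) $ i\<bar>\<^sup>2" using ge by (intro power_mono) auto
            thus "(\<epsilon> * (\<bar>of_int z\<bar> / 2))\<^sup>2 \<le> (\<epsilon> * (\<zeta> + l) $ i)\<^sup>2"
              unfolding power_mult_distrib[of \<epsilon>] power2_abs by (rule mult_left_mono) simp
          qed (use \<epsilon> z1 ne in auto)
          also have "\<dots> = 4 / \<epsilon>\<^sup>2 * (1 / (of_int z)\<^sup>2)" by (simp add: power_mult_distrib power_divide)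
          also have "\<dots> \<le> K * (1 / (of_int z)\<^sup>2)" by (intro mult_right_mono) (auto simp: K_def)
          also have "\<dots> = b \<lfloor>l $ i\<rfloor>"
            using z1 by (simp add: z b_def max_def powr_minus powr_numeral divide_inverse)
          finally show ?thesis .
        qed
      qed
      thus "ennreal (Tent_ft (\<epsilon> *\<^sub>R (\<zeta> + l))) \<le> ennreal (\<Prod>i\<in>UNIV. b \<lfloor>l $ i\<rfloor>)" by (rule ennreal_leI)
    qed
    also have "\<dots> = ennreal C"
      unfolding C_def using bi by (intro nn_integral_eq_integral) (auto intro!: prod_nonneg b0)
    finally show ?thesis .
  qed
  show ?thesis
  proof (rule that[OF C0])
    fix \<eta> :: "real^'d"
    obtain k where k: "k \<in> int_lattice" "\<eta> - k \<in> unit_cell"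
      by (rule unit_cell_minus_lattice[of \<eta>]) blast
    have "(\<integral>\<^sup>+l. ennreal (Tent_ft (\<epsilon> *\<^sub>R (\<eta> + l))) \<partial>lattice_measure) = (\<integral>\<^sup>+l. ennreal (Tent_ft (\<epsilon> *\<^sub>R ((\<eta> - k) + (l + k)))) \<partial>lattice_measure)"
      by (simp add: algebra_simps)
    also have "\<dots> = (\<integral>\<^sup>+l. ennreal (Tent_ft (\<epsilon> *\<^sub>R ((\<eta> - k) + l))) \<partial>lattice_measure)"
      by (rule nn_integral_lattice_shift[OF k(1)])
    also have "\<dots> \<le> ennreal C" by (rule cell[OF k(2)])
    finally show "(\<integral>\<^sup>+l. ennreal (Tent_ft (\<epsilon> *\<^sub>R (\<eta> + l))) \<partial>lattice_measure) \<le> ennreal C" .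
  qed
qed

section \<open>Regularised shift series\<close>

text \<open>An approximate identity of mass 1 supported in the cube of half-width \<epsilon>. Its
  transform is \<open>Tent_ft (\<epsilon> *\<^sub>R \<xi>)\<close>, the damping factor on the
  frequency side.\<close>

definition mollifier :: "real \<Rightarrow> real^'d \<Rightarrow> real" where
  "mollifier \<epsilon> x = (1 / \<epsilon>) ^ CARD('d) * Tent ((1 / \<epsilon>) *\<^sub>R x)"

lemma borel_measurable_mollifier [measurable]: "mollifier \<epsilon> \<in> borel_measurable borel"
  unfolding mollifier_def[abs_def] by measurable

lemma mollifier_nonneg: "0 < \<epsilon> \<Longrightarrow> 0 \<le> mollifier \<epsilon> x"
  and mollifier_le: "0 < \<epsilon> \<Longrightarrow> mollifier \<epsilon> (x :: real^'d) \<le> (1 / \<epsilon>) ^ CARD('d)"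
  by (auto simp: mollifier_def Tent_nonneg Tent_le_1 divide_le_eq intro!: mult_nonneg_nonneg divide_right_mono)

lemma mollifier_eq_0:
  assumes "0 < \<epsilon>" "\<epsilon> \<le> 1/4" "x \<notin> unit_cell"
  shows "mollifier \<epsilon> x = 0"
proof -
  obtain i where "\<not> (- (1/2) \<le> x $ i \<and> x $ i < 1/2)" using assms(3) unfolding unit_cell_def by blast
  hence "1/2 \<le> \<bar>x $ i\<bar>" by linarith
  hence "1 \<le> \<bar>((1 / \<epsilon>) *\<^sub>R x) $ i\<bar>" using assms by (simp add: abs_mult field_simps)
  thus ?thesis by (simp add: mollifier_def Tent_eq_0)
qed

lemma cis_int_lattice:
  assumes "k \<in> int_lattice" "l \<in> int_lattice"
  shows "cis (2 * pi * (k \<bullet> l)) = 1"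
proof -
  have "k \<bullet> l \<in> \<int>" unfolding inner_vec_def using assms by (auto simp: int_lattice_def intro!: Ints_sum Ints_mult)
  thus ?thesis by (rule cis_multiple_2pi)
qed

text \<open>The one-dimensional formula needs coordinates in [-1/2, 1/2], so \<open>y\<close> is
  first moved into the unit cell by \<open>k0\<close>, at the cost of the phase
  \<open>cis (- 2 * pi * (k0 \<bullet> \<eta>))\<close>. As the mollifier vanishes outside the cell,
  \<open>k0\<close> is also the only index that contributes on the right.\<close>

lemma poisson_mollifier:
  fixes y \<eta> :: "real^'d"
  assumes \<epsilon>: "0 < \<epsilon>" "\<epsilon> \<le> 1/4"
  shows "(LINT l|lattice_measure. of_real (Tent_ft (\<epsilon> *\<^sub>R (\<eta> + l))) * cis (2 * pi * (y \<bullet> (\<eta> + l)))) =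
    (LINT k|lattice_measure. of_real (mollifier \<epsilon> (y + k)) * cis (- 2 * pi * (k \<bullet> \<eta>)))"
proof -
  obtain k' where k': "k' \<in> int_lattice" "y - k' \<in> unit_cell" "\<And>k. k \<in> int_lattice \<Longrightarrow> y - k \<in> unit_cell \<longleftrightarrow> k = k'"
    by (rule unit_cell_minus_lattice[of y]) blast
  define k0 where "k0 = - k'"
  have k0: "k0 \<in> int_lattice" using k'(1) by (simp add: k0_def int_lattice_minus)
  have uniq: "y + k \<in> unit_cell \<longleftrightarrow> k = k0" if "k \<in> int_lattice" for k
    using k'(3)[OF int_lattice_minus[OF that]] by (auto simp: k0_def)
  define y0 where "y0 = y + k0"
  have y0: "y0 \<in> unit_cell" using uniq[OF k0] by (simp add: y0_def)
  define f where "f = (\<lambda>i (z::int). of_real (tent_ft (\<epsilon> * (\<eta> $ i + of_int z))) * cis (2 * pi * (y0 $ i * (\<eta> $ i + of_int z))))"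
  have fi: "integrable (count_space UNIV) (f i)" for i
    by (rule Bochner_Integration.integrable_bound[OF integrable_tent_ft_int[OF \<epsilon>(1), of "\<eta> $ i"]])
       (auto simp: f_def norm_mult)
  have cis_sum: "cis (\<Sum>i\<in>A. c i) = (\<Prod>i\<in>A. cis (c i))" if "finite A" for A :: "'d set" and c
    using that by (induction A rule: finite_induct) (auto simp: cis_mult[symmetric])
  have "(LINT l|lattice_measure. of_real (Tent_ft (\<epsilon> *\<^sub>R (\<eta> + l))) * cis (2 * pi * (y \<bullet> (\<eta> + l)))) =
      (LINT l|lattice_measure. cis (- 2 * pi * (k0 \<bullet> \<eta>)) * (\<Prod>i\<in>UNIV. f i \<lfloor>l $ i\<rfloor>))"
  proof (intro Bochner_Integration.integral_cong refl)
    fix l :: "real^'d" assume "l \<in> space lattice_measure"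
    hence l: "l \<in> int_lattice" by simp
    have fl: "real_of_int \<lfloor>l $ i\<rfloor> = l $ i" for i
      using l by (auto simp: int_lattice_def elim!: Ints_cases)
    have "y \<bullet> (\<eta> + l) = y0 \<bullet> (\<eta> + l) - k0 \<bullet> \<eta> - k0 \<bullet> l" by (simp add: y0_def inner_simps)
    hence "2 * pi * (y \<bullet> (\<eta> + l)) = 2 * pi * (y0 \<bullet> (\<eta> + l)) + - 2 * pi * (k0 \<bullet> \<eta>) + - (2 * pi * (k0 \<bullet> l))"
      by (simp add: right_diff_distrib)
    hence "cis (2 * pi * (y \<bullet> (\<eta> + l))) = cis (2 * pi * (y0 \<bullet> (\<eta> + l))) * cis (- 2 * pi * (k0 \<bullet> \<eta>)) * cnj (cis (2 * pi * (k0 \<bullet> l)))"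
      by (simp only: cis_mult cis_cnj)
    also have "cis (2 * pi * (k0 \<bullet> l)) = 1" by (rule cis_int_lattice[OF k0 l])
    also have "cis (2 * pi * (y0 \<bullet> (\<eta> + l))) = (\<Prod>i\<in>UNIV. cis (2 * pi * (y0 $ i * (\<eta> $ i + l $ i))))"
      by (simp add: inner_vec_def sum_distrib_left cis_sum)
    finally show "of_real (Tent_ft (\<epsilon> *\<^sub>R (\<eta> + l))) * cis (2 * pi * (y \<bullet> (\<eta> + l))) = cis (- 2 * pi * (k0 \<bullet> \<eta>)) * (\<Prod>i\<in>UNIV. f i \<lfloor>l $ i\<rfloor>)"
      by (simp add: f_def fl prod.distrib Tent_ft_def mult_ac)
  qed
  also have "\<dots> = cis (- 2 * pi * (k0 \<bullet> \<eta>)) * (LINT l|(lattice_measure :: (real^'d) measure). (\<Prod>i\<in>UNIV. f i \<lfloor>l $ i\<rfloor>))"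
    by (rule integral_mult_right_zero)
  also have "(LINT l|(lattice_measure :: (real^'d) measure). (\<Prod>i\<in>UNIV. f i \<lfloor>l $ i\<rfloor>)) = (\<Prod>i\<in>UNIV. LINT z|count_space UNIV. f i z)"
    by (rule integral_lattice_prod[OF fi])
  also have "\<dots> = (\<Prod>i\<in>UNIV. of_real (tent (y0 $ i / \<epsilon>) / \<epsilon>))"
    unfolding f_def using y0 \<epsilon>
    by (intro prod.cong refl poisson_tent integrable_tent_ft_int) (auto simp: unit_cell_def less_imp_le)
  also have "\<dots> = of_real (mollifier \<epsilon> y0)"
    by (simp add: mollifier_def Tent_def prod_dividef power_one_over field_simps)
  finally have L: "(LINT l|lattice_measure. of_real (Tent_ft (\<epsilon> *\<^sub>R (\<eta> + l))) * cis (2 * pi * (y \<bullet> (\<eta> + l)))) =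
      cis (- 2 * pi * (k0 \<bullet> \<eta>)) * of_real (mollifier \<epsilon> y0)" .
  define F where "F = (\<lambda>k. complex_of_real (mollifier \<epsilon> (y + k)) * cis (- 2 * pi * (k \<bullet> \<eta>)))"
  have F0: "F k = 0" if "k \<in> int_lattice" "k \<noteq> k0" for k
    using mollifier_eq_0[OF \<epsilon>, of "y + k"] uniq[OF that(1)] that(2) by (simp add: F_def)
  have sub: "{k\<in>int_lattice. F k \<noteq> 0} \<subseteq> {k0}" using F0 by auto
  have "(LINT k|lattice_measure. F k) = (\<Sum>k\<in>{k\<in>int_lattice. F k \<noteq> 0}. F k)"
    by (rule lebesgue_integral_count_space_finite_support) (rule finite_subset[OF sub], simp)
  also have "\<dots> = (\<Sum>k\<in>{k0}. F k)"
    using sub k0 by (intro sum.mono_neutral_left) auto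
  finally have "(LINT k|lattice_measure. F k) = F k0" by simp
  thus ?thesis unfolding L F_def y0_def by (simp add: mult.commute)
qed

text \<open>For \<open>\<epsilon> <= 1/4\<close> the mollifier vanishes outside the unit cell, so at
  most one term is nonzero and the sum is at most the height.\<close>

lemma nn_integral_lattice_mollifier_le:
  fixes y :: "real^'d"
  assumes \<epsilon>: "0 < \<epsilon>" "\<epsilon> \<le> 1/4"
  shows "(\<integral>\<^sup>+k. ennreal (mollifier \<epsilon> (y + k)) \<partial>lattice_measure) \<le> ennreal ((1 / \<epsilon>) ^ CARD('d))"
proof -
  have "(\<integral>\<^sup>+k. ennreal (mollifier \<epsilon> (y + k)) \<partial>lattice_measure) \<le> (\<integral>\<^sup>+k. ennreal ((1 / \<epsilon>) ^ CARD('d)) * indicator unit_cell (y - (- k)) \<partial>lattice_measure)"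
  proof (rule nn_integral_mono)
    fix k :: "real^'d"
    show "ennreal (mollifier \<epsilon> (y + k)) \<le> ennreal ((1 / \<epsilon>) ^ CARD('d)) * indicator unit_cell (y - (- k))"
      using mollifier_eq_0[OF \<epsilon>, of "y + k"] mollifier_le[OF \<epsilon>(1), of "y + k"]
      by (cases "y + k \<in> unit_cell") (auto intro: ennreal_leI)
  qed
  also have "\<dots> = ennreal ((1 / \<epsilon>) ^ CARD('d)) * (\<integral>\<^sup>+k. indicator unit_cell (y - (- k)) \<partial>lattice_measure)"
    by (rule nn_integral_cmult) simp
  also have "(\<integral>\<^sup>+k. indicator unit_cell (y - (- k)) \<partial>lattice_measure) = (1::ennreal)"
    using nn_integral_lattice_minus[of "\<lambda>k. indicator unit_cell (y - k)"] nn_integral_lattice_indicator_unit_cell[of y] by simp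
  finally show ?thesis by simp
qed

definition mollify :: "real \<Rightarrow> (real^'d \<Rightarrow> complex) \<Rightarrow> real^'d \<Rightarrow> complex" where
  "mollify \<epsilon> \<phi> y = (LINT x|lborel. \<phi> x * of_real (mollifier \<epsilon> (y - x)))"

definition periodize :: "(real^'d \<Rightarrow> complex) \<Rightarrow> real^'d \<Rightarrow> complex" where
  "periodize H \<eta> = (LINT l|lattice_measure. H (\<eta> + l))"

text \<open>Uniform bounds on the lattice sums of \<open>w\<close> let the integrability of
  \<open>H\<close> control the double sum; this licenses the exchange in the unfolding
  below.\<close>

lemma integrable_mult_lattice_bounded:
  fixes H w :: "real^'d \<Rightarrow> complex"
  assumes H: "integrable lborel H" and [measurable]: "w \<in> borel_measurable borel" and C: "0 \<le> C"
    and w: "\<And>\<eta>. (\<integral>\<^sup>+l. ennreal (norm (w (\<eta> + l))) \<partial>lattice_measure) \<le> ennreal C"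
    and c: "\<And>\<eta> l. norm (c \<eta> l) \<le> 1" and cm: "\<And>l. (\<lambda>\<eta>. c \<eta> l) \<in> borel_measurable borel"
  shows "(\<integral>\<^sup>+\<eta>. \<integral>\<^sup>+l. ennreal (norm (H \<eta> * (w (\<eta> + l) * c \<eta> l))) \<partial>lattice_measure \<partial>lborel) < \<infinity>"
proof -
  have [measurable]: "H \<in> borel_measurable borel" using borel_measurable_integrable[OF H] by simp
  have "(\<integral>\<^sup>+\<eta>. \<integral>\<^sup>+l. ennreal (norm (H \<eta> * (w (\<eta> + l) * c \<eta> l))) \<partial>lattice_measure \<partial>lborel)
      \<le> (\<integral>\<^sup>+\<eta>. ennreal (norm (H \<eta>)) * ennreal C \<partial>lborel)"
  proof (rule nn_integral_mono)
    fix \<eta> :: "real^'d"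
    have "(\<integral>\<^sup>+l. ennreal (norm (H \<eta> * (w (\<eta> + l) * c \<eta> l))) \<partial>lattice_measure) \<le> (\<integral>\<^sup>+l. ennreal (norm (H \<eta>)) * ennreal (norm (w (\<eta> + l))) \<partial>lattice_measure)"
    proof (rule nn_integral_mono)
      fix l
      have "norm (w (\<eta> + l)) * norm (c \<eta> l) \<le> norm (w (\<eta> + l)) * 1" by (intro mult_left_mono c) auto
      hence "norm (H \<eta> * (w (\<eta> + l) * c \<eta> l)) \<le> norm (H \<eta>) * norm (w (\<eta> + l))"
        unfolding norm_mult by (intro mult_left_mono) auto
      thus "ennreal (norm (H \<eta> * (w (\<eta> + l) * c \<eta> l))) \<le> ennreal (norm (H \<eta>)) * ennreal (norm (w (\<eta> + l)))"
        by (simp add: ennreal_mult[symmetric] ennreal_leI)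
    qed
    also have "\<dots> = ennreal (norm (H \<eta>)) * (\<integral>\<^sup>+l. ennreal (norm (w (\<eta> + l))) \<partial>lattice_measure)"
      by (rule nn_integral_cmult) simp
    also have "\<dots> \<le> ennreal (norm (H \<eta>)) * ennreal C" by (rule mult_left_mono[OF w]) simp
    finally show "(\<integral>\<^sup>+l. ennreal (norm (H \<eta> * (w (\<eta> + l) * c \<eta> l))) \<partial>lattice_measure) \<le> ennreal (norm (H \<eta>)) * ennreal C" .
  qed
  also have "\<dots> = (\<integral>\<^sup>+\<eta>. ennreal (norm (H \<eta>)) \<partial>lborel) * ennreal C"
    by (rule nn_integral_multc) measurable
  also have "\<dots> < \<infinity>" using nn_integral_norm_lt_top[OF H] by (simp add: ennreal_mult_less_top)
  finally show ?thesis .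
qed

lemma nn_integral_lattice_swap_pair:
  fixes u :: "real^'d \<Rightarrow> real^'d \<Rightarrow> complex"
  assumes "\<And>l. (\<lambda>x. u x l) \<in> borel_measurable borel"
    and "(\<integral>\<^sup>+x. \<integral>\<^sup>+l. ennreal (norm (u x l)) \<partial>lattice_measure \<partial>lborel) < \<infinity>"
  shows integral_lattice_swap: "(LINT x|lborel. LINT l|lattice_measure. u x l) = (LINT l|lattice_measure. LINT x|lborel. u x l)"
    and integrable_lattice_integral: "integrable lborel (\<lambda>x. LINT l|lattice_measure. u x l)"
proof -
  have m: "(\<lambda>(l, x). u x l) \<in> borel_measurable (lattice_measure \<Otimes>\<^sub>M lborel)"
    by (rule measurable_lattice_pair) (use assms(1) in simp)
  have fin: "(\<integral>\<^sup>+l. \<integral>\<^sup>+x. ennreal (norm (u x l)) \<partial>lborel \<partial>lattice_measure) < \<infinity>"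
    by (subst nn_integral_lattice_lborel_swap[symmetric]) (use assms in auto)
  show "(LINT x|lborel. LINT l|lattice_measure. u x l) = (LINT l|lattice_measure. LINT x|lborel. u x l)"
    by (rule lattice_lborel.integral_swapI[OF m fin, symmetric])
  show "integrable lborel (\<lambda>x. LINT l|lattice_measure. u x l)"
    by (rule lattice_lborel.integrable_snd[OF lattice_lborel.integrable_pairI[OF m fin]])
qed

lemma integral_lborel_shift:
  fixes u :: "'a::euclidean_space \<Rightarrow> complex"
  assumes [measurable]: "u \<in> borel_measurable borel"
  shows "(LINT x|lborel. u (x + l)) = (LINT x|lborel. u x)"
proof -
  have "(LINT x|lborel. u x) = (LINT x|distr lborel borel ((+) l). u x)"
    by (simp add: lborel_distr_plus)
  also have "\<dots> = (LINT x|lborel. u (l + x))"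
    by (subst integral_distr) auto
  finally show ?thesis by (simp add: add.commute)
qed

lemma integral_lattice_minus:
  fixes u :: "real^'d \<Rightarrow> complex"
  shows "(LINT l|lattice_measure. u (- l)) = (LINT l|lattice_measure. u l)"
proof (rule integral_bij_count_space)
  show "bij_betw uminus int_lattice int_lattice"
    by (rule bij_betwI[where g = uminus]) (auto simp: int_lattice_minus)
qed

text \<open>Poisson summation for the convolution of \<phi> with the mollifier, obtained by
  integrating \<open>poisson_mollifier\<close> at \<open>y - x\<close> against
  \<open>\<phi> x\<close>. The mollifier makes all sums absolutely convergent although \<phi> is
  merely integrable.\<close>

lemma zak_mollify:
  fixes \<phi> :: "real^'d \<Rightarrow> complex" and y \<eta> :: "real^'d"
  assumes \<phi>: "integrable lborel \<phi>" and \<epsilon>: "0 < \<epsilon>" "\<epsilon> \<le> 1/4"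
  shows "(LINT l|lattice_measure. ft \<phi> (\<eta> + l) * of_real (Tent_ft (\<epsilon> *\<^sub>R (\<eta> + l))) * cis (2 * pi * (y \<bullet> (\<eta> + l)))) =
    (LINT k|lattice_measure. mollify \<epsilon> \<phi> (y + k) * cis (- 2 * pi * (k \<bullet> \<eta>)))"
proof -
  have [measurable]: "\<phi> \<in> borel_measurable borel" using borel_measurable_integrable[OF \<phi>] by simp
  obtain C where C: "0 \<le> C" "\<And>\<eta> :: real^'d. (\<integral>\<^sup>+l. ennreal (Tent_ft (\<epsilon> *\<^sub>R (\<eta> + l))) \<partial>lattice_measure) \<le> ennreal C"
    using lattice_sum_Tent_ft_le[OF \<epsilon>(1)] by blast
  define u where "u = (\<lambda>x l. \<phi> x * (of_real (Tent_ft (\<epsilon> *\<^sub>R (\<eta> + l))) * cis (2 * pi * ((y - x) \<bullet> (\<eta> + l)))))"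
  define v where "v = (\<lambda>x k. \<phi> x * (of_real (mollifier \<epsilon> (y - x + k)) * cis (- 2 * pi * (k \<bullet> \<eta>))))"
  have "ft \<phi> (\<eta> + l) * of_real (Tent_ft (\<epsilon> *\<^sub>R (\<eta> + l))) * cis (2 * pi * (y \<bullet> (\<eta> + l))) = (LINT x|lborel. u x l)" for l
  proof -
    have "cis (2 * pi * ((y - x) \<bullet> (\<eta> + l))) = cis (- 2 * pi * (x \<bullet> (\<eta> + l))) * cis (2 * pi * (y \<bullet> (\<eta> + l)))" for x
      unfolding cis_mult by (simp add: inner_diff_left algebra_simps)
    hence "u x l = \<phi> x * cis (- 2 * pi * (x \<bullet> (\<eta> + l))) * (of_real (Tent_ft (\<epsilon> *\<^sub>R (\<eta> + l))) * cis (2 * pi * (y \<bullet> (\<eta> + l))))" for x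
      unfolding u_def by (simp only: mult_ac)
    hence "(LINT x|lborel. u x l) = ft \<phi> (\<eta> + l) * (of_real (Tent_ft (\<epsilon> *\<^sub>R (\<eta> + l))) * cis (2 * pi * (y \<bullet> (\<eta> + l))))"
      unfolding ft_def by (simp only: integral_mult_left_zero)
    thus ?thesis by (simp only: mult.assoc)
  qed
  hence "(LINT l|lattice_measure. ft \<phi> (\<eta> + l) * of_real (Tent_ft (\<epsilon> *\<^sub>R (\<eta> + l))) * cis (2 * pi * (y \<bullet> (\<eta> + l)))) =
      (LINT l|lattice_measure. LINT x|lborel. u x l)" by (simp only:)
  also have "\<dots> = (LINT x|lborel. LINT l|lattice_measure. u x l)"
  proof (rule integral_lattice_swap[symmetric])
    show "(\<lambda>x. u x l) \<in> borel_measurable borel" for l unfolding u_def by measurable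
    have "(\<integral>\<^sup>+l. ennreal (norm (u x l)) \<partial>lattice_measure) \<le> ennreal (norm (\<phi> x)) * ennreal C" for x
    proof -
      have "(\<integral>\<^sup>+l. ennreal (norm (u x l)) \<partial>lattice_measure) = (\<integral>\<^sup>+l. ennreal (norm (\<phi> x)) * ennreal (Tent_ft (\<epsilon> *\<^sub>R (\<eta> + l))) \<partial>lattice_measure)"
        by (intro nn_integral_cong) (simp add: u_def norm_mult ennreal_mult[symmetric] Tent_ft_nonneg)
      also have "\<dots> = ennreal (norm (\<phi> x)) * (\<integral>\<^sup>+l. ennreal (Tent_ft (\<epsilon> *\<^sub>R (\<eta> + l))) \<partial>lattice_measure)"
        by (rule nn_integral_cmult) simp
      also have "\<dots> \<le> ennreal (norm (\<phi> x)) * ennreal C" by (rule mult_left_mono[OF C(2)]) simp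
      finally show ?thesis .
    qed
    hence "(\<integral>\<^sup>+x. \<integral>\<^sup>+l. ennreal (norm (u x l)) \<partial>lattice_measure \<partial>lborel) \<le> (\<integral>\<^sup>+x. ennreal (norm (\<phi> x)) * ennreal C \<partial>lborel)"
      by (rule nn_integral_mono)
    also have "\<dots> = (\<integral>\<^sup>+x. ennreal (norm (\<phi> x)) \<partial>lborel) * ennreal C" by (rule nn_integral_multc) measurable
    also have "\<dots> < \<infinity>" using nn_integral_norm_lt_top[OF \<phi>] by (simp add: ennreal_mult_less_top)
    finally show "(\<integral>\<^sup>+x. \<integral>\<^sup>+l. ennreal (norm (u x l)) \<partial>lattice_measure \<partial>lborel) < \<infinity>" .
  qed
  also have "\<dots> = (LINT x|lborel. LINT k|lattice_measure. v x k)"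
    unfolding u_def v_def integral_mult_right_zero by (subst poisson_mollifier[OF \<epsilon>]) rule
  also have "\<dots> = (LINT k|lattice_measure. LINT x|lborel. v x k)"
  proof (rule integral_lattice_swap)
    show "(\<lambda>x. v x l) \<in> borel_measurable borel" for l unfolding v_def by measurable
    have "(\<integral>\<^sup>+l. ennreal (norm (v x l)) \<partial>lattice_measure) \<le> ennreal (norm (\<phi> x)) * ennreal ((1 / \<epsilon>) ^ CARD('d))" for x
    proof -
      have "(\<integral>\<^sup>+l. ennreal (norm (v x l)) \<partial>lattice_measure) = (\<integral>\<^sup>+l. ennreal (norm (\<phi> x)) * ennreal (mollifier \<epsilon> (y - x + l)) \<partial>lattice_measure)"
        by (intro nn_integral_cong) (simp add: v_def norm_mult ennreal_mult[symmetric] mollifier_nonneg[OF \<epsilon>(1)])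
      also have "\<dots> = ennreal (norm (\<phi> x)) * (\<integral>\<^sup>+l. ennreal (mollifier \<epsilon> (y - x + l)) \<partial>lattice_measure)"
        by (rule nn_integral_cmult) simp
      also have "\<dots> \<le> ennreal (norm (\<phi> x)) * ennreal ((1 / \<epsilon>) ^ CARD('d))"
        by (rule mult_left_mono[OF nn_integral_lattice_mollifier_le[OF \<epsilon>]]) simp
      finally show ?thesis .
    qed
    hence "(\<integral>\<^sup>+x. \<integral>\<^sup>+l. ennreal (norm (v x l)) \<partial>lattice_measure \<partial>lborel) \<le> (\<integral>\<^sup>+x. ennreal (norm (\<phi> x)) * ennreal ((1 / \<epsilon>) ^ CARD('d)) \<partial>lborel)"
      by (rule nn_integral_mono)
    also have "\<dots> = (\<integral>\<^sup>+x. ennreal (norm (\<phi> x)) \<partial>lborel) * ennreal ((1 / \<epsilon>) ^ CARD('d))" by (rule nn_integral_multc) measurable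
    also have "\<dots> < \<infinity>" using nn_integral_norm_lt_top[OF \<phi>] by (simp add: ennreal_mult_less_top)
    finally show "(\<integral>\<^sup>+x. \<integral>\<^sup>+l. ennreal (norm (v x l)) \<partial>lattice_measure \<partial>lborel) < \<infinity>" .
  qed
  also have "\<dots> = (LINT k|lattice_measure. mollify \<epsilon> \<phi> (y + k) * cis (- 2 * pi * (k \<bullet> \<eta>)))"
  proof (intro Bochner_Integration.integral_cong refl)
    fix k
    have "v x k = \<phi> x * of_real (mollifier \<epsilon> (y + k - x)) * cis (- 2 * pi * (k \<bullet> \<eta>))" for x
    proof -
      have "y - x + k = y + k - x" by simp
      thus ?thesis unfolding v_def by (simp only: mult.assoc)
    qed
    thus "(LINT x|lborel. v x k) = mollify \<epsilon> \<phi> (y + k) * cis (- 2 * pi * (k \<bullet> \<eta>))"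
      unfolding mollify_def by (simp only: integral_mult_left_zero)
  qed
  finally show ?thesis .
qed

lemma nn_integral_lattice_mollify_le:
  fixes \<phi> :: "real^'d \<Rightarrow> complex" and y :: "real^'d"
  assumes \<phi>: "integrable lborel \<phi>" and \<epsilon>: "0 < \<epsilon>" "\<epsilon> \<le> 1/4"
  shows "(\<integral>\<^sup>+k. ennreal (norm (mollify \<epsilon> \<phi> (y + k))) \<partial>lattice_measure) \<le>
     (\<integral>\<^sup>+x. ennreal (norm (\<phi> x)) \<partial>lborel) * ennreal ((1 / \<epsilon>) ^ CARD('d))"
proof -
  have [measurable]: "\<phi> \<in> borel_measurable borel" using borel_measurable_integrable[OF \<phi>] by simp
  have "(\<integral>\<^sup>+k. ennreal (norm (mollify \<epsilon> \<phi> (y + k))) \<partial>lattice_measure) \<le>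
      (\<integral>\<^sup>+k. \<integral>\<^sup>+x. ennreal (norm (\<phi> x)) * ennreal (mollifier \<epsilon> (y - x + k)) \<partial>lborel \<partial>lattice_measure)"
  proof (rule nn_integral_mono)
    fix k
    have "integrable lborel (\<lambda>x. \<phi> x * of_real (mollifier \<epsilon> (y + k - x)))"
    proof (rule integrable_mult_bounded[OF \<phi>, of _ "(1 / \<epsilon>) ^ CARD('d)"])
      fix x :: "real^'d"
      show "norm (complex_of_real (mollifier \<epsilon> (y + k - x))) \<le> (1 / \<epsilon>) ^ CARD('d)"
        using mollifier_nonneg[OF \<epsilon>(1), of "y + k - x"] mollifier_le[OF \<epsilon>(1), of "y + k - x"] by simp
    qed measurable
    hence "ennreal (norm (mollify \<epsilon> \<phi> (y + k))) \<le> (\<integral>\<^sup>+x. ennreal (norm (\<phi> x * of_real (mollifier \<epsilon> (y + k - x)))) \<partial>lborel)"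
      unfolding mollify_def by (rule integral_norm_bound_ennreal)
    also have "\<dots> = (\<integral>\<^sup>+x. ennreal (norm (\<phi> x)) * ennreal (mollifier \<epsilon> (y - x + k)) \<partial>lborel)"
      by (intro nn_integral_cong) (simp add: norm_mult ennreal_mult[symmetric] mollifier_nonneg[OF \<epsilon>(1)] algebra_simps)
    finally show "ennreal (norm (mollify \<epsilon> \<phi> (y + k))) \<le> (\<integral>\<^sup>+x. ennreal (norm (\<phi> x)) * ennreal (mollifier \<epsilon> (y - x + k)) \<partial>lborel)" .
  qed
  also have "\<dots> = (\<integral>\<^sup>+x. \<integral>\<^sup>+k. ennreal (norm (\<phi> x)) * ennreal (mollifier \<epsilon> (y - x + k)) \<partial>lattice_measure \<partial>lborel)"
    by (rule nn_integral_lattice_lborel_swap[symmetric]) measurable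
  also have "\<dots> \<le> (\<integral>\<^sup>+x. ennreal (norm (\<phi> x)) * ennreal ((1 / \<epsilon>) ^ CARD('d)) \<partial>lborel)"
    by (intro nn_integral_mono) (simp add: nn_integral_cmult mult_left_mono[OF nn_integral_lattice_mollifier_le[OF \<epsilon>]])
  also have "\<dots> = (\<integral>\<^sup>+x. ennreal (norm (\<phi> x)) \<partial>lborel) * ennreal ((1 / \<epsilon>) ^ CARD('d))"
    by (rule nn_integral_multc) measurable
  finally show ?thesis .
qed

text \<open>Unfolding: shifting the integration variable by \<open>l\<close> moves the periodization
  from \<open>H\<close> to the damped transform of \<phi>, whose lattice sum
  \<open>zak_mollify\<close> turns into a series of shifts; integrating this against
  \<open>H\<close> produces the samples \<open>ft H k\<close>.\<close>

lemma
  fixes \<phi> H :: "real^'d \<Rightarrow> complex" and y :: "real^'d"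
  assumes \<phi>: "integrable lborel \<phi>" and H: "integrable lborel H" and \<epsilon>: "0 < \<epsilon>" "\<epsilon> \<le> 1/4"
  shows integral_ft_periodize:
    "(LINT \<eta>|lborel. ft \<phi> \<eta> * periodize H \<eta> * of_real (Tent_ft (\<epsilon> *\<^sub>R \<eta>)) * cis (2 * pi * (y \<bullet> \<eta>))) =
      (LINT k|lattice_measure. ft H k * mollify \<epsilon> \<phi> (y + k))" (is ?eq)
    and integrable_ft_periodize:
    "integrable lborel (\<lambda>\<eta>. ft \<phi> \<eta> * periodize H \<eta> * of_real (Tent_ft (\<epsilon> *\<^sub>R \<eta>)) * cis (2 * pi * (y \<bullet> \<eta>)))" (is ?int)
proof -
  have [measurable]: "H \<in> borel_measurable borel" using borel_measurable_integrable[OF H] by simp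
  have [measurable]: "ft \<phi> \<in> borel_measurable borel" using \<phi> by measurable
  obtain C where C: "0 \<le> C" "\<And>\<eta> :: real^'d. (\<integral>\<^sup>+l. ennreal (Tent_ft (\<epsilon> *\<^sub>R (\<eta> + l))) \<partial>lattice_measure) \<le> ennreal C"
    using lattice_sum_Tent_ft_le[OF \<epsilon>(1)] by blast
  define B where "B = (LINT x|lborel. norm (\<phi> x))"
  have B: "0 \<le> B" by (simp add: B_def)
  define w where "w = (\<lambda>\<eta>. ft \<phi> \<eta> * of_real (Tent_ft (\<epsilon> *\<^sub>R \<eta>)))"
  have [measurable]: "w \<in> borel_measurable borel" unfolding w_def by measurable
  have wC: "(\<integral>\<^sup>+l. ennreal (norm (w (\<eta> + l))) \<partial>lattice_measure) \<le> ennreal (B * C)" for \<eta>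
  proof -
    have "(\<integral>\<^sup>+l. ennreal (norm (w (\<eta> + l))) \<partial>lattice_measure) \<le> (\<integral>\<^sup>+l. ennreal B * ennreal (Tent_ft (\<epsilon> *\<^sub>R (\<eta> + l))) \<partial>lattice_measure)"
      using norm_ft_le[of \<phi>, folded B_def]
      by (intro nn_integral_mono) (auto simp: w_def norm_mult ennreal_mult[symmetric] B Tent_ft_nonneg intro!: ennreal_leI mult_right_mono)
    also have "\<dots> = ennreal B * (\<integral>\<^sup>+l. ennreal (Tent_ft (\<epsilon> *\<^sub>R (\<eta> + l))) \<partial>lattice_measure)"
      by (rule nn_integral_cmult) simp
    also have "\<dots> \<le> ennreal B * ennreal C" by (rule mult_left_mono[OF C(2)]) simp
    finally show ?thesis by (simp add: ennreal_mult[symmetric] B C)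
  qed
  have BC: "0 \<le> B * C" using B C by simp
  define e where "e = (\<lambda>\<eta>. cis (2 * pi * (y \<bullet> \<eta>)))"
  have [measurable]: "e \<in> borel_measurable borel" unfolding e_def by measurable
  define U where "U = (\<lambda>\<eta> l. H \<eta> * (w (\<eta> + l) * e (\<eta> + l)))"
  have Um [measurable]: "(\<lambda>\<eta>. U \<eta> l) \<in> borel_measurable borel" for l unfolding U_def by measurable
  have Ufin: "(\<integral>\<^sup>+\<eta>. \<integral>\<^sup>+l. ennreal (norm (U \<eta> l)) \<partial>lattice_measure \<partial>lborel) < \<infinity>"
    unfolding U_def by (rule integrable_mult_lattice_bounded[OF H _ BC wC]) (auto simp: e_def)
  define V where "V = (\<lambda>\<eta> l. H (\<eta> + l) * (w \<eta> * e \<eta>))"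
  have Vm [measurable]: "(\<lambda>\<eta>. V \<eta> l) \<in> borel_measurable borel" for l unfolding V_def by measurable
  \<comment> \<open>\<open>V\<close> carries the periodization of \<open>H\<close>, \<open>U\<close>
    that of the other factor; they are matched by shifting \<eta> by \<open>l\<close> and reflecting
    \<open>l\<close>.\<close>
  have UV: "V (\<eta> + l) (- l) = U \<eta> l" for \<eta> l by (simp add: U_def V_def)
  have Vfin: "(\<integral>\<^sup>+\<eta>. \<integral>\<^sup>+l. ennreal (norm (V \<eta> l)) \<partial>lattice_measure \<partial>lborel) < \<infinity>"
  proof -
    have "(\<integral>\<^sup>+\<eta>. \<integral>\<^sup>+l. ennreal (norm (V \<eta> l)) \<partial>lattice_measure \<partial>lborel) = (\<integral>\<^sup>+l. \<integral>\<^sup>+\<eta>. ennreal (norm (V \<eta> l)) \<partial>lborel \<partial>lattice_measure)"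
      by (rule nn_integral_lattice_lborel_swap) measurable
    also have "\<dots> = (\<integral>\<^sup>+l. \<integral>\<^sup>+\<eta>. ennreal (norm (V \<eta> (- l))) \<partial>lborel \<partial>lattice_measure)"
      by (rule nn_integral_lattice_minus[symmetric])
    also have "\<dots> = (\<integral>\<^sup>+l. \<integral>\<^sup>+\<eta>. ennreal (norm (V (\<eta> + l) (- l))) \<partial>lborel \<partial>lattice_measure)"
    proof (rule nn_integral_cong)
      fix l :: "real^'d"
      show "(\<integral>\<^sup>+\<eta>. ennreal (norm (V \<eta> (- l))) \<partial>lborel) = (\<integral>\<^sup>+\<eta>. ennreal (norm (V (\<eta> + l) (- l))) \<partial>lborel)"
        by (rule nn_integral_lborel_shift[symmetric, of "\<lambda>\<eta>. ennreal (norm (V \<eta> (- l)))"]) measurable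
    qed
    also have "\<dots> = (\<integral>\<^sup>+\<eta>. \<integral>\<^sup>+l. ennreal (norm (U \<eta> l)) \<partial>lattice_measure \<partial>lborel)"
      unfolding UV by (rule nn_integral_lattice_lborel_swap[symmetric]) measurable
    finally show ?thesis using Ufin by simp
  qed
  have V: "ft \<phi> \<eta> * periodize H \<eta> * of_real (Tent_ft (\<epsilon> *\<^sub>R \<eta>)) * cis (2 * pi * (y \<bullet> \<eta>)) = (LINT l|lattice_measure. V \<eta> l)" for \<eta>
  proof -
    have "(LINT l|lattice_measure. V \<eta> l) = periodize H \<eta> * (w \<eta> * e \<eta>)"
      unfolding V_def periodize_def by (rule integral_mult_left_zero)
    thus ?thesis unfolding w_def e_def by (simp only: mult_ac)
  qed
  show ?int unfolding V by (rule integrable_lattice_integral[OF Vm Vfin])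
  have "(LINT \<eta>|lborel. LINT l|lattice_measure. V \<eta> l) = (LINT l|lattice_measure. LINT \<eta>|lborel. V \<eta> l)"
    by (rule integral_lattice_swap[OF Vm Vfin])
  also have "\<dots> = (LINT l|lattice_measure. LINT \<eta>|lborel. V \<eta> (- l))"
    by (rule integral_lattice_minus[symmetric])
  also have "\<dots> = (LINT l|lattice_measure. LINT \<eta>|lborel. V (\<eta> + l) (- l))"
  proof (rule Bochner_Integration.integral_cong[OF refl])
    fix l :: "real^'d"
    show "(LINT \<eta>|lborel. V \<eta> (- l)) = (LINT \<eta>|lborel. V (\<eta> + l) (- l))"
      by (rule integral_lborel_shift[symmetric]) measurable
  qed
  also have "\<dots> = (LINT \<eta>|lborel. LINT l|lattice_measure. U \<eta> l)"
    unfolding UV by (rule integral_lattice_swap[OF Um Ufin, symmetric])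
  also have "\<dots> = (LINT \<eta>|lborel. LINT k|lattice_measure. H \<eta> * (mollify \<epsilon> \<phi> (y + k) * cis (- 2 * pi * (k \<bullet> \<eta>))))"
    unfolding U_def w_def e_def integral_mult_right_zero by (subst zak_mollify[OF \<phi> \<epsilon>]) rule
  also have "\<dots> = (LINT k|lattice_measure. LINT \<eta>|lborel. H \<eta> * (mollify \<epsilon> \<phi> (y + k) * cis (- 2 * pi * (k \<bullet> \<eta>))))"
  proof (rule integral_lattice_swap)
    define C' where "C' = (\<integral>\<^sup>+x. ennreal (norm (\<phi> x)) \<partial>lborel) * ennreal ((1 / \<epsilon>) ^ CARD('d))"
    have "C' < \<infinity>" unfolding C'_def using nn_integral_norm_lt_top[OF \<phi>] by (simp add: ennreal_mult_less_top)
    have "(\<integral>\<^sup>+\<eta>. \<integral>\<^sup>+k. ennreal (norm (H \<eta> * (mollify \<epsilon> \<phi> (y + k) * cis (- 2 * pi * (k \<bullet> \<eta>))))) \<partial>lattice_measure \<partial>lborel) =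
       (\<integral>\<^sup>+\<eta>. ennreal (norm (H \<eta>)) * (\<integral>\<^sup>+k. ennreal (norm (mollify \<epsilon> \<phi> (y + k))) \<partial>lattice_measure) \<partial>lborel)"
      by (simp add: norm_mult ennreal_mult nn_integral_cmult)
    also have "\<dots> \<le> (\<integral>\<^sup>+\<eta>. ennreal (norm (H \<eta>)) * C' \<partial>lborel)"
      unfolding C'_def by (intro nn_integral_mono mult_left_mono nn_integral_lattice_mollify_le[OF \<phi> \<epsilon>]) simp
    also have "\<dots> = (\<integral>\<^sup>+\<eta>. ennreal (norm (H \<eta>)) \<partial>lborel) * C'" by (rule nn_integral_multc) measurable
    also have "\<dots> < \<infinity>" using nn_integral_norm_lt_top[OF H] \<open>C' < \<infinity>\<close> by (simp add: ennreal_mult_less_top)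
    finally show "(\<integral>\<^sup>+\<eta>. \<integral>\<^sup>+k. ennreal (norm (H \<eta> * (mollify \<epsilon> \<phi> (y + k) * cis (- 2 * pi * (k \<bullet> \<eta>))))) \<partial>lattice_measure \<partial>lborel) < \<infinity>" .
  qed measurable
  also have "\<dots> = (LINT k|lattice_measure. ft H k * mollify \<epsilon> \<phi> (y + k))"
  proof (intro Bochner_Integration.integral_cong refl)
    fix k :: "real^'d"
    have "H \<eta> * (mollify \<epsilon> \<phi> (y + k) * cis (- 2 * pi * (k \<bullet> \<eta>))) = H \<eta> * cis (- 2 * pi * (\<eta> \<bullet> k)) * mollify \<epsilon> \<phi> (y + k)" for \<eta>
      by (simp only: inner_commute mult_ac)
    thus "(LINT \<eta>|lborel. H \<eta> * (mollify \<epsilon> \<phi> (y + k) * cis (- 2 * pi * (k \<bullet> \<eta>)))) = ft H k * mollify \<epsilon> \<phi> (y + k)"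
      unfolding ft_def by (simp only: integral_mult_left_zero)
  qed
  finally show ?eq unfolding V .
qed

section \<open>Removing the regularisation\<close>

lemma AE_lborel_shift:
  fixes R :: "'a::euclidean_space \<Rightarrow> bool"
  assumes "AE x in lborel. R x"
  shows "AE x in lborel. R (x + k)"
proof -
  obtain N where N: "N \<in> null_sets lborel" "{x. \<not> R x} \<subseteq> N"
    using assms by (auto simp: eventually_ae_filter)
  hence [measurable]: "N \<in> sets borel" by auto
  have "emeasure lborel {x. x + k \<in> N} = (\<integral>\<^sup>+x. indicator {x. x + k \<in> N} x \<partial>lborel)"
    by (rule nn_integral_indicator[symmetric]) measurable
  also have "\<dots> = (\<integral>\<^sup>+x. indicator N (x + k) \<partial>lborel)"
    by (intro nn_integral_cong) (auto split: split_indicator)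
  also have "\<dots> = (\<integral>\<^sup>+x. indicator N x \<partial>lborel)" by (rule nn_integral_lborel_shift) measurable
  also have "\<dots> = 0" using N by auto
  finally have "{x. x + k \<in> N} \<in> null_sets lborel" by (intro null_setsI) auto
  thus ?thesis by (rule AE_I') (use N in auto)
qed

lemma AE_lborel_uminus:
  fixes R :: "'a::euclidean_space \<Rightarrow> bool"
  assumes "AE x in lborel. R x"
  shows "AE x in lborel. R (- x)"
proof -
  obtain N where N: "N \<in> null_sets lborel" "{x. \<not> R x} \<subseteq> N"
    using assms by (auto simp: eventually_ae_filter)
  hence [measurable]: "N \<in> sets borel" by auto
  have "emeasure lborel {x. - x \<in> N} = emeasure (distr lborel borel uminus) N"
    by (subst emeasure_distr) (auto simp: vimage_def)
  also have "\<dots> = 0" using N by (auto simp: lborel_distr_uminus_vec)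
  finally have "{x. - x \<in> N} \<in> null_sets lborel" by (intro null_setsI) auto
  thus ?thesis by (rule AE_I') (use N in auto)
qed

text \<open>Tiling makes the sum integrable over the unit cell, hence finite almost everywhere
  there. It is periodic, and countably many shifts of a null set are null, so it is finite almost
  everywhere.\<close>

lemma AE_lattice_sum_finite:
  fixes u :: "real^'d \<Rightarrow> ennreal"
  assumes [measurable]: "u \<in> borel_measurable borel" and fin: "(\<integral>\<^sup>+x. u x \<partial>lborel) < \<infinity>"
  shows "AE y in lborel. (\<integral>\<^sup>+k. u (y + k) \<partial>lattice_measure) < \<infinity>"
proof -
  define S where "S = (\<lambda>y. \<integral>\<^sup>+k. u (y + k) \<partial>lattice_measure)"
  have [measurable]: "S \<in> borel_measurable borel"
    unfolding S_def by (rule borel_measurable_nn_integral_lattice) measurable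
  have "(\<integral>\<^sup>+x. indicator unit_cell x * S x \<partial>lborel) \<noteq> \<infinity>"
    using fin nn_integral_tiling[of u] by (simp add: S_def)
  hence "AE y in lborel. indicator unit_cell y * S y \<noteq> \<infinity>"
    by (intro nn_integral_PInf_AE) auto
  hence Q: "AE y in lborel. y \<in> unit_cell \<longrightarrow> S y < \<infinity>"
    by eventually_elim (auto simp: less_top)
  have "AE y in lborel. \<forall>k\<in>int_lattice. y + - k \<in> unit_cell \<longrightarrow> S (y + - k) < \<infinity>"
    by (intro AE_ball_countable' AE_lborel_shift[OF Q] countable_int_lattice)
  thus ?thesis
  proof eventually_elim
    fix y assume y: "\<forall>k\<in>int_lattice. y + - k \<in> unit_cell \<longrightarrow> S (y + - k) < \<infinity>"
    obtain k where k: "k \<in> int_lattice" "y - k \<in> unit_cell"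
      by (rule unit_cell_minus_lattice[of y]) blast
    have "(\<integral>\<^sup>+l. u (y + l) \<partial>lattice_measure) = (\<integral>\<^sup>+l. u ((y - k) + (l + k)) \<partial>lattice_measure)" by (simp add: algebra_simps)
    also have "\<dots> = S (y + - k)" unfolding S_def using nn_integral_lattice_shift[OF k(1), of "\<lambda>l. u ((y - k) + l)"] by simp
    also have "\<dots> < \<infinity>" using y k by auto
    finally show "(\<integral>\<^sup>+l. u (y + l) \<partial>lattice_measure) < \<infinity>" .
  qed
qed

lemma nn_integral_mollifier:
  assumes \<epsilon>: "0 < \<epsilon>"
  shows "(\<integral>\<^sup>+x. ennreal (mollifier \<epsilon> (x :: real^'d)) \<partial>lborel) = 1"
proof -
  have "(LINT x|lborel. complex_of_real (Tent (x :: real^'d))) = 1"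
    using ft_Tent[of "0 :: real^'d"] by (simp add: ft_def Tent_ft_zero)
  hence I: "(LINT x|lborel. Tent (x :: real^'d)) = 1"
    by (metis integral_complex_of_real of_real_eq_1_iff)
  have int: "integrable lborel (Tent :: real^'d \<Rightarrow> real)"
    using integrable_Tent[where 'd = 'd] by (simp add: complex_of_real_integrable_eq)
  have T1: "(\<integral>\<^sup>+x. ennreal (Tent (x :: real^'d)) \<partial>lborel) = 1"
    using nn_integral_eq_integral[OF int] I by (simp add: Tent_nonneg)
  have "(\<integral>\<^sup>+x. ennreal (Tent (x :: real^'d)) \<partial>lborel) = ennreal ((1 / \<epsilon>) ^ CARD('d)) * (\<integral>\<^sup>+x. ennreal (Tent ((1 / \<epsilon>) *\<^sub>R x :: real^'d)) \<partial>lborel)"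
    using \<epsilon> by (subst nn_integral_lborel_scale[of "\<lambda>x. ennreal (Tent x)" "1 / \<epsilon>"]) auto
  also have "\<dots> = (\<integral>\<^sup>+x. ennreal ((1 / \<epsilon>) ^ CARD('d)) * ennreal (Tent ((1 / \<epsilon>) *\<^sub>R x :: real^'d)) \<partial>lborel)"
    by (rule nn_integral_cmult[symmetric]) measurable
  also have "\<dots> = (\<integral>\<^sup>+x. ennreal (mollifier \<epsilon> (x :: real^'d)) \<partial>lborel)"
    using \<epsilon> by (intro nn_integral_cong) (simp only: mollifier_def ennreal_mult Tent_nonneg zero_le_power zero_le_divide_1_iff less_imp_le)
  finally show ?thesis using T1 by simp
qed

lemma mollifier_support:
  fixes x :: "real^'d"
  assumes "0 < \<epsilon>" "mollifier \<epsilon> x \<noteq> 0"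
  shows "norm x \<le> real CARD('d) * \<epsilon>"
proof -
  have "\<bar>x $ i\<bar> \<le> \<epsilon>" for i
  proof (rule ccontr)
    assume "\<not> \<bar>x $ i\<bar> \<le> \<epsilon>"
    hence "1 \<le> \<bar>((1 / \<epsilon>) *\<^sub>R x) $ i\<bar>" using assms(1) by (simp add: abs_mult field_simps)
    thus False using assms(2) by (simp add: mollifier_def Tent_eq_0)
  qed
  hence "(\<Sum>i\<in>UNIV. \<bar>x $ i\<bar>) \<le> (\<Sum>i\<in>(UNIV :: 'd set). \<epsilon>)" by (intro sum_mono)
  thus ?thesis using norm_le_l1_cart[of x] by simp
qed

lemma borel_measurable_mollify [measurable]:
  assumes [measurable]: "\<phi> \<in> borel_measurable borel"
  shows "mollify \<epsilon> \<phi> \<in> borel_measurable borel"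
  unfolding mollify_def[abs_def] by measurable

text \<open>\<open>mollify \<epsilon> \<phi> y - \<phi> y\<close> is an average of
  \<open>\<phi> (y - t) - \<phi> y\<close> over \<open>t\<close> of norm at most
  \<open>CARD('d) * \<epsilon>\<close>, so the L1 continuity of translations bounds it.\<close>

lemma mollify_tendsto_L1:
  fixes \<phi> :: "real^'d \<Rightarrow> complex"
  assumes \<phi>: "integrable lborel \<phi>" and e: "0 < e"
  obtains d where "0 < d" "\<And>\<epsilon>. 0 < \<epsilon> \<Longrightarrow> \<epsilon> < d \<Longrightarrow> (\<integral>\<^sup>+y. ennreal (norm (mollify \<epsilon> \<phi> y - \<phi> y)) \<partial>lborel) \<le> ennreal e"
proof -
  have [measurable]: "\<phi> \<in> borel_measurable borel" using borel_measurable_integrable[OF \<phi>] by simp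
  obtain d where d: "0 < d" "\<And>t. norm t < d \<Longrightarrow> (\<integral>\<^sup>+x. ennreal (norm (\<phi> (x + t) - \<phi> x)) \<partial>lborel) \<le> ennreal e"
    using integrable_translation_L1[OF \<phi>] e by blast
  show ?thesis
  proof (rule that[of "d / real CARD('d)"])
    show "0 < d / real CARD('d)" using d(1) by simp
    fix \<epsilon> :: real assume \<epsilon>: "0 < \<epsilon>" "\<epsilon> < d / real CARD('d)"
    have \<gamma>0: "0 \<le> mollifier \<epsilon> x" for x :: "real^'d" by (rule mollifier_nonneg[OF \<epsilon>(1)])
    have \<gamma>B: "norm (complex_of_real (mollifier \<epsilon> x)) \<le> (1 / \<epsilon>) ^ CARD('d)" for x :: "real^'d"
      using \<gamma>0[of x] mollifier_le[OF \<epsilon>(1), of x] by simp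
    have \<gamma>int: "integrable lborel (\<lambda>x :: real^'d. complex_of_real (mollifier \<epsilon> x))"
      unfolding integrable_iff_bounded using nn_integral_mollifier[OF \<epsilon>(1), where 'd = 'd] \<gamma>0 by simp
    have "(LINT x|lborel. mollifier \<epsilon> (x :: real^'d)) = 1"
      by (subst integral_eq_nn_integral) (use \<gamma>0 in \<open>auto simp: nn_integral_mollifier[OF \<epsilon>(1)]\<close>)
    hence \<gamma>1: "(LINT x|lborel. complex_of_real (mollifier \<epsilon> (x :: real^'d))) = 1" by simp
    have le: "ennreal (norm (mollify \<epsilon> \<phi> y - \<phi> y)) \<le> (\<integral>\<^sup>+t. ennreal (mollifier \<epsilon> t) * ennreal (norm (\<phi> (y + - t) - \<phi> y)) \<partial>lborel)" for y
    proof -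
      have i: "integrable lborel (\<lambda>x. \<phi> x * of_real (mollifier \<epsilon> (y - x)))"
        by (rule integrable_mult_bounded[OF \<phi> _ \<gamma>B]) measurable
      have i': "integrable lborel (\<lambda>x. of_real (mollifier \<epsilon> (y - x)) * \<phi> y)"
      proof (intro integrable_mult_left)
        have "(\<integral>\<^sup>+x. ennreal (norm (complex_of_real (mollifier \<epsilon> (y - x)))) \<partial>lborel) = (\<integral>\<^sup>+x. ennreal (mollifier \<epsilon> (y + x)) \<partial>distr lborel borel uminus)"
          by (subst nn_integral_distr) (auto simp: \<gamma>0)
        also have "\<dots> = (\<integral>\<^sup>+x. ennreal (mollifier \<epsilon> (x :: real^'d)) \<partial>lborel)"
          unfolding lborel_distr_uminus_vec using nn_integral_lborel_shift[of "\<lambda>x. ennreal (mollifier \<epsilon> x)" y] by (simp add: add.commute)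
        finally show "integrable lborel (\<lambda>x. complex_of_real (mollifier \<epsilon> (y - x)))"
          unfolding integrable_iff_bounded using nn_integral_mollifier[OF \<epsilon>(1), where 'd = 'd] by simp
      qed
      have "(LINT x|lborel. complex_of_real (mollifier \<epsilon> (y - x))) = (LINT x|distr lborel borel uminus. complex_of_real (mollifier \<epsilon> (x + y)))"
        by (subst integral_distr) auto
      also have "\<dots> = 1"
        unfolding lborel_distr_uminus_vec using integral_lborel_shift[of "\<lambda>x. complex_of_real (mollifier \<epsilon> x)" y] \<gamma>1 by simp
      finally have "\<phi> y = (LINT x|lborel. of_real (mollifier \<epsilon> (y - x)) * \<phi> y)" by simp
      hence "mollify \<epsilon> \<phi> y - \<phi> y = (LINT x|lborel. \<phi> x * of_real (mollifier \<epsilon> (y - x)) - of_real (mollifier \<epsilon> (y - x)) * \<phi> y)"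
        unfolding mollify_def using Bochner_Integration.integral_diff[OF i i'] by simp
      hence "ennreal (norm (mollify \<epsilon> \<phi> y - \<phi> y)) \<le> (\<integral>\<^sup>+x. ennreal (norm (\<phi> x * of_real (mollifier \<epsilon> (y - x)) - of_real (mollifier \<epsilon> (y - x)) * \<phi> y)) \<partial>lborel)"
        using i i' by (simp only:) (intro integral_norm_bound_ennreal Bochner_Integration.integrable_diff)
      also have "\<dots> = (\<integral>\<^sup>+x. ennreal (mollifier \<epsilon> (y - x)) * ennreal (norm (\<phi> x - \<phi> y)) \<partial>lborel)"
      proof (rule nn_integral_cong)
        fix x
        have "\<phi> x * of_real (mollifier \<epsilon> (y - x)) - of_real (mollifier \<epsilon> (y - x)) * \<phi> y = of_real (mollifier \<epsilon> (y - x)) * (\<phi> x - \<phi> y)"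
          by (simp add: algebra_simps)
        thus "ennreal (norm (\<phi> x * of_real (mollifier \<epsilon> (y - x)) - of_real (mollifier \<epsilon> (y - x)) * \<phi> y)) = ennreal (mollifier \<epsilon> (y - x)) * ennreal (norm (\<phi> x - \<phi> y))"
          by (simp only: norm_mult norm_of_real abs_of_nonneg[OF \<gamma>0] ennreal_mult[OF \<gamma>0 norm_ge_zero])
      qed
      also have "\<dots> = (\<integral>\<^sup>+x. ennreal (mollifier \<epsilon> (y + x)) * ennreal (norm (\<phi> (- x) - \<phi> y)) \<partial>distr lborel borel uminus)"
        by (subst nn_integral_distr) auto
      also have "\<dots> = (\<integral>\<^sup>+x. ennreal (mollifier \<epsilon> (y + (x + - y))) * ennreal (norm (\<phi> (- (x + - y)) - \<phi> y)) \<partial>lborel)"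
        unfolding lborel_distr_uminus_vec
        by (rule nn_integral_lborel_shift[symmetric, of "\<lambda>x. ennreal (mollifier \<epsilon> (y + x)) * ennreal (norm (\<phi> (- x) - \<phi> y))"]) measurable
      finally show ?thesis by (simp add: algebra_simps)
    qed
    have "(\<integral>\<^sup>+y. ennreal (norm (mollify \<epsilon> \<phi> y - \<phi> y)) \<partial>lborel) \<le> (\<integral>\<^sup>+y. \<integral>\<^sup>+t. ennreal (mollifier \<epsilon> t) * ennreal (norm (\<phi> (y + - t) - \<phi> y)) \<partial>lborel \<partial>lborel)"
      by (intro nn_integral_mono le)
    also have "\<dots> = (\<integral>\<^sup>+t. \<integral>\<^sup>+y. ennreal (mollifier \<epsilon> t) * ennreal (norm (\<phi> (y + - t) - \<phi> y)) \<partial>lborel \<partial>lborel)"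
      by (rule lborel_pair.Fubini') measurable
    also have "\<dots> \<le> (\<integral>\<^sup>+t. ennreal (mollifier \<epsilon> (t :: real^'d)) * ennreal e \<partial>lborel)"
    proof (rule nn_integral_mono)
      fix t :: "real^'d"
      show "(\<integral>\<^sup>+y. ennreal (mollifier \<epsilon> t) * ennreal (norm (\<phi> (y + - t) - \<phi> y)) \<partial>lborel) \<le> ennreal (mollifier \<epsilon> t) * ennreal e"
      proof (cases "mollifier \<epsilon> t = 0")
        case False
        have "norm (- t) \<le> real CARD('d) * \<epsilon>" using mollifier_support[OF \<epsilon>(1) False] by simp
        also have "\<dots> < d" using \<epsilon>(2) by (simp add: field_simps)
        finally have "(\<integral>\<^sup>+y. ennreal (norm (\<phi> (y + - t) - \<phi> y)) \<partial>lborel) \<le> ennreal e" by (rule d(2))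
        from mult_left_mono[OF this, of "ennreal (mollifier \<epsilon> t)"] show ?thesis
          by (subst nn_integral_cmult) auto
      qed simp
    qed
    also have "\<dots> = (\<integral>\<^sup>+t. ennreal (mollifier \<epsilon> (t :: real^'d)) \<partial>lborel) * ennreal e"
      by (rule nn_integral_multc) measurable
    finally show "(\<integral>\<^sup>+y. ennreal (norm (mollify \<epsilon> \<phi> y - \<phi> y)) \<partial>lborel) \<le> ennreal e"
      by (simp add: nn_integral_mollifier[OF \<epsilon>(1)])
  qed
qed

lemma Lp_le_uminus:
  assumes [measurable]: "u \<in> borel_measurable borel" and u: "Lp_le p K u"
  shows "Lp_le p K (\<lambda>y. u (- y))"
proof (cases "p = \<infinity>")
  case True
  thus ?thesis using u AE_lborel_uminus[of "\<lambda>x. norm (u x) \<le> K"] by (simp add: Lp_le_def)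
next
  case False
  have "(\<integral>\<^sup>+x. ennreal (norm (u (- x)) powr enn2real p) \<partial>lborel) = (\<integral>\<^sup>+x. ennreal (norm (u x) powr enn2real p) \<partial>distr lborel borel uminus)"
    by (subst nn_integral_distr) auto
  thus ?thesis using u False by (simp add: Lp_le_def lborel_distr_uminus_vec)
qed

text \<open>Fatou's lemma for finite \<open>p\<close>; for infinite \<open>p\<close> the countably
  many exceptional null sets are united.\<close>

lemma Lp_le_tendsto:
  assumes [measurable]: "\<And>n. u n \<in> borel_measurable borel"
    and K: "\<And>n. Lp_le p K (u n)" and lim: "AE x in lborel. (\<lambda>n. u n x) \<longlonglongrightarrow> v x"
  shows "Lp_le p K v"
proof (cases "p = \<infinity>")
  case True
  have "AE x in lborel. \<forall>n. norm (u n x) \<le> K"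
    using K True by (simp add: Lp_le_def AE_all_countable)
  with lim have "AE x in lborel. norm (v x) \<le> K"
  proof eventually_elim
    fix x assume "(\<lambda>n. u n x) \<longlonglongrightarrow> v x" "\<forall>n. norm (u n x) \<le> K"
    thus "norm (v x) \<le> K" by (intro LIMSEQ_le_const2[OF tendsto_norm]) auto
  qed
  thus ?thesis using True by (simp add: Lp_le_def)
next
  case False
  define r where "r = enn2real p"
  have r: "0 \<le> r" by (simp add: r_def)
  have "(\<integral>\<^sup>+x. ennreal (norm (v x) powr r) \<partial>lborel) \<le> (\<integral>\<^sup>+x. liminf (\<lambda>n. ennreal (norm (u n x) powr r)) \<partial>lborel)"
  proof (rule nn_integral_mono_AE)
    show "AE x in lborel. ennreal (norm (v x) powr r) \<le> liminf (\<lambda>n. ennreal (norm (u n x) powr r))"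
      using lim
    proof eventually_elim
      fix x assume l: "(\<lambda>n. u n x) \<longlonglongrightarrow> v x"
      show "ennreal (norm (v x) powr r) \<le> liminf (\<lambda>n. ennreal (norm (u n x) powr r))"
      \<comment> \<open>\<open>powr\<close> need not be continuous in its base at 0, but there the
        left side is 0 anyway.\<close>
      proof (cases "v x = 0")
        case True thus ?thesis by simp
      next
        case False
        have "(\<lambda>n. ennreal (norm (u n x) powr r)) \<longlonglongrightarrow> ennreal (norm (v x) powr r)"
          using l False by (intro tendsto_intros) auto
        from lim_imp_Liminf[OF sequentially_bot this] show ?thesis by (simp only: order_refl)
      qed
    qed
  qed
  also have "\<dots> \<le> liminf (\<lambda>n. \<integral>\<^sup>+x. ennreal (norm (u n x) powr r) \<partial>lborel)"
    by (rule nn_integral_liminf) measurable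
  also have "\<dots> \<le> liminf (\<lambda>n. ennreal (K powr r))"
    using K False by (intro Liminf_mono always_eventually) (auto simp: Lp_le_def r_def)
  also have "\<dots> = ennreal (K powr r)" by (rule Liminf_const) simp
  finally show ?thesis using False by (simp add: Lp_le_def r_def)
qed

lemma integrable_lattice_iff:
  fixes u :: "real^'d \<Rightarrow> complex"
  shows "integrable lattice_measure u \<longleftrightarrow> (\<integral>\<^sup>+l. ennreal (norm (u l)) \<partial>lattice_measure) < \<infinity>"
  by (simp add: integrable_iff_bounded)

lemma borel_measurable_integral_lattice:
  fixes u :: "'b \<Rightarrow> real^'d \<Rightarrow> complex"
  assumes "\<And>l. l \<in> int_lattice \<Longrightarrow> (\<lambda>x. u x l) \<in> borel_measurable M"
  shows "(\<lambda>x. LINT l|lattice_measure. u x l) \<in> borel_measurable M"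
proof -
  have "(\<lambda>(l, x). u x l) \<in> borel_measurable (lattice_measure \<Otimes>\<^sub>M M)"
    by (rule measurable_lattice_pair) (use assms in auto)
  hence "(\<lambda>(x, l). u x l) \<in> borel_measurable (M \<Otimes>\<^sub>M lattice_measure)"
    by (subst measurable_pair_swap_iff) (simp add: case_prod_beta)
  thus ?thesis using lattice.borel_measurable_lebesgue_integral[where f = u and N = M] by simp
qed

lemma borel_measurable_periodize [measurable]:
  assumes [measurable]: "H \<in> borel_measurable borel"
  shows "periodize H \<in> borel_measurable borel"
  unfolding periodize_def[abs_def] by (rule borel_measurable_integral_lattice) measurable

text \<open>A whole lattice sum has to converge pointwise, so the widths are chosen with L1 errors
  at most \<open>(1/2) ^ n\<close>. For almost every \<open>y\<close> the errors, summed over the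
  lattice, are then summable in \<open>n\<close> and tend to 0.\<close>

lemma mollify_subseq:
  fixes \<phi> :: "real^'d \<Rightarrow> complex"
  assumes \<phi>: "integrable lborel \<phi>"
  obtains c where "\<And>n. 0 < c n" "\<And>n. c n \<le> 1/4" "c \<longlonglongrightarrow> 0"
    "AE y in lborel. (\<lambda>n. \<integral>\<^sup>+k. ennreal (norm (mollify (c n) \<phi> (y + k) - \<phi> (y + k))) \<partial>lattice_measure) \<longlonglongrightarrow> 0"
proof -
  have [measurable]: "\<phi> \<in> borel_measurable borel" using borel_measurable_integrable[OF \<phi>] by simp
  have "\<exists>\<epsilon>. 0 < \<epsilon> \<and> \<epsilon> \<le> 1/4 \<and> \<epsilon> \<le> 1 / real (Suc n) \<and>
      (\<integral>\<^sup>+y. ennreal (norm (mollify \<epsilon> \<phi> y - \<phi> y)) \<partial>lborel) \<le> ennreal ((1/2) ^ n)" for n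
  proof -
    obtain d where d: "0 < d" "\<And>\<epsilon>. 0 < \<epsilon> \<Longrightarrow> \<epsilon> < d \<Longrightarrow> (\<integral>\<^sup>+y. ennreal (norm (mollify \<epsilon> \<phi> y - \<phi> y)) \<partial>lborel) \<le> ennreal ((1/2) ^ n)"
      using mollify_tendsto_L1[OF \<phi>, of "(1/2) ^ n"] by auto
    show ?thesis
      by (rule exI[of _ "min (d / 2) (min (1/4) (1 / real (Suc n)))"]) (use d in auto)
  qed
  note ex = this
  define c where "c = (\<lambda>n. SOME \<epsilon>. 0 < \<epsilon> \<and> \<epsilon> \<le> 1/4 \<and> \<epsilon> \<le> 1 / real (Suc n) \<and>
      (\<integral>\<^sup>+y. ennreal (norm (mollify \<epsilon> \<phi> y - \<phi> y)) \<partial>lborel) \<le> ennreal ((1/2) ^ n))"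
  have c: "0 < c n" "c n \<le> 1/4" "c n \<le> 1 / real (Suc n)"
    "(\<integral>\<^sup>+y. ennreal (norm (mollify (c n) \<phi> y - \<phi> y)) \<partial>lborel) \<le> ennreal ((1/2) ^ n)" for n
    unfolding c_def using someI_ex[OF ex[of n]] by blast+
  have c0: "c \<longlonglongrightarrow> 0"
    by (rule tendsto_sandwich[OF always_eventually always_eventually tendsto_const LIMSEQ_Suc[OF lim_1_over_n]])
       (intro allI less_imp_le c(1), intro allI c(3))
  define D where "D = (\<lambda>n y. ennreal (norm (mollify (c n) \<phi> y - \<phi> y)))"
  have [measurable]: "D n \<in> borel_measurable borel" for n unfolding D_def by measurable
  have "(\<integral>\<^sup>+y. (\<Sum>n. D n y) \<partial>lborel) = (\<Sum>n. \<integral>\<^sup>+y. D n y \<partial>lborel)"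
    by (rule nn_integral_suminf) measurable
  also have "\<dots> \<le> (\<Sum>n. ennreal ((1/2) ^ n))"
    by (rule suminf_le) (use c(4) in \<open>auto simp: D_def\<close>)
  also have "\<dots> < \<infinity>"
    by (subst suminf_ennreal2) (auto intro!: summable_geometric)
  finally have "AE y in lborel. (\<integral>\<^sup>+k. (\<Sum>n. D n (y + k)) \<partial>lattice_measure) < \<infinity>"
    by (intro AE_lattice_sum_finite) auto
  hence "AE y in lborel. (\<lambda>n. \<integral>\<^sup>+k. D n (y + k) \<partial>lattice_measure) \<longlonglongrightarrow> 0"
  proof eventually_elim
    fix y assume y: "(\<integral>\<^sup>+k. (\<Sum>n. D n (y + k)) \<partial>lattice_measure) < \<infinity>"
    have "(\<integral>\<^sup>+k. (\<Sum>n. D n (y + k)) \<partial>lattice_measure) = (\<Sum>n. \<integral>\<^sup>+k. D n (y + k) \<partial>lattice_measure)"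
      by (rule nn_integral_suminf) simp
    hence fin: "(\<Sum>n. \<integral>\<^sup>+k. D n (y + k) \<partial>lattice_measure) \<noteq> \<infinity>" using y by simp
    define a where "a = (\<lambda>n. enn2real (\<integral>\<^sup>+k. D n (y + k) \<partial>lattice_measure))"
    have "(\<integral>\<^sup>+k. D n (y + k) \<partial>lattice_measure) \<noteq> \<infinity>" for n
      using ennreal_suminf_lessD[of "\<lambda>n. \<integral>\<^sup>+k. D n (y + k) \<partial>lattice_measure" \<infinity> n] fin by (auto simp: less_top)
    hence a: "(\<integral>\<^sup>+k. D n (y + k) \<partial>lattice_measure) = ennreal (a n)" for n by (simp add: a_def less_top)
    have "summable a"
      by (rule summable_suminf_not_top) (use fin in \<open>auto simp: a[symmetric]\<close>, simp add: a_def)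
    hence "a \<longlonglongrightarrow> 0" by (rule summable_LIMSEQ_zero)
    thus "(\<lambda>n. \<integral>\<^sup>+k. D n (y + k) \<partial>lattice_measure) \<longlonglongrightarrow> 0"
      unfolding a using tendsto_ennrealI[of a 0 sequentially] by simp
  qed
  thus ?thesis using that[OF c(1,2) c0] by (simp add: D_def)
qed

text \<open>The damping factor \<open>t n\<close> makes the product with the periodization
  integrable and, being at most 1 in modulus, does not increase the bound on q-th powers.
  Hausdorff--Young then gives a bound uniform in \<open>n\<close>, which survives the almost
  everywhere limit.\<close>

lemma Lp_le_shift_series:
  fixes \<phi> G H :: "real^'d \<Rightarrow> complex" and p :: ennreal and q C K :: real
  assumes HY: "\<And>(F :: real^'d \<Rightarrow> complex) K. integrable lborel F \<Longrightarrow> 0 < K \<Longrightarrow>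
      (\<integral>\<^sup>+x. ennreal (norm (F x) powr q) \<partial>lborel) \<le> ennreal (K powr q) \<Longrightarrow> Lp_le p (C * K) (ft F)"
    and q: "0 < q" and \<phi>: "integrable lborel \<phi>" and G: "integrable lborel G" and H: "integrable lborel H" and K: "0 < K"
    and w: "(\<integral>\<^sup>+\<eta>. ennreal (norm (G \<eta> - ft \<phi> \<eta> * periodize H \<eta>) powr q) \<partial>lborel) \<le> ennreal (K powr q)"
  shows "Lp_le p (C * K) (\<lambda>y. ft G (- y) - (LINT k|lattice_measure. ft H k * \<phi> (y + k)))"
proof -
  have [measurable]: "\<phi> \<in> borel_measurable borel" "G \<in> borel_measurable borel" "H \<in> borel_measurable borel"
    using borel_measurable_integrable[OF \<phi>] borel_measurable_integrable[OF G] borel_measurable_integrable[OF H] by simp_all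
  obtain c where c: "\<And>n. 0 < c n" "\<And>n. c n \<le> 1/4" "c \<longlonglongrightarrow> 0"
    "AE y in lborel. (\<lambda>n. \<integral>\<^sup>+k. ennreal (norm (mollify (c n) \<phi> (y + k) - \<phi> (y + k))) \<partial>lattice_measure) \<longlonglongrightarrow> 0"
    using mollify_subseq[OF \<phi>] by blast
  define t where "t = (\<lambda>n (\<eta> :: real^'d). complex_of_real (Tent_ft (c n *\<^sub>R \<eta>)))"
  have [measurable]: "t n \<in> borel_measurable borel" for n unfolding t_def by measurable
  have t1: "norm (t n \<eta>) \<le> 1" for n \<eta> by (simp add: t_def Tent_ft_nonneg Tent_ft_le_1)
  have t_lim: "(\<lambda>n. t n \<eta>) \<longlonglongrightarrow> 1" for \<eta>
  proof -
    have "isCont (ft (\<lambda>x :: real^'d. complex_of_real (Tent x))) 0"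
      using continuous_on_ft[OF integrable_Tent[where 'd = 'd]] by (simp add: continuous_on_eq_continuous_at)
    moreover have "(\<lambda>n. c n *\<^sub>R \<eta>) \<longlonglongrightarrow> 0 *\<^sub>R \<eta>" by (intro tendsto_intros c)
    ultimately have "(\<lambda>n. ft (\<lambda>x :: real^'d. complex_of_real (Tent x)) (c n *\<^sub>R \<eta>)) \<longlonglongrightarrow> ft (\<lambda>x :: real^'d. complex_of_real (Tent x)) 0"
      by (intro isCont_tendsto_compose[of 0 "ft (\<lambda>x :: real^'d. complex_of_real (Tent x))"]) auto
    thus ?thesis by (simp add: ft_Tent t_def Tent_ft_zero)
  qed
  define W where "W = (\<lambda>n \<eta>. G \<eta> * t n \<eta> - ft \<phi> \<eta> * periodize H \<eta> * t n \<eta>)"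
  have Gt: "integrable lborel (\<lambda>\<eta>. G \<eta> * t n \<eta>)" for n
    by (rule integrable_mult_bounded[OF G _ t1]) measurable
  have Pt: "integrable lborel (\<lambda>\<eta>. ft \<phi> \<eta> * periodize H \<eta> * t n \<eta>)" for n
    using integrable_ft_periodize[OF \<phi> H c(1) c(2), of n 0] by (simp add: t_def)
  have W: "integrable lborel (W n)" for n
    unfolding W_def by (intro Bochner_Integration.integrable_diff Gt Pt)
  have Wq: "(\<integral>\<^sup>+\<eta>. ennreal (norm (W n \<eta>) powr q) \<partial>lborel) \<le> ennreal (K powr q)" for n
  proof -
    have "(\<integral>\<^sup>+\<eta>. ennreal (norm (W n \<eta>) powr q) \<partial>lborel) \<le> (\<integral>\<^sup>+\<eta>. ennreal (norm (G \<eta> - ft \<phi> \<eta> * periodize H \<eta>) powr q) \<partial>lborel)"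
    proof (intro nn_integral_mono ennreal_leI powr_mono2)
      fix \<eta>
      have "W n \<eta> = (G \<eta> - ft \<phi> \<eta> * periodize H \<eta>) * t n \<eta>" by (simp add: W_def left_diff_distrib)
      hence "norm (W n \<eta>) = norm (G \<eta> - ft \<phi> \<eta> * periodize H \<eta>) * norm (t n \<eta>)" by (simp only: norm_mult)
      also have "\<dots> \<le> norm (G \<eta> - ft \<phi> \<eta> * periodize H \<eta>) * 1" by (intro mult_left_mono t1) simp
      finally show "norm (W n \<eta>) \<le> norm (G \<eta> - ft \<phi> \<eta> * periodize H \<eta>)" by simp
    qed (use q in auto)
    with w show ?thesis by (rule order_trans[rotated])
  qed
  \<comment> \<open>Evaluation at \<open>- y\<close> turns the transform into the inverse one and
    matches the sign in \<open>integral_ft_periodize\<close>.\<close>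
  have ftW: "ft (W n) (- y) = ft (\<lambda>\<eta>. G \<eta> * t n \<eta>) (- y) - (LINT k|lattice_measure. ft H k * mollify (c n) \<phi> (y + k))" for n y
  proof -
    have "ft (\<lambda>\<eta>. ft \<phi> \<eta> * periodize H \<eta> * t n \<eta>) (- y) = (LINT k|lattice_measure. ft H k * mollify (c n) \<phi> (y + k))"
      using integral_ft_periodize[OF \<phi> H c(1) c(2), of n y] by (simp add: ft_def t_def inner_commute)
    thus ?thesis unfolding W_def by (simp add: ft_diff[OF Gt Pt])
  qed
  show ?thesis
  proof (rule Lp_le_tendsto)
    show "(\<lambda>y. ft (W n) (- y)) \<in> borel_measurable borel" for n using W by measurable
    show "Lp_le p (C * K) (\<lambda>y. ft (W n) (- y))" for n
      by (rule Lp_le_uminus[OF borel_measurable_ft[OF W] HY[OF W K Wq]])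
    define B where "B = (LINT x|lborel. norm (H x))"
    have B: "0 \<le> B" by (simp add: B_def)
    have fB: "norm (ft H k) \<le> B" for k unfolding B_def by (rule norm_ft_le)
    have "AE y in lborel. (\<integral>\<^sup>+k. ennreal (norm (\<phi> (y + k))) \<partial>lattice_measure) < \<infinity>"
      using AE_lattice_sum_finite[OF _ nn_integral_norm_lt_top[OF \<phi>]] by simp
    with c(4) show "AE y in lborel. (\<lambda>n. ft (W n) (- y)) \<longlonglongrightarrow> ft G (- y) - (LINT k|lattice_measure. ft H k * \<phi> (y + k))"
    proof eventually_elim
      fix y assume lim: "(\<lambda>n. \<integral>\<^sup>+k. ennreal (norm (mollify (c n) \<phi> (y + k) - \<phi> (y + k))) \<partial>lattice_measure) \<longlonglongrightarrow> 0"
        and fin: "(\<integral>\<^sup>+k. ennreal (norm (\<phi> (y + k))) \<partial>lattice_measure) < \<infinity>"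
      have mul: "integrable lattice_measure (\<lambda>k. ft H k * u k)" if "(\<integral>\<^sup>+k. ennreal (norm (u k)) \<partial>lattice_measure) < \<infinity>" for u
        using integrable_mult_bounded[of lattice_measure u "ft H" B] that fB by (simp add: integrable_lattice_iff mult.commute)
      have i1: "integrable lattice_measure (\<lambda>k. ft H k * \<phi> (y + k))" by (rule mul[OF fin])
      have i2: "integrable lattice_measure (\<lambda>k. ft H k * mollify (c n) \<phi> (y + k))" for n
      proof (rule mul)
        show "(\<integral>\<^sup>+k. ennreal (norm (mollify (c n) \<phi> (y + k))) \<partial>lattice_measure) < \<infinity>"
          using nn_integral_norm_lt_top[OF \<phi>]
          by (intro le_less_trans[OF nn_integral_lattice_mollify_le[OF \<phi> c(1) c(2), of n y]]) (simp add: ennreal_mult_less_top)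
      qed
      have bound: "ennreal (norm ((LINT k|lattice_measure. ft H k * mollify (c n) \<phi> (y + k)) - (LINT k|lattice_measure. ft H k * \<phi> (y + k)))) \<le>
         ennreal B * (\<integral>\<^sup>+k. ennreal (norm (mollify (c n) \<phi> (y + k) - \<phi> (y + k))) \<partial>lattice_measure)" for n
      proof -
        have "(LINT k|lattice_measure. ft H k * mollify (c n) \<phi> (y + k)) - (LINT k|lattice_measure. ft H k * \<phi> (y + k)) =
            (LINT k|lattice_measure. ft H k * mollify (c n) \<phi> (y + k) - ft H k * \<phi> (y + k))"
          by (rule Bochner_Integration.integral_diff[OF i2 i1, symmetric])
        hence "ennreal (norm ((LINT k|lattice_measure. ft H k * mollify (c n) \<phi> (y + k)) - (LINT k|lattice_measure. ft H k * \<phi> (y + k)))) \<le>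
            (\<integral>\<^sup>+k. ennreal (norm (ft H k * mollify (c n) \<phi> (y + k) - ft H k * \<phi> (y + k))) \<partial>lattice_measure)"
          using i1 i2 by (simp only:) (intro integral_norm_bound_ennreal Bochner_Integration.integrable_diff)
        also have "\<dots> \<le> (\<integral>\<^sup>+k. ennreal B * ennreal (norm (mollify (c n) \<phi> (y + k) - \<phi> (y + k))) \<partial>lattice_measure)"
        proof (rule nn_integral_mono)
          fix k
          have "norm (ft H k * mollify (c n) \<phi> (y + k) - ft H k * \<phi> (y + k)) = norm (ft H k) * norm (mollify (c n) \<phi> (y + k) - \<phi> (y + k))"
            by (simp only: right_diff_distrib[symmetric] norm_mult)
          also have "\<dots> \<le> B * norm (mollify (c n) \<phi> (y + k) - \<phi> (y + k))" by (intro mult_right_mono fB) simp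
          finally show "ennreal (norm (ft H k * mollify (c n) \<phi> (y + k) - ft H k * \<phi> (y + k))) \<le> ennreal B * ennreal (norm (mollify (c n) \<phi> (y + k) - \<phi> (y + k)))"
            using B by (simp add: ennreal_mult[symmetric] ennreal_leI)
        qed
        also have "\<dots> = ennreal B * (\<integral>\<^sup>+k. ennreal (norm (mollify (c n) \<phi> (y + k) - \<phi> (y + k))) \<partial>lattice_measure)"
          by (rule nn_integral_cmult) simp
        finally show ?thesis .
      qed
      have "(\<lambda>n. ennreal B * (\<integral>\<^sup>+k. ennreal (norm (mollify (c n) \<phi> (y + k) - \<phi> (y + k))) \<partial>lattice_measure)) \<longlonglongrightarrow> ennreal B * 0"
        by (intro ennreal_tendsto_cmult lim) simp
      hence l0: "(\<lambda>n. ennreal B * (\<integral>\<^sup>+k. ennreal (norm (mollify (c n) \<phi> (y + k) - \<phi> (y + k))) \<partial>lattice_measure)) \<longlonglongrightarrow> 0"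
        by (simp only: mult_zero_right)
      have "(\<lambda>n. ennreal (norm ((LINT k|lattice_measure. ft H k * mollify (c n) \<phi> (y + k)) - (LINT k|lattice_measure. ft H k * \<phi> (y + k))))) \<longlonglongrightarrow> 0"
        by (rule tendsto_sandwich[OF always_eventually always_eventually tendsto_const l0]) (intro allI zero_le, intro allI bound)
      hence "(\<lambda>n. ennreal (norm ((LINT k|lattice_measure. ft H k * mollify (c n) \<phi> (y + k)) - (LINT k|lattice_measure. ft H k * \<phi> (y + k))))) \<longlonglongrightarrow> ennreal 0"
        by (simp only: ennreal_0)
      hence "(\<lambda>n. norm ((LINT k|lattice_measure. ft H k * mollify (c n) \<phi> (y + k)) - (LINT k|lattice_measure. ft H k * \<phi> (y + k)))) \<longlonglongrightarrow> 0"
        by (subst (asm) tendsto_ennreal_iff) auto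
      hence s: "(\<lambda>n. LINT k|lattice_measure. ft H k * mollify (c n) \<phi> (y + k)) \<longlonglongrightarrow> (LINT k|lattice_measure. ft H k * \<phi> (y + k))"
        by (simp only: tendsto_norm_zero_iff LIM_zero_iff)
      have "(\<lambda>n. ft (\<lambda>\<eta>. G \<eta> * t n \<eta>) (- y)) \<longlonglongrightarrow> ft G (- y)"
        unfolding ft_def
      proof (rule integral_dominated_convergence[where w = "\<lambda>x. norm (G x)"])
        show "AE x in lborel. (\<lambda>n. G x * t n x * cis (- 2 * pi * (x \<bullet> - y))) \<longlonglongrightarrow> G x * cis (- 2 * pi * (x \<bullet> - y))"
        proof (rule AE_I2)
          fix x
          have "(\<lambda>n. G x * t n x * cis (- 2 * pi * (x \<bullet> - y))) \<longlonglongrightarrow> G x * 1 * cis (- 2 * pi * (x \<bullet> - y))"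
            by (intro tendsto_intros t_lim)
          thus "(\<lambda>n. G x * t n x * cis (- 2 * pi * (x \<bullet> - y))) \<longlonglongrightarrow> G x * cis (- 2 * pi * (x \<bullet> - y))" by simp
        qed
        show "AE x in lborel. norm (G x * t n x * cis (- 2 * pi * (x \<bullet> - y))) \<le> norm (G x)" for n
          using mult_left_mono[OF t1, of "norm (G _)"] by (intro AE_I2) (simp add: norm_mult)
      qed (use G in auto)
      from tendsto_diff[OF this s]
      show "(\<lambda>n. ft (W n) (- y)) \<longlonglongrightarrow> ft G (- y) - (LINT k|lattice_measure. ft H k * \<phi> (y + k))"
        unfolding ftW .
    qed
  qed
qed

section \<open>Partial derivatives and Taylor estimates along rays\<close>

lemma partial_deriv_eq_derivative:
  assumes "(f has_derivative D) (at x)"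
  shows "partial_deriv i f x = D (axis i 1)"
proof -
  have lin: "linear D" using assms has_derivative_linear by blast
  have "((\<lambda>t. x + t *\<^sub>R axis i 1) has_derivative (\<lambda>t. t *\<^sub>R axis i (1::real))) (at 0)"
    by (auto intro!: derivative_eq_intros)
  moreover have "(f has_derivative D) (at (x + 0 *\<^sub>R axis i 1))" using assms by simp
  ultimately have "((\<lambda>t. f (x + t *\<^sub>R axis i 1)) has_derivative (\<lambda>t. D (t *\<^sub>R axis i 1))) (at 0)"
    by (rule has_derivative_compose)
  hence "((\<lambda>t. f (x + t *\<^sub>R axis i 1)) has_vector_derivative D (axis i 1)) (at 0)"
    unfolding has_vector_derivative_def by (simp add: linear_scale[OF lin])
  thus ?thesis unfolding partial_deriv_def by (rule vector_derivative_at)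
qed

lemma has_derivative_partial_deriv:
  fixes f :: "real^'d \<Rightarrow> complex"
  assumes "f differentiable (at x)"
  shows "(f has_derivative (\<lambda>h. \<Sum>i\<in>UNIV. (h $ i) *\<^sub>R partial_deriv i f x)) (at x)"
proof -
  obtain D where D: "(f has_derivative D) (at x)" using assms by (auto simp: differentiable_def)
  have lin: "linear D" using D has_derivative_linear by blast
  have "D h = (\<Sum>i\<in>UNIV. (h $ i) *\<^sub>R partial_deriv i f x)" for h
  proof -
    have "h = (\<Sum>i\<in>UNIV. (h $ i) *\<^sub>R axis i 1)"
      using basis_expansion[of h] by (simp add: scalar_mult_eq_scaleR)
    hence "D h = D (\<Sum>i\<in>UNIV. (h $ i) *\<^sub>R axis i 1)" by simp
    also have "\<dots> = (\<Sum>i\<in>UNIV. (h $ i) *\<^sub>R D (axis i 1))"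
      by (simp add: linear_sum[OF lin] linear_scale[OF lin])
    finally show ?thesis by (simp add: partial_deriv_eq_derivative[OF D])
  qed
  hence "D = (\<lambda>h. \<Sum>i\<in>UNIV. (h $ i) *\<^sub>R partial_deriv i f x)" by (rule ext)
  with D show ?thesis by simp
qed

lemma has_vector_derivative_along_line:
  fixes f :: "real^'d \<Rightarrow> complex"
  assumes "f differentiable (at (c + t *\<^sub>R v))"
  shows "((\<lambda>t. f (c + t *\<^sub>R v)) has_vector_derivative (\<Sum>i\<in>UNIV. (v $ i) *\<^sub>R partial_deriv i f (c + t *\<^sub>R v))) (at t)"
proof -
  have "((\<lambda>t. c + t *\<^sub>R v) has_derivative (\<lambda>t. t *\<^sub>R v)) (at t)"
    by (auto intro!: derivative_eq_intros)
  from has_derivative_compose[OF this has_derivative_partial_deriv[OF assms]]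
  show ?thesis unfolding has_vector_derivative_def
    by (simp add: scaleR_sum_right)
qed

text \<open>Identities between iterated derivatives hold only on the open set of smoothness, so
  differentiating them once more has to be justified locally.\<close>

lemma partial_deriv_cong_open:
  fixes f g :: "real^'d \<Rightarrow> complex"
  assumes "open S" "x \<in> S" "\<And>y. y \<in> S \<Longrightarrow> f y = g y"
  shows "partial_deriv i f x = partial_deriv i g x"
proof -
  define T where "T = (\<lambda>t::real. x + t *\<^sub>R axis i 1) -` S"
  have T: "open T" unfolding T_def using assms(1) by (intro open_vimage) (auto intro!: continuous_intros)
  have T0: "0 \<in> T" using assms(2) by (simp add: T_def)
  have "((\<lambda>t. f (x + t *\<^sub>R axis i 1)) has_vector_derivative d) (at 0) \<longleftrightarrow> ((\<lambda>t. g (x + t *\<^sub>R axis i 1)) has_vector_derivative d) (at 0)" for d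
    using has_vector_derivative_transform_within_open[OF _ T T0, of "\<lambda>t. f (x + t *\<^sub>R axis i 1)" d "\<lambda>t. g (x + t *\<^sub>R axis i 1)"]
      has_vector_derivative_transform_within_open[OF _ T T0, of "\<lambda>t. g (x + t *\<^sub>R axis i 1)" d "\<lambda>t. f (x + t *\<^sub>R axis i 1)"]
      assms(3) by (auto simp: T_def)
  thus ?thesis unfolding partial_deriv_def vector_derivative_def by simp
qed

lemma n_times_differentiable_foldr:
  assumes "n_times_differentiable_on n f S" "length ds < n" "x \<in> S"
  shows "foldr partial_deriv ds f differentiable (at x)"
  using assms
\<comment> \<open>\<open>foldr\<close> applies the last index first, and this innermost derivative
  is the one that \<open>n_times_differentiable_on\<close> peels off; hence the induction from the
  end.\<close>
proof (induction ds arbitrary: n f rule: rev_induct)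
  case Nil
  then obtain m where "n = Suc m" by (cases n) auto
  thus ?case using Nil by simp
next
  case (snoc i ds)
  then obtain m where m: "n = Suc m" by (cases n) auto
  have "n_times_differentiable_on m (partial_deriv i f) S" using snoc.prems(1) m by simp
  from snoc.IH[OF this] show ?case using snoc.prems m by simp
qed

lemma norm_diff_le_of_vector_derivative:
  fixes \<psi> :: "real \<Rightarrow> complex"
  assumes "a \<le> b" "\<And>t. a \<le> t \<Longrightarrow> t \<le> b \<Longrightarrow> (\<psi> has_vector_derivative \<psi>' t) (at t)"
    and "\<And>t. a \<le> t \<Longrightarrow> t \<le> b \<Longrightarrow> norm (\<psi>' t) \<le> B"
  shows "norm (\<psi> b - \<psi> a) \<le> B * (b - a)"
proof -
  have "norm (\<psi> b - \<psi> a) \<le> B * norm (b - a)"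
  proof (rule differentiable_bound[where S = "{a..b}" and f' = "\<lambda>t h. h *\<^sub>R \<psi>' t"])
    fix t assume t: "t \<in> {a..b}"
    show "(\<psi> has_derivative (\<lambda>h. h *\<^sub>R \<psi>' t)) (at t within {a..b})"
      using assms(2)[of t] t has_vector_derivative_at_within unfolding has_vector_derivative_def
      by (metis atLeastAtMost_iff has_derivative_at_withinI)
    show "onorm (\<lambda>h. h *\<^sub>R \<psi>' t) \<le> B"
    proof (rule onorm_le)
      fix h :: real
      show "norm (h *\<^sub>R \<psi>' t) \<le> B * norm h"
        using mult_left_mono[OF assms(3)[of t], of "\<bar>h\<bar>"] t by (simp add: mult.commute)
    qed
  qed (use assms(1) in auto)
  thus ?thesis using assms(1) by simp
qed

text \<open>Mean value inequality in direction \<open>i\<close>: the difference of \<open>F\<close>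
  along two parallel segments has as derivative a difference of values of the partial derivative,
  which differentiability of the latter at the single point \<open>x\<close> approximates
  linearly.\<close>

lemma second_difference_bound:
  fixes F :: "real^'d \<Rightarrow> complex"
  assumes S: "open S" "x \<in> S" and F: "\<And>y. y \<in> S \<Longrightarrow> F differentiable (at y)"
    and P: "partial_deriv i F differentiable (at x)" and e: "0 < e"
  obtains d where "0 < d" "\<And>h. 0 < h \<Longrightarrow> h < d \<Longrightarrow>
    norm (F (x + h *\<^sub>R axis i 1 + h *\<^sub>R axis j 1) - F (x + h *\<^sub>R axis i 1) - F (x + h *\<^sub>R axis j 1) + F x
      - h\<^sup>2 *\<^sub>R partial_deriv j (partial_deriv i F) x) \<le> e * h\<^sup>2"
proof -
  define P where "P = partial_deriv i F"
  obtain D where D: "(P has_derivative D) (at x)" using P by (auto simp: differentiable_def P_def)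
  have lin: "linear D" using D has_derivative_linear by blast
  have Dj: "partial_deriv j P x = D (axis j 1)" by (rule partial_deriv_eq_derivative[OF D])
  obtain r where r: "0 < r" "ball x r \<subseteq> S" using S open_contains_ball by blast
  obtain d0 where d0: "0 < d0" "\<And>y. norm (y - x) < d0 \<Longrightarrow> norm (P y - P x - D (y - x)) \<le> e / 4 * norm (y - x)"
    using D e unfolding has_derivative_at_alt by (metis divide_pos_pos zero_less_numeral)
  \<comment> \<open>Points at distance up to \<open>2 * h\<close> from \<open>x\<close> occur; they
    must stay in \<open>S\<close> and within the range of the linear approximation.\<close>
  define d where "d = min r d0 / 2"
  have dr: "2 * d \<le> r" "2 * d \<le> d0" by (auto simp: d_def)
  show ?thesis
  proof (rule that[of d])
    show "0 < d" using r d0 by (simp add: d_def)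
    fix h :: real assume h: "0 < h" "h < d"
    let ?i = "axis i 1 :: real^'d" and ?j = "axis j 1 :: real^'d"
    define y1 where "y1 = (\<lambda>s. x + s *\<^sub>R ?i + h *\<^sub>R ?j)"
    define y2 where "y2 = (\<lambda>s. x + s *\<^sub>R ?i)"
    have ny1: "norm (y1 s - x) \<le> 2 * h" and ny2: "norm (y2 s - x) \<le> h" if "0 \<le> s" "s \<le> h" for s
    proof -
      have "norm (s *\<^sub>R ?i + h *\<^sub>R ?j) \<le> norm (s *\<^sub>R ?i) + norm (h *\<^sub>R ?j)" by (rule norm_triangle_ineq)
      thus "norm (y1 s - x) \<le> 2 * h" using that h by (simp add: y1_def)
      show "norm (y2 s - x) \<le> h" using that by (simp add: y2_def)
    qed
    have in1: "y1 s \<in> S" and in2: "y2 s \<in> S" if "0 \<le> s" "s \<le> h" for s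
      using ny1[OF that] ny2[OF that] h dr r(2) by (auto simp: subset_eq dist_norm norm_minus_commute)
    define \<psi> where "\<psi> = (\<lambda>s. F (y1 s) - F (y2 s) - (s * h) *\<^sub>R D ?j)"
    have comp: "(\<Sum>k\<in>UNIV. (?i $ k) *\<^sub>R partial_deriv k F y) = P y" for y
    proof -
      have "(\<Sum>k\<in>UNIV. (?i $ k) *\<^sub>R partial_deriv k F y) = (\<Sum>k\<in>UNIV. if k = i then partial_deriv k F y else 0)"
        by (intro sum.cong) (auto simp: axis_def)
      thus ?thesis by (simp add: P_def)
    qed
    have "norm (\<psi> h - \<psi> 0) \<le> (e * h) * (h - 0)"
    proof (rule norm_diff_le_of_vector_derivative)
      fix s assume s: "0 \<le> s" "s \<le> h"
      have y1': "y1 = (\<lambda>s. (x + h *\<^sub>R ?j) + s *\<^sub>R ?i)" by (auto simp: y1_def)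
      have d1: "((\<lambda>s. F (y1 s)) has_vector_derivative P (y1 s)) (at s)"
        using has_vector_derivative_along_line[of F "x + h *\<^sub>R ?j" s ?i] F[OF in1[OF s]] unfolding comp y1' by blast
      have d2: "((\<lambda>s. F (y2 s)) has_vector_derivative P (y2 s)) (at s)"
        using has_vector_derivative_along_line[of F x s ?i] F[OF in2[OF s]] unfolding comp y2_def by blast
      have d3: "((\<lambda>s. (s * h) *\<^sub>R D ?j) has_vector_derivative h *\<^sub>R D ?j) (at s)"
        unfolding has_vector_derivative_def by (auto intro!: derivative_eq_intros)
      show "(\<psi> has_vector_derivative (P (y1 s) - P (y2 s) - h *\<^sub>R D ?j)) (at s)"
        unfolding \<psi>_def by (intro has_vector_derivative_diff d1 d2 d3)
      have "D (y1 s - x) - D (y2 s - x) = D (h *\<^sub>R ?j)"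
        unfolding linear_diff[OF lin, symmetric] by (simp add: y1_def y2_def)
      hence "P (y1 s) - P (y2 s) - h *\<^sub>R D ?j = (P (y1 s) - P x - D (y1 s - x)) - (P (y2 s) - P x - D (y2 s - x))"
        by (simp add: linear_scale[OF lin] algebra_simps)
      also have "norm \<dots> \<le> norm (P (y1 s) - P x - D (y1 s - x)) + norm (P (y2 s) - P x - D (y2 s - x))"
        by (rule norm_triangle_ineq4)
      also have "\<dots> \<le> e / 4 * norm (y1 s - x) + e / 4 * norm (y2 s - x)"
        using ny1[OF s] ny2[OF s] h dr by (intro add_mono d0) auto
      also have "\<dots> \<le> e / 4 * (2 * h) + e / 4 * h"
        using ny1[OF s] ny2[OF s] e by (intro add_mono mult_left_mono) auto
      also have "\<dots> \<le> e * h" using e h by simp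
      finally show "norm (P (y1 s) - P (y2 s) - h *\<^sub>R D ?j) \<le> e * h" .
    qed (use h in simp)
    moreover have "\<psi> h - \<psi> 0 = F (x + h *\<^sub>R ?i + h *\<^sub>R ?j) - F (x + h *\<^sub>R ?i) - F (x + h *\<^sub>R ?j) + F x - h\<^sup>2 *\<^sub>R D ?j"
      by (simp add: \<psi>_def y1_def y2_def power2_eq_square)
    ultimately show "norm (F (x + h *\<^sub>R ?i + h *\<^sub>R ?j) - F (x + h *\<^sub>R ?i) - F (x + h *\<^sub>R ?j) + F x
      - h\<^sup>2 *\<^sub>R partial_deriv j (partial_deriv i F) x) \<le> e * h\<^sup>2"
      using Dj by (simp add: P_def power2_eq_square mult.assoc)
  qed
qed

text \<open>Both mixed derivatives approximate the same second difference, which is symmetric in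
  \<open>i\<close> and \<open>j\<close>. Differentiability of the first derivatives at
  \<open>x\<close> suffices for this, without continuity of the second, and that is what repeated
  differentiability supplies.\<close>

lemma partial_deriv_commute:
  fixes F :: "real^'d \<Rightarrow> complex"
  assumes S: "open S" "x \<in> S" and F: "\<And>y. y \<in> S \<Longrightarrow> F differentiable (at y)"
    and P: "\<And>k. partial_deriv k F differentiable (at x)"
  shows "partial_deriv i (partial_deriv j F) x = partial_deriv j (partial_deriv i F) x"
proof -
  let ?a = "partial_deriv i (partial_deriv j F) x" and ?b = "partial_deriv j (partial_deriv i F) x"
  have "norm (?a - ?b) \<le> 0 + e" if e: "0 < e" for e
  proof -
    obtain d1 where d1: "0 < d1" "\<And>h. 0 < h \<Longrightarrow> h < d1 \<Longrightarrow>
      norm (F (x + h *\<^sub>R axis i 1 + h *\<^sub>R axis j 1) - F (x + h *\<^sub>R axis i 1) - F (x + h *\<^sub>R axis j 1) + F x - h\<^sup>2 *\<^sub>R ?b) \<le> e / 2 * h\<^sup>2"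
      using second_difference_bound[OF S F P[of i], of "e / 2" j] e by auto
    obtain d2 where d2: "0 < d2" "\<And>h. 0 < h \<Longrightarrow> h < d2 \<Longrightarrow>
      norm (F (x + h *\<^sub>R axis j 1 + h *\<^sub>R axis i 1) - F (x + h *\<^sub>R axis j 1) - F (x + h *\<^sub>R axis i 1) + F x - h\<^sup>2 *\<^sub>R ?a) \<le> e / 2 * h\<^sup>2"
      using second_difference_bound[OF S F P[of j], of "e / 2" i] e by auto
    define h where "h = min d1 d2 / 2"
    have h: "0 < h" "h < d1" "h < d2" using d1(1) d2(1) by (auto simp: h_def)
    define X where "X = F (x + h *\<^sub>R axis i 1 + h *\<^sub>R axis j 1) - F (x + h *\<^sub>R axis i 1) - F (x + h *\<^sub>R axis j 1) + F x"
    have 1: "norm (X - h\<^sup>2 *\<^sub>R ?b) \<le> e / 2 * h\<^sup>2" using d1(2)[OF h(1,2)] by (simp add: X_def)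
    have 2: "norm (X - h\<^sup>2 *\<^sub>R ?a) \<le> e / 2 * h\<^sup>2" using d2(2)[OF h(1,3)] by (simp add: X_def algebra_simps)
    have "h\<^sup>2 *\<^sub>R (?a - ?b) = (X - h\<^sup>2 *\<^sub>R ?b) - (X - h\<^sup>2 *\<^sub>R ?a)" by (simp add: algebra_simps)
    hence "norm (h\<^sup>2 *\<^sub>R (?a - ?b)) \<le> e / 2 * h\<^sup>2 + e / 2 * h\<^sup>2"
      using norm_triangle_ineq4[of "X - h\<^sup>2 *\<^sub>R ?b" "X - h\<^sup>2 *\<^sub>R ?a"] 1 2 by simp
    hence "h\<^sup>2 * norm (?a - ?b) \<le> h\<^sup>2 * e" by (simp add: mult.commute)
    thus ?thesis using h(1) by (simp add: mult_le_cancel_left_pos)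
  qed
  hence "norm (?a - ?b) \<le> 0" by (rule field_le_epsilon)
  thus ?thesis by simp
qed

lemma foldr_partial_deriv_move:
  fixes f :: "real^'d \<Rightarrow> complex"
  assumes "open S" "n_times_differentiable_on n f S" "length xs + length ys < n" "x \<in> S"
  shows "foldr partial_deriv (xs @ i # ys) f x = foldr partial_deriv (i # xs @ ys) f x"
  using assms(3,4)
proof (induction xs arbitrary: x)
  case (Cons a xs)
  have "foldr partial_deriv ((a # xs) @ i # ys) f x = partial_deriv a (foldr partial_deriv (xs @ i # ys) f) x" by simp
  also have "\<dots> = partial_deriv a (foldr partial_deriv (i # xs @ ys) f) x"
    using Cons.prems by (intro partial_deriv_cong_open[OF assms(1) Cons.prems(2)] Cons.IH) auto
  also have "\<dots> = partial_deriv a (partial_deriv i (foldr partial_deriv (xs @ ys) f)) x" by simp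
  also have "\<dots> = partial_deriv i (partial_deriv a (foldr partial_deriv (xs @ ys) f)) x"
  proof (rule partial_deriv_commute[OF assms(1) Cons.prems(2)])
    show "foldr partial_deriv (xs @ ys) f differentiable at y" if "y \<in> S" for y
      by (rule n_times_differentiable_foldr[OF assms(2) _ that]) (use Cons.prems in simp)
    show "partial_deriv k (foldr partial_deriv (xs @ ys) f) differentiable at x" for k
      using n_times_differentiable_foldr[OF assms(2) _ Cons.prems(2), of "k # xs @ ys"] Cons.prems by simp
  qed
  finally show ?case by simp
qed simp

text \<open>\<open>mi_deriv\<close> fixes an unspecified order of differentiation; up to total order
  \<open>n\<close> all orders agree, as one index after the other can be moved to the front.\<close>

lemma foldr_partial_deriv_perm:
  fixes f :: "real^'d \<Rightarrow> complex"
  assumes "open S" "n_times_differentiable_on n f S" "mset js = mset is" "length is \<le> n" "x \<in> S"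
  shows "foldr partial_deriv is f x = foldr partial_deriv js f x"
  using assms(3-5)
proof (induction "is" arbitrary: js x)
  case (Cons i is')
  have "i \<in> set js" using Cons.prems(1) by (metis list.set_intros(1) set_mset_mset)
  then obtain xs ys where js: "js = xs @ i # ys" by (auto simp: in_set_conv_decomp)
  have m: "mset (xs @ ys) = mset is'" using Cons.prems(1) js by simp
  have len: "length xs + length ys = length is'" using arg_cong[OF m, of size] by simp
  have "foldr partial_deriv (i # is') f x = partial_deriv i (foldr partial_deriv is' f) x" by simp
  also have "\<dots> = partial_deriv i (foldr partial_deriv (xs @ ys) f) x"
    using Cons.prems by (intro partial_deriv_cong_open[OF assms(1) Cons.prems(3)] Cons.IH m) auto
  also have "\<dots> = foldr partial_deriv (i # xs @ ys) f x" by simp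
  also have "\<dots> = foldr partial_deriv js f x"
    unfolding js by (rule foldr_partial_deriv_move[OF assms(1,2), symmetric]) (use Cons.prems len in auto)
  finally show ?case .
qed simp

lemma mi_abs_count_list: "mi_abs (count_list ds) = length ds"
proof (induction ds)
  case (Cons a ds)
  have "mi_abs (count_list (a # ds)) = (\<Sum>i\<in>UNIV. (if a = i then 1 else 0) + count_list ds i)"
    unfolding mi_abs_def by (intro sum.cong) auto
  thus ?case using Cons by (simp add: sum.distrib mi_abs_def)
qed (simp add: mi_abs_def)

lemma foldr_partial_deriv_eq_mi_deriv:
  fixes f :: "real^'d \<Rightarrow> complex"
  assumes "open S" "n_times_differentiable_on n f S" "length ds \<le> n" "x \<in> S"
  shows "foldr partial_deriv ds f x = mi_deriv (count_list ds) f x"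
proof -
  define js where "js = (SOME is. \<forall>i. count_list is i = count_list ds i)"
  have "\<forall>i. count_list js i = count_list ds i"
    unfolding js_def by (rule someI_ex) (rule ex_list_count)
  hence "mset js = mset ds" by (intro multiset_eqI) (simp add: count_mset)
  thus ?thesis
    unfolding mi_deriv_def js_def[symmetric] by (intro foldr_partial_deriv_perm[OF assms(1,2)] assms)
qed

text \<open>The \<open>k\<close>-th derivative of \<open>f\<close> along the ray, summed over words
  of length \<open>k\<close> in place of multi-indices: differentiation adds one letter, so no
  multinomial coefficients appear.\<close>

definition ray_deriv :: "(real^'d \<Rightarrow> complex) \<Rightarrow> real^'d \<Rightarrow> real^'d \<Rightarrow> nat \<Rightarrow> real \<Rightarrow> complex" where
  "ray_deriv f c v k t = (\<Sum>ds | length ds = k. prod_list (map (\<lambda>i. v $ i) ds) *\<^sub>R foldr partial_deriv ds f (c + t *\<^sub>R v))"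

lemma ray_deriv_0: "ray_deriv f c v 0 t = f (c + t *\<^sub>R v)"
  by (simp add: ray_deriv_def)

lemma has_vector_derivative_ray_deriv:
  fixes f :: "real^'d \<Rightarrow> complex"
  assumes "n_times_differentiable_on n f S" "c + t *\<^sub>R v \<in> S" "k < n"
  shows "(ray_deriv f c v k has_vector_derivative ray_deriv f c v (Suc k) t) (at t)"
proof -
  have "(ray_deriv f c v k has_vector_derivative
      (\<Sum>ds | length ds = k. prod_list (map (\<lambda>i. v $ i) ds) *\<^sub>R (\<Sum>i\<in>UNIV. (v $ i) *\<^sub>R partial_deriv i (foldr partial_deriv ds f) (c + t *\<^sub>R v)))) (at t)"
    unfolding ray_deriv_def
  proof (intro has_vector_derivative_sum)
    fix ds :: "'d list" assume "ds \<in> {ds. length ds = k}"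
    hence "foldr partial_deriv ds f differentiable (at (c + t *\<^sub>R v))"
      by (intro n_times_differentiable_foldr[OF assms(1) _ assms(2)]) (use assms(3) in simp)
    from has_vector_derivative_along_line[OF this]
    show "((\<lambda>t. prod_list (map (\<lambda>i. v $ i) ds) *\<^sub>R foldr partial_deriv ds f (c + t *\<^sub>R v)) has_vector_derivative
      prod_list (map (\<lambda>i. v $ i) ds) *\<^sub>R (\<Sum>i\<in>UNIV. (v $ i) *\<^sub>R partial_deriv i (foldr partial_deriv ds f) (c + t *\<^sub>R v))) (at t)"
      by (rule bounded_linear.has_vector_derivative[OF bounded_linear_scaleR_right])
  qed
  also have "(\<Sum>ds | length ds = k. prod_list (map (\<lambda>i. v $ i) ds) *\<^sub>R (\<Sum>i\<in>UNIV. (v $ i) *\<^sub>R partial_deriv i (foldr partial_deriv ds f) (c + t *\<^sub>R v)))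
      = (\<Sum>ds | length ds = k. \<Sum>i\<in>UNIV. prod_list (map (\<lambda>i. v $ i) (i # ds)) *\<^sub>R foldr partial_deriv (i # ds) f (c + t *\<^sub>R v))"
    by (simp add: scaleR_sum_right mult.commute)
  also have "\<dots> = (\<Sum>(ds, i)\<in>{ds. length ds = k} \<times> UNIV. prod_list (map (\<lambda>i. v $ i) (i # ds)) *\<^sub>R foldr partial_deriv (i # ds) f (c + t *\<^sub>R v))"
    by (rule sum.cartesian_product)
  also have "\<dots> = ray_deriv f c v (Suc k) t"
    unfolding ray_deriv_def
    by (rule sum.reindex_bij_witness[where i = "\<lambda>ds. (tl ds, hd ds)" and j = "\<lambda>(ds, i). i # ds"])
       (auto simp: length_Suc_conv)
  finally show ?thesis .
qed

text \<open>Downward induction on the order: on [0, 1] each step preserves the bound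
  \<open>B\<close>, and the vanishing initial values leave no other terms. The factor
  \<open>1 / fact n\<close> of Taylor's formula is given up.\<close>

lemma ray_chain_bound:
  fixes \<Psi> :: "nat \<Rightarrow> real \<Rightarrow> complex"
  assumes D: "\<And>k t. k < n \<Longrightarrow> 0 \<le> t \<Longrightarrow> t \<le> 1 \<Longrightarrow> (\<Psi> k has_vector_derivative \<Psi> (Suc k) t) (at t)"
    and Z: "\<And>k. k < n \<Longrightarrow> \<Psi> k 0 = 0" and B: "\<And>t. 0 \<le> t \<Longrightarrow> t \<le> 1 \<Longrightarrow> norm (\<Psi> n t) \<le> B"
  shows "norm (\<Psi> 0 1) \<le> B"
proof -
  have "\<forall>t. 0 \<le> t \<and> t \<le> 1 \<longrightarrow> norm (\<Psi> k t) \<le> B" if "k \<le> n" for k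
    using that
  proof (induction rule: inc_induct)
    case (step k)
    show ?case
    proof (intro allI impI)
      fix t :: real assume t: "0 \<le> t \<and> t \<le> 1"
      have "norm (\<Psi> k t - \<Psi> k 0) \<le> B * (t - 0)"
        using step t by (intro norm_diff_le_of_vector_derivative[of 0 t "\<Psi> k" "\<Psi> (Suc k)"] D) auto
      also have "\<dots> \<le> B * 1"
        using t order_trans[OF norm_ge_zero B[of 0]] by (intro mult_left_mono) auto
      finally show "norm (\<Psi> k t) \<le> B" using Z[of k] step by simp
    qed
  qed (use B in auto)
  from this[of 0] show ?thesis by simp
qed

lemma prod_list_norm_le:
  fixes v :: "real^'d"
  shows "\<bar>prod_list (map (\<lambda>i. v $ i) ds)\<bar> \<le> norm v ^ length ds"
  by (induction ds) (auto simp: abs_mult intro!: mult_mono component_le_norm_cart)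

text \<open>Interchanging the sum over words with the sum over points leaves, for each word, exactly
  the sum of derivatives that is assumed to be bounded.\<close>

lemma norm_sum_ray_deriv_le:
  fixes f :: "real^'d \<Rightarrow> complex"
  assumes "finite \<Lambda>" "\<And>l. l \<in> \<Lambda> \<Longrightarrow> norm (s l) \<le> 1"
    and K: "\<And>ds. length ds = n \<Longrightarrow> (\<Sum>l\<in>\<Lambda>. norm (foldr partial_deriv ds f (l + t *\<^sub>R v))) \<le> K ds"
  shows "norm (\<Sum>l\<in>\<Lambda>. s l * ray_deriv f l v n t) \<le> norm v ^ n * (\<Sum>ds | length ds = n. K ds)"
proof -
  have "norm (\<Sum>l\<in>\<Lambda>. s l * ray_deriv f l v n t) \<le> (\<Sum>l\<in>\<Lambda>. \<Sum>ds | length ds = n. norm v ^ n * norm (foldr partial_deriv ds f (l + t *\<^sub>R v)))"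
  proof (rule sum_norm_le)
    fix l assume l: "l \<in> \<Lambda>"
    have "norm (s l * ray_deriv f l v n t) \<le> 1 * norm (ray_deriv f l v n t)"
      unfolding norm_mult using assms(2)[OF l] by (rule mult_right_mono) simp
    also have "1 * norm (ray_deriv f l v n t) \<le> (\<Sum>ds | length ds = n. norm v ^ n * norm (foldr partial_deriv ds f (l + t *\<^sub>R v)))"
      unfolding ray_deriv_def mult_1_left
    proof (rule sum_norm_le)
      fix ds :: "'d list" assume "ds \<in> {ds. length ds = n}"
      thus "norm (prod_list (map (\<lambda>i. v $ i) ds) *\<^sub>R foldr partial_deriv ds f (l + t *\<^sub>R v)) \<le> norm v ^ n * norm (foldr partial_deriv ds f (l + t *\<^sub>R v))"
        using prod_list_norm_le[of v ds] by (auto intro!: mult_right_mono)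
    qed
    finally show "norm (s l * ray_deriv f l v n t) \<le> (\<Sum>ds | length ds = n. norm v ^ n * norm (foldr partial_deriv ds f (l + t *\<^sub>R v)))" .
  qed
  also have "\<dots> = norm v ^ n * (\<Sum>ds | length ds = n. \<Sum>l\<in>\<Lambda>. norm (foldr partial_deriv ds f (l + t *\<^sub>R v)))"
    by (subst sum.swap) (simp add: sum_distrib_left)
  also have "\<dots> \<le> norm v ^ n * (\<Sum>ds | length ds = n. K ds)"
    by (intro mult_left_mono sum_mono K) auto
  finally show ?thesis .
qed

text \<open>Unimodular weights turn the sum of moduli into a single function, to which Taylor's formula
  along the ray applies; this way only pointwise bounds on the sum of the derivatives are needed.\<close>

lemma sum_norm_le_of_vanishing_derivs:
  fixes f :: "real^'d \<Rightarrow> complex"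
  assumes \<Lambda>: "finite \<Lambda>" and v: "norm v < \<delta>"
    and f: "\<And>l. l \<in> \<Lambda> \<Longrightarrow> n_times_differentiable_on n f (ball l \<delta>)"
    and Z: "\<And>l \<beta>. l \<in> \<Lambda> \<Longrightarrow> mi_abs \<beta> < n \<Longrightarrow> mi_deriv \<beta> f l = 0"
    and K: "\<And>\<beta> \<xi>. mi_abs \<beta> = n \<Longrightarrow> norm \<xi> < \<delta> \<Longrightarrow> (\<Sum>l\<in>\<Lambda>. norm (mi_deriv \<beta> f (\<xi> + l))) \<le> K \<beta>"
  shows "(\<Sum>l\<in>\<Lambda>. norm (f (v + l))) \<le> norm v ^ n * (\<Sum>ds | length ds = n. K (count_list ds))"
proof -
  have \<delta>: "0 < \<delta>" using v norm_ge_zero[of v] by linarith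
  have tv: "norm (t *\<^sub>R v) < \<delta>" if "0 \<le> t" "t \<le> 1" for t
    using that v mult_right_mono[of t 1 "norm v"] by simp
  have inb: "l + t *\<^sub>R v \<in> ball l \<delta>" if "0 \<le> t" "t \<le> 1" for t l
    using tv[OF that] by (simp add: dist_norm)
  \<comment> \<open>The conjugate phase at the end point \<open>v\<close>; it stays fixed along the
    ray, so the weighted sum can be differentiated term by term. The value 0 where \<open>f\<close>
    vanishes keeps \<open>s\<close> bounded by 1.\<close>
  define s where "s = (\<lambda>l. if f (v + l) = 0 then 0 else cnj (f (v + l)) / of_real (norm (f (v + l))))"
  have s1: "norm (s l) \<le> 1" for l by (simp add: s_def norm_divide)
  have s2: "s l * f (v + l) = of_real (norm (f (v + l)))" for l
  proof (cases "f (v + l) = 0")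
    case False
    have "cnj (f (v + l)) * f (v + l) = of_real (norm (f (v + l))) * of_real (norm (f (v + l)))"
      using complex_norm_square[of "f (v + l)"] by (simp add: mult.commute power2_eq_square)
    thus ?thesis using False by (simp add: s_def)
  qed (simp add: s_def)
  define \<Psi> where "\<Psi> = (\<lambda>k t. \<Sum>l\<in>\<Lambda>. s l * ray_deriv f l v k t)"
  have "norm (\<Psi> 0 1) \<le> norm v ^ n * (\<Sum>ds | length ds = n. K (count_list ds))"
  proof (rule ray_chain_bound)
    fix k and t :: real assume k: "k < n" and t: "0 \<le> t" "t \<le> 1"
    show "(\<Psi> k has_vector_derivative \<Psi> (Suc k) t) (at t)"
      unfolding \<Psi>_def
      by (intro has_vector_derivative_sum has_vector_derivative_mult_right has_vector_derivative_ray_deriv[OF f inb[OF t] k])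
  next
    fix k assume k: "k < n"
    have "ray_deriv f l v k 0 = 0" if l: "l \<in> \<Lambda>" for l
      unfolding ray_deriv_def
    proof (rule sum.neutral, rule ballI)
      fix ds :: "'d list" assume ds: "ds \<in> {ds. length ds = k}"
      have "foldr partial_deriv ds f l = mi_deriv (count_list ds) f l"
        by (rule foldr_partial_deriv_eq_mi_deriv[OF open_ball f[OF l]]) (use ds k \<delta> in auto)
      also have "\<dots> = 0" by (rule Z[OF l]) (use ds k in \<open>simp add: mi_abs_count_list\<close>)
      finally show "prod_list (map (\<lambda>i. v $ i) ds) *\<^sub>R foldr partial_deriv ds f (l + 0 *\<^sub>R v) = 0" by simp
    qed
    thus "\<Psi> k 0 = 0" by (simp add: \<Psi>_def)
  next
    fix t :: real assume t: "0 \<le> t" "t \<le> 1"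
    show "norm (\<Psi> n t) \<le> norm v ^ n * (\<Sum>ds | length ds = n. K (count_list ds))"
      unfolding \<Psi>_def
    proof (rule norm_sum_ray_deriv_le[OF \<Lambda> s1])
      fix ds :: "'d list" assume ds: "length ds = n"
      have "(\<Sum>l\<in>\<Lambda>. norm (foldr partial_deriv ds f (l + t *\<^sub>R v))) = (\<Sum>l\<in>\<Lambda>. norm (mi_deriv (count_list ds) f (t *\<^sub>R v + l)))"
        using ds by (intro sum.cong refl arg_cong[where f = norm])
          (subst foldr_partial_deriv_eq_mi_deriv[OF open_ball f _ inb[OF t]], auto simp: add.commute)
      also have "\<dots> \<le> K (count_list ds)" by (rule K) (use ds tv[OF t] in \<open>auto simp: mi_abs_count_list\<close>)
      finally show "(\<Sum>l\<in>\<Lambda>. norm (foldr partial_deriv ds f (l + t *\<^sub>R v))) \<le> K (count_list ds)" .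
    qed
  qed
  moreover have "\<Psi> 0 1 = of_real (\<Sum>l\<in>\<Lambda>. norm (f (v + l)))"
    by (simp add: \<Psi>_def ray_deriv_0 add.commute[of _ v] s2)
  moreover have "norm (complex_of_real (\<Sum>l\<in>\<Lambda>. norm (f (v + l)))) = (\<Sum>l\<in>\<Lambda>. norm (f (v + l)))"
    unfolding norm_of_real by (intro abs_of_nonneg sum_nonneg) simp
  ultimately show ?thesis by simp
qed

text \<open>The compatibility condition concerns \<open>1 - f\<close>, while smoothness is assumed
  of \<open>f\<close>; from the first order on the derivatives differ only in sign.\<close>

lemma foldr_partial_deriv_one_minus:
  fixes f :: "real^'d \<Rightarrow> complex"
  assumes "open S" "n_times_differentiable_on n f S" "ds \<noteq> []" "length ds \<le> n" "x \<in> S"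
  shows "foldr partial_deriv ds (\<lambda>x. 1 - f x) x = - foldr partial_deriv ds f x"
  using assms(3-5)
proof (induction ds arbitrary: x)
  case (Cons i ds)
  have diff: "foldr partial_deriv ds f differentiable (at x)"
    by (rule n_times_differentiable_foldr[OF assms(2) _ Cons.prems(3)]) (use Cons.prems in simp)
  then obtain D where D: "(foldr partial_deriv ds f has_derivative D) (at x)" by (auto simp: differentiable_def)
  have D': "((\<lambda>x. c - foldr partial_deriv ds f x) has_derivative (\<lambda>h. - D h)) (at x)" for c
    using D by (auto intro!: derivative_eq_intros)
  have neg: "partial_deriv i (\<lambda>x. c - foldr partial_deriv ds f x) x = - partial_deriv i (foldr partial_deriv ds f) x" for c
    unfolding partial_deriv_eq_derivative[OF D'] partial_deriv_eq_derivative[OF D] ..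
  show ?case
  proof (cases "ds = []")
    case True thus ?thesis using neg[of 1] by simp
  next
    case False
    have "partial_deriv i (foldr partial_deriv ds (\<lambda>x. 1 - f x)) x = partial_deriv i (\<lambda>x. 0 - foldr partial_deriv ds f x) x"
      using Cons.prems False by (intro partial_deriv_cong_open[OF assms(1) Cons.prems(3)]) (auto simp: Cons.IH)
    thus ?thesis using neg[of 0] by simp
  qed
qed simp

lemma norm_one_minus_le_of_vanishing_derivs:
  fixes f :: "real^'d \<Rightarrow> complex"
  assumes v: "norm v < \<delta>" and n: "1 \<le> n"
    and f: "n_times_differentiable_on n f (ball 0 \<delta>)"
    and Z: "\<And>\<beta>. mi_abs \<beta> < n \<Longrightarrow> mi_deriv \<beta> (\<lambda>x. 1 - f x) 0 = 0"
    and K: "\<And>\<beta> \<xi>. mi_abs \<beta> = n \<Longrightarrow> norm \<xi> < \<delta> \<Longrightarrow> norm (mi_deriv \<beta> f \<xi>) \<le> K \<beta>"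
  shows "norm (1 - f v) \<le> norm v ^ n * (\<Sum>ds | length ds = n. K (count_list ds))"
proof -
  have \<delta>: "0 < \<delta>" using v norm_ge_zero[of v] by linarith
  have tv: "norm (t *\<^sub>R v) < \<delta>" if "0 \<le> t" "t \<le> 1" for t
    using that v mult_right_mono[of t 1 "norm v"] by simp
  have inb: "0 + t *\<^sub>R v \<in> ball 0 \<delta>" if "0 \<le> t" "t \<le> 1" for t
    using tv[OF that] by (simp add: dist_norm)
  have Zd: "foldr partial_deriv ds f 0 = 0" if ds: "length ds < n" "ds \<noteq> []" for ds
  proof -
    define \<beta> where "\<beta> = count_list ds"
    define js where "js = (SOME is. \<forall>i. count_list is i = \<beta> i)"
    have js: "\<forall>i. count_list js i = \<beta> i"
      unfolding js_def by (rule someI_ex) (rule ex_list_count)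
    hence ms: "mset js = mset ds" by (intro multiset_eqI) (simp add: count_mset \<beta>_def)
    have jl: "length js = length ds" using arg_cong[OF ms, of size] by simp
    hence jn: "js \<noteq> []" using ds by auto
    have "foldr partial_deriv ds f 0 = foldr partial_deriv js f 0"
      by (rule foldr_partial_deriv_perm[OF open_ball f ms]) (use ds \<delta> in auto)
    also have "\<dots> = - foldr partial_deriv js (\<lambda>x. 1 - f x) 0"
      by (subst foldr_partial_deriv_one_minus[OF open_ball f jn]) (use ds jl \<delta> in auto)
    also have "foldr partial_deriv js (\<lambda>x. 1 - f x) 0 = mi_deriv \<beta> (\<lambda>x. 1 - f x) 0"
      by (simp add: mi_deriv_def js_def)
    also have "\<dots> = 0" by (rule Z) (use ds in \<open>simp add: \<beta>_def mi_abs_count_list\<close>)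
    finally show ?thesis by simp
  qed
  \<comment> \<open>This is the zero multi-index: the list chosen by \<open>SOME\<close> has all
    counts 0, so it is empty and the derivative is the function itself.\<close>
  have f0: "f 0 = 1"
  proof -
    have "\<forall>i. count_list (SOME is. \<forall>i. count_list is i = (0::nat)) i = (0::nat)" for i :: 'd
      by (rule someI_ex[of "\<lambda>is. \<forall>i. count_list is i = 0"]) (rule exI[of _ "[]"], simp)
    hence "\<forall>i::'d. count_list (SOME is. \<forall>i. count_list is i = (0::nat)) i = (0::nat)" by blast
    hence "set (SOME is. \<forall>i::'d. count_list is i = (0::nat)) = {}" by (auto simp: count_list_0_iff)
    hence "mi_deriv (\<lambda>_. 0) (\<lambda>x. 1 - f x) 0 = 1 - f 0" by (simp add: mi_deriv_def)
    moreover have "mi_deriv (\<lambda>_. 0) (\<lambda>x. 1 - f x) 0 = 0" by (rule Z) (use n in \<open>simp add: mi_abs_def\<close>)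
    ultimately show ?thesis by simp
  qed
  \<comment> \<open>The constant 1 enters at order 0 only, where it is cancelled by
    \<open>f 0 = 1\<close>; its derivatives vanish.\<close>
  define \<Psi> where "\<Psi> = (\<lambda>k t. (if k = 0 then 1 else 0) - ray_deriv f 0 v k t)"
  have "norm (\<Psi> 0 1) \<le> norm v ^ n * (\<Sum>ds | length ds = n. K (count_list ds))"
  proof (rule ray_chain_bound)
    fix k and t :: real assume k: "k < n" and t: "0 \<le> t" "t \<le> 1"
    have "((\<lambda>t. (if k = 0 then 1 else 0) - ray_deriv f 0 v k t) has_vector_derivative 0 - ray_deriv f 0 v (Suc k) t) (at t)"
      by (intro has_vector_derivative_diff has_vector_derivative_const has_vector_derivative_ray_deriv[OF f inb[OF t] k])
    thus "(\<Psi> k has_vector_derivative \<Psi> (Suc k) t) (at t)" by (simp add: \<Psi>_def)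
  next
    fix k assume k: "k < n"
    show "\<Psi> k 0 = 0"
    proof (cases "k = 0")
      case True thus ?thesis by (simp add: \<Psi>_def ray_deriv_0 f0)
    next
      case False
      have "ray_deriv f 0 v k 0 = 0"
        unfolding ray_deriv_def
      proof (rule sum.neutral, rule ballI)
        fix ds :: "'d list" assume ds: "ds \<in> {ds. length ds = k}"
        have "foldr partial_deriv ds f 0 = 0" by (rule Zd) (use ds k False in auto)
        thus "prod_list (map (\<lambda>i. v $ i) ds) *\<^sub>R foldr partial_deriv ds f (0 + 0 *\<^sub>R v) = 0" by simp
      qed
      thus ?thesis using False by (simp add: \<Psi>_def)
    qed
  next
    fix t :: real assume t: "0 \<le> t" "t \<le> 1"
    have "norm (\<Sum>l\<in>{0::real^'d}. 1 * ray_deriv f l v n t) \<le> norm v ^ n * (\<Sum>ds | length ds = n. K (count_list ds))"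
    proof (rule norm_sum_ray_deriv_le)
      fix ds :: "'d list" assume ds: "length ds = n"
      have "foldr partial_deriv ds f (0 + t *\<^sub>R v) = mi_deriv (count_list ds) f (0 + t *\<^sub>R v)"
        by (rule foldr_partial_deriv_eq_mi_deriv[OF open_ball f _ inb[OF t]]) (use ds in simp)
      thus "(\<Sum>l\<in>{0::real^'d}. norm (foldr partial_deriv ds f (l + t *\<^sub>R v))) \<le> K (count_list ds)"
        using K[of "count_list ds" "t *\<^sub>R v"] ds tv[OF t] by (simp add: mi_abs_count_list)
    qed auto
    thus "norm (\<Psi> n t) \<le> norm v ^ n * (\<Sum>ds | length ds = n. K (count_list ds))"
      using n by (simp add: \<Psi>_def)
  qed
  thus ?thesis by (simp add: \<Psi>_def ray_deriv_0)
qed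

section \<open>The estimate of q-th powers on cosets\<close>

lemma add_powr_le:
  fixes x y q :: real
  assumes "0 \<le> x" "0 \<le> y" "0 < q"
  shows "(x + y) powr q \<le> 2 powr q * (x powr q + y powr q)"
proof -
  have "(x + y) powr q \<le> (2 * max x y) powr q" using assms by (intro powr_mono2) auto
  also have "\<dots> = 2 powr q * max x y powr q" using assms by (simp add: powr_mult)
  also have "max x y powr q \<le> x powr q + y powr q" by (simp add: max_def)
  finally show ?thesis by simp
qed

text \<open>Young's inequality with constants 1: compare \<open>y\<close> with
  \<open>x powr (1 / (p - 1))\<close>; in either case one of the two powers alone dominates the
  product.\<close>

lemma mult_le_powr_add_powr:
  fixes x y p q :: real
  assumes xy: "0 \<le> x" "0 \<le> y" and p: "1 < p" and q: "q = p / (p - 1)"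
  shows "x * y \<le> x powr q + y powr p"
proof (cases "x = 0 \<or> y = 0")
  case False
  hence pos: "0 < x" "0 < y" using xy by auto
  have q1: "q = 1 + 1 / (p - 1)" using p q by (simp add: field_simps)
  show ?thesis
  proof (cases "y \<le> x powr (1 / (p - 1))")
    case True
    have "x * y \<le> x * x powr (1 / (p - 1))" using True pos by (intro mult_left_mono) auto
    also have "\<dots> = x powr q" unfolding q1 using pos by (simp only: powr_add powr_one less_imp_le)
    also have "\<dots> \<le> x powr q + y powr p" by simp
    finally show ?thesis .
  next
    case False
    have "x = (x powr (1 / (p - 1))) powr (p - 1)" using pos p by (simp add: powr_powr)
    also have "\<dots> \<le> y powr (p - 1)" using False p by (intro powr_mono2) auto
    finally have "x * y \<le> y powr (p - 1) * y powr 1" using pos by simp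
    also have "\<dots> = y powr p" by (simp only: powr_add[symmetric]) simp
    also have "\<dots> \<le> x powr q + y powr p" by simp
    finally show ?thesis .
  qed
qed auto

lemma periodize_shift:
  assumes "k \<in> int_lattice"
  shows "periodize H (\<eta> + k) = periodize H \<eta>"
proof -
  have "bij_betw (\<lambda>l. k + l) int_lattice int_lattice"
    by (rule bij_betwI[where g = "\<lambda>l. l - k"]) (auto simp: assms int_lattice_add int_lattice_diff)
  from integral_bij_count_space[OF this, of "\<lambda>l. H (\<eta> + l)"]
  show ?thesis unfolding periodize_def by (simp add: add.assoc)
qed

text \<open>Apart from its point in the cell, a coset has norm at least 1/2, so the weight can be
  inserted at the cost of \<open>2 powr r\<close>.\<close>

lemma unit_cell_powr_ge:
  fixes \<zeta> l :: "real^'d"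
  assumes "\<zeta> \<in> unit_cell" "l \<in> int_lattice" "l \<noteq> 0" "0 \<le> r"
  shows "1 \<le> 2 powr r * norm (\<zeta> + l) powr r"
proof -
  have "1 / 2 \<le> norm (\<zeta> + l)"
    using unit_cell_norm_ge[OF assms(1,2)] int_lattice_norm_ge_1[OF assms(2,3)] by linarith
  hence "1 powr r \<le> (2 * norm (\<zeta> + l)) powr r" using assms(4) by (intro powr_mono2) auto
  thus ?thesis by (simp add: powr_mult)
qed

text \<open>Hoelder's inequality over the lattice; this is where \<open>d < p\<close> enters.\<close>

lemma lattice_tail_sum_bound:
  fixes p :: ennreal and q r :: real
  assumes p: "2 \<le> p" "1 / p + 1 / ennreal q = 1" and dp: "of_nat CARD('d) < p" and r: "1 \<le> r"
  obtains C where "0 \<le> C" "\<And>(G :: real^'d \<Rightarrow> complex) \<zeta> s. \<zeta> \<in> unit_cell \<Longrightarrow> 0 < s \<Longrightarrow>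
    (\<integral>\<^sup>+l. ennreal ((norm (\<zeta> + l) powr r * norm (G (\<zeta> + l))) powr q) \<partial>lattice_measure) \<le> ennreal (s powr q) \<Longrightarrow>
    (\<integral>\<^sup>+l. ennreal (norm (G (\<zeta> + l))) * indicator (- {0}) l \<partial>lattice_measure) \<le> ennreal (C * s)"
  using p
proof (cases rule: conjugate_exponent_cases)
  case infinite
  show ?thesis
  proof (rule that[of "2 powr r"])
    fix G :: "real^'d \<Rightarrow> complex" and \<zeta> :: "real^'d" and s :: real
    assume \<zeta>: "\<zeta> \<in> unit_cell" and s: "0 < s"
      and S: "(\<integral>\<^sup>+l. ennreal ((norm (\<zeta> + l) powr r * norm (G (\<zeta> + l))) powr q) \<partial>lattice_measure) \<le> ennreal (s powr q)"
    have "(\<integral>\<^sup>+l. ennreal (norm (G (\<zeta> + l))) * indicator (- {0}) l \<partial>lattice_measure) \<le>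
        (\<integral>\<^sup>+l. ennreal (2 powr r) * ennreal ((norm (\<zeta> + l) powr r * norm (G (\<zeta> + l))) powr q) \<partial>lattice_measure)"
    proof (rule nn_integral_mono)
      fix l :: "real^'d" assume "l \<in> space lattice_measure"
      hence l: "l \<in> int_lattice" by simp
      show "ennreal (norm (G (\<zeta> + l))) * indicator (- {0}) l \<le> ennreal (2 powr r) * ennreal ((norm (\<zeta> + l) powr r * norm (G (\<zeta> + l))) powr q)"
      proof (cases "l = 0")
        case False
        have "1 * norm (G (\<zeta> + l)) \<le> (2 powr r * norm (\<zeta> + l) powr r) * norm (G (\<zeta> + l))"
          using r by (intro mult_right_mono unit_cell_powr_ge[OF \<zeta> l False]) auto
        thus ?thesis using False infinite by (simp add: ennreal_mult[symmetric] ennreal_leI mult.assoc)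
      qed simp
    qed
    also have "\<dots> = ennreal (2 powr r) * (\<integral>\<^sup>+l. ennreal ((norm (\<zeta> + l) powr r * norm (G (\<zeta> + l))) powr q) \<partial>lattice_measure)"
      by (rule nn_integral_cmult) simp
    also have "\<dots> \<le> ennreal (2 powr r) * ennreal (s powr q)" by (rule mult_left_mono[OF S]) simp
    also have "\<dots> = ennreal (2 powr r * s)" using infinite s by (simp add: ennreal_mult[symmetric])
    finally show "(\<integral>\<^sup>+l. ennreal (norm (G (\<zeta> + l))) * indicator (- {0}) l \<partial>lattice_measure) \<le> ennreal (2 powr r * s)" .
  qed simp
next
  case (finite \<rho>)
  have "ennreal (real CARD('d)) < ennreal \<rho>" using dp finite by (simp add: ennreal_of_nat_eq_real_of_nat)
  hence d\<rho>: "real CARD('d) < \<rho>" by (simp add: ennreal_less_iff)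
  define Z where "Z = (LINT l|(lattice_measure :: (real^'d) measure). max 1 (norm l) powr (- \<rho>))"
  have Z0: "0 \<le> Z" unfolding Z_def by (intro Bochner_Integration.integral_nonneg) simp
  have Z: "(\<integral>\<^sup>+l. ennreal (max 1 (norm l) powr (- \<rho>)) \<partial>(lattice_measure :: (real^'d) measure)) = ennreal Z"
    unfolding Z_def by (rule nn_integral_eq_integral[OF integrable_lattice_powr[OF d\<rho>]]) simp
  define W where "W = 2 powr (r * \<rho>)"
  have W0: "0 \<le> W" by (simp add: W_def)
  show ?thesis
  \<comment> \<open>The summand 1 comes from the weighted q-sum of \<open>G\<close>, and
    \<open>W * Z\<close> from the lattice sum of negative powers, which converges because \<rho>
    exceeds the dimension.\<close>
  proof (rule that[of "1 + W * Z"])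
    fix G :: "real^'d \<Rightarrow> complex" and \<zeta> :: "real^'d" and s :: real
    assume \<zeta>: "\<zeta> \<in> unit_cell" and s: "0 < s"
      and S: "(\<integral>\<^sup>+l. ennreal ((norm (\<zeta> + l) powr r * norm (G (\<zeta> + l))) powr q) \<partial>lattice_measure) \<le> ennreal (s powr q)"
    define a where "a = (\<lambda>l. norm (\<zeta> + l) powr r * norm (G (\<zeta> + l)))"
    have a0: "0 \<le> a l" for l by (simp add: a_def)
    have tm: "ennreal (norm (G (\<zeta> + l))) * indicator (- {0}) l \<le>
        ennreal (s * s powr (- q)) * ennreal (a l powr q) + ennreal (s * W) * ennreal (max 1 (norm l) powr (- \<rho>))"
      if l: "l \<in> int_lattice" for l
    proof (cases "l = 0")
      case False
      have nl: "1 \<le> norm l" by (rule int_lattice_norm_ge_1[OF l False])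
      have n2: "norm l / 2 \<le> norm (\<zeta> + l)" by (rule unit_cell_norm_ge[OF \<zeta> l])
      have npos: "0 < norm (\<zeta> + l)" using nl n2 by linarith
      define y where "y = norm (\<zeta> + l) powr (- r)"
      \<comment> \<open>Splitting off the scale \<open>s\<close> makes Young's inequality
        homogeneous, so that it yields a bound linear in \<open>s\<close>, as Hoelder's inequality
        does.\<close>
      have G: "norm (G (\<zeta> + l)) = s * ((a l / s) * y)"
        using npos s by (simp add: a_def y_def powr_minus)
      have "(a l / s) * y \<le> (a l / s) powr q + y powr \<rho>"
        using a0[of l] s finite by (intro mult_le_powr_add_powr) (auto simp: y_def)
      also have "(a l / s) powr q = s powr (- q) * a l powr q"
        unfolding powr_divide powr_minus by (simp only: divide_inverse mult.commute)
      also have "y powr \<rho> \<le> W * max 1 (norm l) powr (- \<rho>)"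
      proof -
        have "y powr \<rho> = norm (\<zeta> + l) powr (- (r * \<rho>))" by (simp add: y_def powr_powr)
        also have "\<dots> \<le> (norm l / 2) powr (- (r * \<rho>))"
          using n2 nl r finite by (intro powr_mono2') auto
        also have "\<dots> = W * norm l powr (- (r * \<rho>))"
          using nl by (simp add: W_def powr_divide powr_minus field_simps)
        also have "\<dots> \<le> W * norm l powr (- \<rho>)"
          using nl r finite W0 by (intro mult_left_mono powr_mono) auto
        also have "norm l = max 1 (norm l)" using nl by simp
        finally show ?thesis .
      qed
      finally have "s * ((a l / s) * y) \<le> s * (s powr (- q) * a l powr q + W * max 1 (norm l) powr (- \<rho>))"
        using s by (intro mult_left_mono) auto
      hence "norm (G (\<zeta> + l)) \<le> s * s powr (- q) * a l powr q + s * W * max 1 (norm l) powr (- \<rho>)"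
        unfolding G[symmetric] by (simp only: distrib_left mult.assoc)
      hence "ennreal (norm (G (\<zeta> + l))) \<le> ennreal (s * s powr (- q) * a l powr q + s * W * max 1 (norm l) powr (- \<rho>))"
        by (rule ennreal_leI)
      also have "\<dots> = ennreal (s * s powr (- q)) * ennreal (a l powr q) + ennreal (s * W) * ennreal (max 1 (norm l) powr (- \<rho>))"
        using s W0 by (simp add: ennreal_mult)
      finally show ?thesis using False by simp
    qed simp
    have "(\<integral>\<^sup>+l. ennreal (norm (G (\<zeta> + l))) * indicator (- {0}) l \<partial>lattice_measure) \<le>
        (\<integral>\<^sup>+l. ennreal (s * s powr (- q)) * ennreal (a l powr q) + ennreal (s * W) * ennreal (max 1 (norm l) powr (- \<rho>)) \<partial>lattice_measure)"
      by (intro nn_integral_mono tm) simp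
    also have "\<dots> = ennreal (s * s powr (- q)) * (\<integral>\<^sup>+l. ennreal (a l powr q) \<partial>lattice_measure) + ennreal (s * W) * ennreal Z"
      by (simp add: nn_integral_add nn_integral_cmult Z)
    also have "\<dots> \<le> ennreal (s * s powr (- q)) * ennreal (s powr q) + ennreal (s * W) * ennreal Z"
      using S by (intro add_mono mult_left_mono) (auto simp: a_def)
    also have "\<dots> = ennreal (s * s powr (- q) * s powr q + s * W * Z)"
      using s W0 Z0 by (simp add: ennreal_mult)
    also have "s * s powr (- q) * s powr q + s * W * Z = (1 + W * Z) * s"
      using s by (simp add: powr_minus algebra_simps)
    finally show "(\<integral>\<^sup>+l. ennreal (norm (G (\<zeta> + l))) * indicator (- {0}) l \<partial>lattice_measure) \<le> ennreal ((1 + W * Z) * s)" .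
  qed (use W0 Z0 in simp)
qed

lemma integral_lattice_split_zero:
  fixes u :: "real^'d \<Rightarrow> complex"
  assumes u: "integrable lattice_measure u"
  shows "(LINT l|lattice_measure. u l) = u 0 + (LINT l|lattice_measure. indicator (- {0}) l *\<^sub>R u l)"
proof -
  have i0: "integrable lattice_measure (\<lambda>l. indicator {0::real^'d} l *\<^sub>R u l)"
    using u by (rule integrable_mult_indicator[rotated]) (simp add: int_lattice_zero)
  have i1: "integrable lattice_measure (\<lambda>l. indicator (- {0::real^'d}) l *\<^sub>R u l)"
    by (rule Bochner_Integration.integrable_bound[OF u]) (auto split: split_indicator)
  have "(LINT l|lattice_measure. indicator {0::real^'d} l *\<^sub>R u l) = u 0"
  proof -
    have sub: "{l\<in>int_lattice. indicator {0::real^'d} l *\<^sub>R u l \<noteq> 0} \<subseteq> {0}" by (auto split: split_indicator)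
    have "(LINT l|lattice_measure. indicator {0::real^'d} l *\<^sub>R u l) = (\<Sum>l\<in>{l\<in>int_lattice. indicator {0::real^'d} l *\<^sub>R u l \<noteq> 0}. indicator {0::real^'d} l *\<^sub>R u l)"
      by (rule lebesgue_integral_count_space_finite_support) (rule finite_subset[OF sub], simp)
    also have "\<dots> = (\<Sum>l\<in>{0}. indicator {0::real^'d} l *\<^sub>R u l)"
      using sub by (intro sum.mono_neutral_left) (auto simp: int_lattice_zero)
    finally show ?thesis by simp
  qed
  moreover have "(LINT l|lattice_measure. u l) = (LINT l|lattice_measure. indicator {0::real^'d} l *\<^sub>R u l + indicator (- {0}) l *\<^sub>R u l)"
    by (intro Bochner_Integration.integral_cong refl) (auto split: split_indicator)
  ultimately show ?thesis by (simp add: Bochner_Integration.integral_add[OF i0 i1])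
qed

text \<open>On a coset the error splits into three parts: \<open>G\<close> at the points with
  nonzero \<open>l\<close>, where the weight is bounded below; \<open>G \<zeta>\<close> times the
  symbol defect, which carries the factor \<open>norm \<zeta> powr r\<close>; and \<open>F\<close>
  times the tail of the periodization, controlled by the weighted q-sum of \<open>G\<close>. Tiling
  adds the cosets up.\<close>

lemma shift_series_symbol_bound:
  fixes p :: ennreal and q r B C0 :: real and F A :: "real^'d \<Rightarrow> complex"
  assumes p: "2 \<le> p" "1 / p + 1 / ennreal q = 1" and dp: "of_nat CARD('d) < p" and r: "1 \<le> r"
    and [measurable]: "F \<in> borel_measurable borel" "A \<in> borel_measurable borel" and A1: "\<And>\<xi>. norm (A \<xi>) \<le> 1"
    and B: "0 \<le> B" "\<And>\<xi>. (\<integral>\<^sup>+l. ennreal (norm (F (\<xi> + l)) powr q) \<partial>lattice_measure) \<le> ennreal B"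
    and C0: "0 \<le> C0" "\<And>\<zeta>. \<zeta> \<in> unit_cell \<Longrightarrow>
      (\<integral>\<^sup>+l. ennreal (norm ((if l = 0 then 1 else 0) - F (\<zeta> + l) * A \<zeta>) powr q) \<partial>lattice_measure) \<le> ennreal (C0 * norm \<zeta> powr (r * q))"
  obtains C where "0 < C" "\<And>G :: real^'d \<Rightarrow> complex. G \<in> borel_measurable borel \<Longrightarrow>
    (\<integral>\<^sup>+\<eta>. ennreal (norm (G \<eta> - F \<eta> * periodize (\<lambda>\<xi>. G \<xi> * A \<xi>) \<eta>) powr q) \<partial>lborel) \<le>
    ennreal C * (\<integral>\<^sup>+\<eta>. ennreal ((norm \<eta> powr r * norm (G \<eta>)) powr q) \<partial>lborel)"
proof -
  have q: "0 < q" using p by (cases rule: conjugate_exponent_cases) auto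
  obtain C2 where C2: "0 \<le> C2" "\<And>(G :: real^'d \<Rightarrow> complex) \<zeta> s. \<zeta> \<in> unit_cell \<Longrightarrow> 0 < s \<Longrightarrow>
    (\<integral>\<^sup>+l. ennreal ((norm (\<zeta> + l) powr r * norm (G (\<zeta> + l))) powr q) \<partial>lattice_measure) \<le> ennreal (s powr q) \<Longrightarrow>
    (\<integral>\<^sup>+l. ennreal (norm (G (\<zeta> + l))) * indicator (- {0}) l \<partial>lattice_measure) \<le> ennreal (C2 * s)"
    using lattice_tail_sum_bound[OF p dp r] by blast
  \<comment> \<open>\<open>c1\<close>, \<open>c2\<close>, \<open>c3\<close> belong to the three
    parts; each use of \<open>add_powr_le\<close> contributes a factor
    \<open>2 powr q\<close>.\<close>
  define c1 where "c1 = 2 powr q * 2 powr (r * q)"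
  define c2 where "c2 = 2 powr q * (2 powr q * C0)"
  define c3 where "c3 = 2 powr q * (2 powr q * (B * C2 powr q))"
  have c: "0 < c1" "0 \<le> c2" "0 \<le> c3" using B C0 C2 by (auto simp: c1_def c2_def c3_def)
  define C where "C = c1 + c2 + c3"
  have C: "0 < C" using c by (simp add: C_def)
  show ?thesis
  proof (rule that[OF C])
    fix G :: "real^'d \<Rightarrow> complex" assume [measurable]: "G \<in> borel_measurable borel"
    define w where "w = (\<lambda>\<eta>. G \<eta> - F \<eta> * periodize (\<lambda>\<xi>. G \<xi> * A \<xi>) \<eta>)"
    have [measurable]: "w \<in> borel_measurable borel" unfolding w_def by measurable
    define S where "S = (\<lambda>\<zeta>. \<integral>\<^sup>+l. ennreal ((norm (\<zeta> + l) powr r * norm (G (\<zeta> + l))) powr q) \<partial>lattice_measure)"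
    have [measurable]: "S \<in> borel_measurable borel"
      unfolding S_def by (rule borel_measurable_nn_integral_lattice) measurable
    have key: "(\<integral>\<^sup>+l. ennreal (norm (w (\<zeta> + l)) powr q) \<partial>lattice_measure) \<le> ennreal (C * s powr q)"
      if \<zeta>: "\<zeta> \<in> unit_cell" and s: "0 < s" and Ss: "S \<zeta> \<le> ennreal (s powr q)" for \<zeta> s
    proof -
      define tail where "tail = (LINT l|lattice_measure. indicator (- {0}) l *\<^sub>R (G (\<zeta> + l) * A (\<zeta> + l)))"
      have R: "(\<integral>\<^sup>+l. ennreal (norm (G (\<zeta> + l))) * indicator (- {0}) l \<partial>lattice_measure) \<le> ennreal (C2 * s)"
        by (rule C2(2)[OF \<zeta> s Ss[unfolded S_def]])
      have GA: "norm (G x * A x) \<le> norm (G x)" for x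
        unfolding norm_mult using mult_left_mono[OF A1, of "norm (G x)"] by simp
      have Rt: "(\<integral>\<^sup>+l. ennreal (norm (indicator (- {0}) l *\<^sub>R (G (\<zeta> + l) * A (\<zeta> + l)))) \<partial>lattice_measure) \<le> ennreal (C2 * s)"
        by (rule order_trans[OF nn_integral_mono R]) (use GA in \<open>auto split: split_indicator intro: ennreal_leI\<close>)
      have it: "integrable lattice_measure (\<lambda>l. indicator (- {0}) l *\<^sub>R (G (\<zeta> + l) * A (\<zeta> + l)))"
        unfolding integrable_lattice_iff using Rt by (rule le_less_trans) simp
      have i0: "integrable lattice_measure (\<lambda>l. indicator {0} l *\<^sub>R (G (\<zeta> + l) * A (\<zeta> + l)))"
      proof -
        have "(\<integral>\<^sup>+l. ennreal (norm (indicator {0} l *\<^sub>R (G (\<zeta> + l) * A (\<zeta> + l)))) \<partial>lattice_measure) =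
          (\<integral>\<^sup>+l. ennreal (norm (G \<zeta> * A \<zeta>)) * indicator {0::real^'d} l \<partial>lattice_measure)"
          by (intro nn_integral_cong) (auto split: split_indicator)
        also have "\<dots> = ennreal (norm (G \<zeta> * A \<zeta>)) * emeasure lattice_measure {0::real^'d}"
          by (rule nn_integral_cmult_indicator) (simp add: int_lattice_zero)
        also have "\<dots> < \<infinity>" by (simp add: emeasure_count_space int_lattice_zero)
        finally show ?thesis unfolding integrable_lattice_iff .
      qed
      have iGA: "integrable lattice_measure (\<lambda>l. G (\<zeta> + l) * A (\<zeta> + l))"
      proof -
        have "(\<lambda>l. G (\<zeta> + l) * A (\<zeta> + l)) = (\<lambda>l. indicator {0} l *\<^sub>R (G (\<zeta> + l) * A (\<zeta> + l)) + indicator (- {0}) l *\<^sub>R (G (\<zeta> + l) * A (\<zeta> + l)))"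
          by (rule ext) (auto split: split_indicator)
        thus ?thesis using Bochner_Integration.integrable_add[OF i0 it] by simp
      qed
      have per: "periodize (\<lambda>\<xi>. G \<xi> * A \<xi>) \<zeta> = G \<zeta> * A \<zeta> + tail"
        unfolding periodize_def integral_lattice_split_zero[OF iGA] tail_def by simp
      have "ennreal (norm tail) \<le> ennreal (C2 * s)"
        unfolding tail_def by (rule order_trans[OF integral_norm_bound_ennreal[OF it] Rt])
      hence tail: "norm tail \<le> C2 * s" using C2(1) s by simp
      have pt: "norm (w (\<zeta> + l)) powr q \<le> c1 * (norm (\<zeta> + l) powr r * norm (G (\<zeta> + l))) powr q +
          (2 powr q * (2 powr q * norm (G \<zeta>) powr q)) * norm ((if l = 0 then 1 else 0) - F (\<zeta> + l) * A \<zeta>) powr q +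
          (2 powr q * (2 powr q * (C2 * s) powr q)) * norm (F (\<zeta> + l)) powr q"
        if l: "l \<in> int_lattice" for l
      proof -
        define x1 where "x1 = (if l = 0 then 0 else norm (G (\<zeta> + l)))"
        define x2 where "x2 = norm ((if l = 0 then 1 else 0) - F (\<zeta> + l) * A \<zeta>) * norm (G \<zeta>)"
        define x3 where "x3 = norm (F (\<zeta> + l)) * (C2 * s)"
        have x0: "0 \<le> x1" "0 \<le> x2" "0 \<le> x3" using C2(1) s by (auto simp: x1_def x2_def x3_def)
        \<comment> \<open>The periodization is constant on the coset; its \<open>l = 0\<close> term
          is merged with \<open>G \<zeta>\<close> into the defect, and the rest is
          \<open>tail\<close>.\<close>
        have "w (\<zeta> + l) = (if l = 0 then 0 else G (\<zeta> + l)) + (((if l = 0 then 1 else 0) - F (\<zeta> + l) * A \<zeta>) * G \<zeta> - F (\<zeta> + l) * tail)"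
          unfolding w_def periodize_shift[OF l] per by (simp add: algebra_simps)
        also have "norm \<dots> \<le> norm (if l = 0 then 0 else G (\<zeta> + l)) + (norm (((if l = 0 then 1 else 0) - F (\<zeta> + l) * A \<zeta>) * G \<zeta>) + norm (F (\<zeta> + l) * tail))"
          by (rule order_trans[OF norm_triangle_ineq add_left_mono[OF norm_triangle_ineq4]])
        also have "\<dots> \<le> x1 + (x2 + x3)"
        proof (intro add_mono)
          show "norm (F (\<zeta> + l) * tail) \<le> x3"
            unfolding x3_def norm_mult by (rule mult_left_mono[OF tail]) simp
        qed (simp_all only: x1_def x2_def norm_mult if_distrib[of norm] norm_zero order_refl)
        finally have "norm (w (\<zeta> + l)) powr q \<le> (x1 + (x2 + x3)) powr q"
          using q by (intro powr_mono2) auto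
        also have "\<dots> \<le> 2 powr q * (x1 powr q + (x2 + x3) powr q)"
          using x0 q by (intro add_powr_le) auto
        also have "\<dots> \<le> 2 powr q * (x1 powr q + 2 powr q * (x2 powr q + x3 powr q))"
          using x0 q by (intro mult_left_mono add_left_mono add_powr_le) auto
        also have "\<dots> = 2 powr q * x1 powr q + 2 powr q * (2 powr q * x2 powr q) + 2 powr q * (2 powr q * x3 powr q)"
          by (simp only: distrib_left add.assoc)
        also have "2 powr q * x1 powr q \<le> c1 * (norm (\<zeta> + l) powr r * norm (G (\<zeta> + l))) powr q"
        proof (cases "l = 0")
          case False
          have "1 * norm (G (\<zeta> + l)) \<le> (2 powr r * norm (\<zeta> + l) powr r) * norm (G (\<zeta> + l))"
            using r by (intro mult_right_mono unit_cell_powr_ge[OF \<zeta> l False]) auto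
          hence "x1 powr q \<le> (2 powr r * (norm (\<zeta> + l) powr r * norm (G (\<zeta> + l)))) powr q"
            using q False by (intro powr_mono2) (auto simp: x1_def mult.assoc)
          also have "\<dots> = 2 powr (r * q) * (norm (\<zeta> + l) powr r * norm (G (\<zeta> + l))) powr q"
            by (subst powr_mult) (auto simp: powr_powr)
          finally show ?thesis unfolding c1_def mult.assoc by (rule mult_left_mono) simp
        qed (use c in \<open>simp add: x1_def\<close>)
        also have "2 powr q * (2 powr q * x2 powr q) = (2 powr q * (2 powr q * norm (G \<zeta>) powr q)) * norm ((if l = 0 then 1 else 0) - F (\<zeta> + l) * A \<zeta>) powr q"
          unfolding x2_def by (simp add: powr_mult)
        also have "2 powr q * (2 powr q * x3 powr q) = (2 powr q * (2 powr q * (C2 * s) powr q)) * norm (F (\<zeta> + l)) powr q"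
        proof -
          have "x3 powr q = norm (F (\<zeta> + l)) powr q * (C2 * s) powr q"
            unfolding x3_def using C2(1) s by (simp add: powr_mult)
          thus ?thesis by (simp only: mult_ac)
        qed
        finally show ?thesis by simp
      qed
      have "(\<integral>\<^sup>+l. ennreal (norm (w (\<zeta> + l)) powr q) \<partial>lattice_measure) \<le>
        (\<integral>\<^sup>+l. ennreal c1 * ennreal ((norm (\<zeta> + l) powr r * norm (G (\<zeta> + l))) powr q) +
           ennreal (2 powr q * (2 powr q * norm (G \<zeta>) powr q)) * ennreal (norm ((if l = 0 then 1 else 0) - F (\<zeta> + l) * A \<zeta>) powr q) +
           ennreal (2 powr q * (2 powr q * (C2 * s) powr q)) * ennreal (norm (F (\<zeta> + l)) powr q) \<partial>lattice_measure)"
      proof (rule nn_integral_mono)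
        fix l :: "real^'d" assume "l \<in> space lattice_measure"
        hence "l \<in> int_lattice" by simp
        from ennreal_leI[OF pt[OF this]] c
        show "ennreal (norm (w (\<zeta> + l)) powr q) \<le> ennreal c1 * ennreal ((norm (\<zeta> + l) powr r * norm (G (\<zeta> + l))) powr q) +
           ennreal (2 powr q * (2 powr q * norm (G \<zeta>) powr q)) * ennreal (norm ((if l = 0 then 1 else 0) - F (\<zeta> + l) * A \<zeta>) powr q) +
           ennreal (2 powr q * (2 powr q * (C2 * s) powr q)) * ennreal (norm (F (\<zeta> + l)) powr q)"
          by (simp only: ennreal_mult[symmetric] ennreal_plus[symmetric] mult_nonneg_nonneg add_nonneg_nonneg powr_ge_zero less_imp_le)
      qed
      also have "\<dots> = ennreal c1 * S \<zeta> +
           ennreal (2 powr q * (2 powr q * norm (G \<zeta>) powr q)) * (\<integral>\<^sup>+l. ennreal (norm ((if l = 0 then 1 else 0) - F (\<zeta> + l) * A \<zeta>) powr q) \<partial>lattice_measure) +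
           ennreal (2 powr q * (2 powr q * (C2 * s) powr q)) * (\<integral>\<^sup>+l. ennreal (norm (F (\<zeta> + l)) powr q) \<partial>lattice_measure)"
        unfolding S_def by (simp add: nn_integral_add nn_integral_cmult)
      also have "\<dots> \<le> ennreal c1 * ennreal (s powr q) +
           ennreal (2 powr q * (2 powr q * norm (G \<zeta>) powr q)) * ennreal (C0 * norm \<zeta> powr (r * q)) +
           ennreal (2 powr q * (2 powr q * (C2 * s) powr q)) * ennreal B"
        by (intro add_mono mult_left_mono Ss C0(2)[OF \<zeta>] B(2)) auto
      also have "\<dots> = ennreal (c1 * s powr q + 2 powr q * (2 powr q * norm (G \<zeta>) powr q) * (C0 * norm \<zeta> powr (r * q)) + 2 powr q * (2 powr q * (C2 * s) powr q) * B)"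
        using c B(1) C0(1) by (simp only: ennreal_mult[symmetric] ennreal_plus[symmetric] mult_nonneg_nonneg add_nonneg_nonneg powr_ge_zero less_imp_le)
      also have "\<dots> \<le> ennreal (C * s powr q)"
      proof (rule ennreal_leI)
        \<comment> \<open>The \<open>l = 0\<close> term of \<open>S \<zeta>\<close> bounds
          \<open>G \<zeta>\<close> together with its weight, which is exactly the combination
          produced by the defect.\<close>
        have "(norm (\<zeta> + 0) powr r * norm (G (\<zeta> + 0))) powr q \<le> s powr q"
        proof -
          have "ennreal ((norm (\<zeta> + 0) powr r * norm (G (\<zeta> + 0))) powr q) = (\<integral>\<^sup>+l. ennreal ((norm (\<zeta> + l) powr r * norm (G (\<zeta> + l))) powr q) * indicator {0} l \<partial>lattice_measure)"
          proof -
            have "(\<integral>\<^sup>+l. ennreal ((norm (\<zeta> + l) powr r * norm (G (\<zeta> + l))) powr q) * indicator {0} l \<partial>lattice_measure) =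
              (\<integral>\<^sup>+l. ennreal ((norm (\<zeta> + 0) powr r * norm (G (\<zeta> + 0))) powr q) * indicator {0::real^'d} l \<partial>lattice_measure)"
              by (intro nn_integral_cong) (auto split: split_indicator)
            also have "\<dots> = ennreal ((norm (\<zeta> + 0) powr r * norm (G (\<zeta> + 0))) powr q) * emeasure lattice_measure {0::real^'d}"
              by (rule nn_integral_cmult_indicator) (simp add: int_lattice_zero)
            finally show ?thesis by (simp add: emeasure_count_space int_lattice_zero)
          qed
          also have "\<dots> \<le> S \<zeta>" unfolding S_def by (intro nn_integral_mono) (auto split: split_indicator)
          also have "\<dots> \<le> ennreal (s powr q)" by (rule Ss)
          finally show ?thesis by simp
        qed
        hence g0: "norm (G \<zeta>) powr q * norm \<zeta> powr (r * q) \<le> s powr q"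
          by (simp add: powr_mult powr_powr mult.commute)
        have "2 powr q * (2 powr q * norm (G \<zeta>) powr q) * (C0 * norm \<zeta> powr (r * q)) = c2 * (norm (G \<zeta>) powr q * norm \<zeta> powr (r * q))"
          by (simp only: c2_def mult_ac)
        also have "\<dots> \<le> c2 * s powr q" by (rule mult_left_mono[OF g0 c(2)])
        finally have "2 powr q * (2 powr q * norm (G \<zeta>) powr q) * (C0 * norm \<zeta> powr (r * q)) \<le> c2 * s powr q" .
        moreover have "2 powr q * (2 powr q * (C2 * s) powr q) * B = c3 * s powr q"
        proof -
          have "(C2 * s) powr q = C2 powr q * s powr q" using C2(1) s by (simp add: powr_mult)
          thus ?thesis by (simp only: c3_def mult_ac)
        qed
        ultimately show "c1 * s powr q + 2 powr q * (2 powr q * norm (G \<zeta>) powr q) * (C0 * norm \<zeta> powr (r * q)) + 2 powr q * (2 powr q * (C2 * s) powr q) * B \<le> C * s powr q"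
          by (simp add: C_def distrib_right)
      qed
      finally show ?thesis .
    qed
    have le: "(\<integral>\<^sup>+l. ennreal (norm (w (\<zeta> + l)) powr q) \<partial>lattice_measure) \<le> ennreal C * S \<zeta>" if \<zeta>: "\<zeta> \<in> unit_cell" for \<zeta>
    proof (rule ennreal_le_epsilon)
      fix e :: real assume fin: "ennreal C * S \<zeta> < top" and e: "0 < e"
      have "S \<zeta> < top" using fin C by (auto simp: ennreal_mult_less_top)
      then obtain x where x: "0 \<le> x" "S \<zeta> = ennreal x" by (cases "S \<zeta>") auto
      \<comment> \<open>\<open>key\<close> needs a positive \<open>s\<close>, but
        \<open>S \<zeta>\<close> may be 0; the excess \<open>e / C\<close> costs only
        \<open>e\<close> in the result.\<close>
      define s where "s = (x + e / C) powr (1 / q)"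
      have xe: "0 < x + e / C" using x e C by (intro add_nonneg_pos) auto
      have sq: "s powr q = x + e / C" unfolding s_def using xe q by (simp add: powr_powr)
      have "0 < s" unfolding s_def using xe by simp
      moreover have "S \<zeta> \<le> ennreal (s powr q)" unfolding sq x(2) using e C by (intro ennreal_leI) auto
      ultimately have "(\<integral>\<^sup>+l. ennreal (norm (w (\<zeta> + l)) powr q) \<partial>lattice_measure) \<le> ennreal (C * s powr q)"
        by (rule key[OF \<zeta>])
      also have "C * s powr q = C * x + e" unfolding sq using C by (simp add: distrib_left)
      also have "ennreal (C * x + e) = ennreal C * S \<zeta> + ennreal e" using C x e by (simp add: ennreal_mult)
      finally show "(\<integral>\<^sup>+l. ennreal (norm (w (\<zeta> + l)) powr q) \<partial>lattice_measure) \<le> ennreal C * S \<zeta> + ennreal e" .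
    qed
    have "(\<integral>\<^sup>+\<eta>. ennreal (norm (w \<eta>) powr q) \<partial>lborel) = (\<integral>\<^sup>+\<zeta>. indicator unit_cell \<zeta> * (\<integral>\<^sup>+l. ennreal (norm (w (\<zeta> + l)) powr q) \<partial>lattice_measure) \<partial>lborel)"
      by (rule nn_integral_tiling) measurable
    also have "\<dots> \<le> (\<integral>\<^sup>+\<zeta>. ennreal C * (indicator unit_cell \<zeta> * S \<zeta>) \<partial>lborel)"
      by (intro nn_integral_mono) (use le in \<open>auto split: split_indicator\<close>)
    also have "\<dots> = ennreal C * (\<integral>\<^sup>+\<zeta>. indicator unit_cell \<zeta> * S \<zeta> \<partial>lborel)"
      by (rule nn_integral_cmult) measurable
    also have "(\<integral>\<^sup>+\<zeta>. indicator unit_cell \<zeta> * S \<zeta> \<partial>lborel) = (\<integral>\<^sup>+\<eta>. ennreal ((norm \<eta> powr r * norm (G \<eta>)) powr q) \<partial>lborel)"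
      unfolding S_def by (rule nn_integral_tiling[symmetric]) measurable
    finally show "(\<integral>\<^sup>+\<eta>. ennreal (norm (G \<eta> - F \<eta> * periodize (\<lambda>\<xi>. G \<xi> * A \<xi>) \<eta>) powr q) \<partial>lborel) \<le>
      ennreal C * (\<integral>\<^sup>+\<eta>. ennreal ((norm \<eta> powr r * norm (G \<eta>)) powr q) \<partial>lborel)"
      by (simp add: w_def)
  qed
qed

section \<open>The symbol of averaging over a ball\<close>

text \<open>The multinomial theorem in terms of divided powers, for which the binomial formula is a
  convolution without coefficients; this is what makes the induction over \<open>A\<close>
  close.\<close>

lemma sum_power_div_fact:
  fixes x :: "'d::finite \<Rightarrow> real"
  assumes "finite A"
  shows "(\<Sum>i\<in>A. x i) ^ k / fact k =
    (\<Sum>\<beta> | (\<forall>i. i \<notin> A \<longrightarrow> \<beta> i = 0) \<and> (\<Sum>i\<in>A. \<beta> i) = k. \<Prod>i\<in>A. x i ^ \<beta> i / fact (\<beta> i))"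
  using assms
proof (induction A arbitrary: k rule: finite_induct)
  case empty
  have "{\<beta> :: 'd \<Rightarrow> nat. (\<forall>i. \<beta> i = 0) \<and> 0 = k} = (if k = 0 then {\<lambda>_. 0} else {})"
    by (auto simp: fun_eq_iff)
  thus ?case by auto
next
  case (insert a A)
  let ?B = "\<lambda>A k. {\<beta> :: 'd \<Rightarrow> nat. (\<forall>i. i \<notin> A \<longrightarrow> \<beta> i = 0) \<and> (\<Sum>i\<in>A. \<beta> i) = k}"
  have fin: "finite (?B A k)" for k
  proof (rule finite_subset)
    show "?B A k \<subseteq> PiE UNIV (\<lambda>_. {..k})"
    proof
      fix \<beta> assume \<beta>: "\<beta> \<in> ?B A k"
      have "\<beta> i \<le> k" for i
      proof (cases "i \<in> A")
        case True
        thus ?thesis using \<beta> member_le_sum[of i A \<beta>] insert.hyps(1) by auto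
      qed (use \<beta> in auto)
      thus "\<beta> \<in> PiE UNIV (\<lambda>_. {..k})" by (auto simp: PiE_UNIV_domain)
    qed
  qed (auto intro: finite_PiE)
  have "(\<Sum>i\<in>insert a A. x i) ^ k / fact k = (\<Sum>j\<le>k. of_nat (k choose j) * x a ^ j * (\<Sum>i\<in>A. x i) ^ (k - j)) / fact k"
    using insert.hyps by (simp add: binomial_ring)
  also have "\<dots> = (\<Sum>j\<le>k. (x a ^ j / fact j) * ((\<Sum>i\<in>A. x i) ^ (k - j) / fact (k - j)))"
    unfolding sum_divide_distrib
  proof (rule sum.cong[OF refl])
    fix j assume "j \<in> {..k}"
    hence "real (k choose j) = fact k / (fact j * fact (k - j))" by (intro binomial_fact) simp
    thus "of_nat (k choose j) * x a ^ j * (\<Sum>i\<in>A. x i) ^ (k - j) / fact k = (x a ^ j / fact j) * ((\<Sum>i\<in>A. x i) ^ (k - j) / fact (k - j))"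
      by simp
  qed
  also have "\<dots> = (\<Sum>j\<le>k. \<Sum>\<beta>\<in>?B A (k - j). (x a ^ j / fact j) * (\<Prod>i\<in>A. x i ^ \<beta> i / fact (\<beta> i)))"
    by (simp only: insert.IH sum_distrib_left)
  also have "\<dots> = (\<Sum>(j, \<beta>)\<in>(SIGMA j:{..k}. ?B A (k - j)). (x a ^ j / fact j) * (\<Prod>i\<in>A. x i ^ \<beta> i / fact (\<beta> i)))"
    by (rule sum.Sigma) (use fin in auto)
  also have "\<dots> = (\<Sum>\<beta>\<in>?B (insert a A) k. \<Prod>i\<in>insert a A. x i ^ \<beta> i / fact (\<beta> i))"
  proof (rule sum.reindex_bij_witness[where i = "\<lambda>\<beta>. (\<beta> a, \<beta>(a := 0))" and j = "\<lambda>(j, \<beta>). \<beta>(a := j)"])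
    fix p assume p: "p \<in> (SIGMA j:{..k}. ?B A (k - j))"
    obtain j \<beta> where jb: "p = (j, \<beta>)" by (cases p)
    have b: "j \<le> k" "\<forall>i. i \<notin> A \<longrightarrow> \<beta> i = 0" "(\<Sum>i\<in>A. \<beta> i) = k - j" using p jb by auto
    have ba: "\<beta> a = 0" using b(2) insert.hyps by auto
    have s: "(\<Sum>i\<in>A. (\<beta>(a := j)) i) = (\<Sum>i\<in>A. \<beta> i)" using insert.hyps by (intro sum.cong) auto
    have pr: "(\<Prod>i\<in>A. x i ^ (\<beta>(a := j)) i / fact ((\<beta>(a := j)) i)) = (\<Prod>i\<in>A. x i ^ \<beta> i / fact (\<beta> i))"
      using insert.hyps by (intro prod.cong) auto
    show "(\<lambda>\<beta>. (\<beta> a, \<beta>(a := 0))) ((\<lambda>(j, \<beta>). \<beta>(a := j)) p) = p" using jb ba by (auto simp: fun_eq_iff)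
    show "(\<lambda>(j, \<beta>). \<beta>(a := j)) p \<in> ?B (insert a A) k"
      using b s insert.hyps by (auto simp: jb)
    show "(\<Prod>i\<in>insert a A. x i ^ (\<lambda>(j, \<beta>). \<beta>(a := j)) p i / fact ((\<lambda>(j, \<beta>). \<beta>(a := j)) p i)) =
      (\<lambda>(j, \<beta>). (x a ^ j / fact j) * (\<Prod>i\<in>A. x i ^ \<beta> i / fact (\<beta> i))) p"
      using insert.hyps pr by (simp add: jb)
  next
    fix \<beta> assume \<beta>: "\<beta> \<in> ?B (insert a A) k"
    have s: "(\<Sum>i\<in>A. (\<beta>(a := 0)) i) = (\<Sum>i\<in>A. \<beta> i)" using insert.hyps by (intro sum.cong) auto
    show "(\<beta> a, \<beta>(a := 0)) \<in> (SIGMA j:{..k}. ?B A (k - j))"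
      using \<beta> s insert.hyps by auto
  qed auto
  finally show ?case .
qed

lemma sum_mi_power:
  fixes x t :: "real^'d"
  shows "(\<Sum>\<beta> | mi_abs \<beta> = k. mi_power x \<beta> * mi_power t \<beta> / mi_fact \<beta>) = (x \<bullet> t) ^ k / fact k"
proof -
  have "(x \<bullet> t) ^ k / fact k = (\<Sum>\<beta> | (\<forall>i. i \<notin> (UNIV :: 'd set) \<longrightarrow> \<beta> i = 0) \<and> (\<Sum>i\<in>UNIV. \<beta> i) = k. \<Prod>i\<in>UNIV. (x $ i * t $ i) ^ \<beta> i / fact (\<beta> i))"
    using sum_power_div_fact[of UNIV "\<lambda>i. x $ i * t $ i" k] by (simp add: inner_vec_def)
  also have "\<dots> = (\<Sum>\<beta> | mi_abs \<beta> = k. mi_power x \<beta> * mi_power t \<beta> / mi_fact \<beta>)"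
    by (simp add: mi_abs_def mi_power_def mi_fact_def prod_dividef power_mult_distrib prod.distrib)
  finally show ?thesis ..
qed

lemma Delta_eq_UN: "Delta n = (\<Union>k<n. {\<beta>. mi_abs \<beta> = k})"
  by (auto simp: Delta_def)

lemma finite_mi_abs_eq: "finite {\<beta> :: 'd::finite \<Rightarrow> nat. mi_abs \<beta> = k}"
  by (rule finite_subset[OF _ finite_Delta[of "Suc k"]]) (auto simp: Delta_def)

text \<open>The right side is a Taylor polynomial of the exponential; with
  \<open>z = - 2 * pi * \<i>\<close> this identifies the transform of \<open>phi_tilde\<close> as an
  averaged Taylor polynomial.\<close>

lemma sum_Delta_mi_power:
  fixes x t :: "real^'d" and z :: complex
  shows "(\<Sum>\<beta>\<in>Delta n. z ^ mi_abs \<beta> * of_real (mi_power x \<beta> * mi_power t \<beta> / mi_fact \<beta>)) = (\<Sum>k<n. (z * of_real (x \<bullet> t)) ^ k / fact k)"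
proof -
  have "(\<Sum>\<beta>\<in>Delta n. z ^ mi_abs \<beta> * of_real (mi_power x \<beta> * mi_power t \<beta> / mi_fact \<beta>)) =
      (\<Sum>k<n. \<Sum>\<beta> | mi_abs \<beta> = k. z ^ mi_abs \<beta> * of_real (mi_power x \<beta> * mi_power t \<beta> / mi_fact \<beta>))"
    unfolding Delta_eq_UN by (rule sum.UNION_disjoint) (auto simp: finite_mi_abs_eq)
  also have "\<dots> = (\<Sum>k<n. z ^ k * of_real (\<Sum>\<beta> | mi_abs \<beta> = k. mi_power x \<beta> * mi_power t \<beta> / mi_fact \<beta>))"
    by (intro sum.cong refl) (simp add: sum_distrib_left)
  also have "\<dots> = (\<Sum>k<n. (z * of_real (x \<bullet> t)) ^ k / fact k)"
    unfolding sum_mi_power by (simp add: power_mult_distrib)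
  finally show ?thesis .
qed

text \<open>The Fourier multiplier of averaging: the mean of
  \<open>cis (- 2 * pi * (t \<bullet> \<xi>))\<close> over \<open>t\<close> in the ball, hence
  bounded by 1.\<close>

definition ball_symbol :: "real \<Rightarrow> real^'d \<Rightarrow> complex" where
  "ball_symbol h \<xi> = of_real (1 / measure lebesgue (cball (0 :: real^'d) h)) *
     ft (\<lambda>t. indicator (cball 0 h) t *\<^sub>R 1) \<xi>"

lemma measure_lebesgue_cball: "measure lebesgue (cball (0 :: real^'d) h) = measure lborel (cball (0 :: real^'d) h)"
  by (simp add: measure_completion)

lemma measure_lebesgue_cball_pos:
  assumes "0 < h"
  shows "0 < measure lebesgue (cball (0 :: real^'d) h)"
  unfolding measure_lebesgue_cball by (rule content_cball_pos[OF assms])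

lemma integrable_cball:
  fixes u :: "real^'d \<Rightarrow> 'a::{banach, second_countable_topology}"
  assumes "continuous_on UNIV u"
  shows "integrable lborel (\<lambda>t. indicator (cball 0 h) t *\<^sub>R u t)"
  by (rule borel_integrable_compact) (auto intro: continuous_on_subset[OF assms])

lemma integral_indicator_cball:
  "(LINT t|lborel. indicator (cball (0 :: real^'d) h) t *\<^sub>R (c::real)) = c * measure lebesgue (cball (0 :: real^'d) h)"
proof -
  have "(LINT t|lborel. indicator (cball (0 :: real^'d) h) t * c) = (LINT t|lborel. indicator (cball (0 :: real^'d) h) t) * c"
    by (rule integral_mult_left_zero)
  thus ?thesis by (simp add: measure_lebesgue_cball mult.commute)
qed

lemma norm_average_cball_le:
  fixes u :: "real^'d \<Rightarrow> complex"
  assumes h: "0 < h" and u: "continuous_on UNIV u" and B: "\<And>t. norm t \<le> h \<Longrightarrow> norm (u t) \<le> B"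
  shows "norm (of_real (1 / measure lebesgue (cball (0 :: real^'d) h)) * (LINT t|lborel. indicator (cball 0 h) t *\<^sub>R u t)) \<le> B"
proof -
  let ?V = "measure lebesgue (cball (0 :: real^'d) h)"
  have V: "0 < ?V" by (rule measure_lebesgue_cball_pos[OF h])
  have "norm (LINT t|lborel. indicator (cball 0 h) t *\<^sub>R u t) \<le> (LINT t|lborel. norm (indicator (cball 0 h) t *\<^sub>R u t))"
    by (rule integral_norm_bound)
  also have "\<dots> \<le> (LINT t|lborel. indicator (cball (0 :: real^'d) h) t *\<^sub>R B)"
    by (rule integral_mono[OF integrable_norm[OF integrable_cball[OF u]] integrable_cball[OF continuous_on_const]])
       (auto simp: B split: split_indicator)
  also have "\<dots> = B * ?V" by (rule integral_indicator_cball)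
  finally show ?thesis using V by (simp add: norm_mult norm_divide divide_le_eq)
qed

lemma ball_symbol_eq:
  "ball_symbol h (\<xi> :: real^'d) = of_real (1 / measure lebesgue (cball (0 :: real^'d) h)) *
     (LINT t|lborel. indicator (cball 0 h) t *\<^sub>R cis (- 2 * pi * (t \<bullet> \<xi>)))"
  unfolding ball_symbol_def ft_def by simp

lemma norm_ball_symbol_le: "0 < h \<Longrightarrow> norm (ball_symbol h (\<xi> :: real^'d)) \<le> 1"
  unfolding ball_symbol_eq by (rule norm_average_cball_le) (auto intro!: continuous_intros)

lemma borel_measurable_ball_symbol [measurable]: "ball_symbol h \<in> borel_measurable borel"
proof -
  have "integrable lborel (\<lambda>t :: real^'a. indicator (cball 0 h) t *\<^sub>R (1 :: complex))"
    by (rule integrable_cball) (rule continuous_on_const)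
  from borel_measurable_ft[OF this] show ?thesis
    unfolding ball_symbol_def[abs_def] by measurable
qed

lemma continuous_on_mi_power: "continuous_on UNIV (\<lambda>t :: real^'d. mi_power t \<beta>)"
  unfolding mi_power_def by (intro continuous_intros)

text \<open>The coefficients of \<open>phi_tilde\<close> are the normalised moments of the ball, so
  its transform is the mean over the ball of the Taylor polynomial of degree \<open>N\<close> of the
  exponential; averaging the remainder gives order \<open>N + 1\<close>.\<close>

lemma ball_symbol_minus_phi_tilde_le:
  fixes \<xi> :: "real^'d"
  assumes h: "0 < h"
  shows "norm (ball_symbol h \<xi> - fourier_distr (phi_tilde h N) \<xi>) \<le> (2 * pi * h * norm \<xi>) ^ (N + 1)"
proof -
  let ?V = "measure lebesgue (cball (0 :: real^'d) h)" and ?z = "- 2 * pi * \<i> :: complex"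
  \<comment> \<open>The coefficients are real, so conjugation does nothing, and the signs combine
    with the factors of the monomial to powers of \<open>- 2 * pi * \<i>\<close>.\<close>
  have coef: "cnj (avg_coeff h \<beta>) * (-1) ^ mi_abs \<beta> * mi_power (\<chi> i. 2 * pi * \<i> * (\<xi> $ i)) \<beta> =
      of_real (1 / ?V) * (LINT t|lborel. indicator (cball 0 h) t *\<^sub>R (?z ^ mi_abs \<beta> * of_real (mi_power \<xi> \<beta> * mi_power t \<beta> / mi_fact \<beta>)))"
    for \<beta> :: "'d \<Rightarrow> nat"
  proof -
    have "(LINT t:cball (0 :: real^'d) h|lebesgue. mi_power t \<beta>) = (LINT t|lborel. indicator (cball 0 h) t *\<^sub>R mi_power t \<beta>)"
      unfolding set_lebesgue_integral_def
      by (rule integral_completion) (use borel_measurable_integrable[OF integrable_cball[OF continuous_on_mi_power[of \<beta>], of h]] in simp)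
    hence a: "cnj (avg_coeff h \<beta>) = of_real (1 / ?V) * (of_real (1 / mi_fact \<beta>) * of_real (LINT t|lborel. indicator (cball (0 :: real^'d) h) t *\<^sub>R mi_power t \<beta>))"
      unfolding avg_coeff_def by simp
    have "mi_power (\<chi> i. 2 * pi * \<i> * (\<xi> $ i)) \<beta> = (\<Prod>i\<in>UNIV. (2 * pi * \<i>) ^ \<beta> i) * of_real (mi_power \<xi> \<beta>)"
      unfolding mi_power_def by (simp add: power_mult_distrib prod.distrib)
    also have "(\<Prod>i\<in>UNIV. (2 * pi * \<i>) ^ \<beta> i) = (2 * pi * \<i>) ^ mi_abs \<beta>"
      by (simp add: mi_abs_def power_sum)
    finally have m: "(-1) ^ mi_abs \<beta> * mi_power (\<chi> i. 2 * pi * \<i> * (\<xi> $ i)) \<beta> = ?z ^ mi_abs \<beta> * of_real (mi_power \<xi> \<beta>)"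
      by (simp add: power_mult_distrib[symmetric] mult.assoc[symmetric])
    have "(LINT t|lborel. indicator (cball 0 h) t *\<^sub>R (?z ^ mi_abs \<beta> * of_real (mi_power \<xi> \<beta> * mi_power t \<beta> / mi_fact \<beta>))) =
        (LINT t|lborel. (?z ^ mi_abs \<beta> * of_real (mi_power \<xi> \<beta>) * of_real (1 / mi_fact \<beta>)) * complex_of_real (indicator (cball (0 :: real^'d) h) t *\<^sub>R mi_power t \<beta>))"
      by (intro Bochner_Integration.integral_cong refl) (simp add: scaleR_conv_of_real)
    also have "\<dots> = (?z ^ mi_abs \<beta> * of_real (mi_power \<xi> \<beta>) * of_real (1 / mi_fact \<beta>)) * of_real (LINT t|lborel. indicator (cball (0 :: real^'d) h) t *\<^sub>R mi_power t \<beta>)"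
      by (simp only: integral_mult_right_zero integral_complex_of_real)
    finally show ?thesis unfolding a mult.assoc[of _ "(-1) ^ mi_abs \<beta>"] m by (simp only: mult_ac)
  qed
  define T where "T = (\<lambda>t. \<Sum>k<N + 1. (?z * of_real (\<xi> \<bullet> t)) ^ k / fact k)"
  have Tc: "continuous_on UNIV T" unfolding T_def by (intro continuous_intros) auto
  have "fourier_distr (phi_tilde h N) \<xi> = of_real (1 / ?V) * (\<Sum>\<beta>\<in>Delta (N + 1).
      (LINT t|lborel. indicator (cball 0 h) t *\<^sub>R (?z ^ mi_abs \<beta> * of_real (mi_power \<xi> \<beta> * mi_power t \<beta> / mi_fact \<beta>))))"
    unfolding fourier_distr_phi_tilde coef sum_distrib_left ..
  also have "(\<Sum>\<beta>\<in>Delta (N + 1). (LINT t|lborel. indicator (cball 0 h) t *\<^sub>R (?z ^ mi_abs \<beta> * of_real (mi_power \<xi> \<beta> * mi_power t \<beta> / mi_fact \<beta>)))) =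
      (LINT t|lborel. (\<Sum>\<beta>\<in>Delta (N + 1). indicator (cball 0 h) t *\<^sub>R (?z ^ mi_abs \<beta> * of_real (mi_power \<xi> \<beta> * mi_power t \<beta> / mi_fact \<beta>))))"
  proof (rule Bochner_Integration.integral_sum[symmetric], rule integrable_cball)
    fix \<beta> :: "'d \<Rightarrow> nat"
    show "continuous_on UNIV (\<lambda>t. ?z ^ mi_abs \<beta> * of_real (mi_power \<xi> \<beta> * mi_power t \<beta> / mi_fact \<beta>))"
      by (intro continuous_intros continuous_on_mi_power) (auto simp: mi_fact_def)
  qed
  also have "\<dots> = (LINT t|lborel. indicator (cball 0 h) t *\<^sub>R T t)"
    unfolding scaleR_sum_right[symmetric] sum_Delta_mi_power T_def ..
  finally have phi: "fourier_distr (phi_tilde h N) \<xi> = of_real (1 / ?V) * (LINT t|lborel. indicator (cball 0 h) t *\<^sub>R T t)" .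
  have cc: "continuous_on UNIV (\<lambda>t. cis (- 2 * pi * (t \<bullet> \<xi>)))" by (intro continuous_intros)
  have "ball_symbol h \<xi> - fourier_distr (phi_tilde h N) \<xi> = of_real (1 / ?V) * ((LINT t|lborel. indicator (cball 0 h) t *\<^sub>R cis (- 2 * pi * (t \<bullet> \<xi>))) - (LINT t|lborel. indicator (cball 0 h) t *\<^sub>R T t))"
    unfolding ball_symbol_eq phi by (rule right_diff_distrib[symmetric])
  also have "(LINT t|lborel. indicator (cball 0 h) t *\<^sub>R cis (- 2 * pi * (t \<bullet> \<xi>))) - (LINT t|lborel. indicator (cball 0 h) t *\<^sub>R T t) =
      (LINT t|lborel. indicator (cball 0 h) t *\<^sub>R (cis (- 2 * pi * (t \<bullet> \<xi>)) - T t))"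
    unfolding scaleR_diff_right by (rule Bochner_Integration.integral_diff[symmetric, OF integrable_cball[OF cc] integrable_cball[OF Tc]])
  finally have eq: "ball_symbol h \<xi> - fourier_distr (phi_tilde h N) \<xi> = of_real (1 / ?V) * (LINT t|lborel. indicator (cball 0 h) t *\<^sub>R (cis (- 2 * pi * (t \<bullet> \<xi>)) - T t))" .
  show ?thesis
    unfolding eq
  proof (rule norm_average_cball_le[OF h continuous_on_diff[OF cc Tc]])
    fix t :: "real^'d" assume t: "norm t \<le> h"
    define x where "x = - 2 * pi * (t \<bullet> \<xi>)"
    have "T t = (\<Sum>k\<le>N. (\<i> * of_real x) ^ k / fact k)"
      unfolding T_def x_def by (intro sum.cong) (auto simp: inner_commute mult_ac)
    moreover have "norm (iexp x - (\<Sum>k\<le>N. (\<i> * of_real x) ^ k / fact k)) \<le> \<bar>x\<bar> ^ Suc N / fact (Suc N)"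
      by (rule iexp_approx1)
    ultimately have "norm (cis x - T t) \<le> \<bar>x\<bar> ^ Suc N / fact (Suc N)" by (simp add: cis_conv_exp)
    also have "\<dots> \<le> \<bar>x\<bar> ^ Suc N / 1" using fact_ge_1[of "Suc N", where 'a = real] by (intro divide_left_mono) (simp_all del: fact_Suc)
    also have "\<bar>x\<bar> ^ Suc N \<le> (2 * pi * h * norm \<xi>) ^ Suc N"
    proof (rule power_mono)
      have "\<bar>t \<bullet> \<xi>\<bar> \<le> norm t * norm \<xi>" by (rule Cauchy_Schwarz_ineq2)
      also have "\<dots> \<le> h * norm \<xi>" using t by (intro mult_right_mono) auto
      finally show "\<bar>x\<bar> \<le> 2 * pi * h * norm \<xi>" by (simp add: x_def abs_mult mult.assoc)
    qed simp
    finally show "norm (cis (- 2 * pi * (t \<bullet> \<xi>)) - T t) \<le> (2 * pi * h * norm \<xi>) ^ (N + 1)"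
      by (simp add: x_def)
  qed
qed

section \<open>Powers of an isotropic dilation\<close>

lemma
  fixes A :: "'a::semiring_1^'n^'m"
  assumes "invertible A"
  shows matrix_inv_left: "matrix_inv A ** A = mat 1" and matrix_inv_right: "A ** matrix_inv A = mat 1"
  using someI_ex[OF assms[unfolded invertible_def]] unfolding matrix_inv_def by blast+

lemma mat_pow_0: "mat_pow A 0 = mat 1" and mat_pow_Suc: "mat_pow A (Suc j) = A ** mat_pow A j"
  by (simp_all add: mat_pow_def)

lemma mat_pow_Suc2: "mat_pow A (Suc j) = mat_pow A j ** A"
  by (induction j) (simp_all add: mat_pow_0 mat_pow_Suc matrix_mul_assoc)

lemma det_mat_pow: "det (mat_pow A j) = det A ^ j"
  by (induction j) (simp_all add: mat_pow_0 mat_pow_Suc det_mul)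

lemma mat_pow_inverse:
  fixes M :: "real^'d^'d"
  assumes "invertible M"
  shows "mat_pow (matrix_inv M) j ** mat_pow M j = mat 1"
proof (induction j)
  case (Suc j)
  have "mat_pow (matrix_inv M) (Suc j) ** mat_pow M (Suc j) = (mat_pow (matrix_inv M) j ** (matrix_inv M ** M)) ** mat_pow M j"
    unfolding mat_pow_Suc2[of "matrix_inv M"] mat_pow_Suc[of M] by (simp only: matrix_mul_assoc)
  thus ?case using Suc matrix_inv_left[OF assms] by simp
qed (simp add: mat_pow_0)

definition cvec :: "real^'d \<Rightarrow> complex^'d" where
  "cvec v = (\<chi> i. complex_of_real (v $ i))"

lemma norm_cvec: "norm (cvec v) = norm v"
  by (simp add: cvec_def norm_vec_def L2_set_def)

lemma cvec_matrix_vector: "cvec (M *v v) = map_matrix complex_of_real M *v cvec v"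
  by (simp add: cvec_def vec_eq_iff matrix_vector_mult_def map_matrix_def)

lemma bounded_linear_cmatrix: "bounded_linear ((*v) (A :: complex^'d^'d))"
  unfolding linear_conv_bounded_linear[symmetric]
  by (rule linearI) (simp_all add: vec_eq_iff matrix_vector_mult_def scaleR_sum_right distrib_left sum.distrib)

text \<open>In the eigenbasis of an isotropic matrix the map multiplies the Euclidean norm by \<open>|\<lambda>|\<close> exactly.\<close>

lemma isotropic_norm_growth:
  fixes M :: "real^'d^'d"
  assumes M: "dilation_matrix M" "isotropic M" and lam: "is_eigenvalue (map_matrix complex_of_real M) lam"
  obtains C where "0 < C" "\<And>j v. cmod lam ^ j * norm v \<le> C * norm (mat_pow M j *v v)" "1 < cmod lam"
proof -
  let ?M = "map_matrix complex_of_real M"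
  have lam1: "1 < cmod lam" using M(1) lam by (simp add: dilation_matrix_def)
  obtain P :: "complex^'d^'d" and \<Lambda> :: "complex^'d" where PL: "invertible P \<and> matrix_inv P ** ?M ** P = (\<chi> i j. if i = j then \<Lambda> $ i else 0) \<and>
      (\<forall>i j. cmod (\<Lambda> $ i) = cmod (\<Lambda> $ j))"
    using M(2) unfolding isotropic_def by blast
  hence P: "invertible P" and D: "matrix_inv P ** ?M ** P = (\<chi> i j. if i = j then \<Lambda> $ i else 0)"
    and eq: "cmod (\<Lambda> $ i) = cmod (\<Lambda> $ j)" for i j by auto
  define D where "D = (\<chi> i j. if i = j then \<Lambda> $ i else (0::complex))"
  have PP: "P ** matrix_inv P = mat 1" using P by (rule matrix_inv_right)
  have Dv: "(D *v u) $ i = \<Lambda> $ i * u $ i" for u i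
    by (simp add: D_def matrix_vector_mult_def if_distrib[of "\<lambda>x. x * _"] cong: if_cong)
  have conj: "matrix_inv P *v (?M *v w) = D *v (matrix_inv P *v w)" for w
  proof -
    have "D *v (matrix_inv P *v w) = (matrix_inv P ** ?M ** (P ** matrix_inv P)) *v w"
      unfolding D_def D[symmetric] by (simp only: matrix_vector_mul_assoc matrix_mul_assoc)
    thus ?thesis unfolding PP by (simp add: matrix_vector_mul_assoc)
  qed
  have inj: "w = P *v (matrix_inv P *v w)" for w :: "complex^'d"
    unfolding matrix_vector_mul_assoc PP by simp
  obtain v where v: "v \<noteq> 0" "?M *v v = lam *s v" using lam by (auto simp: is_eigenvalue_def)
  define w where "w = matrix_inv P *v v"
  have "w \<noteq> 0" using inj[of v] v(1) by (auto simp: w_def)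
  then obtain i where wi: "w $ i \<noteq> 0" by (auto simp: vec_eq_iff)
  \<comment> \<open>The given eigenvalue is the diagonal entry at a nonzero coordinate of its
    eigenvector in the eigenbasis; equality of the moduli transfers \<open>cmod lam\<close> to all
    entries.\<close>
  have "D *v w = lam *s w" unfolding w_def conj[symmetric] v(2) by (simp add: vector_scalar_commute)
  hence "(D *v w) $ i = (lam *s w) $ i" by (rule arg_cong)
  hence "\<Lambda> $ i = lam" using wi unfolding Dv by simp
  hence \<Lambda>: "cmod (\<Lambda> $ k) = cmod lam" for k using eq[of k i] by simp
  have nD: "norm (D *v u) = cmod lam * norm u" for u
  proof -
    have "norm (D *v u) = L2_set (\<lambda>i. cmod lam * norm (u $ i)) UNIV"
      unfolding norm_vec_def by (simp add: Dv norm_mult \<Lambda>)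
    thus ?thesis by (simp add: L2_set_right_distrib norm_vec_def)
  qed
  define nn where "nn = (\<lambda>v. norm (matrix_inv P *v cvec v))"
  have step: "nn (M *v v) = cmod lam * nn v" for v
    unfolding nn_def cvec_matrix_vector conj nD ..
  have pow: "nn (mat_pow M j *v v) = cmod lam ^ j * nn v" for j v
  proof (induction j)
    case (Suc j)
    have "nn (mat_pow M (Suc j) *v v) = nn (M *v (mat_pow M j *v v))" by (simp add: mat_pow_Suc matrix_vector_mul_assoc)
    thus ?case using Suc step by simp
  qed (simp add: mat_pow_0)
  \<comment> \<open>Bounds for the inverse of \<open>P\<close> and for \<open>P\<close>: passing to
    the eigenbasis and back costs their product, whatever the power \<open>j\<close>.\<close>
  obtain K1 where K1: "0 < K1" "\<And>w. norm (matrix_inv P *v w) \<le> norm w * K1"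
    using bounded_linear.pos_bounded[OF bounded_linear_cmatrix[of "matrix_inv P"]] by blast
  obtain K2 where K2: "0 < K2" "\<And>w. norm (P *v w) \<le> norm w * K2"
    using bounded_linear.pos_bounded[OF bounded_linear_cmatrix[of P]] by blast
  have up: "nn v \<le> norm v * K1" for v unfolding nn_def using K1(2)[of "cvec v"] by (simp add: norm_cvec)
  have lo: "norm v \<le> nn v * K2" for v
    unfolding nn_def using K2(2)[of "matrix_inv P *v cvec v"] inj[of "cvec v"] norm_cvec[of v] by simp
  show ?thesis
  proof (rule that[of "K1 * K2"])
    fix j v
    have "cmod lam ^ j * norm v \<le> cmod lam ^ j * (nn v * K2)" by (rule mult_left_mono[OF lo]) simp
    also have "\<dots> = nn (mat_pow M j *v v) * K2" by (simp add: pow)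
    also have "\<dots> \<le> (norm (mat_pow M j *v v) * K1) * K2" by (rule mult_right_mono[OF up]) (use K2 in simp)
    finally show "cmod lam ^ j * norm v \<le> K1 * K2 * norm (mat_pow M j *v v)" by (simp add: mult_ac)
  qed (use K1 K2 lam1 in auto)
qed

text \<open>The growth estimate with \<open>j = 1\<close> excludes a kernel.\<close>

lemma dilation_invertible:
  fixes M :: "real^'d^'d"
  assumes "dilation_matrix M" "isotropic M" "is_eigenvalue (map_matrix complex_of_real M) lam"
  shows "invertible M"
proof -
  obtain C where "0 < C" and C: "\<And>j v. cmod lam ^ j * norm v \<le> C * norm (mat_pow M j *v v)" "1 < cmod lam"
    by (rule isotropic_norm_growth[OF assms], rule that)
  have "v = 0" if "M *v v = 0" for v
  proof -
    have "cmod lam * norm v \<le> 0" using C(1)[of 1 v] that by (simp add: mat_pow_def)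
    moreover have "1 * norm v \<le> cmod lam * norm v" by (rule mult_right_mono) (use C(2) in simp_all)
    ultimately have "norm v \<le> 0" by linarith
    thus ?thesis by simp
  qed
  thus ?thesis unfolding invertible_left_inverse matrix_left_invertible_ker by blast
qed

text \<open>Duality: the squared norm of the transposed image is an inner product of \<xi> with an
  image under \<open>A\<close>. It is needed because the growth is known for the matrix while the
  frequency side sees its transpose.\<close>

lemma norm_transpose_le:
  fixes A :: "real^'d^'d"
  assumes "\<And>v. norm (A *v v) \<le> K * norm v"
  shows "norm (transpose A *v \<xi>) \<le> K * norm \<xi>"
proof (cases "transpose A *v \<xi> = 0")
  case True
  have "0 \<le> K * norm \<xi>" using assms[of \<xi>] norm_ge_zero order_trans by blast
  thus ?thesis using True by simp
next
  case False
  let ?y = "transpose A *v \<xi>"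
  have "norm ?y * norm ?y = ?y \<bullet> ?y" using power2_norm_eq_inner[of ?y] by (simp add: power2_eq_square)
  also have "\<dots> = \<xi> \<bullet> (A *v ?y)"
    unfolding dot_lmul_matrix[symmetric] transpose_matrix_vector[symmetric] ..
  also have "\<dots> \<le> norm \<xi> * norm (A *v ?y)" by (rule norm_cauchy_schwarz)
  also have "\<dots> \<le> norm \<xi> * (K * norm ?y)" by (rule mult_left_mono[OF assms]) simp
  finally have "norm ?y * norm ?y \<le> (K * norm \<xi>) * norm ?y" by (simp add: mult_ac)
  thus ?thesis using False by (simp add: mult_le_cancel_right)
qed

section \<open>Linear change of variables\<close>

lemma borel_measurable_matrix_vector [measurable]: "(*v) (T :: real^'d^'d) \<in> borel_measurable borel"
  by (intro borel_measurable_continuous_onI linear_continuous_on matrix_vector_mul_bounded_linear)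

lemma nn_integral_unit_box: "(\<integral>\<^sup>+x. indicator (box (0::real^'d) (\<chi> i. 1)) x \<partial>lborel) = (1::ennreal)"
proof -
  have "emeasure lborel (box (0::real^'d) (\<chi> i. 1)) = ennreal (\<Prod>b\<in>Basis. ((\<chi> i. 1) - (0::real^'d)) \<bullet> b)"
    by (rule emeasure_lborel_box) (auto simp: Basis_vec_def inner_axis)
  also have "(\<Prod>b\<in>Basis. ((\<chi> i. 1) - (0::real^'d)) \<bullet> b) = (\<Prod>b\<in>(Basis::(real^'d) set). 1)"
    by (rule prod.cong) (auto simp: Basis_vec_def inner_axis)
  finally show ?thesis by simp
qed

text \<open>Uniqueness of Haar measure: both integrals equal the double integral of \<open>u (T x + y) w y\<close> for a
  normalised \<open>w\<close>.\<close>

lemma nn_integral_matrix_const: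
  fixes T :: "real^'d^'d"
  assumes T: "invertible T"
  obtains c :: ennreal where "\<And>u. u \<in> borel_measurable borel \<Longrightarrow> (\<integral>\<^sup>+x. u (T *v x) \<partial>lborel) = c * (\<integral>\<^sup>+x. u x \<partial>lborel)"
proof -
  define w :: "real^'d \<Rightarrow> ennreal" where "w = indicator (box 0 (\<chi> i. 1))"
  have [measurable]: "w \<in> borel_measurable borel" unfolding w_def by simp
  have w1: "(\<integral>\<^sup>+x. w x \<partial>lborel) = 1" unfolding w_def by (rule nn_integral_unit_box)
  define c where "c = (\<integral>\<^sup>+x. w (T *v x) \<partial>lborel)"
  have refl: "(\<integral>\<^sup>+x. v (- x) \<partial>lborel) = (\<integral>\<^sup>+x. v x \<partial>lborel)" if [measurable]: "v \<in> borel_measurable borel" for v :: "real^'d \<Rightarrow> ennreal"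
  proof -
    have "(\<integral>\<^sup>+x. v x \<partial>lborel) = (\<integral>\<^sup>+x. v x \<partial>distr lborel borel uminus)" by (simp add: lborel_distr_uminus_vec)
    thus ?thesis by (simp add: nn_integral_distr)
  qed
  have shift: "(\<integral>\<^sup>+x. v (x + a) \<partial>lborel) = (\<integral>\<^sup>+x. v x \<partial>lborel)" if "v \<in> borel_measurable borel" for v :: "real^'d \<Rightarrow> ennreal" and a
    using that by (rule nn_integral_lborel_shift)
  have "(\<integral>\<^sup>+x. u (T *v x) \<partial>lborel) = c * (\<integral>\<^sup>+x. u x \<partial>lborel)" if [measurable]: "u \<in> borel_measurable borel" for u
  proof -
    have "(\<integral>\<^sup>+x. u (T *v x) \<partial>lborel) = (\<integral>\<^sup>+y. w y * (\<integral>\<^sup>+x. u (T *v x) \<partial>lborel) \<partial>lborel)"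
      by (simp add: nn_integral_multc w1)
    also have "\<dots> = (\<integral>\<^sup>+y. (\<integral>\<^sup>+x. w y * u (T *v x + y) \<partial>lborel) \<partial>lborel)"
    proof (rule nn_integral_cong)
      fix y :: "real^'d"
      \<comment> \<open>Translating \<open>x\<close> by the preimage of \<open>y\<close> shifts
        \<open>T *v x\<close> by \<open>y\<close>, so the inner integral does not change.\<close>
      have e: "T *v (x + matrix_inv T *v y) = T *v x + y" for x
        by (simp add: matrix_vector_right_distrib matrix_vector_mul_assoc matrix_inv_right[OF T])
      have "(\<integral>\<^sup>+x. u (T *v x) \<partial>lborel) = (\<integral>\<^sup>+x. u (T *v (x + matrix_inv T *v y)) \<partial>lborel)"
        by (rule shift[symmetric]) measurable
      also have "\<dots> = (\<integral>\<^sup>+x. u (T *v x + y) \<partial>lborel)" unfolding e ..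
      finally show "w y * (\<integral>\<^sup>+x. u (T *v x) \<partial>lborel) = (\<integral>\<^sup>+x. w y * u (T *v x + y) \<partial>lborel)"
        by (simp add: nn_integral_cmult)
    qed
    also have "\<dots> = (\<integral>\<^sup>+x. (\<integral>\<^sup>+y. w y * u (T *v x + y) \<partial>lborel) \<partial>lborel)"
      by (rule lborel_pair.Fubini'[symmetric]) measurable
    also have "\<dots> = (\<integral>\<^sup>+x. (\<integral>\<^sup>+y. w (y - T *v x) * u y \<partial>lborel) \<partial>lborel)"
    proof (rule nn_integral_cong)
      fix x :: "real^'d"
      have "(\<integral>\<^sup>+y. w (y + T *v x - T *v x) * u (y + T *v x) \<partial>lborel) = (\<integral>\<^sup>+y. w (y - T *v x) * u y \<partial>lborel)"
        by (rule shift[of "\<lambda>y. w (y - T *v x) * u y"]) measurable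
      thus "(\<integral>\<^sup>+y. w y * u (T *v x + y) \<partial>lborel) = (\<integral>\<^sup>+y. w (y - T *v x) * u y \<partial>lborel)"
        by (simp add: add.commute)
    qed
    also have "\<dots> = (\<integral>\<^sup>+y. (\<integral>\<^sup>+x. w (y - T *v x) * u y \<partial>lborel) \<partial>lborel)"
      by (rule lborel_pair.Fubini'[symmetric]) measurable
    also have "\<dots> = (\<integral>\<^sup>+y. c * u y \<partial>lborel)"
    proof (rule nn_integral_cong)
      fix y :: "real^'d"
      have e: "y - T *v (- (x + - (matrix_inv T *v y))) = T *v x" for x
        by (simp add: matrix_vector_right_distrib matrix_vector_mult_diff_distrib matrix_vector_mul_assoc matrix_inv_right[OF T])
      have "(\<integral>\<^sup>+x. w (y - T *v x) \<partial>lborel) = (\<integral>\<^sup>+x. w (y - T *v (- x)) \<partial>lborel)"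
        by (rule refl[symmetric]) measurable
      also have "\<dots> = (\<integral>\<^sup>+x. w (y - T *v (- (x + - (matrix_inv T *v y)))) \<partial>lborel)"
        by (rule shift[symmetric]) measurable
      also have "\<dots> = c" unfolding e c_def ..
      finally show "(\<integral>\<^sup>+x. w (y - T *v x) * u y \<partial>lborel) = c * u y" by (simp add: nn_integral_multc)
    qed
    finally show ?thesis by (simp add: nn_integral_cmult)
  qed
  thus ?thesis by (rule that)
qed

text \<open>The shears and transpositions reduce to involutions, for which the constant \<open>c\<close> above satisfies \<open>c\<^sup>2 = 1\<close>.\<close>

lemma nn_integral_matrix:
  fixes T :: "real^'d^'d"
  assumes T: "invertible T" and u: "u \<in> borel_measurable borel"
  shows "(\<integral>\<^sup>+x. u x \<partial>lborel) = ennreal \<bar>det T\<bar> * (\<integral>\<^sup>+x. u (T *v x) \<partial>lborel)"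
proof -
  \<comment> \<open>The condition on the determinant is a premise inside \<open>P\<close>, so that
    the induction over elementary matrices, which includes singular ones, meets those
    trivially.\<close>
  define P where "P = (\<lambda>T :: real^'d^'d. det T \<noteq> 0 \<longrightarrow> (\<forall>u\<in>borel_measurable borel.
    (\<integral>\<^sup>+x. u x \<partial>lborel) = ennreal \<bar>det T\<bar> * (\<integral>\<^sup>+x. u (T *v x) \<partial>lborel)))"
  have mult: "P (A ** B)" if A: "P A" and B: "P B" for A B
    unfolding P_def
  proof (intro impI ballI)
    fix u :: "real^'d \<Rightarrow> ennreal" assume d: "det (A ** B) \<noteq> 0" and [measurable]: "u \<in> borel_measurable borel"
    have dA: "det A \<noteq> 0" and dB: "det B \<noteq> 0" using d by (auto simp: det_mul)
    have "(\<integral>\<^sup>+x. u x \<partial>lborel) = ennreal \<bar>det A\<bar> * (\<integral>\<^sup>+x. u (A *v x) \<partial>lborel)"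
      by (rule A[unfolded P_def, rule_format, OF dA]) measurable
    also have "(\<integral>\<^sup>+x. u (A *v x) \<partial>lborel) = ennreal \<bar>det B\<bar> * (\<integral>\<^sup>+x. u (A *v (B *v x)) \<partial>lborel)"
      by (rule B[unfolded P_def, rule_format, OF dB]) measurable
    finally show "(\<integral>\<^sup>+x. u x \<partial>lborel) = ennreal \<bar>det (A ** B)\<bar> * (\<integral>\<^sup>+x. u ((A ** B) *v x) \<partial>lborel)"
      by (simp add: det_mul abs_mult ennreal_mult mult.assoc matrix_vector_mul_assoc)
  qed
  have invol: "P A" if A: "A ** A = mat 1" for A
  proof -
    have invA: "invertible A" unfolding invertible_def using A by blast
    obtain c where c: "\<And>u. u \<in> borel_measurable borel \<Longrightarrow> (\<integral>\<^sup>+x. u (A *v x) \<partial>lborel) = c * (\<integral>\<^sup>+x. u x \<partial>lborel)"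
      by (rule nn_integral_matrix_const[OF invA], rule that)
    let ?w = "indicator (box (0::real^'d) (\<chi> i. 1)) :: _ \<Rightarrow> ennreal"
    have w: "(\<integral>\<^sup>+x. ?w x \<partial>lborel) = 1" by (rule nn_integral_unit_box)
    have "(\<integral>\<^sup>+x. ?w (A *v (A *v x)) \<partial>lborel) = c * (\<integral>\<^sup>+x. ?w (A *v x) \<partial>lborel)"
      by (rule c[of "\<lambda>x. ?w (A *v x)"]) measurable
    also have "(\<integral>\<^sup>+x. ?w (A *v x) \<partial>lborel) = c * (\<integral>\<^sup>+x. ?w x \<partial>lborel)"
      by (rule c) measurable
    finally have cc: "c * c = 1" using w by (simp add: matrix_vector_mul_assoc A)
    have c1: "c = 1"
    proof (cases c)
      case (real r)
      have "ennreal (r * r) = ennreal 1" using cc real by (simp add: ennreal_mult)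
      hence "r * r = 1" using real by (subst (asm) ennreal_inj) auto
      hence "r = 1" using real(1) by (metis abs_of_nonneg abs_square_eq_1 power2_eq_square)
      thus ?thesis using real by simp
    next
      case top thus ?thesis using cc by simp
    qed
    have "det A * det A = 1" using arg_cong[OF A, of det] by (simp add: det_mul)
    hence dA: "\<bar>det A\<bar> = 1" by (metis abs_square_eq_1 power2_eq_square)
    show ?thesis unfolding P_def
    proof (intro impI ballI)
      fix u :: "real^'d \<Rightarrow> ennreal" assume "u \<in> borel_measurable borel"
      from c[OF this] show "(\<integral>\<^sup>+x. u x \<partial>lborel) = ennreal \<bar>det A\<bar> * (\<integral>\<^sup>+x. u (A *v x) \<partial>lborel)"
        by (simp only: c1 dA ennreal_1 mult_1)
    qed
  qed
  \<comment> \<open>A diagonal matrix scales each coordinate separately, and for such maps the image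
    of \<open>lborel\<close> is known.\<close>
  have diagonal: "P A" if A: "\<And>i j. i \<noteq> j \<Longrightarrow> A $ i $ j = 0" for A
    unfolding P_def
  proof (intro impI ballI)
    fix u :: "real^'d \<Rightarrow> ennreal" assume d: "det A \<noteq> 0" and [measurable]: "u \<in> borel_measurable borel"
    have dA: "det A = (\<Prod>i\<in>UNIV. A $ i $ i)" by (rule det_diagonal) (rule A)
    define c where "c = (\<lambda>b. b \<bullet> (A *v b))"
    have cax: "c (axis i 1) = A $ i $ i" for i
      unfolding c_def by (simp add: inner_axis' matrix_vector_mult_basis column_def)
    have B: "(Basis :: (real^'d) set) = range (\<lambda>i. axis i 1)" by (auto simp: Basis_vec_def)
    have inj: "inj (\<lambda>i::'d. axis i (1::real))" by (auto simp: inj_on_def axis_eq_axis)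
    have c0: "c b \<noteq> 0" if "b \<in> Basis" for b using that d unfolding B dA by (auto simp: cax)
    have Av: "A *v x = 0 + (\<Sum>b\<in>Basis. (c b * (x \<bullet> b)) *\<^sub>R b)" for x
    proof -
      have "(A *v x) $ i = A $ i $ i * x $ i" for i
        unfolding matrix_vector_mult_def by (simp add: sum.remove[of UNIV i] A)
      moreover have "(\<Sum>b\<in>Basis. (c b * (x \<bullet> b)) *\<^sub>R b) $ i = A $ i $ i * x $ i" for i
      proof -
        have "(\<Sum>b\<in>Basis. (c b * (x \<bullet> b)) *\<^sub>R b) $ i = (\<Sum>k\<in>UNIV. if k = i then A $ k $ k * x $ k else 0)"
          unfolding B sum.reindex[OF inj] comp_def sum_component cax inner_axis by (intro sum.cong) (auto simp: axis_def)
        thus ?thesis by simp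
      qed
      ultimately show ?thesis by (simp add: vec_eq_iff)
    qed
    have pr: "(\<Prod>b\<in>(Basis::(real^'d) set). \<bar>c b\<bar>) = \<bar>det A\<bar>"
      unfolding B prod.reindex[OF inj] by (simp add: cax dA abs_prod)
    have eq: "(lborel :: (real^'d) measure) = density (distr lborel borel ((*v) A)) (\<lambda>_. ennreal \<bar>det A\<bar>)"
      using lborel_affine_euclidean[of c "0::real^'d", OF c0] unfolding Av[symmetric] pr by simp
    have "(\<integral>\<^sup>+x. u x \<partial>lborel) = (\<integral>\<^sup>+x. u x \<partial>density (distr lborel borel ((*v) A)) (\<lambda>_. ennreal \<bar>det A\<bar>))"
      by (simp only: eq[symmetric])
    thus "(\<integral>\<^sup>+x. u x \<partial>lborel) = ennreal \<bar>det A\<bar> * (\<integral>\<^sup>+x. u (A *v x) \<partial>lborel)"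
      by (simp add: nn_integral_density nn_integral_distr nn_integral_cmult)
  qed
  have "P T"
  proof (rule induct_matrix_elementary_alt[where P = P, OF mult _ diagonal])
    fix A :: "real^'d^'d" and i assume "row i A = 0"
    thus "P A" unfolding P_def using det_zero_row(1)[of i A] by simp
  next
    fix m n :: 'd assume mn: "m \<noteq> n"
    let ?W = "(\<chi> i j. mat 1 $ i $ Transposition.transpose m n j) :: real^'d^'d"
    have Wv: "?W *v x = (\<chi> i. x $ Transposition.transpose m n i)" for x
    proof -
      have "(\<Sum>j\<in>UNIV. mat 1 $ i $ Transposition.transpose m n j * x $ j) = (\<Sum>j\<in>UNIV. if j = Transposition.transpose m n i then x $ j else 0)" for i
        by (intro sum.cong) (auto simp: mat_def Transposition.transpose_def)
      thus ?thesis by (simp add: vec_eq_iff matrix_vector_mult_def)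
    qed
    have "(?W ** ?W) *v x = mat 1 *v x" for x
      unfolding matrix_vector_mul_assoc[symmetric] Wv by (simp add: vec_eq_iff)
    thus "P ?W" by (intro invol) (unfold matrix_eq, blast)
    \<comment> \<open>\<open>?S\<close> is the shear adding coordinate \<open>n\<close> to
      coordinate \<open>m\<close>. Composed with the reflection \<open>?D\<close> of coordinate
      \<open>n\<close> it becomes an involution, and a second \<open>?D\<close>, itself diagonal,
      restores it.\<close>
    let ?S = "(\<chi> i j. of_bool (i = m \<and> j = n \<or> i = j)) :: real^'d^'d"
    let ?D = "(\<chi> i j. if i = j then if j = n then - 1 else 1 else 0) :: real^'d^'d"
    have Dv: "?D *v x = (\<chi> i. if i = n then - x $ i else x $ i)" for x
      by (simp add: vec_eq_iff matrix_vector_mult_def if_distrib[of "\<lambda>x. x * _"] cong: if_cong)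
    have Sv: "?S *v x = (\<chi> i. if i = m then x $ m + x $ n else x $ i)" for x
    proof -
      have "(\<Sum>j\<in>UNIV. of_bool (i = m \<and> j = n \<or> i = j) * x $ j) = (\<Sum>j\<in>UNIV. (if j = i then x $ j else 0) + (if j = n then (if i = m then x $ n else 0) else 0))" for i
        using mn by (intro sum.cong) auto
      thus ?thesis by (auto simp: vec_eq_iff matrix_vector_mult_def sum.distrib)
    qed
    have "P ((?S ** ?D) ** ?D)"
    proof (rule mult)
      have "((?S ** ?D) ** (?S ** ?D)) *v x = mat 1 *v x" for x
        unfolding matrix_vector_mul_assoc[symmetric] Dv Sv using mn by (auto simp: vec_eq_iff)
      thus "P (?S ** ?D)" by (intro invol) (unfold matrix_eq, blast)
      show "P ?D" by (rule diagonal) simp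
    qed
    moreover have "(?S ** ?D) ** ?D = ?S"
    proof -
      have "((?S ** ?D) ** ?D) *v x = ?S *v x" for x
        unfolding matrix_vector_mul_assoc[symmetric] Dv Sv by (auto simp: vec_eq_iff)
      thus ?thesis unfolding matrix_eq by blast
    qed
    ultimately show "P ?S" by (simp only:)
  qed
  moreover have "det T \<noteq> 0" using T by (simp add: invertible_det_nz)
  ultimately show ?thesis using u unfolding P_def by blast
qed

lemma lborel_matrix:
  fixes T :: "real^'d^'d"
  assumes T: "invertible T"
  shows "lborel = density (distr lborel borel ((*v) T)) (\<lambda>_. ennreal \<bar>det T\<bar>)"
proof (rule measure_eqI)
  fix A :: "(real^'d) set" assume "A \<in> sets lborel"
  hence [measurable]: "A \<in> sets borel" by simp
  have "emeasure lborel A = (\<integral>\<^sup>+x. indicator A x \<partial>lborel)" by simp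
  also have "\<dots> = ennreal \<bar>det T\<bar> * (\<integral>\<^sup>+x. indicator A (T *v x) \<partial>lborel)" by (rule nn_integral_matrix[OF T]) measurable
  also have "(\<integral>\<^sup>+x. indicator A (T *v x) \<partial>lborel) = (\<integral>\<^sup>+x. indicator A x \<partial>distr lborel borel ((*v) T))"
    by (rule nn_integral_distr[symmetric]) measurable
  finally show "emeasure lborel A = emeasure (density (distr lborel borel ((*v) T)) (\<lambda>_. ennreal \<bar>det T\<bar>)) A"
    by (simp add: emeasure_density_const)
qed simp

lemma integral_matrix:
  fixes T :: "real^'d^'d" and u :: "real^'d \<Rightarrow> complex"
  assumes T: "invertible T" and [measurable]: "u \<in> borel_measurable borel"
  shows "(LINT x|lborel. u x) = of_real \<bar>det T\<bar> * (LINT x|lborel. u (T *v x))"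
proof -
  have "(LINT x|lborel. u x) = (LINT x|density (distr lborel borel ((*v) T)) (\<lambda>_. ennreal \<bar>det T\<bar>). u x)"
    by (simp only: lborel_matrix[OF T, symmetric])
  thus ?thesis by (simp add: integral_density integral_distr scaleR_conv_of_real)
qed

lemma integrable_matrix:
  fixes T :: "real^'d^'d" and u :: "real^'d \<Rightarrow> complex"
  assumes T: "invertible T" and u: "integrable lborel u"
  shows "integrable lborel (\<lambda>x. u (T *v x))"
proof -
  have [measurable]: "u \<in> borel_measurable borel" using borel_measurable_integrable[OF u] by simp
  have "det T \<noteq> 0" using T by (simp add: invertible_det_nz)
  hence "0 < \<bar>det T\<bar>" by simp
  moreover have "ennreal \<bar>det T\<bar> * (\<integral>\<^sup>+x. ennreal (norm (u (T *v x))) \<partial>lborel) < \<infinity>"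
    using nn_integral_matrix[OF T, of "\<lambda>x. ennreal (norm (u x))"] nn_integral_norm_lt_top[OF u] by simp
  ultimately have "(\<integral>\<^sup>+x. ennreal (norm (u (T *v x))) \<partial>lborel) < \<infinity>"
    by (auto simp: ennreal_mult_less_top)
  thus ?thesis unfolding integrable_iff_bounded by simp
qed

lemma AE_matrix:
  fixes T :: "real^'d^'d"
  assumes T: "invertible T" and R: "AE x in lborel. R x"
  shows "AE x in lborel. R (T *v x)"
proof -
  obtain N where N: "N \<in> null_sets lborel" "{x. \<not> R x} \<subseteq> N"
    using R by (auto simp: eventually_ae_filter)
  hence [measurable]: "N \<in> sets borel" by auto
  have d: "det T \<noteq> 0" using T by (simp add: invertible_det_nz)
  have "ennreal \<bar>det T\<bar> * (\<integral>\<^sup>+x. indicator N (T *v x) \<partial>lborel) = (\<integral>\<^sup>+x. indicator N x \<partial>lborel)"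
    by (rule nn_integral_matrix[OF T, symmetric]) measurable
  also have "\<dots> = 0" using N by auto
  finally have z: "(\<integral>\<^sup>+x. indicator N (T *v x) \<partial>lborel) = (0::ennreal)" using d by simp
  have "emeasure lborel {x. T *v x \<in> N} = (\<integral>\<^sup>+x. indicator {x. T *v x \<in> N} x \<partial>lborel)"
    by (rule nn_integral_indicator[symmetric]) measurable
  also have "\<dots> = (\<integral>\<^sup>+x. indicator N (T *v x) \<partial>lborel)"
    by (intro nn_integral_cong) (auto split: split_indicator)
  finally have "{x. T *v x \<in> N} \<in> null_sets lborel" using z by (intro null_setsI) auto
  thus ?thesis by (rule AE_I') (use N in auto)
qed

section \<open>The symbol defect\<close>

text \<open>The derivative conditions bound plain lattice sums, while the coset estimate asks for
  sums of q-th powers; since \<open>1 <= q\<close> the former control the latter.\<close>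

lemma sum_powr_le_powr_sum:
  fixes x :: "'a \<Rightarrow> real"
  assumes "\<And>i. i \<in> A \<Longrightarrow> 0 \<le> x i" "1 \<le> q"
  shows "(\<Sum>i\<in>A. x i powr q) \<le> (\<Sum>i\<in>A. x i) powr q"
proof (cases "finite A")
  case True
  define S where "S = (\<Sum>i\<in>A. x i)"
  have S0: "0 \<le> S" unfolding S_def by (rule sum_nonneg) (rule assms(1))
  have pw: "t powr q = t * t powr (q - 1)" if "0 \<le> t" for t :: real
  proof (cases "t = 0")
    case False
    hence "t powr (1 + (q - 1)) = t powr 1 * t powr (q - 1)" by (intro powr_add)
    thus ?thesis using that False by simp
  qed simp
  have "(\<Sum>i\<in>A. x i powr q) \<le> (\<Sum>i\<in>A. x i * S powr (q - 1))"
  proof (rule sum_mono)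
    fix i assume i: "i \<in> A"
    have "x i \<le> S" unfolding S_def by (rule member_le_sum[OF i]) (use assms True in auto)
    hence "x i powr (q - 1) \<le> S powr (q - 1)" using assms i by (intro powr_mono2) auto
    thus "x i powr q \<le> x i * S powr (q - 1)"
      unfolding pw[OF assms(1)[OF i]] using assms(1)[OF i] by (rule mult_left_mono)
  qed
  also have "\<dots> = S powr q" unfolding pw[OF S0] by (simp add: S_def sum_distrib_right)
  finally show ?thesis by (simp add: S_def)
qed simp

lemma nn_integral_count_space_leI:
  fixes u :: "'a \<Rightarrow> real"
  assumes "\<And>\<Lambda>. finite \<Lambda> \<Longrightarrow> \<Lambda> \<subseteq> A \<Longrightarrow> (\<Sum>l\<in>\<Lambda>. u l) \<le> c" "\<And>l. 0 \<le> u l"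
  shows "(\<integral>\<^sup>+l. ennreal (u l) \<partial>count_space A) \<le> ennreal c"
  unfolding infsum_eq_nn_integral[symmetric]
proof (rule infsum_le_finite_sums[OF nonneg_summable_on_complete])
  fix \<Lambda> assume "finite \<Lambda>" "\<Lambda> \<subseteq> A"
  thus "(\<Sum>l\<in>\<Lambda>. ennreal (u l)) \<le> ennreal c"
    using assms by (subst sum_ennreal) (auto intro!: ennreal_leI)
qed simp

text \<open>The bound is \<open>max c 0\<close> because \<open>ennreal\<close> truncates a negative
  \<open>c\<close> to 0.\<close>

lemma sum_le_of_infsum_le:
  fixes u :: "'a \<Rightarrow> real"
  assumes "(\<Sum>\<^sub>\<infinity>l\<in>A. ennreal (u l)) \<le> ennreal c" "finite \<Lambda>" "\<Lambda> \<subseteq> A" "\<And>l. 0 \<le> u l"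
  shows "(\<Sum>l\<in>\<Lambda>. u l) \<le> max c 0"
proof -
  have "ennreal (\<Sum>l\<in>\<Lambda>. u l) = (\<Sum>l\<in>\<Lambda>. ennreal (u l))" using assms(4) by (simp add: sum_ennreal)
  also have "\<dots> = (\<Sum>\<^sub>\<infinity>l\<in>\<Lambda>. ennreal (u l))" using assms(2) by simp
  also have "\<dots> \<le> (\<Sum>\<^sub>\<infinity>l\<in>A. ennreal (u l))"
    using assms(3) by (intro infsum_mono_neutral[OF nonneg_summable_on_complete nonneg_summable_on_complete]) auto
  also have "\<dots> \<le> ennreal (max c 0)" using assms(1) by (rule order_trans) (simp add: ennreal_leI)
  finally show ?thesis by simp
qed

text \<open>Finite subsets with a constant independent of them suffice for the lattice sum and
  confine the Taylor argument to finitely many terms.\<close>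

lemma strang_fix_tail_bound:
  fixes F :: "real^'d \<Rightarrow> complex"
  assumes "\<forall>l\<in>int_lattice - {0}. boundedly_differentiable_on n F {\<xi>. norm (\<xi> + l) < \<delta>}"
    and "\<forall>\<beta>. mi_abs \<beta> = n \<longrightarrow> (\<exists>K::real. \<forall>\<xi>. norm \<xi> < \<delta> \<longrightarrow>
              (\<Sum>\<^sub>\<infinity>l\<in>int_lattice - {0}. ennreal (cmod (mi_deriv \<beta> F (\<xi> + l)))) \<le> ennreal K)"
    and Z: "\<forall>k\<in>int_lattice - {0}. \<forall>\<beta>\<in>Delta n. mi_deriv \<beta> F k = 0"
  obtains C where "0 \<le> C" "\<And>\<zeta> \<Lambda>. norm \<zeta> < \<delta> \<Longrightarrow> finite \<Lambda> \<Longrightarrow> \<Lambda> \<subseteq> int_lattice - {0} \<Longrightarrow>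
    (\<Sum>l\<in>\<Lambda>. norm (F (\<zeta> + l))) \<le> C * norm \<zeta> ^ n"
proof -
  have "\<forall>\<beta>. \<exists>K::real. mi_abs \<beta> = n \<longrightarrow> (\<forall>\<xi>. norm \<xi> < \<delta> \<longrightarrow>
      (\<Sum>\<^sub>\<infinity>l\<in>int_lattice - {0}. ennreal (cmod (mi_deriv \<beta> F (\<xi> + l)))) \<le> ennreal K)"
    using assms(2) by blast
  from choice[OF this] obtain K where K: "\<And>\<beta> \<xi>. mi_abs \<beta> = n \<Longrightarrow> norm \<xi> < \<delta> \<Longrightarrow>
      (\<Sum>\<^sub>\<infinity>l\<in>int_lattice - {0}. ennreal (cmod (mi_deriv \<beta> F (\<xi> + l)))) \<le> ennreal (K \<beta>)"
    by blast
  define C where "C = (\<Sum>ds :: 'd list | length ds = n. max (K (count_list ds)) 0)"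
  have C0: "0 \<le> C" unfolding C_def by (intro sum_nonneg) auto
  show ?thesis
  proof (rule that[OF C0])
    fix \<zeta> :: "real^'d" and \<Lambda> :: "(real^'d) set" assume \<zeta>: "norm \<zeta> < \<delta>" and \<Lambda>: "finite \<Lambda>" "\<Lambda> \<subseteq> int_lattice - {0}"
    have "(\<Sum>l\<in>\<Lambda>. norm (F (\<zeta> + l))) \<le> norm \<zeta> ^ n * (\<Sum>ds | length ds = n. max (K (count_list ds)) 0)"
    proof (rule sum_norm_le_of_vanishing_derivs[OF \<Lambda>(1) \<zeta>, where K = "\<lambda>\<beta>. max (K \<beta>) 0"])
      fix l assume l: "l \<in> \<Lambda>"
      \<comment> \<open>The set in the hypothesis for an index is the ball about its negative, so
        the hypothesis is applied at \<open>- l\<close>.\<close>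
      hence "- l \<in> int_lattice - {0}" using \<Lambda>(2) by (auto simp: int_lattice_minus)
      hence "n_times_differentiable_on n F {\<xi>. norm (\<xi> + - l) < \<delta>}"
        using assms(1) unfolding boundedly_differentiable_on_def by blast
      moreover have "{\<xi>. norm (\<xi> + - l) < \<delta>} = ball l \<delta>" by (auto simp: dist_norm norm_minus_commute)
      ultimately show "n_times_differentiable_on n F (ball l \<delta>)" by simp
    next
      fix l and \<beta> :: "'d \<Rightarrow> nat" assume "l \<in> \<Lambda>" "mi_abs \<beta> < n"
      thus "mi_deriv \<beta> F l = 0" using Z \<Lambda>(2) by (auto simp: Delta_def)
    next
      fix \<beta> :: "'d \<Rightarrow> nat" and \<xi> :: "real^'d" assume "mi_abs \<beta> = n" "norm \<xi> < \<delta>"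
      from sum_le_of_infsum_le[OF K[OF this] \<Lambda>]
      show "(\<Sum>l\<in>\<Lambda>. norm (mi_deriv \<beta> F (\<xi> + l))) \<le> max (K \<beta>) 0" by simp
    qed
    thus "(\<Sum>l\<in>\<Lambda>. norm (F (\<zeta> + l))) \<le> C * norm \<zeta> ^ n" by (simp add: C_def mult.commute)
  qed
qed

lemma one_minus_symbol_bound:
  fixes H :: "real^'d \<Rightarrow> complex"
  assumes n: "1 \<le> n" and H: "boundedly_differentiable_on n H {\<xi>. norm \<xi> < \<delta>}"
    and Z: "\<forall>\<beta>\<in>Delta n. mi_deriv \<beta> (\<lambda>\<xi>. 1 - H \<xi>) 0 = 0"
  obtains C where "0 \<le> C" "\<And>\<zeta>. norm \<zeta> < \<delta> \<Longrightarrow> norm (1 - H \<zeta>) \<le> C * norm \<zeta> ^ n"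
proof -
  have ball: "{\<xi>. norm \<xi> < \<delta>} = ball (0 :: real^'d) \<delta>" by (auto simp: dist_norm)
  have "\<forall>\<beta>. \<exists>K::real. mi_abs \<beta> = n \<longrightarrow> (\<forall>\<xi>. norm \<xi> < \<delta> \<longrightarrow> norm (mi_deriv \<beta> H \<xi>) \<le> K)"
  proof
    fix \<beta> :: "'d \<Rightarrow> nat"
    show "\<exists>K::real. mi_abs \<beta> = n \<longrightarrow> (\<forall>\<xi>. norm \<xi> < \<delta> \<longrightarrow> norm (mi_deriv \<beta> H \<xi>) \<le> K)"
    proof (cases "mi_abs \<beta> = n")
      case True
      hence "bounded (mi_deriv \<beta> H ` {\<xi>. norm \<xi> < \<delta>})" using H by (simp add: boundedly_differentiable_on_def)
      then obtain K where "\<forall>x\<in>mi_deriv \<beta> H ` {\<xi>. norm \<xi> < \<delta>}. norm x \<le> K" unfolding bounded_iff by blast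
      thus ?thesis by auto
    qed simp
  qed
  from choice[OF this] obtain K where K: "\<And>\<beta> \<xi>. mi_abs \<beta> = n \<Longrightarrow> norm \<xi> < \<delta> \<Longrightarrow> norm (mi_deriv \<beta> H \<xi>) \<le> K \<beta>"
    by blast
  define C where "C = (\<Sum>ds :: 'd list | length ds = n. max (K (count_list ds)) 0)"
  have C0: "0 \<le> C" unfolding C_def by (intro sum_nonneg) auto
  show ?thesis
  proof (rule that[OF C0])
    fix \<zeta> :: "real^'d" assume \<zeta>: "norm \<zeta> < \<delta>"
    have "norm (1 - H \<zeta>) \<le> norm \<zeta> ^ n * (\<Sum>ds | length ds = n. max (K (count_list ds)) 0)"
    proof (rule norm_one_minus_le_of_vanishing_derivs[OF \<zeta> n, where K = "\<lambda>\<beta>. max (K \<beta>) 0"])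
      show "n_times_differentiable_on n H (ball 0 \<delta>)" using H ball by (simp add: boundedly_differentiable_on_def)
      show "mi_deriv \<beta> (\<lambda>x. 1 - H x) 0 = 0" if "mi_abs \<beta> < n" for \<beta> using Z that by (auto simp: Delta_def)
      show "norm (mi_deriv \<beta> H \<xi>) \<le> max (K \<beta>) 0" if "mi_abs \<beta> = n" "norm \<xi> < \<delta>" for \<beta> \<xi>
        using K[OF that] by simp
    qed
    thus "norm (1 - H \<zeta>) \<le> C * norm \<zeta> ^ n" by (simp add: C_def mult.commute)
  qed
qed

text \<open>Near the origin the \<open>l = 0\<close> defect is of order \<open>n\<close> by the
  compatibility condition, up to an error of order \<open>N + 1\<close> from replacing the transform
  of \<open>phi_tilde\<close> by the true symbol; the other terms are of order \<open>n\<close> by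
  the Strang-Fix condition. Away from the origin a constant bound suffices.\<close>

lemma symbol_defect_bound:
  fixes F :: "real^'d \<Rightarrow> complex" and q h \<delta> Bq :: real and N n :: nat
  defines "r \<equiv> min n (N + 1)"
  assumes q: "1 \<le> q" and h: "0 < h" and n: "1 \<le> n" and \<delta>: "0 < \<delta>" "\<delta> < 1/2"
    and FB: "\<And>\<xi>. norm (F \<xi>) \<le> BF"
    and Bq: "0 \<le> Bq" "\<And>\<xi>. (\<integral>\<^sup>+l. ennreal (norm (F (\<xi> + l)) powr q) \<partial>lattice_measure) \<le> ennreal Bq"
    and H: "boundedly_differentiable_on n (\<lambda>\<xi>. F \<xi> * fourier_distr (phi_tilde h N) \<xi>) {\<xi>. norm \<xi> < \<delta>}"
    and FD: "\<forall>l\<in>int_lattice - {0}. boundedly_differentiable_on n F {\<xi>. norm (\<xi> + l) < \<delta>}"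
    and FK: "\<forall>\<beta>. mi_abs \<beta> = n \<longrightarrow> (\<exists>K::real. \<forall>\<xi>. norm \<xi> < \<delta> \<longrightarrow>
              (\<Sum>\<^sub>\<infinity>l\<in>int_lattice - {0}. ennreal (cmod (mi_deriv \<beta> F (\<xi> + l)))) \<le> ennreal K)"
    and Z0: "\<forall>\<beta>\<in>Delta n. mi_deriv \<beta> (\<lambda>\<xi>. 1 - F \<xi> * fourier_distr (phi_tilde h N) \<xi>) 0 = 0"
    and Z: "\<forall>k\<in>int_lattice - {0}. \<forall>\<beta>\<in>Delta n. mi_deriv \<beta> F k = 0"
  obtains C where "0 \<le> C" "\<And>\<zeta>. \<zeta> \<in> unit_cell \<Longrightarrow>
      (\<integral>\<^sup>+l. ennreal (norm ((if l = 0 then 1 else 0) - F (\<zeta> + l) * ball_symbol h \<zeta>) powr q) \<partial>lattice_measure) \<le> ennreal (C * norm \<zeta> powr (real r * q))"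
proof -
  obtain K2 where K2: "0 \<le> K2" "\<And>\<zeta> \<Lambda>. norm \<zeta> < \<delta> \<Longrightarrow> finite \<Lambda> \<Longrightarrow> \<Lambda> \<subseteq> int_lattice - {0} \<Longrightarrow>
    (\<Sum>l\<in>\<Lambda>. norm (F (\<zeta> + l))) \<le> K2 * norm \<zeta> ^ n"
    using strang_fix_tail_bound[OF FD FK Z] by blast
  obtain K1 where K1: "0 \<le> K1" "\<And>\<zeta>. norm \<zeta> < \<delta> \<Longrightarrow> norm (1 - F \<zeta> * fourier_distr (phi_tilde h N) \<zeta>) \<le> K1 * norm \<zeta> ^ n"
    using one_minus_symbol_bound[OF n H Z0] by blast
  have BF: "0 \<le> BF" using FB[of 0] norm_ge_zero order_trans by blast
  have r1: "1 \<le> r" using n by (simp add: r_def)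
  \<comment> \<open>The constants of the three contributions: compatibility at the origin,
    replacement of the symbol, and the Strang-Fix tail.\<close>
  define X where "X = K1 + BF * (2 * pi * h) ^ (N + 1) + K2"
  have X0: "0 \<le> X" using K1 K2 BF h by (simp add: X_def)
  \<comment> \<open>For \<open>norm \<zeta> >= \<delta>\<close> the constant bound is converted into
    the desired power by inserting
    \<open>(norm \<zeta> / \<delta>) powr (r * q) >= 1\<close>.\<close>
  define Y where "Y = 2 powr q * (1 + Bq) * \<delta> powr (- (real r * q))"
  have Y0: "0 \<le> Y" using Bq by (simp add: Y_def)
  show ?thesis
  proof (rule that[of "X powr q + Y"])
    show "0 \<le> X powr q + Y" using Y0 by simp
    fix \<zeta> :: "real^'d" assume \<zeta>: "\<zeta> \<in> unit_cell"
    define D where "D = (\<lambda>l. (if l = 0 then 1 else 0) - F (\<zeta> + l) * ball_symbol h \<zeta>)"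
    have A1: "norm (ball_symbol h \<zeta>) \<le> 1" by (rule norm_ball_symbol_le[OF h])
    have FA: "norm (F x * ball_symbol h \<zeta>) \<le> norm (F x)" for x
      unfolding norm_mult using mult_left_mono[OF A1, of "norm (F x)"] by simp
    have "(\<integral>\<^sup>+l. ennreal (norm (D l) powr q) \<partial>lattice_measure) \<le> ennreal ((X powr q + Y) * norm \<zeta> powr (real r * q))"
    proof (cases "norm \<zeta> < \<delta>")
      case True
      have z1: "norm \<zeta> \<le> 1" using True \<delta> by simp
      \<comment> \<open>Here the norm is below 1, so both orders are at least as good as the smaller
        one, \<open>r\<close>.\<close>
      have zn: "norm \<zeta> ^ n \<le> norm \<zeta> ^ r" and zN: "norm \<zeta> ^ (N + 1) \<le> norm \<zeta> ^ r"
        by (rule power_decreasing; use z1 in \<open>simp add: r_def\<close>)+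
      have D0: "norm (D 0) \<le> (K1 + BF * (2 * pi * h) ^ (N + 1)) * norm \<zeta> ^ r"
      proof -
        let ?P = "fourier_distr (phi_tilde h N) \<zeta>"
        have "D 0 = (1 - F \<zeta> * ?P) - F \<zeta> * (ball_symbol h \<zeta> - ?P)" by (simp add: D_def algebra_simps)
        also have "norm \<dots> \<le> norm (1 - F \<zeta> * ?P) + norm (F \<zeta> * (ball_symbol h \<zeta> - ?P))" by (rule norm_triangle_ineq4)
        also have "\<dots> \<le> K1 * norm \<zeta> ^ n + BF * (2 * pi * h * norm \<zeta>) ^ (N + 1)"
          unfolding norm_mult using BF
          by (intro add_mono mult_mono K1(2)[OF True] FB ball_symbol_minus_phi_tilde_le[OF h]) auto
        also have "\<dots> = K1 * norm \<zeta> ^ n + BF * (2 * pi * h) ^ (N + 1) * norm \<zeta> ^ (N + 1)"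
          by (simp only: power_mult_distrib mult.assoc)
        also have "\<dots> \<le> K1 * norm \<zeta> ^ r + BF * (2 * pi * h) ^ (N + 1) * norm \<zeta> ^ r"
          using K1(1) BF h by (intro add_mono mult_left_mono zn zN) auto
        finally show ?thesis by (simp only: distrib_right)
      qed
      have "(\<integral>\<^sup>+l. ennreal (norm (D l) powr q) \<partial>lattice_measure) \<le> ennreal ((X * norm \<zeta> ^ r) powr q)"
      proof (rule nn_integral_count_space_leI)
        fix \<Lambda> :: "(real^'d) set" assume \<Lambda>: "finite \<Lambda>" "\<Lambda> \<subseteq> int_lattice"
        have "(\<Sum>l\<in>\<Lambda>. norm (D l) powr q) \<le> (\<Sum>l\<in>\<Lambda>. norm (D l)) powr q"
          using q by (intro sum_powr_le_powr_sum) auto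
        also have "\<dots> \<le> (X * norm \<zeta> ^ r) powr q"
        proof (rule powr_mono2)
          have "(\<Sum>l\<in>\<Lambda>. norm (D l)) \<le> (\<Sum>l\<in>insert 0 (\<Lambda> - {0}). norm (D l))"
            using \<Lambda> by (intro sum_mono2) auto
          also have "\<dots> = norm (D 0) + (\<Sum>l\<in>\<Lambda> - {0}. norm (D l))"
            using \<Lambda> by (subst sum.insert) auto
          also have "(\<Sum>l\<in>\<Lambda> - {0}. norm (D l)) \<le> (\<Sum>l\<in>\<Lambda> - {0}. norm (F (\<zeta> + l)))"
            by (intro sum_mono) (use FA in \<open>auto simp: D_def\<close>)
          also have "\<dots> \<le> K2 * norm \<zeta> ^ n" using \<Lambda> by (intro K2(2)[OF True]) auto
          also have "\<dots> \<le> K2 * norm \<zeta> ^ r" by (rule mult_left_mono[OF zn K2(1)])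
          finally show "(\<Sum>l\<in>\<Lambda>. norm (D l)) \<le> X * norm \<zeta> ^ r"
            using D0 by (simp add: X_def distrib_right)
        qed (use q in \<open>auto intro: sum_nonneg\<close>)
        finally show "(\<Sum>l\<in>\<Lambda>. norm (D l) powr q) \<le> (X * norm \<zeta> ^ r) powr q" .
      qed simp
      also have "(X * norm \<zeta> ^ r) powr q = X powr q * norm \<zeta> powr (real r * q)"
      proof (cases "norm \<zeta> = 0")
        case True thus ?thesis using r1 by (simp add: power_0_left)
      next
        case False
        hence "norm \<zeta> ^ r = norm \<zeta> powr real r" by (simp add: powr_realpow)
        thus ?thesis by (simp add: powr_mult powr_powr)
      qed
      also have "ennreal (X powr q * norm \<zeta> powr (real r * q)) \<le> ennreal ((X powr q + Y) * norm \<zeta> powr (real r * q))"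
        using Y0 by (intro ennreal_leI mult_right_mono) auto
      finally show ?thesis .
    next
      case False
      have "(\<integral>\<^sup>+l. ennreal (norm (D l) powr q) \<partial>lattice_measure) \<le>
          (\<integral>\<^sup>+l. ennreal (2 powr q) * (indicator {0} l + ennreal (norm (F (\<zeta> + l)) powr q)) \<partial>lattice_measure)"
      proof (rule nn_integral_mono)
        fix l :: "real^'d"
        have "norm (D l) \<le> norm (if l = 0 then 1 else 0 :: complex) + norm (F (\<zeta> + l))"
          unfolding D_def using norm_triangle_ineq4[of "if l = 0 then 1 else 0 :: complex" "F (\<zeta> + l) * ball_symbol h \<zeta>"] FA[of "\<zeta> + l"] by linarith
        also have "norm (if l = 0 then 1 else 0 :: complex) = indicator {0} l" by simp
        finally have "norm (D l) powr q \<le> (indicator {0} l + norm (F (\<zeta> + l))) powr q" using q by (intro powr_mono2) auto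
        also have "\<dots> \<le> 2 powr q * (indicator {0} l powr q + norm (F (\<zeta> + l)) powr q)"
          using q by (intro add_powr_le) auto
        also have "indicator {0} l powr q = (indicator {0} l :: real)" by (auto split: split_indicator)
        finally have "ennreal (norm (D l) powr q) \<le> ennreal (2 powr q * (indicator {0} l + norm (F (\<zeta> + l)) powr q))" by (rule ennreal_leI)
        thus "ennreal (norm (D l) powr q) \<le> ennreal (2 powr q) * (indicator {0} l + ennreal (norm (F (\<zeta> + l)) powr q))"
          by (simp add: ennreal_mult ennreal_indicator)
      qed
      also have "\<dots> = ennreal (2 powr q) * (emeasure lattice_measure {0 :: real^'d} + (\<integral>\<^sup>+l. ennreal (norm (F (\<zeta> + l)) powr q) \<partial>lattice_measure))"
        by (simp add: nn_integral_cmult nn_integral_add int_lattice_zero)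
      also have "\<dots> \<le> ennreal (2 powr q) * (1 + ennreal Bq)"
        by (intro mult_left_mono add_mono Bq(2)) (auto simp: emeasure_count_space int_lattice_zero)
      also have "\<dots> = ennreal (2 powr q * (1 + Bq))" using Bq(1) by (simp add: ennreal_mult)
      also have "\<dots> \<le> ennreal ((X powr q + Y) * norm \<zeta> powr (real r * q))"
      proof (rule ennreal_leI)
        have "\<delta> powr (real r * q) \<le> norm \<zeta> powr (real r * q)" using False \<delta> q by (intro powr_mono2) auto
        hence "\<delta> powr (- (real r * q)) * \<delta> powr (real r * q) \<le> \<delta> powr (- (real r * q)) * norm \<zeta> powr (real r * q)"
          by (intro mult_left_mono) auto
        hence "1 \<le> \<delta> powr (- (real r * q)) * norm \<zeta> powr (real r * q)" using \<delta> by (simp add: powr_minus)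
        hence "2 powr q * (1 + Bq) * 1 \<le> 2 powr q * (1 + Bq) * (\<delta> powr (- (real r * q)) * norm \<zeta> powr (real r * q))"
          using Bq(1) by (intro mult_left_mono) auto
        also have "\<dots> = Y * norm \<zeta> powr (real r * q)" by (simp only: Y_def mult.assoc)
        also have "\<dots> \<le> (X powr q + Y) * norm \<zeta> powr (real r * q)" by (intro mult_right_mono) auto
        finally show "2 powr q * (1 + Bq) \<le> (X powr q + Y) * norm \<zeta> powr (real r * q)" by simp
      qed
      finally show ?thesis .
    qed
    thus "(\<integral>\<^sup>+l. ennreal (norm ((if l = 0 then 1 else 0) - F (\<zeta> + l) * ball_symbol h \<zeta>) powr q) \<partial>lattice_measure) \<le> ennreal ((X powr q + Y) * norm \<zeta> powr (real r * q))"
      by (simp add: D_def)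
  qed
qed

section \<open>Borel representatives and integrability\<close>

text \<open>\<phi> and \<open>g\<close> are only Lebesgue measurable, while the Fubini arguments run
  over Borel functions; an almost everywhere equal Borel function has the same transform.\<close>

lemma lebesgue_borel_representative:
  fixes f :: "real^'d \<Rightarrow> complex"
  assumes "f \<in> borel_measurable lebesgue"
  obtains f' where "f' \<in> borel_measurable borel" "AE x in lborel. f x = f' x"
proof -
  have re: "(\<lambda>x. Re (f x)) \<in> borel_measurable lebesgue" by (rule measurable_compose[OF assms]) measurable
  have im: "(\<lambda>x. Im (f x)) \<in> borel_measurable lebesgue" by (rule measurable_compose[OF assms]) measurable
  obtain u where u: "u \<in> borel_measurable lborel" "AE x in lborel. Re (f x) = u x"
    by (rule bexE[OF completion_ex_borel_measurable_real[OF re]], rule that)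
  obtain v where v: "v \<in> borel_measurable lborel" "AE x in lborel. Im (f x) = v x"
    by (rule bexE[OF completion_ex_borel_measurable_real[OF im]], rule that)
  have [measurable]: "u \<in> borel_measurable borel" "v \<in> borel_measurable borel" using u(1) v(1) by auto
  show ?thesis
  proof (rule that[of "\<lambda>x. of_real (u x) + \<i> * of_real (v x)"])
    show "AE x in lborel. f x = of_real (u x) + \<i> * of_real (v x)"
      using u(2) v(2) by eventually_elim (simp add: complex_eq_iff)
    show "(\<lambda>x. complex_of_real (u x) + \<i> * complex_of_real (v x)) \<in> borel_measurable borel" by measurable
  qed
qed

lemma borel_measurable_lebesgueI: "f \<in> borel_measurable borel \<Longrightarrow> f \<in> borel_measurable lebesgue"
  by (rule measurable_completion) simp

lemma fourier_cong_AE: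
  assumes "f \<in> borel_measurable lebesgue" "g \<in> borel_measurable lebesgue" "AE x in lborel. f x = g x"
  shows "fourier f = fourier g"
proof
  fix \<xi> :: "real^'a"
  have e: "(\<lambda>x :: real^'a. exp (- (2 * pi * \<i> * (x \<bullet> \<xi>)))) \<in> borel_measurable lebesgue"
    by (intro borel_measurable_lebesgueI borel_measurable_continuous_onI continuous_intros)
  show "fourier f \<xi> = fourier g \<xi>"
    unfolding fourier_def
  proof (rule integral_cong_AE)
    show "AE x in lebesgue. f x * exp (- (2 * pi * \<i> * (x \<bullet> \<xi>))) = g x * exp (- (2 * pi * \<i> * (x \<bullet> \<xi>)))"
      using AE_completion[OF assms(3)] by eventually_elim simp
  qed (rule borel_measurable_times[OF assms(1) e], rule borel_measurable_times[OF assms(2) e])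
qed

lemma ennreal_powr_ennreal: "0 \<le> x \<Longrightarrow> ennreal_powr (ennreal x) a = ennreal (x powr a)"
  by (simp add: ennreal_powr_def)

lemma ennreal_powr_lt_top: "ennreal_powr x a < \<infinity> \<Longrightarrow> x < \<infinity>"
  by (auto simp: ennreal_powr_def less_top split: if_splits)

text \<open>On a space of finite measure the pointwise bound of \<open>u\<close> by 1 plus its p-th
  power gives integrability; for infinite \<open>p\<close> the essential supremum is
  integrated.\<close>

lemma Lp_norm_lt_top_imp_nn_integral:
  fixes u :: "'a \<Rightarrow> ennreal"
  assumes fin: "Lp_norm M p u < \<infinity>" and M: "emeasure M (space M) < \<infinity>" and p: "1 \<le> p"
  shows "(\<integral>\<^sup>+x. u x \<partial>M) < \<infinity>"
proof -
  have um [measurable]: "u \<in> borel_measurable M" using fin by (auto simp: Lp_norm_def split: if_splits)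
  show ?thesis
  proof (cases p)
    case top
    hence f: "esssup M u < \<infinity>" using fin um by (simp add: Lp_norm_def)
    have "(\<integral>\<^sup>+x. u x \<partial>M) \<le> (\<integral>\<^sup>+x. esssup M u \<partial>M)" by (rule nn_integral_mono_AE[OF esssup_AE])
    also have "\<dots> = esssup M u * emeasure M (space M)" by simp
    also have "\<dots> < \<infinity>" using f M by (simp add: ennreal_mult_less_top)
    finally show ?thesis .
  next
    case (real r)
    have "ennreal 1 \<le> ennreal r" using p real by simp
    hence r: "1 \<le> r" using real by (subst (asm) ennreal_le_iff) auto
    have "ennreal_powr (\<integral>\<^sup>+x. ennreal_powr (u x) r \<partial>M) (1 / r) < \<infinity>"
      using fin um real r by (simp add: Lp_norm_def)
    hence f: "(\<integral>\<^sup>+x. ennreal_powr (u x) r \<partial>M) < \<infinity>" by (rule ennreal_powr_lt_top)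
    have pm [measurable]: "(\<lambda>x. ennreal_powr (u x) r) \<in> borel_measurable M"
      unfolding ennreal_powr_def by measurable
    have le: "u x \<le> 1 + ennreal_powr (u x) r" for x
    proof (cases "u x")
      case (real t)
      have "t \<le> 1 + t powr r"
      proof (cases "t \<le> 1")
        case False
        hence "t powr 1 \<le> t powr r" using r by (intro powr_mono) auto
        thus ?thesis using False by simp
      next
        case True thus ?thesis using powr_ge_zero[of t r] by linarith
      qed
      hence "ennreal t \<le> ennreal (1 + t powr r)" by (rule ennreal_leI)
      thus ?thesis using real by (simp add: ennreal_powr_ennreal)
    qed (simp add: ennreal_powr_def)
    have "(\<integral>\<^sup>+x. u x \<partial>M) \<le> (\<integral>\<^sup>+x. 1 + ennreal_powr (u x) r \<partial>M)" by (intro nn_integral_mono le)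
    also have "\<dots> = emeasure M (space M) + (\<integral>\<^sup>+x. ennreal_powr (u x) r \<partial>M)" by (simp add: nn_integral_add)
    also have "\<dots> < \<infinity>" using f M by simp
    finally show ?thesis .
  qed
qed

text \<open>By tiling, the integral of the modulus is the integral of its periodization over one
  cell, and on a cube a finite p-norm gives a finite integral.\<close>

lemma script_L_integrable:
  fixes \<phi> \<phi>' :: "real^'d \<Rightarrow> complex"
  assumes \<phi>: "script_L p \<phi>" and p: "1 \<le> p" and [measurable]: "\<phi>' \<in> borel_measurable borel" and eq: "AE x in lborel. \<phi> x = \<phi>' x"
  shows "integrable lborel \<phi>'"
proof -
  define u where "u = (\<lambda>x. \<integral>\<^sup>+k. ennreal (cmod (\<phi> (x + k))) \<partial>lattice_measure)"
  have fin: "Lp_norm (lebesgue_on unit_torus) p u < \<infinity>"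
    using \<phi> by (simp add: script_L_def u_def infsum_eq_nn_integral)
  have tm: "(unit_torus :: (real^'d) set) \<in> sets lebesgue" and tf: "emeasure lebesgue (unit_torus :: (real^'d) set) < \<infinity>"
    unfolding unit_torus_def using emeasure_lborel_cbox_finite[of "(\<chi> i. - (1/2)) :: real^'d" "\<chi> i. 1/2"] by auto
  have um: "u \<in> borel_measurable (lebesgue_on unit_torus)" using fin by (auto simp: Lp_norm_def split: if_splits)
  have "(\<integral>\<^sup>+x. u x \<partial>lebesgue_on unit_torus) < \<infinity>"
    by (rule Lp_norm_lt_top_imp_nn_integral[OF fin _ p]) (use tm tf in \<open>simp add: emeasure_restrict_space\<close>)
  hence fin2: "(\<integral>\<^sup>+x. u x * indicator unit_torus x \<partial>lebesgue) < \<infinity>"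
    using tm by (simp add: nn_integral_restrict_space)
  have AE: "AE x in lborel. \<forall>k\<in>int_lattice. \<phi> (x + k) = \<phi>' (x + k)"
    by (intro AE_ball_countable' AE_lborel_shift[OF eq] countable_int_lattice)
  have "(\<integral>\<^sup>+x. ennreal (norm (\<phi>' x)) \<partial>lborel) = (\<integral>\<^sup>+x. indicator unit_cell x * (\<integral>\<^sup>+k. ennreal (norm (\<phi>' (x + k))) \<partial>lattice_measure) \<partial>lborel)"
    by (rule nn_integral_tiling) measurable
  also have "\<dots> \<le> (\<integral>\<^sup>+x. u x * indicator unit_torus x \<partial>lborel)"
  proof (rule nn_integral_mono_AE, rule AE_mp[OF AE], rule AE_I2, rule impI)
    fix x assume k: "\<forall>k\<in>int_lattice. \<phi> (x + k) = \<phi>' (x + k)"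
    have "(\<integral>\<^sup>+k. ennreal (norm (\<phi>' (x + k))) \<partial>lattice_measure) = u x"
      unfolding u_def by (intro nn_integral_cong) (use k in auto)
    moreover have "x \<in> unit_cell \<Longrightarrow> x \<in> unit_torus"
      by (auto simp: unit_cell_def unit_torus_def mem_box_cart less_imp_le)
    ultimately show "indicator unit_cell x * (\<integral>\<^sup>+k. ennreal (norm (\<phi>' (x + k))) \<partial>lattice_measure) \<le> u x * indicator unit_torus x"
      by (auto split: split_indicator)
  qed
  also have "\<dots> = (\<integral>\<^sup>+x. u x * indicator unit_torus x \<partial>lebesgue)" by (rule nn_integral_completion[symmetric])
  finally show ?thesis using fin2 unfolding integrable_iff_bounded by simp
qed

lemma in_Lp_nn_integral:
  fixes g g' :: "real^'d \<Rightarrow> complex"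
  assumes g: "in_Lp (ennreal q) g" and q: "0 < q" and eq: "AE x in lborel. g x = g' x"
  shows "(\<integral>\<^sup>+x. ennreal (norm (g' x) powr q) \<partial>lborel) < \<infinity>"
proof -
  have "Lp_norm lebesgue (ennreal q) (\<lambda>x. ennreal (cmod (g x))) < \<infinity>" using g by (simp add: in_Lp_def)
  hence "ennreal_powr (\<integral>\<^sup>+x. ennreal_powr (ennreal (cmod (g x))) q \<partial>lebesgue) (1 / q) < \<infinity>"
    using q by (auto simp: Lp_norm_def split: if_splits)
  hence "(\<integral>\<^sup>+x. ennreal_powr (ennreal (cmod (g x))) q \<partial>lebesgue) < \<infinity>" by (rule ennreal_powr_lt_top)
  hence "(\<integral>\<^sup>+x. ennreal (cmod (g x) powr q) \<partial>lborel) < \<infinity>"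
    by (simp add: ennreal_powr_ennreal nn_integral_completion)
  moreover have "(\<integral>\<^sup>+x. ennreal (norm (g' x) powr q) \<partial>lborel) = (\<integral>\<^sup>+x. ennreal (cmod (g x) powr q) \<partial>lborel)"
    by (rule nn_integral_cong_AE, rule AE_mp[OF eq], rule AE_I2) simp
  ultimately show ?thesis by simp
qed

text \<open>Tiling reduces the integral to the lattice sum of the same power, at the cost of
  \<open>2 powr t\<close> for moving within the cell.\<close>

lemma nn_integral_powr_tail:
  fixes t :: real
  assumes t: "real CARD('d) < t"
  shows "(\<integral>\<^sup>+x. ennreal (max 1 (norm (x :: real^'d)) powr (- t)) \<partial>lborel) < \<infinity>"
proof -
  have t0: "0 < t" using t by (meson le_less_trans of_nat_0_le_iff)
  have cell: "(\<integral>\<^sup>+l. ennreal (max 1 (norm (\<zeta> + l)) powr (- t)) \<partial>lattice_measure) \<le>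
      ennreal (2 powr t) * (\<integral>\<^sup>+l. ennreal (max 1 (norm l) powr (- t)) \<partial>(lattice_measure :: (real^'d) measure))"
    if \<zeta>: "\<zeta> \<in> unit_cell" for \<zeta> :: "real^'d"
  proof -
    have "(\<integral>\<^sup>+l. ennreal (max 1 (norm (\<zeta> + l)) powr (- t)) \<partial>lattice_measure) \<le>
      (\<integral>\<^sup>+l. ennreal (2 powr t) * ennreal (max 1 (norm (l :: real^'d)) powr (- t)) \<partial>lattice_measure)"
    proof (rule nn_integral_mono)
      fix l :: "real^'d" assume "l \<in> space lattice_measure"
      hence l: "l \<in> int_lattice" by simp
      have "max 1 (norm l) / 2 \<le> max 1 (norm (\<zeta> + l))"
        using unit_cell_norm_ge[OF \<zeta> l] by (auto simp: max_def)
      hence "max 1 (norm (\<zeta> + l)) powr (- t) \<le> (max 1 (norm l) / 2) powr (- t)"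
        using t0 by (intro powr_mono2') auto
      also have "\<dots> = 2 powr t * max 1 (norm l) powr (- t)"
        unfolding powr_divide powr_minus by (simp add: field_simps)
      finally show "ennreal (max 1 (norm (\<zeta> + l)) powr (- t)) \<le> ennreal (2 powr t) * ennreal (max 1 (norm l) powr (- t))"
        by (simp add: ennreal_mult[symmetric] ennreal_leI)
    qed
    thus ?thesis by (simp add: nn_integral_cmult)
  qed
  define Z where "Z = ennreal (2 powr t) * (\<integral>\<^sup>+l. ennreal (max 1 (norm l) powr (- t)) \<partial>(lattice_measure :: (real^'d) measure))"
  have "(\<integral>\<^sup>+l. ennreal (norm (max 1 (norm l) powr (- t))) \<partial>(lattice_measure :: (real^'d) measure)) < \<infinity>"
    by (rule nn_integral_norm_lt_top[OF integrable_lattice_powr[OF t]])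
  hence Z: "Z < \<infinity>" by (simp add: Z_def ennreal_mult_less_top)
  have uc: "emeasure lborel (unit_cell :: (real^'d) set) < \<infinity>"
  proof -
    have "emeasure lborel (unit_cell :: (real^'d) set) \<le> emeasure lborel (unit_torus :: (real^'d) set)"
      by (rule emeasure_mono) (auto simp: unit_cell_def unit_torus_def mem_box_cart less_imp_le)
    also have "\<dots> < \<infinity>" unfolding unit_torus_def by (rule emeasure_lborel_cbox_finite)
    finally show ?thesis .
  qed
  have "(\<integral>\<^sup>+x. ennreal (max 1 (norm (x :: real^'d)) powr (- t)) \<partial>lborel) =
     (\<integral>\<^sup>+x. indicator unit_cell x * (\<integral>\<^sup>+l. ennreal (max 1 (norm (x + l :: real^'d)) powr (- t)) \<partial>lattice_measure) \<partial>lborel)"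
    by (rule nn_integral_tiling) measurable
  also have "\<dots> \<le> (\<integral>\<^sup>+x. Z * indicator (unit_cell :: (real^'d) set) x \<partial>lborel)"
    unfolding Z_def by (intro nn_integral_mono) (use cell in \<open>auto split: split_indicator\<close>)
  also have "\<dots> = Z * emeasure lborel (unit_cell :: (real^'d) set)"
    by (rule nn_integral_cmult_indicator) measurable
  also have "\<dots> < \<infinity>" using Z uc by (simp add: ennreal_mult_less_top)
  finally show ?thesis .
qed

text \<open>Inside the ball of radius \<open>R\<close> the integrability of the q-th power is used,
  through \<open>norm (g x) <= 1 + norm (g x) powr q\<close> for the first claim; outside it the
  decay. The weight uses up \<open>r\<close> of the decay, and the margin \<open>s - r\<close> must
  still exceed the dimension.\<close>

lemma decay_integrable:
  fixes g :: "real^'d \<Rightarrow> complex" and q s r R c :: real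
  assumes [measurable]: "g \<in> borel_measurable borel" and q: "1 \<le> q" and R: "1 \<le> R" and c: "0 \<le> c"
    and gq: "(\<integral>\<^sup>+x. ennreal (norm (g x) powr q) \<partial>lborel) < \<infinity>"
    and decay: "AE x in lborel. R \<le> norm x \<longrightarrow> norm (g x) \<le> c * norm x powr (- s)"
    and r: "0 \<le> r" "real CARD('d) < s - r"
  shows "integrable lborel g" (is ?int)
    and "(\<integral>\<^sup>+x. ennreal ((norm x powr r * norm (g x)) powr q) \<partial>lborel) < \<infinity>" (is ?W)
proof -
  have cb: "emeasure lborel (cball (0 :: real^'d) R) < \<infinity>" by (rule emeasure_lborel_cball_finite)
  have "(\<integral>\<^sup>+x. ennreal (norm (g x)) \<partial>lborel) \<le>
      (\<integral>\<^sup>+x. (indicator (cball (0::real^'d) R) x + ennreal (norm (g x) powr q)) + ennreal c * ennreal (max 1 (norm x) powr (- s)) \<partial>lborel)"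
  proof (rule nn_integral_mono_AE, rule AE_mp[OF decay], rule AE_I2, rule impI)
    fix x :: "real^'d" assume d: "R \<le> norm x \<longrightarrow> norm (g x) \<le> c * norm x powr (- s)"
    show "ennreal (norm (g x)) \<le> (indicator (cball (0::real^'d) R) x + ennreal (norm (g x) powr q)) + ennreal c * ennreal (max 1 (norm x) powr (- s))"
    proof (cases "R \<le> norm x")
      case True
      have "ennreal (norm (g x)) \<le> ennreal (c * max 1 (norm x) powr (- s))"
        using d True R by (intro ennreal_leI) (simp add: max_def)
      also have "\<dots> = ennreal c * ennreal (max 1 (norm x) powr (- s))" using c by (simp add: ennreal_mult)
      also have "\<dots> \<le> (indicator (cball (0::real^'d) R) x + ennreal (norm (g x) powr q)) + ennreal c * ennreal (max 1 (norm x) powr (- s))"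
        by (rule add_increasing) simp_all
      finally show ?thesis .
    next
      case False
      have "norm (g x) \<le> 1 + norm (g x) powr q"
      proof (cases "norm (g x) \<le> 1")
        case False
        hence "norm (g x) powr 1 \<le> norm (g x) powr q" using q by (intro powr_mono) auto
        thus ?thesis using False by simp
      qed (simp add: add_increasing2)
      hence "ennreal (norm (g x)) \<le> ennreal (1 + norm (g x) powr q)" by (rule ennreal_leI)
      also have "\<dots> = indicator (cball (0::real^'d) R) x + ennreal (norm (g x) powr q)"
        using False by simp
      also have "\<dots> \<le> (indicator (cball (0::real^'d) R) x + ennreal (norm (g x) powr q)) + ennreal c * ennreal (max 1 (norm x) powr (- s))"
        by (rule add_increasing2) simp_all
      finally show ?thesis .
    qed
  qed
  also have "\<dots> = (emeasure lborel (cball (0 :: real^'d) R) + (\<integral>\<^sup>+x. ennreal (norm (g x) powr q) \<partial>lborel)) + ennreal c * (\<integral>\<^sup>+x. ennreal (max 1 (norm (x :: real^'d)) powr (- s)) \<partial>lborel)"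
  proof -
    have m1: "(\<lambda>x. ennreal (norm (g x) powr q)) \<in> borel_measurable lborel" by measurable
    have m2: "(\<lambda>x :: real^'d. ennreal (max 1 (norm x) powr (- s))) \<in> borel_measurable lborel" by measurable
    have m4: "(\<lambda>x :: real^'d. ennreal c * ennreal (max 1 (norm x) powr (- s))) \<in> borel_measurable lborel" by measurable
    have m3: "(\<lambda>x. indicator (cball (0::real^'d) R) x :: ennreal) \<in> borel_measurable lborel" by (rule borel_measurable_indicator) simp
    show ?thesis
      unfolding nn_integral_add[OF borel_measurable_add[OF m3 m1] m4]
        nn_integral_add[OF m3 m1] nn_integral_cmult[OF m2] by simp
  qed
  also have "\<dots> < \<infinity>"
    using cb gq nn_integral_powr_tail[where 'd = 'd, of s] r by (simp add: ennreal_mult_less_top)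
  finally show ?int unfolding integrable_iff_bounded by simp
  \<comment> \<open>The exponent after raising to the power \<open>q\<close>; as
    \<open>1 <= q\<close>, it still exceeds the dimension.\<close>
  define t where "t = (s - r) * q"
  have "(s - r) * 1 \<le> t" unfolding t_def using r q by (intro mult_left_mono) (auto intro: order_trans[OF of_nat_0_le_iff less_imp_le])
  hence "s - r \<le> t" by simp
  with r(2) have t: "real CARD('d) < t" by (rule less_le_trans)
  have "(\<integral>\<^sup>+x. ennreal ((norm x powr r * norm (g x)) powr q) \<partial>lborel) \<le>
      (\<integral>\<^sup>+x. ennreal (R powr (r * q)) * ennreal (norm (g x) powr q) + ennreal (c powr q) * ennreal (max 1 (norm x) powr (- t)) \<partial>lborel)"
  proof (rule nn_integral_mono_AE, rule AE_mp[OF decay], rule AE_I2, rule impI)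
    fix x :: "real^'d" assume d: "R \<le> norm x \<longrightarrow> norm (g x) \<le> c * norm x powr (- s)"
    show "ennreal ((norm x powr r * norm (g x)) powr q) \<le> ennreal (R powr (r * q)) * ennreal (norm (g x) powr q) + ennreal (c powr q) * ennreal (max 1 (norm x) powr (- t))"
    proof (cases "R \<le> norm x")
      case True
      have "norm x powr r * norm (g x) \<le> norm x powr r * (c * norm x powr (- s))"
        using d True by (intro mult_left_mono) auto
      also have "\<dots> = c * norm x powr (- (s - r))" by (simp add: powr_add[symmetric] mult.left_commute)
      finally have "(norm x powr r * norm (g x)) powr q \<le> (c * norm x powr (- (s - r))) powr q"
        using q by (intro powr_mono2) auto
      also have "\<dots> = c powr q * max 1 (norm x) powr (- t)"
      proof -
        have "(norm x powr (- (s - r))) powr q = norm x powr (- t)"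
          unfolding powr_powr t_def by (simp add: algebra_simps)
        moreover have "max 1 (norm x) = norm x" using True R by simp
        ultimately show ?thesis by (simp only: powr_mult)
      qed
      finally have "ennreal ((norm x powr r * norm (g x)) powr q) \<le> ennreal (c powr q) * ennreal (max 1 (norm x) powr (- t))"
        by (simp add: ennreal_mult[symmetric] ennreal_leI)
      thus ?thesis by (rule add_increasing[rotated]) simp
    next
      case False
      have "norm x powr r \<le> R powr r" using False r by (intro powr_mono2) auto
      hence "norm x powr r * norm (g x) \<le> R powr r * norm (g x)" by (rule mult_right_mono) simp
      hence "(norm x powr r * norm (g x)) powr q \<le> (R powr r * norm (g x)) powr q" using q by (intro powr_mono2) auto
      also have "\<dots> = R powr (r * q) * norm (g x) powr q" by (simp add: powr_mult powr_powr)
      finally have "ennreal ((norm x powr r * norm (g x)) powr q) \<le> ennreal (R powr (r * q)) * ennreal (norm (g x) powr q)"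
        by (simp add: ennreal_mult[symmetric] ennreal_leI)
      thus ?thesis by (rule add_increasing2[rotated]) simp
    qed
  qed
  also have "\<dots> = ennreal (R powr (r * q)) * (\<integral>\<^sup>+x. ennreal (norm (g x) powr q) \<partial>lborel) + ennreal (c powr q) * (\<integral>\<^sup>+x. ennreal (max 1 (norm (x :: real^'d)) powr (- t)) \<partial>lborel)"
  proof -
    have m1: "(\<lambda>x. ennreal (norm (g x) powr q)) \<in> borel_measurable lborel" by measurable
    have m2: "(\<lambda>x :: real^'d. ennreal (max 1 (norm x) powr (- t))) \<in> borel_measurable lborel" by measurable
    have m3: "(\<lambda>x. ennreal (R powr (r * q)) * ennreal (norm (g x) powr q)) \<in> borel_measurable lborel" by measurable
    have m4: "(\<lambda>x :: real^'d. ennreal (c powr q) * ennreal (max 1 (norm x) powr (- t))) \<in> borel_measurable lborel" by measurable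
    show ?thesis
      unfolding nn_integral_add[OF m3 m4]
        nn_integral_cmult[OF m1] nn_integral_cmult[OF m2] ..
  qed
  also have "\<dots> < \<infinity>" using gq nn_integral_powr_tail[OF t] by (simp add: ennreal_mult_less_top)
  finally show ?W .
qed

section \<open>Undoing the dilation\<close>

text \<open>The change of variables contributes the determinant to the power \<open>- 1/p\<close>;
  with the outer factor the exponent becomes \<open>1 - 1/p = 1/q\<close>.\<close>

lemma Lp_le_matrix_scale:
  fixes E :: "real^'d \<Rightarrow> complex" and T :: "real^'d^'d" and p :: ennreal and q K :: real
  assumes p: "2 \<le> p" "1 / p + 1 / ennreal q = 1" and T: "invertible T" and [measurable]: "E \<in> borel_measurable borel"
    and E: "Lp_le p K E" and K: "0 < K"
  shows "Lp_le p (\<bar>det T\<bar> powr (1 / q) * K) (\<lambda>x. of_real \<bar>det T\<bar> * E (T *v x))"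
proof -
  let ?m = "\<bar>det T\<bar>"
  have m: "0 < ?m" using T by (simp add: invertible_det_nz)
  from p show ?thesis
  proof (cases rule: conjugate_exponent_cases)
    case infinite
    hence "AE x in lborel. norm (E x) \<le> K" using E by (simp add: Lp_le_def)
    from AE_matrix[OF T this] have "AE x in lborel. norm (of_real ?m * E (T *v x)) \<le> ?m * K"
      by eventually_elim (simp add: norm_mult mult_left_mono)
    thus ?thesis using infinite m by (simp add: Lp_le_def)
  next
    case (finite \<rho>)
    have E': "(\<integral>\<^sup>+x. ennreal (norm (E x) powr \<rho>) \<partial>lborel) \<le> ennreal (K powr \<rho>)" using E finite by (simp add: Lp_le_def)
    define I where "I = (\<integral>\<^sup>+x. ennreal (norm (E (T *v x)) powr \<rho>) \<partial>lborel)"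
    have I: "ennreal ?m * I \<le> ennreal (K powr \<rho>)"
      unfolding I_def using E' nn_integral_matrix[OF T, of "\<lambda>x. ennreal (norm (E x) powr \<rho>)"] by simp
    have "(\<integral>\<^sup>+x. ennreal (norm (of_real ?m * E (T *v x)) powr \<rho>) \<partial>lborel) = (\<integral>\<^sup>+x. ennreal (?m powr \<rho>) * ennreal (norm (E (T *v x)) powr \<rho>) \<partial>lborel)"
      by (intro nn_integral_cong) (simp add: norm_mult powr_mult ennreal_mult)
    also have "\<dots> = ennreal (?m powr \<rho>) * I" unfolding I_def by (rule nn_integral_cmult) measurable
    also have "?m powr \<rho> = ?m powr (\<rho> - 1) * ?m" using m powr_add[of ?m "\<rho> - 1" 1] by simp
    also have "ennreal (?m powr (\<rho> - 1) * ?m) * I = ennreal (?m powr (\<rho> - 1)) * (ennreal ?m * I)"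
      by (simp add: ennreal_mult mult.assoc)
    also have "\<dots> \<le> ennreal (?m powr (\<rho> - 1)) * ennreal (K powr \<rho>)" by (rule mult_left_mono[OF I]) simp
    also have "\<dots> = ennreal ((?m powr (1 / q) * K) powr \<rho>)"
    proof -
      have "1 / q * \<rho> = \<rho> - 1" unfolding finite(4) using finite(2) by simp
      hence "(?m powr (1 / q)) powr \<rho> = ?m powr (\<rho> - 1)" by (simp only: powr_powr)
      thus ?thesis by (simp only: powr_mult ennreal_mult powr_ge_zero)
    qed
    finally show ?thesis using finite by (simp add: Lp_le_def)
  qed
qed

text \<open>\<open>Lp_norm\<close> is infinite on nonmeasurable functions, so measurability of
  \<open>v\<close> has to be shown; it follows from completeness of Lebesgue measure.\<close>

lemma Lp_norm_le_of_Lp_le: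
  fixes u v :: "real^'d \<Rightarrow> complex"
  assumes p: "2 \<le> p" and [measurable]: "u \<in> borel_measurable borel" and eq: "AE x in lborel. u x = v x"
    and u: "Lp_le p K u" and K: "0 \<le> K"
  shows "Lp_norm lebesgue p (\<lambda>x. ennreal (cmod (v x))) \<le> ennreal K"
proof -
  have "u \<in> borel_measurable lebesgue" by (rule borel_measurable_lebesgueI) measurable
  hence vm: "v \<in> borel_measurable lebesgue" using AE_completion[OF eq] by (rule borel_measurable_AE)
  have nm: "(\<lambda>x. ennreal (cmod (v x))) \<in> borel_measurable lebesgue" by (rule measurable_compose[OF vm]) measurable
  show ?thesis
  proof (cases p)
    case top
    have "AE x in lborel. norm (u x) \<le> K" using u top by (simp add: Lp_le_def)
    with eq have "AE x in lborel. ennreal (cmod (v x)) \<le> ennreal K" by eventually_elim (simp add: ennreal_leI)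
    from esssup_I[OF nm AE_completion[OF this]] show ?thesis using top nm by (simp add: Lp_norm_def)
  next
    case (real \<rho>)
    have "ennreal 2 \<le> ennreal \<rho>" using p real by simp
    hence \<rho>: "2 \<le> \<rho>" using real by (subst (asm) ennreal_le_iff) auto
    have "(\<integral>\<^sup>+x. ennreal_powr (ennreal (cmod (v x))) \<rho> \<partial>lebesgue) = (\<integral>\<^sup>+x. ennreal (norm (u x) powr \<rho>) \<partial>lborel)"
      unfolding nn_integral_completion
      by (rule nn_integral_cong_AE, rule AE_mp[OF eq], rule AE_I2) (simp add: ennreal_powr_ennreal)
    also have "\<dots> \<le> ennreal (K powr \<rho>)" using u real by (simp add: Lp_le_def)
    finally have le: "(\<integral>\<^sup>+x. ennreal_powr (ennreal (cmod (v x))) \<rho> \<partial>lebesgue) \<le> ennreal (K powr \<rho>)" .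
    then obtain I where I: "0 \<le> I" "(\<integral>\<^sup>+x. ennreal_powr (ennreal (cmod (v x))) \<rho> \<partial>lebesgue) = ennreal I" "I \<le> K powr \<rho>"
      by (cases "\<integral>\<^sup>+x. ennreal_powr (ennreal (cmod (v x))) \<rho> \<partial>lebesgue") (auto simp: top_unique)
    have "I powr (1 / \<rho>) \<le> (K powr \<rho>) powr (1 / \<rho>)" using I \<rho> by (intro powr_mono2) auto
    also have "\<dots> = K" using K \<rho> by (simp add: powr_powr)
    finally have "I powr (1 / \<rho>) \<le> K" .
    hence "ennreal (I powr (1 / \<rho>)) \<le> ennreal K" by (rule ennreal_leI)
    thus ?thesis using nm real \<rho> I by (simp add: Lp_norm_def ennreal_powr_ennreal)
  qed
qed

lemma
  fixes u :: "real^'d \<Rightarrow> complex"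
  assumes u: "integrable lattice_measure u"
  shows summable_on_int_lattice: "u summable_on int_lattice"
    and infsum_int_lattice: "(\<Sum>\<^sub>\<infinity>k\<in>int_lattice. u k) = (LINT k|lattice_measure. u k)"
proof -
  have s: "Infinite_Set_Sum.abs_summable_on u int_lattice"
    using u by (simp add: Infinite_Set_Sum.abs_summable_on_def)
  hence "Infinite_Sum.abs_summable_on u int_lattice" by (simp add: abs_summable_equivalent)
  thus "u summable_on int_lattice" by (rule abs_summable_summable)
  show "(\<Sum>\<^sub>\<infinity>k\<in>int_lattice. u k) = (LINT k|lattice_measure. u k)"
    using infsetsum_infsum[OF s] by (simp add: infsetsum_def)
qed

lemma integral_lborel_uminus:
  fixes u :: "'a::euclidean_space \<Rightarrow> complex"
  assumes [measurable]: "u \<in> borel_measurable borel"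
  shows "(LINT x|lborel. u (- x)) = (LINT x|lborel. u x)"
proof -
  have "(LINT x|lborel. u x) = (LINT x|distr lborel borel uminus. u x)" by (simp only: lborel_distr_uminus_vec)
  also have "\<dots> = (LINT x|lborel. u (- x))" by (rule integral_distr) measurable
  finally show ?thesis ..
qed

lemma inner_transpose_matrix: "v \<bullet> (transpose T *v y) = (T *v v) \<bullet> (y :: real^'d)" for T :: "real^'d^'d"
  unfolding transpose_matrix_vector inner_commute[of v] dot_lmul_matrix by (rule inner_commute)

lemma ft_matrix:
  fixes T :: "real^'d^'d" and g :: "real^'d \<Rightarrow> complex"
  assumes T: "invertible T" and [measurable]: "g \<in> borel_measurable borel"
  shows "ft g y = of_real \<bar>det T\<bar> * ft (\<lambda>v. g (T *v v)) (transpose T *v y)"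
  unfolding ft_def inner_transpose_matrix by (rule integral_matrix[OF T]) measurable

text \<open>Substitution by the matrix power turns the averaging set into a ball and the sampling
  point into \<open>- k\<close>; by the multiplication formula, averaging a transform over the ball
  multiplies \<open>G\<close> by \<open>ball_symbol\<close>. The Jacobian is cancelled by the
  determinant factor in \<open>Av\<close>.\<close>

lemma Av_eq_ft:
  fixes M :: "real^'d^'d" and G f :: "real^'d \<Rightarrow> complex"
  assumes M: "invertible M" and h: "0 < h" and G: "integrable lborel G"
    and f: "\<And>x. f x = of_real (\<bar>det M\<bar> ^ j) * ft G (- (mat_pow M j *v x))"
  shows "Av M h j f (- (mat_pow (matrix_inv M) j *v k)) = of_real (\<bar>det M\<bar> ^ j) * ft (\<lambda>\<eta>. G \<eta> * ball_symbol h \<eta>) k"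
proof -
  let ?B = "mat_pow M j" and ?A = "mat_pow (matrix_inv M) j" and ?m = "\<bar>det M\<bar> ^ j"
  let ?cb = "cball (0 :: real^'d) h"
  define b where "b = measure lebesgue ?cb"
  have b: "0 < b" unfolding b_def by (rule measure_lebesgue_cball_pos[OF h])
  have AB: "?A ** ?B = mat 1" by (rule mat_pow_inverse[OF M])
  hence BA: "?B ** ?A = mat 1" using matrix_left_right_inverse by blast
  have invA: "invertible ?A" unfolding invertible_def using AB BA by blast
  have BAv: "?B *v (?A *v v) = v" for v by (simp add: matrix_vector_mul_assoc BA)
  have ABv: "?A *v (?B *v v) = v" for v by (simp add: matrix_vector_mul_assoc AB)
  have dm: "\<bar>det ?A\<bar> * ?m = 1"
    using arg_cong[OF AB, of det] by (simp add: det_mul det_mat_pow[of M] abs_mult[symmetric] power_abs[symmetric])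
  have [measurable]: "G \<in> borel_measurable borel" using borel_measurable_integrable[OF G] by simp
  have [measurable]: "ft G \<in> borel_measurable borel" by (rule borel_measurable_ft[OF G])
  have [measurable]: "(\<lambda>s. ft G (k - s)) \<in> borel_measurable borel"
    by (rule measurable_compose[OF _ borel_measurable_ft[OF G]]) measurable
  have [measurable]: "?cb \<in> sets borel" by simp
  have [measurable]: "f \<in> borel_measurable borel" unfolding f[abs_def] by measurable
  have S: "(*v) ?A ` ?cb = {t. ?B *v t \<in> ?cb}"
  proof (intro set_eqI iffI)
    fix t assume "t \<in> {t. ?B *v t \<in> ?cb}"
    thus "t \<in> (*v) ?A ` ?cb" using ABv[of t] by (metis image_eqI mem_Collect_eq)
  qed (use BAv in auto)
  have [measurable]: "{t. ?B *v t \<in> ?cb} \<in> sets borel"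
    using measurable_sets[OF borel_measurable_matrix_vector[of ?B] borel_closed[OF closed_cball[of 0 h]]] by (simp add: vimage_def)
  let ?u = "\<lambda>t. indicator {t. ?B *v t \<in> ?cb} t *\<^sub>R f (- (?A *v k) + t)"
  have fA: "f (- (?A *v k) + ?A *v s) = of_real ?m * ft G (k - s)" for s
  proof -
    have "?B *v (- (?A *v k) + ?A *v s) = s - k"
      using BAv[of s] BAv[of k] by (simp add: matrix_vector_right_distrib matrix_vector_mult_diff_distrib)
    thus ?thesis unfolding f by simp
  qed
  \<comment> \<open>Modulating \<open>G\<close> absorbs the shift by \<open>k\<close>, so that the
    multiplication formula can be applied with the indicator of the ball.\<close>
  define Gk where "Gk = (\<lambda>\<eta>. G \<eta> * cis (- 2 * pi * (\<eta> \<bullet> k)))"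
  have Gk: "integrable lborel Gk" unfolding Gk_def by (rule integrable_mult_cis[OF G]) measurable
  have ftGk: "ft G (k + s) = ft Gk s" for s
    unfolding ft_def Gk_def
    by (rule Bochner_Integration.integral_cong[OF refl]) (simp add: mult.assoc cis_mult inner_add_right distrib_left)
  have ind: "integrable lborel (\<lambda>t. indicator ?cb t *\<^sub>R (1 :: complex))"
    by (rule integrable_cball) (rule continuous_on_const)
  have "(LINT t:((*v) ?A ` ?cb)|lebesgue. f (- (?A *v k) + t)) = (LINT t|lebesgue. ?u t)"
    unfolding set_lebesgue_integral_def S ..
  also have "\<dots> = (LINT t|lborel. ?u t)" by (rule integral_completion) measurable
  also have "\<dots> = of_real \<bar>det ?A\<bar> * (LINT s|lborel. ?u (?A *v s))" by (rule integral_matrix[OF invA]) measurable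
  also have "(LINT s|lborel. ?u (?A *v s)) = (LINT s|lborel. of_real ?m * (indicator ?cb s *\<^sub>R ft G (k - s)))"
    by (rule Bochner_Integration.integral_cong[OF refl]) (simp only: fA, simp add: BAv indicator_def)
  also have "\<dots> = of_real ?m * (LINT s|lborel. indicator ?cb s *\<^sub>R ft G (k - s))" by (rule integral_mult_right_zero)
  \<comment> \<open>The ball is symmetric, so \<open>k - s\<close> may be replaced by
    \<open>k + s\<close>.\<close>
  also have "(LINT s|lborel. indicator ?cb s *\<^sub>R ft G (k - s)) = (LINT s|lborel. indicator ?cb (- s) *\<^sub>R ft G (k - (- s)))"
    by (rule integral_lborel_uminus[symmetric]) measurable
  also have "\<dots> = (LINT s|lborel. ft Gk s * (indicator ?cb s *\<^sub>R 1))"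
    by (rule Bochner_Integration.integral_cong[OF refl]) (simp add: ftGk indicator_def)
  also have "\<dots> = (LINT \<eta>|lborel. Gk \<eta> * ft (\<lambda>t. indicator ?cb t *\<^sub>R 1) \<eta>)"
    by (rule integral_ft_mult[OF Gk ind])
  also have "\<dots> = (LINT \<eta>|lborel. of_real b * (G \<eta> * ball_symbol h \<eta> * cis (- 2 * pi * (\<eta> \<bullet> k))))"
  proof (rule Bochner_Integration.integral_cong[OF refl])
    fix \<eta> :: "real^'d"
    have "ft (\<lambda>t. indicator ?cb t *\<^sub>R 1) \<eta> = of_real b * ball_symbol h \<eta>"
      using b unfolding ball_symbol_def b_def[symmetric] by simp
    thus "Gk \<eta> * ft (\<lambda>t. indicator ?cb t *\<^sub>R 1) \<eta> = of_real b * (G \<eta> * ball_symbol h \<eta> * cis (- 2 * pi * (\<eta> \<bullet> k)))"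
      unfolding Gk_def by simp
  qed
  also have "\<dots> = of_real b * ft (\<lambda>\<eta>. G \<eta> * ball_symbol h \<eta>) k" unfolding ft_def by (rule integral_mult_right_zero)
  finally have e: "(LINT t:((*v) ?A ` ?cb)|lebesgue. f (- (?A *v k) + t)) =
      of_real \<bar>det ?A\<bar> * (of_real ?m * (of_real b * ft (\<lambda>\<eta>. G \<eta> * ball_symbol h \<eta>) k))" .
  have "of_real \<bar>det ?A\<bar> * (of_real ?m * (of_real b * z)) = of_real b * z" for z :: complex
    using arg_cong[OF dm, of complex_of_real] by (simp add: mult.assoc[symmetric])
  thus ?thesis unfolding Av_def e b_def[symmetric] using b by simp
qed

text \<open>The approximation error in the rescaled variable, up to the power of the determinant
  that \<open>sampling_error_eq\<close> restores.\<close>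

definition shift_series_error :: "(real^'d \<Rightarrow> complex) \<Rightarrow> (real^'d \<Rightarrow> complex) \<Rightarrow> (real^'d \<Rightarrow> complex) \<Rightarrow> real^'d \<Rightarrow> complex" where
  "shift_series_error G H \<phi> y = ft G (- y) - (LINT k|lattice_measure. ft H k * \<phi> (y + k))"

text \<open>Exceptional are the points at which some lattice shift meets the set where \<phi> and
  \<open>\<phi>'\<close> differ, or at which the shift series is not absolutely convergent. Both
  sets are null, and remain so under the invertible matrix power.\<close>

lemma sampling_error_eq:
  fixes M :: "real^'d^'d" and G f \<phi> \<phi>' :: "real^'d \<Rightarrow> complex"
  assumes M: "invertible M" and h: "0 < h" and G: "integrable lborel G"
    and f: "\<And>x. f x = of_real (\<bar>det M\<bar> ^ j) * ft G (- (mat_pow M j *v x))"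
    and \<phi>': "integrable lborel \<phi>'" and eq: "AE x in lborel. \<phi> x = \<phi>' x"
  shows "AE x in lborel.
     (\<lambda>k. Av M h j f (- (mat_pow (matrix_inv M) j *v k)) * dil M \<phi> j k x) summable_on int_lattice \<and>
     of_real \<bar>det (mat_pow M j)\<bar> * shift_series_error G (\<lambda>\<eta>. G \<eta> * ball_symbol h \<eta>) \<phi>' (mat_pow M j *v x) =
       f x - complex_of_real (\<bar>det M\<bar> powr (- real j / 2)) *
        (\<Sum>\<^sub>\<infinity>k\<in>int_lattice. Av M h j f (- (mat_pow (matrix_inv M) j *v k)) * dil M \<phi> j k x)"
proof -
  let ?B = "mat_pow M j" and ?m = "\<bar>det M\<bar> ^ j" and ?s = "\<bar>det M\<bar> powr (real j / 2)"
  let ?H = "\<lambda>\<eta>. G \<eta> * ball_symbol h \<eta>"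
  have dM: "0 < \<bar>det M\<bar>" using M by (simp add: invertible_det_nz)
  have invB: "invertible ?B" using dM by (simp add: invertible_det_nz det_mat_pow)
  have [measurable]: "\<phi>' \<in> borel_measurable borel" using borel_measurable_integrable[OF \<phi>'] by simp
  have A: "AE y in lborel. \<forall>k\<in>int_lattice. \<phi> (y + k) = \<phi>' (y + k)"
    by (intro AE_ball_countable' AE_lborel_shift[OF eq] countable_int_lattice)
  have S: "AE y in lborel. (\<integral>\<^sup>+k. ennreal (norm (\<phi>' (y + k))) \<partial>lattice_measure) < \<infinity>"
    by (rule AE_lattice_sum_finite[where u = "\<lambda>x. ennreal (norm (\<phi>' x))"]) (use nn_integral_norm_lt_top[OF \<phi>'] in auto)
  define D where "D = (LINT x|lborel. norm (?H x))"
  have D: "norm (ft ?H k) \<le> D" for k unfolding D_def by (rule norm_ft_le)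
  have D0: "0 \<le> D" using D[of 0] norm_ge_zero order_trans by blast
  show ?thesis
    using AE_matrix[OF invB A] AE_matrix[OF invB S]
  proof eventually_elim
    case (elim x)
    let ?w = "\<lambda>k. ft ?H k * \<phi>' (?B *v x + k)"
    let ?W = "\<lambda>k. Av M h j f (- (mat_pow (matrix_inv M) j *v k)) * dil M \<phi> j k x"
    have "(\<integral>\<^sup>+k. ennreal (norm (?w k)) \<partial>lattice_measure) \<le> (\<integral>\<^sup>+k. ennreal D * ennreal (norm (\<phi>' (?B *v x + k))) \<partial>lattice_measure)"
      by (rule nn_integral_mono) (simp add: norm_mult ennreal_mult[symmetric] D0 mult_right_mono[OF D] ennreal_leI)
    also have "\<dots> = ennreal D * (\<integral>\<^sup>+k. ennreal (norm (\<phi>' (?B *v x + k))) \<partial>lattice_measure)"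
      by (rule nn_integral_cmult) simp
    also have "\<dots> < \<infinity>" using elim(2) by (simp add: ennreal_mult_less_top)
    finally have w: "integrable lattice_measure ?w" unfolding integrable_lattice_iff .
    have W: "?W k = of_real (?m * ?s) * ?w k" if "k \<in> int_lattice" for k
      unfolding Av_eq_ft[OF M h G f] dil_def using elim(1) that by simp
    have w': "integrable lattice_measure (\<lambda>k. of_real (?m * ?s) * ?w k)" using w by (rule integrable_mult_right)
    have "?W summable_on int_lattice \<longleftrightarrow> (\<lambda>k. of_real (?m * ?s) * ?w k) summable_on int_lattice"
      by (rule summable_on_cong) (rule W)
    hence 1: "?W summable_on int_lattice" using summable_on_int_lattice[OF w'] by simp
    have "(\<Sum>\<^sub>\<infinity>k\<in>int_lattice. ?W k) = (\<Sum>\<^sub>\<infinity>k\<in>int_lattice. of_real (?m * ?s) * ?w k)" by (rule infsum_cong) (rule W)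
    also have "\<dots> = (LINT k|lattice_measure. of_real (?m * ?s) * ?w k)" by (rule infsum_int_lattice[OF w'])
    also have "\<dots> = of_real (?m * ?s) * (LINT k|lattice_measure. ?w k)" by (rule integral_mult_right_zero)
    finally have 2: "(\<Sum>\<^sub>\<infinity>k\<in>int_lattice. ?W k) = of_real (?m * ?s) * (LINT k|lattice_measure. ?w k)" .
    \<comment> \<open>The half powers of the determinant from \<open>dil\<close> and from the
      normalisation of the series cancel; the full power from the averages is left as the outer
      factor.\<close>
    have ss: "\<bar>det M\<bar> powr (- real j / 2) * (?m * ?s) = ?m"
      using dM powr_add[of "\<bar>det M\<bar>" "- real j / 2" "real j / 2"] by simp
    have "f x - complex_of_real (\<bar>det M\<bar> powr (- real j / 2)) * (\<Sum>\<^sub>\<infinity>k\<in>int_lattice. ?W k) =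
        f x - of_real (\<bar>det M\<bar> powr (- real j / 2) * (?m * ?s)) * (LINT k|lattice_measure. ?w k)"
      unfolding 2 by (simp only: of_real_mult mult.assoc)
    also have "\<dots> = of_real ?m * shift_series_error G ?H \<phi>' (?B *v x)"
      unfolding ss f shift_series_error_def right_diff_distrib ..
    finally show ?case using 1 by (simp add: det_mat_pow power_abs)
  qed
qed

text \<open>The rate is gained here: with \<open>a\<close> of the size of the inverse expansion,
  comparing the weight at \<eta> with the one at \<open>T *v \<eta>\<close> contributes
  \<open>a powr (r * q)\<close>; the determinant comes from the change of variables.\<close>

lemma weighted_norm_dilate:
  fixes T :: "real^'d^'d" and g :: "real^'d \<Rightarrow> complex"
  assumes T: "invertible T" and [measurable]: "g \<in> borel_measurable borel"
    and a: "\<And>\<eta>. norm \<eta> \<le> a * norm (T *v \<eta>)" "0 \<le> a" and r: "0 \<le> r" and q: "0 \<le> q"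
    and W: "(\<integral>\<^sup>+x. ennreal ((norm x powr r * norm (g x)) powr q) \<partial>lborel) \<le> ennreal W" "0 \<le> W"
  shows "(\<integral>\<^sup>+\<eta>. ennreal ((norm \<eta> powr r * norm (g (T *v \<eta>))) powr q) \<partial>lborel) \<le> ennreal (a powr (r * q) * W / \<bar>det T\<bar>)"
proof -
  have d: "0 < \<bar>det T\<bar>" using T by (simp add: invertible_det_nz)
  let ?u = "\<lambda>x. ennreal ((norm x powr r * norm (g x)) powr q)"
  have "ennreal \<bar>det T\<bar> * (\<integral>\<^sup>+\<eta>. ?u (T *v \<eta>) \<partial>lborel) = (\<integral>\<^sup>+x. ?u x \<partial>lborel)"
    by (rule nn_integral_matrix[OF T, symmetric]) measurable
  hence le: "ennreal \<bar>det T\<bar> * (\<integral>\<^sup>+\<eta>. ?u (T *v \<eta>) \<partial>lborel) \<le> ennreal W" using W by simp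
  have I: "(\<integral>\<^sup>+\<eta>. ?u (T *v \<eta>) \<partial>lborel) \<le> ennreal (W / \<bar>det T\<bar>)"
  proof (cases "\<integral>\<^sup>+\<eta>. ?u (T *v \<eta>) \<partial>lborel")
    case (real t)
    have "ennreal (\<bar>det T\<bar> * t) \<le> ennreal W" using le unfolding real(2) by (simp add: ennreal_mult real(1))
    hence "\<bar>det T\<bar> * t \<le> W" using W(2) by simp
    hence "t \<le> W / \<bar>det T\<bar>" using d by (simp add: pos_le_divide_eq mult.commute)
    thus ?thesis unfolding real(2) by (rule ennreal_leI)
  next
    case top
    thus ?thesis using le d by (simp add: ennreal_mult_top top_unique)
  qed
  have "(\<integral>\<^sup>+\<eta>. ennreal ((norm \<eta> powr r * norm (g (T *v \<eta>))) powr q) \<partial>lborel) \<le> (\<integral>\<^sup>+\<eta>. ennreal (a powr (r * q)) * ?u (T *v \<eta>) \<partial>lborel)"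
  proof (rule nn_integral_mono)
    fix \<eta> :: "real^'d"
    have "norm \<eta> powr r \<le> (a * norm (T *v \<eta>)) powr r" using a r by (intro powr_mono2) auto
    hence "norm \<eta> powr r * norm (g (T *v \<eta>)) \<le> (a * norm (T *v \<eta>)) powr r * norm (g (T *v \<eta>))"
      by (rule mult_right_mono) simp
    hence "(norm \<eta> powr r * norm (g (T *v \<eta>))) powr q \<le> ((a * norm (T *v \<eta>)) powr r * norm (g (T *v \<eta>))) powr q"
      using q by (intro powr_mono2) auto
    also have "\<dots> = a powr (r * q) * (norm (T *v \<eta>) powr r * norm (g (T *v \<eta>))) powr q"
      by (simp only: powr_mult powr_powr mult.assoc)
    finally show "ennreal ((norm \<eta> powr r * norm (g (T *v \<eta>))) powr q) \<le> ennreal (a powr (r * q)) * ?u (T *v \<eta>)"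
      by (simp add: ennreal_mult[symmetric] ennreal_leI)
  qed
  also have "\<dots> = ennreal (a powr (r * q)) * (\<integral>\<^sup>+\<eta>. ?u (T *v \<eta>) \<partial>lborel)" by (rule nn_integral_cmult) measurable
  also have "\<dots> \<le> ennreal (a powr (r * q)) * ennreal (W / \<bar>det T\<bar>)" by (rule mult_left_mono[OF I]) simp
  also have "\<dots> = ennreal (a powr (r * q) * W / \<bar>det T\<bar>)" using W by (simp add: ennreal_mult[symmetric])
  finally show ?thesis .
qed

text \<open>Expansion of the power bounds its inverse, the bound passes to the transposed inverse,
  and applied to the transposed image it is an expansion again.\<close>

lemma transpose_mat_pow_expands:
  fixes M :: "real^'d^'d"
  assumes M: "invertible M" and C: "\<And>j v. L ^ j * norm v \<le> C * norm (mat_pow M j *v v)" and L: "0 < L"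
  shows "norm \<eta> \<le> C / L ^ j * norm (transpose (mat_pow M j) *v \<eta>)"
proof -
  let ?B = "mat_pow M j" and ?A = "mat_pow (matrix_inv M) j"
  have BA: "?B ** ?A = mat 1" using mat_pow_inverse[OF M, of j] matrix_left_right_inverse by blast
  have "norm (?A *v v) \<le> C / L ^ j * norm v" for v
    using C[of j "?A *v v"] L by (simp add: matrix_vector_mul_assoc BA field_simps)
  from norm_transpose_le[OF this, of "transpose ?B *v \<eta>"]
  show ?thesis
    unfolding matrix_vector_mul_assoc matrix_transpose_mul[symmetric] BA transpose_mat matrix_vector_mul_lid .
qed

lemma borel_measurable_shift_series_error:
  assumes G: "integrable lborel G" and \<phi>: "integrable lborel \<phi>"
  shows "shift_series_error G H \<phi> \<in> borel_measurable borel"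
  unfolding shift_series_error_def[abs_def]
proof (rule borel_measurable_diff)
  have \<phi>m: "\<phi> \<in> borel_measurable borel" using borel_measurable_integrable[OF \<phi>] by simp
  show "(\<lambda>y. ft G (- y)) \<in> borel_measurable borel"
    by (rule measurable_compose[OF _ borel_measurable_ft[OF G]]) measurable
  show "(\<lambda>y. LINT k|lattice_measure. ft H k * \<phi> (y + k)) \<in> borel_measurable borel"
  proof (rule borel_measurable_integral_lattice)
    fix k :: "real^'a"
    have "(\<lambda>y. \<phi> (y + k)) \<in> borel_measurable borel" by (rule measurable_compose[OF _ \<phi>m]) measurable
    thus "(\<lambda>y. ft H k * \<phi> (y + k)) \<in> borel_measurable borel" by measurable
  qed
qed

lemma sampling_error_Lp_le:
  fixes M :: "real^'d^'d" and g \<phi> :: "real^'d \<Rightarrow> complex" and p :: ennreal and q h r a W C1 C2 :: real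
  assumes p: "2 \<le> p" "1 / p + 1 / ennreal q = 1" and q: "1 \<le> q" and h: "0 < h" and M: "invertible M" and r: "0 \<le> r"
    and g: "integrable lborel g" and \<phi>: "integrable lborel \<phi>"
    and W: "(\<integral>\<^sup>+x. ennreal ((norm x powr r * norm (g x)) powr q) \<partial>lborel) \<le> ennreal W" "0 < W"
    and a: "\<And>\<eta>. norm \<eta> \<le> a * norm (transpose (mat_pow M j) *v \<eta>)" "0 < a"
    and HY: "\<And>(F :: real^'d \<Rightarrow> complex) K. integrable lborel F \<Longrightarrow> 0 < K \<Longrightarrow>
      (\<integral>\<^sup>+x. ennreal (norm (F x) powr q) \<partial>lborel) \<le> ennreal (K powr q) \<Longrightarrow> Lp_le p (C1 * K) (ft F)" and C1: "0 < C1"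
    and C2: "0 < C2" "\<And>G :: real^'d \<Rightarrow> complex. G \<in> borel_measurable borel \<Longrightarrow>
      (\<integral>\<^sup>+\<eta>. ennreal (norm (G \<eta> - ft \<phi> \<eta> * periodize (\<lambda>\<xi>. G \<xi> * ball_symbol h \<xi>) \<eta>) powr q) \<partial>lborel) \<le>
      ennreal C2 * (\<integral>\<^sup>+\<eta>. ennreal ((norm \<eta> powr r * norm (G \<eta>)) powr q) \<partial>lborel)"
  defines "G \<equiv> \<lambda>\<eta>. g (transpose (mat_pow M j) *v \<eta>)"
  shows "Lp_le p (C1 * (C2 * W) powr (1 / q) * a powr r)
    (\<lambda>x. of_real \<bar>det (mat_pow M j)\<bar> * shift_series_error G (\<lambda>\<eta>. G \<eta> * ball_symbol h \<eta>) \<phi> (mat_pow M j *v x))"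
proof -
  let ?T = "transpose (mat_pow M j)" and ?H = "\<lambda>\<eta>. G \<eta> * ball_symbol h \<eta>"
  define m where "m = \<bar>det (mat_pow M j)\<bar>"
  have m: "0 < m" using M by (simp add: m_def invertible_det_nz det_mat_pow)
  have invB: "invertible (mat_pow M j)" using m by (simp add: m_def invertible_det_nz)
  have dT: "\<bar>det ?T\<bar> = m" by (simp add: m_def det_transpose)
  have invT: "invertible ?T" using m dT by (simp add: invertible_det_nz)
  have gm: "g \<in> borel_measurable borel" using borel_measurable_integrable[OF g] by simp
  have G: "integrable lborel G" unfolding G_def by (rule integrable_matrix[OF invT g])
  hence Gm: "G \<in> borel_measurable borel" using borel_measurable_integrable by fastforce
  have H: "integrable lborel ?H"
    by (rule integrable_mult_bounded[OF G _ norm_ball_symbol_le[OF h]]) (use borel_measurable_ball_symbol in simp)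
  have \<phi>m: "\<phi> \<in> borel_measurable borel" using borel_measurable_integrable[OF \<phi>] by simp
  \<comment> \<open>The power \<open>- (1 / q)\<close> of the determinant comes from dilating
    \<open>g\<close>; scaling the error back in \<open>Lp_le_matrix_scale\<close> multiplies by the
    power \<open>1 / q\<close>, so the determinant disappears and the final bound involves the
    dilation only through \<open>a powr r\<close>.\<close>
  define K where "K = m powr (- (1 / q)) * ((C2 * W) powr (1 / q) * a powr r)"
  have K: "0 < K" using m C2 W(2) a(2) by (simp add: K_def)
  have Kq: "K powr q = C2 * (a powr (r * q) * W / m)"
  proof -
    have "K powr q = m powr (- 1) * (C2 * W * a powr (r * q))"
      using q C2 W(2) by (simp add: K_def powr_mult powr_powr)
    thus ?thesis using m by (simp add: powr_minus field_simps)
  qed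
  have I: "(\<integral>\<^sup>+\<eta>. ennreal ((norm \<eta> powr r * norm (G \<eta>)) powr q) \<partial>lborel) \<le> ennreal (a powr (r * q) * W / m)"
    unfolding G_def using weighted_norm_dilate[OF invT gm a(1) _ r _ W(1)] a(2) q W(2) dT by simp
  have nn: "0 \<le> C2" "0 \<le> a powr (r * q) * W / m" using C2(1) W(2) m by simp_all
  have "(\<integral>\<^sup>+\<eta>. ennreal (norm (G \<eta> - ft \<phi> \<eta> * periodize ?H \<eta>) powr q) \<partial>lborel) \<le>
      ennreal C2 * ennreal (a powr (r * q) * W / m)"
    by (rule order_trans[OF C2(2)[OF Gm] mult_left_mono[OF I]]) simp
  also have "\<dots> = ennreal (K powr q)" unfolding Kq by (rule ennreal_mult[OF nn, symmetric])
  finally have wq: "(\<integral>\<^sup>+\<eta>. ennreal (norm (G \<eta> - ft \<phi> \<eta> * periodize ?H \<eta>) powr q) \<partial>lborel) \<le> ennreal (K powr q)" .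
  have q0: "0 < q" using q by simp
  have E: "Lp_le p (C1 * K) (shift_series_error G ?H \<phi>)"
    unfolding shift_series_error_def[abs_def] by (rule Lp_le_shift_series[OF HY q0 \<phi> G H K wq])
  have Em: "shift_series_error G ?H \<phi> \<in> borel_measurable borel"
    by (rule borel_measurable_shift_series_error[OF G \<phi>])
  have CK: "0 < C1 * K" using C1 K by simp
  have "m powr (1 / q) * (C1 * K) = C1 * (C2 * W) powr (1 / q) * a powr r"
    using m powr_add[of m "1 / q" "- (1 / q)"] by (simp add: K_def)
  thus ?thesis using Lp_le_matrix_scale[OF p invB Em E CK] by (simp only: m_def)
qed

lemma sampling_error_rate:
  fixes p :: ennreal and q h \<epsilon> \<delta> :: real and N n :: nat
    and M :: "real^'d^'d" and lam :: complex
    and \<phi> g f :: "real^'d \<Rightarrow> complex"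
  assumes dp: "of_nat CARD('d) < p" and p2: "2 \<le> p" and pq: "1 / p + 1 / ennreal q = 1" and h: "0 < h"
    and M: "dilation_matrix M" "isotropic M"
    and lam: "is_eigenvalue (map_matrix complex_of_real M) lam"
    and \<phi>: "script_L p \<phi>"
    and B: "\<exists>B>0. \<forall>\<xi>. (\<Sum>\<^sub>\<infinity>k\<in>int_lattice. ennreal (cmod (fourier \<phi> (\<xi> + k)) powr q)) < ennreal B"
    and n: "1 \<le> n" and \<delta>: "0 < \<delta>" "\<delta> < 1/2"
    and d1: "boundedly_differentiable_on n (\<lambda>\<xi>. fourier \<phi> \<xi> * fourier_distr (phi_tilde h N) \<xi>)
           {\<xi>. norm \<xi> < \<delta>}"
    and d2: "\<forall>l\<in>int_lattice - {0}. boundedly_differentiable_on n (fourier \<phi>) {\<xi>. norm (\<xi> + l) < \<delta>}"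
    and d3: "\<forall>\<beta>. mi_abs \<beta> = n \<longrightarrow>
           (\<exists>K::real. \<forall>\<xi>. norm \<xi> < \<delta> \<longrightarrow>
              (\<Sum>\<^sub>\<infinity>l\<in>int_lattice - {0}. ennreal (cmod (mi_deriv \<beta> (fourier \<phi>) (\<xi> + l)))) \<le> ennreal K)"
    and z0: "\<forall>\<beta>\<in>Delta n. mi_deriv \<beta> (\<lambda>\<xi>. 1 - fourier \<phi> \<xi> * fourier_distr (phi_tilde h N) \<xi>) 0 = 0"
    and sf: "strang_fix n \<phi>"
    and f: "\<forall>x. f x = fourier g (- x)" and g: "in_Lp (ennreal q) g" and \<epsilon>: "1 < \<epsilon>"
    and decay: "(\<lambda>\<xi>. cmod (g \<xi>)) \<in> O[at_infinity](\<lambda>\<xi>. norm \<xi> powr (- (real N + real CARD('d) + \<epsilon>)))"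
  shows "\<exists>C::real. \<forall>j::nat.
    (AE x in lebesgue.
       (\<lambda>k. Av M h j f (- (mat_pow (matrix_inv M) j *v k)) * dil M \<phi> j k x) summable_on int_lattice) \<and>
    Lp_norm lebesgue p (\<lambda>x. ennreal (cmod (f x -
        complex_of_real (\<bar>det M\<bar> powr (- real j / 2)) *
        (\<Sum>\<^sub>\<infinity>k\<in>int_lattice.
           Av M h j f (- (mat_pow (matrix_inv M) j *v k)) * dil M \<phi> j k x))))
      \<le> ennreal (C * cmod lam powi (- int (j * min n (N + 1))))"
proof -
  define r where "r = min n (N + 1)"
  have r1: "1 \<le> real r" using n by (simp add: r_def)
  have q1: "1 \<le> q" using p2 pq by (cases rule: conjugate_exponent_cases) auto
  have p1: "1 \<le> p" using p2 order_trans[of 1 2 p] by simp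
  have Mi: "invertible M" by (rule dilation_invertible[OF M lam])
  obtain C3 where C3: "0 < C3" "\<And>j v. cmod lam ^ j * norm v \<le> C3 * norm (mat_pow M j *v v)" "1 < cmod lam"
    by (rule isotropic_norm_growth[OF M lam], rule that)
  have gl: "g \<in> borel_measurable lebesgue" and \<phi>l: "\<phi> \<in> borel_measurable lebesgue"
    using g \<phi> by (auto simp: in_Lp_def script_L_def)
  obtain g' where g': "g' \<in> borel_measurable borel" "AE x in lborel. g x = g' x"
    by (rule lebesgue_borel_representative[OF gl], rule that)
  obtain \<phi>' where \<phi>': "\<phi>' \<in> borel_measurable borel" "AE x in lborel. \<phi> x = \<phi>' x"
    by (rule lebesgue_borel_representative[OF \<phi>l], rule that)
  have \<phi>'i: "integrable lborel \<phi>'" by (rule script_L_integrable[OF \<phi> p1 \<phi>'])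
  have F: "fourier \<phi> = ft \<phi>'"
    using fourier_cong_AE[OF \<phi>l borel_measurable_lebesgueI[OF \<phi>'(1)] \<phi>'(2)] fourier_eq_ft[OF \<phi>'(1)] by simp
  have fg: "fourier g = ft g'"
    using fourier_cong_AE[OF gl borel_measurable_lebesgueI[OF g'(1)] g'(2)] fourier_eq_ft[OF g'(1)] by simp
  define s where "s = real N + real CARD('d) + \<epsilon>"
  obtain c where c: "0 < c" "\<forall>\<^sub>F \<xi> in at_infinity. norm (cmod (g \<xi>)) \<le> c * norm (norm \<xi> powr (- s))"
    using landau_o.bigE[OF decay] unfolding s_def by blast
  then obtain b where b: "\<And>\<xi>. b \<le> norm \<xi> \<Longrightarrow> cmod (g \<xi>) \<le> c * norm \<xi> powr (- s)"
    unfolding eventually_at_infinity by auto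
  define R where "R = max b 1"
  have gd: "AE x in lborel. R \<le> norm x \<longrightarrow> norm (g' x) \<le> c * norm x powr (- s)"
    using g'(2)
  proof eventually_elim
    case (elim x)
    show ?case using b[of x] elim by (simp add: R_def)
  qed
  have rN: "real r \<le> real N + 1" by (simp add: r_def)
  have gq: "(\<integral>\<^sup>+x. ennreal (norm (g' x) powr q) \<partial>lborel) < \<infinity>"
    by (rule in_Lp_nn_integral[OF g _ g'(2)]) (use q1 in simp)
  \<comment> \<open>The margin over the dimension is at least \<open>\<epsilon> - 1\<close>: the
    weight has order \<open>r <= N + 1\<close>, and this is where \<open>1 < \<epsilon>\<close>
    enters.\<close>
  have R1: "1 \<le> R" and c0: "0 \<le> c" and r0: "0 \<le> real r" and srd: "real CARD('d) < s - real r"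
    using c(1) rN \<epsilon> by (auto simp: R_def s_def)
  have g'i: "integrable lborel g'" by (rule decay_integrable(1)[OF g'(1) q1 R1 c0 gq gd r0 srd])
  have "(\<integral>\<^sup>+x. ennreal ((norm x powr real r * norm (g' x)) powr q) \<partial>lborel) < \<infinity>"
    by (rule decay_integrable(2)[OF g'(1) q1 R1 c0 gq gd r0 srd])
  then obtain w where w: "0 \<le> w" "(\<integral>\<^sup>+x. ennreal ((norm x powr real r * norm (g' x)) powr q) \<partial>lborel) = ennreal w"
    by (cases "\<integral>\<^sup>+x. ennreal ((norm x powr real r * norm (g' x)) powr q) \<partial>lborel") auto
  \<comment> \<open>Adding 1 makes \<open>W\<close> positive also when \<open>g\<close> vanishes
    almost everywhere.\<close>
  define W where "W = w + 1"
  have W: "(\<integral>\<^sup>+x. ennreal ((norm x powr real r * norm (g' x)) powr q) \<partial>lborel) \<le> ennreal W" "0 < W"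
    unfolding w(2) W_def using w(1) by (auto intro: ennreal_leI)
  obtain B0 where B0: "0 < B0" "\<And>\<xi>. (\<integral>\<^sup>+l. ennreal (norm (ft \<phi>' (\<xi> + l)) powr q) \<partial>lattice_measure) \<le> ennreal B0"
    using B unfolding F infsum_eq_nn_integral by (auto intro: less_imp_le)
  have B00: "0 \<le> B0" using B0(1) by simp
  obtain C0 where C0': "0 \<le> C0" "\<And>\<zeta>. \<zeta> \<in> unit_cell \<Longrightarrow>
      (\<integral>\<^sup>+l. ennreal (norm ((if l = 0 then 1 else 0) - ft \<phi>' (\<zeta> + l) * ball_symbol h \<zeta>) powr q) \<partial>lattice_measure) \<le> ennreal (C0 * norm \<zeta> powr (real (min n (N + 1)) * q))"
    by (rule symbol_defect_bound[OF q1 h n \<delta> norm_ft_le B00 B0(2) d1[unfolded F] d2[unfolded F] d3[unfolded F] z0[unfolded F] sf[unfolded strang_fix_def F]], rule that)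
  note C0 = C0'[folded r_def]
  obtain C2 where C2: "0 < C2" "\<And>G :: real^'d \<Rightarrow> complex. G \<in> borel_measurable borel \<Longrightarrow>
      (\<integral>\<^sup>+\<eta>. ennreal (norm (G \<eta> - ft \<phi>' \<eta> * periodize (\<lambda>\<xi>. G \<xi> * ball_symbol h \<xi>) \<eta>) powr q) \<partial>lborel) \<le>
      ennreal C2 * (\<integral>\<^sup>+\<eta>. ennreal ((norm \<eta> powr real r * norm (G \<eta>)) powr q) \<partial>lborel)"
    by (rule shift_series_symbol_bound[OF p2 pq dp r1 borel_measurable_ft[OF \<phi>'i] borel_measurable_ball_symbol norm_ball_symbol_le[OF h] B00 B0(2) C0], assumption, rule that)
  obtain C1 where C1: "0 < C1" "\<And>(F :: real^'d \<Rightarrow> complex) K. integrable lborel F \<Longrightarrow> 0 < K \<Longrightarrow>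
    (\<integral>\<^sup>+x. ennreal (norm (F x) powr q) \<partial>lborel) \<le> ennreal (K powr q) \<Longrightarrow> Lp_le p (C1 * K) (ft F)"
    by (rule hausdorff_young[OF p2 pq], rule that)
  \<comment> \<open>No factor depends on \<open>j\<close>: they are the Hausdorff--Young constant,
    the coset estimate with the weighted norm of \<open>g\<close>, and the distortion of the
    eigenbasis.\<close>
  define C where "C = C1 * (C2 * W) powr (1 / q) * C3 ^ r"
  show ?thesis
  proof (intro exI[of _ C] allI)
    fix j
    \<comment> \<open>A bound for the inverse of the transposed power; its \<open>r\<close>-th power
      is the rate.\<close>
    define a where "a = C3 / cmod lam ^ j"
    have a0: "0 < a" unfolding a_def using C3 by (intro divide_pos_pos zero_less_power) auto
    have L0: "0 < cmod lam" using C3(3) by (rule less_trans[OF zero_less_one])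
    have a: "norm \<eta> \<le> a * norm (transpose (mat_pow M j) *v \<eta>)" for \<eta>
      unfolding a_def by (rule transpose_mat_pow_expands[OF Mi C3(2) L0])
    let ?T = "transpose (mat_pow M j)"
    define G where "G = (\<lambda>\<eta>. g' (?T *v \<eta>))"
    have invT: "invertible ?T" using Mi by (simp add: invertible_det_nz det_transpose det_mat_pow)
    have Gi: "integrable lborel G" unfolding G_def by (rule integrable_matrix[OF invT g'i])
    have fG: "f x = of_real (\<bar>det M\<bar> ^ j) * ft G (- (mat_pow M j *v x))" for x
    proof -
      have "mat_pow M j *v (- x) = - (mat_pow M j *v x)"
        by (simp add: vec_eq_iff matrix_vector_mult_def sum_negf)
      hence e: "transpose ?T *v (- x) = - (mat_pow M j *v x)" unfolding transpose_transpose .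
      have dt: "\<bar>det ?T\<bar> = \<bar>det M\<bar> ^ j" by (simp only: det_transpose det_mat_pow power_abs)
      have "f x = ft g' (- x)" using f fg by simp
      also have "\<dots> = of_real \<bar>det ?T\<bar> * ft (\<lambda>v. g' (?T *v v)) (transpose ?T *v (- x))"
        by (rule ft_matrix[OF invT g'(1)])
      finally show ?thesis unfolding e dt G_def .
    qed
    let ?u = "\<lambda>x. of_real \<bar>det (mat_pow M j)\<bar> * shift_series_error G (\<lambda>\<eta>. G \<eta> * ball_symbol h \<eta>) \<phi>' (mat_pow M j *v x)"
    have AE: "AE x in lborel.
      (\<lambda>k. Av M h j f (- (mat_pow (matrix_inv M) j *v k)) * dil M \<phi> j k x) summable_on int_lattice \<and>
      ?u x = f x - complex_of_real (\<bar>det M\<bar> powr (- real j / 2)) *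
        (\<Sum>\<^sub>\<infinity>k\<in>int_lattice. Av M h j f (- (mat_pow (matrix_inv M) j *v k)) * dil M \<phi> j k x)"
      by (rule sampling_error_eq[OF Mi h Gi fG \<phi>'i \<phi>'(2)])
    have le: "Lp_le p (C1 * (C2 * W) powr (1 / q) * a powr real r) ?u"
      unfolding G_def
      by (rule sampling_error_Lp_le[OF p2 pq q1 h Mi r0 g'i \<phi>'i W a a0 C1(2) C1(1) C2])
    have K0: "0 \<le> C1 * (C2 * W) powr (1 / q) * a powr real r" using C1(1) by simp
    have um: "?u \<in> borel_measurable borel"
    proof -
      have E: "shift_series_error G (\<lambda>\<eta>. G \<eta> * ball_symbol h \<eta>) \<phi>' \<in> borel_measurable borel"
        by (rule borel_measurable_shift_series_error[OF Gi \<phi>'i])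
      show ?thesis by (intro borel_measurable_times borel_measurable_const measurable_compose[OF borel_measurable_matrix_vector E])
    qed
    have eqK: "C1 * (C2 * W) powr (1 / q) * a powr real r = C * cmod lam powi (- int (j * r))"
    proof -
      have "a powr real r = C3 ^ r / cmod lam ^ (j * r)"
        using a0 by (simp add: powr_realpow) (simp add: a_def power_divide power_mult)
      thus ?thesis by (simp add: C_def power_int_minus power_int_of_nat divide_inverse del: of_nat_mult)
    qed
    have "AE x in lborel. ?u x = f x - complex_of_real (\<bar>det M\<bar> powr (- real j / 2)) *
        (\<Sum>\<^sub>\<infinity>k\<in>int_lattice. Av M h j f (- (mat_pow (matrix_inv M) j *v k)) * dil M \<phi> j k x)"
      using AE by eventually_elim (rule conjunct2)
    from Lp_norm_le_of_Lp_le[OF p2 um this le K0]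
    have n1: "Lp_norm lebesgue p (\<lambda>x. ennreal (cmod (f x - complex_of_real (\<bar>det M\<bar> powr (- real j / 2)) *
        (\<Sum>\<^sub>\<infinity>k\<in>int_lattice. Av M h j f (- (mat_pow (matrix_inv M) j *v k)) * dil M \<phi> j k x))))
      \<le> ennreal (C * cmod lam powi (- int (j * min n (N + 1))))"
      unfolding r_def eqK[unfolded r_def] .
    have s1: "AE x in lborel. (\<lambda>k. Av M h j f (- (mat_pow (matrix_inv M) j *v k)) * dil M \<phi> j k x) summable_on int_lattice"
      using AE by eventually_elim (rule conjunct1)
    show "(AE x in lebesgue. (\<lambda>k. Av M h j f (- (mat_pow (matrix_inv M) j *v k)) * dil M \<phi> j k x) summable_on int_lattice) \<and>
      Lp_norm lebesgue p (\<lambda>x. ennreal (cmod (f x - complex_of_real (\<bar>det M\<bar> powr (- real j / 2)) *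
        (\<Sum>\<^sub>\<infinity>k\<in>int_lattice. Av M h j f (- (mat_pow (matrix_inv M) j *v k)) * dil M \<phi> j k x))))
      \<le> ennreal (C * cmod lam powi (- int (j * min n (N + 1))))"
      by (rule conjI[OF AE_completion[OF s1] n1])
  qed
qed

theorem theorem13:
  fixes p :: ennreal and q h \<epsilon> \<delta> :: real and N n :: nat
    and M :: "real^'d^'d" and lam :: complex
    and \<phi> g f :: "real^'d \<Rightarrow> complex"
  assumes "of_nat CARD('d) < p" and "2 \<le> p" and "1 / p + 1 / ennreal q = 1" and "0 < h"
    and "dilation_matrix M" and "isotropic M"
    and "is_eigenvalue (map_matrix complex_of_real M) lam"
    and "script_L p \<phi>"
    and "\<exists>B>0. \<forall>\<xi>. (\<Sum>\<^sub>\<infinity>k\<in>int_lattice. ennreal (cmod (fourier \<phi> (\<xi> + k)) powr q)) < ennreal B"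
    and "1 \<le> n" and "0 < \<delta>" and "\<delta> < 1/2"
    and "boundedly_differentiable_on n (\<lambda>\<xi>. fourier \<phi> \<xi> * fourier_distr (phi_tilde h N) \<xi>)
           {\<xi>. norm \<xi> < \<delta>}"
    and "\<forall>l\<in>int_lattice - {0}. boundedly_differentiable_on n (fourier \<phi>) {\<xi>. norm (\<xi> + l) < \<delta>}"
    and "\<forall>\<beta>. mi_abs \<beta> = n \<longrightarrow>
           (\<exists>K::real. \<forall>\<xi>. norm \<xi> < \<delta> \<longrightarrow>
              (\<Sum>\<^sub>\<infinity>l\<in>int_lattice - {0}. ennreal (cmod (mi_deriv \<beta> (fourier \<phi>) (\<xi> + l)))) \<le> ennreal K)"
    and "\<forall>\<beta>\<in>Delta n. mi_deriv \<beta> (\<lambda>\<xi>. 1 - fourier \<phi> \<xi> * fourier_distr (phi_tilde h N) \<xi>) 0 = 0"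
    and "strang_fix n \<phi>"
    and "\<forall>x. f x = fourier g (- x)" and "in_Lp (ennreal q) g" and "1 < \<epsilon>"
    and "(\<lambda>\<xi>. cmod (g \<xi>)) \<in> O[at_infinity](\<lambda>\<xi>. norm \<xi> powr (- (real N + real CARD('d) + \<epsilon>)))"
  shows "\<exists>C::real. \<forall>j::nat.
    (AE x in lebesgue.
       (\<lambda>k. Av M h j f (- (mat_pow (matrix_inv M) j *v k)) * dil M \<phi> j k x) summable_on int_lattice) \<and>
    Lp_norm lebesgue p (\<lambda>x. ennreal (cmod (f x -
        complex_of_real (\<bar>det M\<bar> powr (- real j / 2)) *
        (\<Sum>\<^sub>\<infinity>k\<in>int_lattice.
           Av M h j f (- (mat_pow (matrix_inv M) j *v k)) * dil M \<phi> j k x))))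
      \<le> ennreal (if n > N + 1 then C * cmod lam powi (- int (j * (N + 1)))
                 else C * cmod lam powi (- int (j * n)))"
proof -
  \<comment> \<open>The two cases of the rate are one formula with exponent
    \<open>min n (N + 1)\<close>.\<close>
  have e: "(if n > N + 1 then C * cmod lam powi (- int (j * (N + 1))) else C * cmod lam powi (- int (j * n))) =
      C * cmod lam powi (- int (j * min n (N + 1)))" for C j
  proof (cases "n > N + 1")
    case True
    have m: "min n (N + 1) = N + 1" using True by simp
    show ?thesis unfolding m using True by (simp only: if_True)
  next
    case False
    have m: "min n (N + 1) = n" using False by simp
    show ?thesis unfolding m using False by (simp only: if_False)
  qed
  show ?thesis unfolding e by (rule sampling_error_rate[OF assms])
qed

end
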